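(* Let $c:\Pi\to\mathbb N$ be a coloring. Then: (1) $\mathcal H^{BM}_c$ is a free $R$-module; (2) the set $\{\mathcal F_{\mathbf r}:\mathbf r\in\mathcal P_c\}$ is a basis of $\mathcal H^{BM}_c$; (3) $\mathcal H^{BM}_c$ is the only non-vanishing module among the $H^{BM}_\bullet(\mathrm{Conf}_c,S;R_c)$, i.e. $H^{BM}_k(\mathrm{Conf}_c,S;R_c)=0$ for $k\ne m_c$.
   Context: **Lie data.** $(a_{ij})_{1\le i,j\le l}$ is the Cartan matrix of a semisimple Lie algebra, $d_i$ positive integers with $(d_ia_{ij})$ symmetric positive definite, $\Pi=\{\alpha_1,\dots,\alpha_l\}$ the simple roots, $(\alpha_i,\alpha_j)=d_ia_{ij}$. $R=\mathbb Z[q^{\pm1/2}]$. **Configuration spaces.** For $c:\Pi\to\mathbb N$, $m_c=\sum_\alpha c(\alpha)$. $D=[-1,1]^2\subset\mathbb C$ (a disk), $\partial^-D$ its two vertical sides. $\mathrm{Conf}_c=\left(D^{m_c}\setminus\bigcup_{i<j}\{z_i=z_j\}\right)/\mathfrak S_{c(\alpha_1)}\times\cdots\times\mathfrak S_{c(\alpha_l)}$: configurations $(\mathbf z^{\alpha_1},\dots,\mathbf z^{\alpha_l})$ with $\mathbf z^{\alpha_i}$ a set of $c(\alpha_i)$ points colored by $\alpha_i$. $S$: configurations with at least one point in $\partial^-D$. **Local system.** $f(\{z_i\})=\prod_{i<j}\left(\frac{z_j-z_i}{|z_j-z_i|}\right)^2$, $g(\{z_i\},\{w_j\})=\prod_{i,j}\left(\frac{w_j-z_i}{|w_j-z_i|}\right)^2$,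 $\Phi_c(\mathbf z)=\left((f(\mathbf z^{\alpha_i}))_i,(g(\mathbf z^{\alpha_i},\mathbf z^{\alpha_j}))_{i<j}\right)\in(\mathbb S^1)^{l+l(l-1)/2}$, $W_c=\Phi_c\circ r$ with $r$ the rotation of all points by $\pi/2$; vertically aligned configurations go to $b=(1,\dots,1)$. $R_c$ is the pullback by $W_c$ of the rank one local system of $R$-modules on the torus with fibre $R$ at $b$ and monodromy $-q^{d_i}$ (coordinate $f(\mathbf z^{\alpha_i})$), $q^{(\alpha_i,\alpha_j)/2}$ (coordinate $g(\mathbf z^{\alpha_i},\mathbf z^{\alpha_j})$) along counterclockwise circles. **Homology.** $H^{BM}_\bullet(X,Y)=\varprojlim_{K\text{ compact}}H_\bullet(X,Y\cup(X\setminus K))$ (twisted version); $\mathcal H^{BM}_c=H^{BM}_{m_c}(\mathrm{Conf}_c,S;R_c)$. **Pearl necklaces.** $\mathcal P_c$ is the set of words $\mathbf r=(r_1,\dots,r_{m_c})\in\{1,\dots,l\}^{m_c}$ in which each $i$ occurs $c(\alpha_i)$ times. $\mathcal F_{\mathbf r}\in\mathcal H^{BM}_c$ is the class of the oriented open simplex $\{0<t_1<\dots<t_{m_c}<1\}\to\mathrm{Conf}_c$ sending $t$ to the configuration with points $(-1+2t_j,0)$ colored $\alpha_{r_j}$, $1\le j\le m_c$ (a Borel–Moore cycle relative to $S$). It is lifted to twisted homology by a handle, i.e. a path from a vertically aligned configuration (over which the fibre of $R_c$ is canonically $R$) to the simplex: the handle starts on the right side of $D$ below height $0$, points move along disjoint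 paths horizontally left below the segment, then vertically up to it, lower starting points ending further left. *)

theory Defs
  imports "HOL-Homology.Homology" "HOL-Algebra.Module" "HOL-Library.Poly_Mapping"
begin

section \<open>Modules\<close>

definition module_basis ::
    "('r, 'p) ring_scheme \<Rightarrow> ('r, 'v, 's) module_scheme \<Rightarrow> 'v set \<Rightarrow> bool" where
  "module_basis R M B \<longleftrightarrow>
     B \<subseteq> carrier M \<and>
     (\<forall>v \<in> carrier M. \<exists>A f. finite A \<and> A \<subseteq> B \<and> f \<in> A \<rightarrow> carrier R \<and>
        v = (\<Oplus>\<^bsub>M\<^esub>b\<in>A. f b \<odot>\<^bsub>M\<^esub> b)) \<and>
     (\<forall>A f. finite A \<and> A \<subseteq> B \<and> f \<in> A \<rightarrow> carrier R \<and>
        (\<Oplus>\<^bsub>M\<^esub>b\<in>A. f b \<odot>\<^bsub>M\<^esub> b) = \<zero>\<^bsub>M\<^esub> \<longrightarrow> (\<forall>b\<in>A. f b = \<zero>\<^bsub>R\<^esub>))"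

definition free_module ::
    "('r, 'p) ring_scheme \<Rightarrow> ('r, 'v, 's) module_scheme \<Rightarrow> bool" where
  "free_module R M \<longleftrightarrow> module R M \<and> (\<exists>B. module_basis R M B)"

text \<open>The ring of Laurent polynomials in the variable \<open>q\<^sup>1\<^sup>/\<^sup>2\<close> is the group ring of the
  integers; the exponent \<open>k\<close> stands for \<open>q\<^sup>k\<^sup>/\<^sup>2\<close>.\<close>

type_synonym laurent = "int \<Rightarrow>\<^sub>0 int"

definition q_half_pow :: "int \<Rightarrow> laurent" where
  "q_half_pow k = Poly_Mapping.single k 1"

definition laurent_ring :: "laurent ring" where
  "laurent_ring = \<lparr>carrier = UNIV, monoid.mult = (*), one = 1, ring.zero = 0, add = (+)\<rparr>"

section \<open>Homology twisted by a rank one local system\<close>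

text \<open>A rank one local system is encoded by choosing a generator of the fibre at every point and
  recording, for each path \<open>\<gamma> : [0,1] \<rightarrow> X\<close>, the scalar \<open>T \<gamma>\<close> by which parallel transport from
  the fibre at \<open>\<gamma> 0\<close> to the fibre at \<open>\<gamma> 1\<close> acts with respect to these generators.  The generators
  need not vary continuously.\<close>

type_synonym 'x transport = "(real \<Rightarrow> 'x) \<Rightarrow> laurent"

definition pullback_transport :: "('x \<Rightarrow> 'y) \<Rightarrow> 'y transport \<Rightarrow> 'x transport" where
  "pullback_transport W T \<gamma> = T (W \<circ> \<gamma>)"

type_synonym 'x tchain = "((nat \<Rightarrow> real) \<Rightarrow> 'x) \<Rightarrow>\<^sub>0 laurent"

definition chain_scale :: "laurent \<Rightarrow> 'x tchain \<Rightarrow> 'x tchain" where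
  "chain_scale r c = Poly_Mapping.map ((*) r) c"

definition twisted_chains :: "nat \<Rightarrow> 'x topology \<Rightarrow> 'x tchain set" where
  "twisted_chains n X = {c. Poly_Mapping.keys c \<subseteq> singular_simplex_set n X}"

text \<open>The coefficient of a singular simplex lives in the fibre over the image of its vertex \<open>0\<close>.
  The face opposite to that vertex starts at vertex \<open>1\<close>, hence the transport along the first edge.\<close>

definition first_edge :: "((nat \<Rightarrow> real) \<Rightarrow> 'x) \<Rightarrow> real \<Rightarrow> 'x" where
  "first_edge \<sigma> t = \<sigma> (\<lambda>i. if i = 0 then 1 - t else if i = 1 then t else 0)"

definition twisted_boundary :: "'x transport \<Rightarrow> nat \<Rightarrow> 'x tchain \<Rightarrow> 'x tchain" where
  "twisted_boundary T n c =
     (if n = 0 then 0 else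
        \<Sum>\<sigma>\<in>Poly_Mapping.keys c. \<Sum>k\<le>n.
          Poly_Mapping.single (singular_face n k \<sigma>)
            ((-1) ^ k * (if k = 0 then T (first_edge \<sigma>) else 1) * Poly_Mapping.lookup c \<sigma>))"

definition twisted_relcycles ::
    "'x transport \<Rightarrow> nat \<Rightarrow> 'x topology \<Rightarrow> 'x set \<Rightarrow> 'x tchain set" where
  "twisted_relcycles T n X A =
     {c \<in> twisted_chains n X. twisted_boundary T n c \<in> twisted_chains (n - 1) (subtopology X A)}"

definition twisted_relboundaries ::
    "'x transport \<Rightarrow> nat \<Rightarrow> 'x topology \<Rightarrow> 'x set \<Rightarrow> 'x tchain set" where
  "twisted_relboundaries T n X A =
     {twisted_boundary T (Suc n) e + a | e a.
        e \<in> twisted_chains (Suc n) X \<and> a \<in> twisted_chains n (subtopology X A)}"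

definition twisted_class ::
    "'x transport \<Rightarrow> nat \<Rightarrow> 'x topology \<Rightarrow> 'x set \<Rightarrow> 'x tchain \<Rightarrow> 'x tchain set" where
  "twisted_class T n X A z =
     {z' \<in> twisted_relcycles T n X A. z' - z \<in> twisted_relboundaries T n X A}"

text \<open>The fields \<open>mult\<close> and \<open>one\<close> play no role in a module.\<close>

definition twisted_homology ::
    "'x transport \<Rightarrow> nat \<Rightarrow> 'x topology \<Rightarrow> 'x set \<Rightarrow> (laurent, 'x tchain set) module" where
  "twisted_homology T n X A =
     \<lparr>carrier = twisted_class T n X A ` twisted_relcycles T n X A,
      monoid.mult = undefined, one = undefined,
      ring.zero = twisted_class T n X A 0,
      add = (\<lambda>g h. twisted_class T n X A ((SOME z. z \<in> g) + (SOME z. z \<in> h))),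
      smult = (\<lambda>r h. twisted_class T n X A (chain_scale r (SOME z. z \<in> h)))\<rparr>"

text \<open>The Borel--Moore homology of \<open>(X, Y)\<close> is the inverse limit of the homology of
  \<open>(X, Y \<union> (X - K))\<close> over the compact subsets \<open>K\<close> of \<open>X\<close>; the transition map for \<open>K \<subseteq> L\<close> sends
  the class of a relative cycle \<open>z\<close> to the class of \<open>z\<close>.\<close>

definition off_compact :: "'x topology \<Rightarrow> 'x set \<Rightarrow> 'x set \<Rightarrow> 'x set" where
  "off_compact X Y K = Y \<union> (topspace X - K)"

definition borel_moore_homology ::
    "'x transport \<Rightarrow> nat \<Rightarrow> 'x topology \<Rightarrow> 'x set \<Rightarrow> (laurent, 'x set \<Rightarrow> 'x tchain set) module" where
  "borel_moore_homology T n X Y =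
     (let H = (\<lambda>K. twisted_homology T n X (off_compact X Y K)) in
      \<lparr>carrier = {h \<in> Pi\<^sub>E {K. compactin X K} (\<lambda>K. carrier (H K)).
          \<forall>K L. compactin X K \<and> compactin X L \<and> K \<subseteq> L \<longrightarrow>
            (\<forall>z \<in> h L. h K = twisted_class T n X (off_compact X Y K) z)},
       monoid.mult = undefined, one = undefined,
       ring.zero = (\<lambda>K\<in>{K. compactin X K}. \<zero>\<^bsub>H K\<^esub>),
       add = (\<lambda>g h. \<lambda>K\<in>{K. compactin X K}. g K \<oplus>\<^bsub>H K\<^esub> h K),
       smult = (\<lambda>r h. \<lambda>K\<in>{K. compactin X K}. r \<odot>\<^bsub>H K\<^esub> h K)\<rparr>)"

section \<open>Rank one local systems on tori\<close>

text \<open>On a circle, the generator of the fibre at \<open>exp (2 \<pi> \<i> x)\<close>, \<open>0 \<le> x < 1\<close>, is the transport of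
  the generator \<open>1\<close> of the fibre at the base point \<open>1\<close> along the counterclockwise arc.  A path then
  acts by the monodromy to the number of its signed crossings of the base point.\<close>

definition crossings :: "(real \<Rightarrow> complex) \<Rightarrow> int" where
  "crossings \<gamma> =
     (let \<theta> = (SOME \<theta>. continuous_on {0..1} \<theta> \<and> (\<forall>t\<in>{0..1}. \<gamma> t = cis (2 * pi * \<theta> t)))
      in \<lfloor>\<theta> 1\<rfloor> - \<lfloor>\<theta> 0\<rfloor>)"

definition torus_transport :: "'i set \<Rightarrow> ('i \<Rightarrow> laurent) \<Rightarrow> ('i \<Rightarrow> complex) transport" where
  "torus_transport I u \<gamma> = (\<Prod>p\<in>I. u p [^]\<^bsub>laurent_ring\<^esub> crossings (\<lambda>t. \<gamma> t p))"

lemma crossings_eq: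
  assumes "continuous_on {0..1} \<theta>" "\<And>t. t \<in> {0..1} \<Longrightarrow> \<gamma> t = cis (2 * pi * \<theta> t)"
  shows "crossings \<gamma> = \<lfloor>\<theta> 1\<rfloor> - \<lfloor>\<theta> 0\<rfloor>"
proof -
  define P where "P \<theta> \<longleftrightarrow> continuous_on {0..1} \<theta> \<and> (\<forall>t\<in>{0..1}. \<gamma> t = cis (2 * pi * \<theta> t))"
    for \<theta> :: "real \<Rightarrow> real"
  define \<eta> where "\<eta> = (SOME \<theta>. P \<theta>)"
  have "P \<theta>"
    using assms by (simp add: P_def)
  then have \<eta>: "P \<eta>"
    unfolding \<eta>_def by (rule someI[of P])
  let ?d = "\<lambda>t. \<eta> t - \<theta> t"
  have cont: "continuous_on {0..1} ?d"
    using \<eta> assms(1) by (auto simp: P_def intro!: continuous_intros)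
  have int: "?d t \<in> \<int>" if "t \<in> {0..1}" for t
  proof -
    have "cis (2 * pi * \<eta> t) = cis (2 * pi * \<theta> t)"
      using \<eta> assms(2)[OF that] that by (simp add: P_def)
    then have "cis (2 * pi * ?d t) = 1"
      by (simp add: right_diff_distrib cis_divide[symmetric])
    then have "cos (2 * pi * ?d t) = 1"
      by (metis cis.simps(1) one_complex.simps(1))
    then obtain k :: int where "2 * pi * ?d t = real_of_int k * 2 * pi"
      by (auto simp: cos_one_2pi_int)
    then have "?d t = real_of_int k"
      by simp
    then show ?thesis
      by simp
  qed
  have "?d constant_on {0..1}"
  proof (rule continuous_discrete_range_constant[OF _ cont])
    show "connected {0..1::real}"
      by simp
    show "\<exists>e>0. \<forall>y. y \<in> {0..1} \<and> ?d y \<noteq> ?d x \<longrightarrow> e \<le> norm (?d y - ?d x)" if "x \<in> {0..1}" for x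
    proof (intro exI[of _ 1] conjI allI impI)
      fix y assume y: "y \<in> {0..1} \<and> ?d y \<noteq> ?d x"
      then have "?d y - ?d x \<in> \<int>"
        using int[OF that] int[of y] by (metis Ints_diff)
      then show "1 \<le> norm (?d y - ?d x)"
        using y Ints_nonzero_abs_ge1[of "?d y - ?d x"] by simp
    qed simp
  qed
  then have "?d 1 = ?d 0"
    unfolding constant_on_def by (metis atLeastAtMost_iff order_refl zero_le_one)
  moreover obtain k where "?d 0 = of_int k"
    using int[of 0] by (auto elim: Ints_cases)
  ultimately have "\<eta> 1 = \<theta> 1 + of_int k" "\<eta> 0 = \<theta> 0 + of_int k"
    by auto
  then have "\<lfloor>\<eta> 1\<rfloor> - \<lfloor>\<eta> 0\<rfloor> = \<lfloor>\<theta> 1\<rfloor> - \<lfloor>\<theta> 0\<rfloor>"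
    by simp
  then show ?thesis
    by (simp add: crossings_def \<eta>_def P_def Let_def)
qed

lemma crossings_counterclockwise: "crossings (\<lambda>t. cis (2 * pi * t)) = 1"
  using crossings_eq[of "\<lambda>t. t"] by simp

section \<open>Lie data\<close>

text \<open>The Cartan matrices of semisimple Lie algebras are the generalized Cartan matrices that admit
  a symmetrization that is positive definite.  Simple roots and colors are numbered from 1 to \<open>l\<close>.\<close>

definition cartan_datum :: "nat \<Rightarrow> (nat \<Rightarrow> nat \<Rightarrow> int) \<Rightarrow> (nat \<Rightarrow> int) \<Rightarrow> bool" where
  "cartan_datum l a d \<longleftrightarrow>
     (\<forall>i\<in>{1..l}. a i i = 2) \<and>
     (\<forall>i\<in>{1..l}. \<forall>j\<in>{1..l}. i \<noteq> j \<longrightarrow> a i j \<le> 0) \<and>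
     (\<forall>i\<in>{1..l}. \<forall>j\<in>{1..l}. a i j = 0 \<longrightarrow> a j i = 0) \<and>
     (\<forall>i\<in>{1..l}. 0 < d i) \<and>
     (\<forall>i\<in>{1..l}. \<forall>j\<in>{1..l}. d i * a i j = d j * a j i) \<and>
     (\<forall>x :: nat \<Rightarrow> real. (\<exists>i\<in>{1..l}. x i \<noteq> 0) \<longrightarrow>
        0 < (\<Sum>i\<in>{1..l}. \<Sum>j\<in>{1..l}. of_int (d i * a i j) * x i * x j))"

definition root_form :: "(nat \<Rightarrow> nat \<Rightarrow> int) \<Rightarrow> (nat \<Rightarrow> int) \<Rightarrow> nat \<Rightarrow> nat \<Rightarrow> int" where
  "root_form a d i j = d i * a i j"

section \<open>Colored configuration spaces\<close>

definition coloring_size :: "nat \<Rightarrow> (nat \<Rightarrow> nat) \<Rightarrow> nat" where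
  "coloring_size l c = (\<Sum>i\<in>{1..l}. c i)"

definition square :: "complex set" where
  "square = {z. \<bar>Re z\<bar> \<le> 1 \<and> \<bar>Im z\<bar> \<le> 1}"

definition vertical_sides :: "complex set" where
  "vertical_sides = {z \<in> square. \<bar>Re z\<bar> = 1}"

definition quotient_topology :: "'x topology \<Rightarrow> ('x \<Rightarrow> 'y) \<Rightarrow> 'y topology" where
  "quotient_topology X f =
     topology (\<lambda>U. U \<subseteq> f ` topspace X \<and> openin X {x \<in> topspace X. f x \<in> U})"

lemma openin_quotient_topology:
  "openin (quotient_topology X f) U \<longleftrightarrow>
     U \<subseteq> f ` topspace X \<and> openin X {x \<in> topspace X. f x \<in> U}"
proof -
  have "istopology (\<lambda>U. U \<subseteq> f ` topspace X \<and> openin X {x \<in> topspace X. f x \<in> U})"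
    unfolding istopology_def
  proof (intro conjI allI impI)
    fix S T
    assume "S \<subseteq> f ` topspace X \<and> openin X {x \<in> topspace X. f x \<in> S}"
      and "T \<subseteq> f ` topspace X \<and> openin X {x \<in> topspace X. f x \<in> T}"
    moreover have "{x \<in> topspace X. f x \<in> S \<inter> T} =
        {x \<in> topspace X. f x \<in> S} \<inter> {x \<in> topspace X. f x \<in> T}"
      by auto
    ultimately show "S \<inter> T \<subseteq> f ` topspace X" "openin X {x \<in> topspace X. f x \<in> S \<inter> T}"
      by auto
  next
    fix \<K>
    assume \<K>: "\<forall>K\<in>\<K>. K \<subseteq> f ` topspace X \<and> openin X {x \<in> topspace X. f x \<in> K}"
    then show "\<Union> \<K> \<subseteq> f ` topspace X"
      by blast
    have "{x \<in> topspace X. f x \<in> \<Union> \<K>} = (\<Union>K\<in>\<K>. {x \<in> topspace X. f x \<in> K})"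
      by auto
    with \<K> show "openin X {x \<in> topspace X. f x \<in> \<Union> \<K>}"
      by auto
  qed
  then show ?thesis
    by (simp add: quotient_topology_def)
qed

lemma topspace_quotient_topology: "topspace (quotient_topology X f) = f ` topspace X"
proof
  show "topspace (quotient_topology X f) \<subseteq> f ` topspace X"
    unfolding topspace_def[of "quotient_topology X f"] by (auto simp: openin_quotient_topology)
  have "{x \<in> topspace X. f x \<in> f ` topspace X} = topspace X"
    by auto
  then have "openin (quotient_topology X f) (f ` topspace X)"
    by (simp add: openin_quotient_topology)
  then show "f ` topspace X \<subseteq> topspace (quotient_topology X f)"
    by (rule openin_subset)
qed

lemma quotient_map_quotient_topology: "quotient_map X (quotient_topology X f) f"
  by (auto simp: quotient_map_def topspace_quotient_topology openin_quotient_topology)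

text \<open>Points of an ordered configuration are labelled by pairs (color, rank within the color).
  Forgetting the ranks identifies exactly the configurations in the same orbit of the product of
  symmetric groups.  The result is the family of the sets of points of each color.\<close>

definition point_labels :: "nat \<Rightarrow> (nat \<Rightarrow> nat) \<Rightarrow> (nat \<times> nat) set" where
  "point_labels l c = (SIGMA i:{1..l}. {..<c i})"

definition ordered_conf :: "nat \<Rightarrow> (nat \<Rightarrow> nat) \<Rightarrow> (nat \<times> nat \<Rightarrow> complex) topology" where
  "ordered_conf l c =
     subtopology (product_topology (\<lambda>_. euclidean) (point_labels l c))
       {z \<in> Pi\<^sub>E (point_labels l c) (\<lambda>_. square). inj_on z (point_labels l c)}"

type_synonym config = "nat \<Rightarrow> complex set"

definition forget_order :: "nat \<Rightarrow> (nat \<Rightarrow> nat) \<Rightarrow> (nat \<times> nat \<Rightarrow> complex) \<Rightarrow> config" where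
  "forget_order l c z = (\<lambda>i. {z (i, k) | k. (i, k) \<in> point_labels l c})"

definition Conf :: "nat \<Rightarrow> (nat \<Rightarrow> nat) \<Rightarrow> config topology" where
  "Conf l c = quotient_topology (ordered_conf l c) (forget_order l c)"

definition Conf_side :: "nat \<Rightarrow> (nat \<Rightarrow> nat) \<Rightarrow> config set" where
  "Conf_side l c = {Z \<in> topspace (Conf l c). \<exists>i\<in>{1..l}. Z i \<inter> vertical_sides \<noteq> {}}"

section \<open>The local system on the configuration space\<close>

text \<open>Each factor is symmetric in the two points, so any enumeration of \<open>Z\<close> gives the same product;
  the lexicographic one is used.\<close>

definition self_phase :: "complex set \<Rightarrow> complex" where
  "self_phase Z =
     (\<Prod>(z, w) \<in> {(z, w) \<in> Z \<times> Z. Re z < Re w \<or> (Re z = Re w \<and> Im z < Im w)}. (sgn (w - z))\<^sup>2)"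

definition mixed_phase :: "complex set \<Rightarrow> complex set \<Rightarrow> complex" where
  "mixed_phase Z Z' = (\<Prod>(z, w) \<in> Z \<times> Z'. (sgn (w - z))\<^sup>2)"

definition torus_coords :: "nat \<Rightarrow> (nat \<times> nat) set" where
  "torus_coords l = {(i, j). i \<in> {1..l} \<and> j \<in> {1..l} \<and> i \<le> j}"

definition phase_map :: "config \<Rightarrow> nat \<times> nat \<Rightarrow> complex" where
  "phase_map Z = (\<lambda>(i, j). if i = j then self_phase (Z i) else mixed_phase (Z i) (Z j))"

definition rotate_config :: "config \<Rightarrow> config" where
  "rotate_config Z = (\<lambda>i. (\<lambda>z. \<i> * z) ` Z i)"

definition monodromy :: "(nat \<Rightarrow> nat \<Rightarrow> int) \<Rightarrow> (nat \<Rightarrow> int) \<Rightarrow> nat \<times> nat \<Rightarrow> laurent" where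
  "monodromy a d = (\<lambda>(i, j). if i = j then - q_half_pow (2 * d i) else q_half_pow (root_form a d i j))"

definition Conf_transport ::
    "nat \<Rightarrow> (nat \<Rightarrow> nat \<Rightarrow> int) \<Rightarrow> (nat \<Rightarrow> int) \<Rightarrow> config transport" where
  "Conf_transport l a d =
     pullback_transport (phase_map \<circ> rotate_config) (torus_transport (torus_coords l) (monodromy a d))"

definition HBM ::
    "nat \<Rightarrow> (nat \<Rightarrow> nat \<Rightarrow> int) \<Rightarrow> (nat \<Rightarrow> int) \<Rightarrow> (nat \<Rightarrow> nat) \<Rightarrow> nat
      \<Rightarrow> (laurent, config set \<Rightarrow> config tchain set) module" where
  "HBM l a d c n = borel_moore_homology (Conf_transport l a d) n (Conf l c) (Conf_side l c)"

section \<open>Pearl necklaces\<close>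

definition color_words :: "nat \<Rightarrow> (nat \<Rightarrow> nat) \<Rightarrow> nat list set" where
  "color_words l c =
     {r. length r = coloring_size l c \<and> set r \<subseteq> {1..l} \<and> (\<forall>i\<in>{1..l}. count_list r i = c i)}"

definition place_points :: "nat list \<Rightarrow> (nat \<Rightarrow> complex) \<Rightarrow> config" where
  "place_points r p = (\<lambda>i. {p j | j. j < length r \<and> r ! j = i})"

text \<open>In the code the points of a necklace are numbered from 0: \<open>t j\<close> stands for the coordinate
  written \<open>t\<^sub>j\<^sub>+\<^sub>1\<close> in the comments.\<close>

definition segment_config :: "nat list \<Rightarrow> (nat \<Rightarrow> real) \<Rightarrow> config" where
  "segment_config r t = place_points r (\<lambda>j. complex_of_real (-1 + 2 * t j))"

text \<open>The open simplex of necklaces is exhausted by the closed simplices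
  \<open>0 \<le> t\<^sub>1, t\<^sub>j + \<epsilon> \<le> t\<^sub>j\<^sub>+\<^sub>1, t\<^sub>m \<le> 1\<close> as \<open>\<epsilon>\<close> tends to 0.  Of their faces, the two outermost ones
  lie in \<open>S\<close>, and the others leave every compact set.  The parametrization by the standard
  simplex sends the vertex number \<open>k\<close> to the point with \<open>t\<^sub>j = (j - 1) \<epsilon>\<close> for \<open>j \<le> k\<close> and
  \<open>t\<^sub>j = 1 - (m - j) \<epsilon>\<close> for \<open>j > k\<close>.\<close>

definition necklace_coords :: "nat \<Rightarrow> real \<Rightarrow> (nat \<Rightarrow> real) \<Rightarrow> nat \<Rightarrow> real" where
  "necklace_coords m \<epsilon> x j = (1 - (real m - 1) * \<epsilon>) * (\<Sum>k\<le>j. x k) + real j * \<epsilon>"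

definition necklace_simplex :: "nat list \<Rightarrow> real \<Rightarrow> (nat \<Rightarrow> real) \<Rightarrow> config" where
  "necklace_simplex r \<epsilon> =
     (\<lambda>x\<in>standard_simplex (length r). segment_config r (necklace_coords (length r) \<epsilon> x))"

text \<open>The point carrying the coordinate \<open>t j\<close> starts on the right side at height \<open>- (m - j) / (m + 1)\<close>,
  moves left and then up.\<close>

definition handle :: "nat list \<Rightarrow> (nat \<Rightarrow> real) \<Rightarrow> real \<Rightarrow> config" where
  "handle r t s = place_points r
     (\<lambda>j. let x = -1 + 2 * t j; y = - (real (length r) - real j) / (real (length r) + 1) in
        if s \<le> 1 / 2 then Complex (1 - 2 * s * (1 - x)) y else Complex x ((2 - 2 * s) * y))"

text \<open>The handle ends at vertex 0 of the simplex.  The parametrization by the standard simplex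
  has degree \<open>(-1)\<^sup>m\<close> with respect to the orientation given by the coordinates
  \<open>(t\<^sub>1, \<dots>, t\<^sub>m)\<close>, which accounts for the sign.\<close>

definition necklace_chain ::
    "nat \<Rightarrow> (nat \<Rightarrow> nat \<Rightarrow> int) \<Rightarrow> (nat \<Rightarrow> int) \<Rightarrow> nat list \<Rightarrow> real \<Rightarrow> config tchain" where
  "necklace_chain l a d r \<epsilon> =
     Poly_Mapping.single (necklace_simplex r \<epsilon>)
       ((-1) ^ length r *
        Conf_transport l a d
          (handle r (necklace_coords (length r) \<epsilon> (\<lambda>i. if i = 0 then 1 else 0))))"

definition necklace_class ::
    "nat \<Rightarrow> (nat \<Rightarrow> nat \<Rightarrow> int) \<Rightarrow> (nat \<Rightarrow> int) \<Rightarrow> (nat \<Rightarrow> nat) \<Rightarrow> nat list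
      \<Rightarrow> config set \<Rightarrow> config tchain set" where
  "necklace_class l a d c r =
     (\<lambda>K\<in>{K. compactin (Conf l c) K}.
        let T = Conf_transport l a d; m = coloring_size l c;
            A = off_compact (Conf l c) (Conf_side l c) K
        in THE h. \<forall>\<^sub>F \<epsilon> in at_right 0.
             necklace_chain l a d r \<epsilon> \<in> twisted_relcycles T m (Conf l c) A \<and>
             h = twisted_class T m (Conf l c) A (necklace_chain l a d r \<epsilon>))"

end

theory Submission
  imports Defs "HOL-Analysis.Further_Topology"
begin

text \<open>The compact sets of configurations at mutual distances at least \<open>e\<close> exhaust the configuration
  space, so only the homology relative to \<open>A\<^sub>e\<close> matters, where \<open>A\<^sub>e\<close> consists of \<open>S\<close> and the
  configurations with two points at distance less than \<open>e\<close>.  Compressing the heights of all points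
  preserves \<open>A\<^sub>e\<close> and moves the configurations with two nearly equal real parts into \<open>A\<^sub>e\<close>.  Hence one may
  excise the configurations whose real parts are not pairwise distinct.  What is left is the disjoint union,
  over the words \<open>r\<close>, of chambers in which the colors are read off as \<open>r\<close> from left to right.  The horizontal
  gaps between neighbours deform the chamber of \<open>r\<close> onto the simplex, with \<open>A\<^sub>e\<close> corresponding to its boundary
  and the necklace of \<open>r\<close> to its fundamental class.  On a chamber the local system is trivial, and so the
  homology is free of rank one in degree \<open>m\<close> and vanishes in the other degrees.  The handles are
  compatible with the change of \<open>e\<close>, so the bases fit together in the limit.\<close>

section \<open>Chains with Laurent coefficients\<close>

text \<open>Two features keep the standard theorems from applying directly: coefficients vary along
  paths, and configurations with aligned points enter \<open>A_e\<close> only at the end of the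
  compression, so the set to be excised is not contained in \<open>A_e\<close>. One device meets
  both. A prism over a simplex contracts onto a corner, so the local system has a potential on it,
  and integral chains chosen once on the universal prisms can be pushed into any twisted complex.
  They give a single operator that subdivides and compresses at the same time. On a convex chamber
  the same kind of potential removes the twisting, and the exponents of the Laurent polynomials then
  split the complex into copies of the integral one. The constants come from widths and heights: the
  horizontal gaps add up to 2, so after subtracting at most \<open>(m + 1) * e\<close>, which is at
  most 1, enough is left to rescale; heights differ by at most 2, so the factor \<open>e / 4\<close>
  brings them within \<open>e / 2\<close>; and \<open>2 * m * \<epsilon> < e\<close> keeps any run
  of beads with collapsed gaps shorter than \<open>e\<close>.\<close>

lemma lookup_chain_scale [simp]:
  "Poly_Mapping.lookup (chain_scale r c) \<sigma> = r * Poly_Mapping.lookup c \<sigma>"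
  unfolding chain_scale_def by transfer (simp add: when_def)

lemma chain_scale_add: "chain_scale r (a + b) = chain_scale r a + chain_scale r b"
  by (rule poly_mapping_eqI) (simp add: lookup_add distrib_left)

lemma chain_scale_diff: "chain_scale r (a - b) = chain_scale r a - chain_scale r b"
  by (rule poly_mapping_eqI) (simp add: lookup_minus right_diff_distrib)

lemma chain_scale_add_left: "chain_scale (r + s) a = chain_scale r a + chain_scale s a"
  by (rule poly_mapping_eqI) (simp add: lookup_add distrib_right)

lemma chain_scale_scale [simp]: "chain_scale r (chain_scale s a) = chain_scale (r * s) a"
  by (rule poly_mapping_eqI) (simp add: mult.assoc)

lemma chain_scale_one [simp]: "chain_scale 1 a = a"
  by (rule poly_mapping_eqI) simp

lemma chain_scale_0 [simp]: "chain_scale r 0 = 0"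
  by (rule poly_mapping_eqI) simp

lemma chain_scale_0_left [simp]: "chain_scale 0 a = 0"
  by (rule poly_mapping_eqI) simp

lemma chain_scale_minus_left: "chain_scale (- r) a = - chain_scale r a"
  by (rule poly_mapping_eqI) simp

lemma chain_scale_sum: "chain_scale r (\<Sum>i\<in>I. f i) = (\<Sum>i\<in>I. chain_scale r (f i))"
  by (induction I rule: infinite_finite_induct) (simp_all add: chain_scale_add)

lemma chain_scale_single [simp]:
  "chain_scale r (Poly_Mapping.single \<sigma> s) = Poly_Mapping.single \<sigma> (r * s)"
  by (rule poly_mapping_eqI) (simp add: lookup_single when_def)

lemma keys_chain_scale: "Poly_Mapping.keys (chain_scale r c) \<subseteq> Poly_Mapping.keys c"
  by (auto simp: in_keys_iff)

text \<open>The twisted counterpart of \<open>frag_extend\<close>. Boundaries, pushforwards,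
  restrictions and prism operators all have this form, so identities between their composites reduce
  to single simplices by \<open>lextend_lextend\<close> and \<open>lextend_cong\<close>.\<close>

definition lextend :: "(((nat \<Rightarrow> real) \<Rightarrow> 'x) \<Rightarrow> 'y tchain) \<Rightarrow> 'x tchain \<Rightarrow> 'y tchain" where
  "lextend g c = (\<Sum>\<sigma>\<in>Poly_Mapping.keys c. chain_scale (Poly_Mapping.lookup c \<sigma>) (g \<sigma>))"

lemma lextend_superset:
  assumes "finite S" "Poly_Mapping.keys c \<subseteq> S"
  shows "lextend g c = (\<Sum>\<sigma>\<in>S. chain_scale (Poly_Mapping.lookup c \<sigma>) (g \<sigma>))"
  unfolding lextend_def
  by (rule sum.mono_neutral_left[OF assms]) (simp add: in_keys_iff)

lemma lextend_0 [simp]: "lextend g 0 = 0"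
  by (simp add: lextend_def)

lemma lextend_single [simp]: "lextend g (Poly_Mapping.single \<sigma> r) = chain_scale r (g \<sigma>)"
  by (cases "r = 0") (simp_all add: lextend_def)

lemma lextend_add: "lextend g (a + b) = lextend g a + lextend g b"
proof -
  let ?S = "Poly_Mapping.keys a \<union> Poly_Mapping.keys b"
  have "Poly_Mapping.keys (a + b) \<subseteq> ?S"
    by (rule Poly_Mapping.keys_add)
  then show ?thesis
    by (simp add: lextend_superset[of ?S] lookup_add chain_scale_add_left sum.distrib)
qed

lemma lextend_scale: "lextend g (chain_scale r a) = chain_scale r (lextend g a)"
  by (simp add: lextend_superset[OF finite_keys keys_chain_scale, of g r a] lextend_def[of g a] chain_scale_sum)

lemma lextend_minus: "lextend g (- a) = - lextend g a"
  by (simp add: lextend_def chain_scale_minus_left sum_negf)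

lemma lextend_diff: "lextend g (a - b) = lextend g a - lextend g b"
  using lextend_add[of g a "- b"] by (simp add: lextend_minus)

lemma lextend_sum: "lextend g (\<Sum>i\<in>I. f i) = (\<Sum>i\<in>I. lextend g (f i))"
  by (induction I rule: infinite_finite_induct) (simp_all add: lextend_add)

lemma lextend_lextend: "lextend g (lextend f c) = lextend (\<lambda>\<sigma>. lextend g (f \<sigma>)) c"
  by (simp add: lextend_def[of f] lextend_def[of "\<lambda>\<sigma>. lextend g (f \<sigma>)"] lextend_sum lextend_scale)

lemma lextend_cong:
  "(\<And>\<sigma>. \<sigma> \<in> Poly_Mapping.keys c \<Longrightarrow> g \<sigma> = g' \<sigma>) \<Longrightarrow> lextend g c = lextend g' c"
  unfolding lextend_def by (intro sum.cong) auto

lemma lextend_diff_fun: "lextend (\<lambda>\<sigma>. g \<sigma> - g' \<sigma>) c = lextend g c - lextend g' c"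
  by (simp add: lextend_def chain_scale_diff sum_subtractf)

lemma lextend_single_one: "lextend (\<lambda>\<sigma>. Poly_Mapping.single \<sigma> 1) c = c"
proof -
  have "lextend (\<lambda>\<sigma>. Poly_Mapping.single \<sigma> 1) c
      = (\<Sum>\<sigma>\<in>Poly_Mapping.keys c. Poly_Mapping.single \<sigma> (Poly_Mapping.lookup c \<sigma>))"
    by (simp add: lextend_def)
  also have "\<dots> = c"
    by (rule poly_mapping_eqI) (auto simp: lookup_sum lookup_single when_def in_keys_iff)
  finally show ?thesis .
qed

lemma keys_lextend:
  "Poly_Mapping.keys (lextend g c) \<subseteq> (\<Union>\<sigma>\<in>Poly_Mapping.keys c. Poly_Mapping.keys (g \<sigma>))"
proof -
  have "Poly_Mapping.keys (lextend g c) \<subseteq>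
      (\<Union>\<sigma>\<in>Poly_Mapping.keys c. Poly_Mapping.keys (chain_scale (Poly_Mapping.lookup c \<sigma>) (g \<sigma>)))"
    unfolding lextend_def by (rule Poly_Mapping.keys_sum)
  then show ?thesis
    using keys_chain_scale by fastforce
qed

section \<open>Twisted chains, relative cycles and relative boundaries\<close>

lemma twisted_chains_iff:
  "c \<in> twisted_chains n X \<longleftrightarrow> (\<forall>\<sigma>\<in>Poly_Mapping.keys c. singular_simplex n X \<sigma>)"
  by (auto simp: twisted_chains_def)

lemma twisted_chains_0 [simp]: "0 \<in> twisted_chains n X"
  by (simp add: twisted_chains_def)

lemma twisted_chains_add:
  "a \<in> twisted_chains n X \<Longrightarrow> b \<in> twisted_chains n X \<Longrightarrow> a + b \<in> twisted_chains n X"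
  using Poly_Mapping.keys_add[of a b] by (fastforce simp: twisted_chains_iff)

lemma twisted_chains_minus: "- a \<in> twisted_chains n X \<longleftrightarrow> a \<in> twisted_chains n X"
  by (simp add: twisted_chains_def)

lemma twisted_chains_diff:
  "a \<in> twisted_chains n X \<Longrightarrow> b \<in> twisted_chains n X \<Longrightarrow> a - b \<in> twisted_chains n X"
  using twisted_chains_add[of a n X "- b"] by (simp add: twisted_chains_minus)

lemma twisted_chains_scale:
  "a \<in> twisted_chains n X \<Longrightarrow> chain_scale r a \<in> twisted_chains n X"
  using keys_chain_scale[of r a] by (auto simp: twisted_chains_iff)

lemma twisted_chains_sum:
  "(\<And>i. i \<in> I \<Longrightarrow> f i \<in> twisted_chains n X) \<Longrightarrow> (\<Sum>i\<in>I. f i) \<in> twisted_chains n X"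
  by (induction I rule: infinite_finite_induct) (simp_all add: twisted_chains_add)

lemma twisted_chains_single:
  "singular_simplex n X \<sigma> \<Longrightarrow> Poly_Mapping.single \<sigma> r \<in> twisted_chains n X"
  by (auto simp: twisted_chains_iff)

lemma twisted_chains_lextend:
  "(\<And>\<sigma>. \<sigma> \<in> Poly_Mapping.keys c \<Longrightarrow> g \<sigma> \<in> twisted_chains n X) \<Longrightarrow> lextend g c \<in> twisted_chains n X"
  unfolding lextend_def by (intro twisted_chains_sum twisted_chains_scale)

lemma twisted_chains_subtopology:
  "c \<in> twisted_chains n (subtopology X A) \<longleftrightarrow>
     c \<in> twisted_chains n X \<and> (\<forall>\<sigma>\<in>Poly_Mapping.keys c. \<sigma> ` standard_simplex n \<subseteq> A)"
  by (auto simp: twisted_chains_iff singular_simplex_subtopology)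

lemma twisted_chains_mono:
  "c \<in> twisted_chains n (subtopology X A) \<Longrightarrow> A \<subseteq> B \<Longrightarrow> c \<in> twisted_chains n (subtopology X B)"
  by (auto simp: twisted_chains_subtopology)

lemma twisted_chains_subtopologyD:
  "c \<in> twisted_chains n (subtopology X A) \<Longrightarrow> c \<in> twisted_chains n X"
  by (auto simp: twisted_chains_subtopology)

text \<open>The boundary of a simplex with coefficient 1. A coefficient multiplies all faces alike,
  so \<open>twisted_boundary\<close> is the linear extension of this.\<close>

definition face_sum :: "'x transport \<Rightarrow> nat \<Rightarrow> ((nat \<Rightarrow> real) \<Rightarrow> 'x) \<Rightarrow> 'x tchain" where
  "face_sum T n \<sigma> = (if n = 0 then 0 else
     \<Sum>k\<le>n. Poly_Mapping.single (singular_face n k \<sigma>)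
       ((-1) ^ k * (if k = 0 then T (first_edge \<sigma>) else 1)))"

lemma twisted_boundary_lextend: "twisted_boundary T n c = lextend (face_sum T n) c"
  by (auto simp: twisted_boundary_def lextend_def face_sum_def chain_scale_sum mult_ac
        intro!: sum.cong)

lemmas twisted_boundary_0 [simp] = lextend_0[of "face_sum T n" for T n, folded twisted_boundary_lextend]
  and twisted_boundary_add = lextend_add[of "face_sum T n" for T n, folded twisted_boundary_lextend]
  and twisted_boundary_diff = lextend_diff[of "face_sum T n" for T n, folded twisted_boundary_lextend]
  and twisted_boundary_scale = lextend_scale[of "face_sum T n" for T n, folded twisted_boundary_lextend]
  and twisted_boundary_sum = lextend_sum[of "face_sum T n" for T n, folded twisted_boundary_lextend]

lemma face_sum_chains:
  assumes "singular_simplex n X \<sigma>"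
  shows "face_sum T n \<sigma> \<in> twisted_chains (n - 1) X"
  using assms unfolding face_sum_def
  by (auto intro!: twisted_chains_sum twisted_chains_single singular_simplex_singular_face)

lemma twisted_boundary_chains:
  "c \<in> twisted_chains n X \<Longrightarrow> twisted_boundary T n c \<in> twisted_chains (n - 1) X"
  unfolding twisted_boundary_lextend
  by (intro twisted_chains_lextend face_sum_chains) (auto simp: twisted_chains_iff)

lemma twisted_relcycles_0 [simp]: "0 \<in> twisted_relcycles T n X A"
  by (simp add: twisted_relcycles_def)

lemma twisted_relcycles_add:
  "a \<in> twisted_relcycles T n X A \<Longrightarrow> b \<in> twisted_relcycles T n X A \<Longrightarrow> a + b \<in> twisted_relcycles T n X A"
  by (simp add: twisted_relcycles_def twisted_chains_add twisted_boundary_add)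

lemma twisted_relcycles_scale:
  "a \<in> twisted_relcycles T n X A \<Longrightarrow> chain_scale r a \<in> twisted_relcycles T n X A"
  by (simp add: twisted_relcycles_def twisted_chains_scale twisted_boundary_scale)

lemma twisted_relcycles_sum:
  "(\<And>i. i \<in> I \<Longrightarrow> f i \<in> twisted_relcycles T n X A) \<Longrightarrow> (\<Sum>i\<in>I. f i) \<in> twisted_relcycles T n X A"
  by (induction I rule: infinite_finite_induct) (simp_all add: twisted_relcycles_add)

lemma twisted_relcycles_mono:
  "c \<in> twisted_relcycles T n X A \<Longrightarrow> A \<subseteq> B \<Longrightarrow> c \<in> twisted_relcycles T n X B"
  by (auto simp: twisted_relcycles_def intro: twisted_chains_mono)

lemma twisted_relboundariesI:
  "e \<in> twisted_chains (Suc n) X \<Longrightarrow> a \<in> twisted_chains n (subtopology X A) \<Longrightarrow>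
   c = twisted_boundary T (Suc n) e + a \<Longrightarrow> c \<in> twisted_relboundaries T n X A"
  by (auto simp: twisted_relboundaries_def)

lemma twisted_relboundariesE:
  assumes "c \<in> twisted_relboundaries T n X A"
  obtains e a where "e \<in> twisted_chains (Suc n) X" "a \<in> twisted_chains n (subtopology X A)"
    "c = twisted_boundary T (Suc n) e + a"
  using assms by (auto simp: twisted_relboundaries_def)

lemma twisted_relboundaries_0 [simp]: "0 \<in> twisted_relboundaries T n X A"
  by (rule twisted_relboundariesI[of 0 _ _ 0]) auto

lemma twisted_relboundaries_add:
  assumes "a \<in> twisted_relboundaries T n X A" "b \<in> twisted_relboundaries T n X A"
  shows "a + b \<in> twisted_relboundaries T n X A"
proof -
  obtain e a' where 1: "e \<in> twisted_chains (Suc n) X" "a' \<in> twisted_chains n (subtopology X A)"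
    "a = twisted_boundary T (Suc n) e + a'" using assms(1) by (rule twisted_relboundariesE)
  obtain f b' where 2: "f \<in> twisted_chains (Suc n) X" "b' \<in> twisted_chains n (subtopology X A)"
    "b = twisted_boundary T (Suc n) f + b'" using assms(2) by (rule twisted_relboundariesE)
  show ?thesis
    by (rule twisted_relboundariesI[of "e + f" _ _ "a' + b'"])
      (use 1 2 in \<open>simp_all add: twisted_chains_add twisted_boundary_add\<close>)
qed

lemma twisted_relboundaries_scale:
  assumes "a \<in> twisted_relboundaries T n X A"
  shows "chain_scale r a \<in> twisted_relboundaries T n X A"
proof -
  obtain e a' where 1: "e \<in> twisted_chains (Suc n) X" "a' \<in> twisted_chains n (subtopology X A)"
    "a = twisted_boundary T (Suc n) e + a'" using assms(1) by (rule twisted_relboundariesE)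
  show ?thesis
    by (rule twisted_relboundariesI[of "chain_scale r e" _ _ "chain_scale r a'"])
      (use 1 in \<open>simp_all add: twisted_chains_scale twisted_boundary_scale chain_scale_add\<close>)
qed

lemma twisted_relboundaries_diff:
  assumes "a \<in> twisted_relboundaries T n X A" "b \<in> twisted_relboundaries T n X A"
  shows "a - b \<in> twisted_relboundaries T n X A"
  using twisted_relboundaries_add[OF assms(1) twisted_relboundaries_scale[OF assms(2), of "-1"]]
  by (simp add: chain_scale_minus_left)

lemma twisted_relboundaries_swap:
  "a - b \<in> twisted_relboundaries T n X A \<Longrightarrow> b - a \<in> twisted_relboundaries T n X A"
  using twisted_relboundaries_diff[OF twisted_relboundaries_0] by fastforce

lemma twisted_relboundaries_trans:
  "a - b \<in> twisted_relboundaries T n X A \<Longrightarrow> b - c \<in> twisted_relboundaries T n X A \<Longrightarrow>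
   a - c \<in> twisted_relboundaries T n X A"
  using twisted_relboundaries_add by fastforce

lemma twisted_relboundaries_sum:
  "(\<And>i. i \<in> I \<Longrightarrow> f i \<in> twisted_relboundaries T n X A) \<Longrightarrow> (\<Sum>i\<in>I. f i) \<in> twisted_relboundaries T n X A"
  by (induction I rule: infinite_finite_induct) (simp_all add: twisted_relboundaries_add)

lemma twisted_relboundaries_mono:
  "c \<in> twisted_relboundaries T n X A \<Longrightarrow> A \<subseteq> B \<Longrightarrow> c \<in> twisted_relboundaries T n X B"
  by (blast elim: twisted_relboundariesE intro: twisted_relboundariesI twisted_chains_mono)

section \<open>Chain maps of local systems\<close>

text \<open>The first clause is there because paths are functions on the whole real line. The square
  law is flatness: both ways around a continuous square agree. Homotopy invariance and reversal are
  extracted from it by choosing squares with constant sides, so concatenation of paths never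
  enters.\<close>

definition flat_transport :: "'x topology \<Rightarrow> 'x transport \<Rightarrow> bool" where
  "flat_transport X T \<longleftrightarrow>
     (\<forall>g g'. (\<forall>t\<in>{0..1}. g t = g' t) \<longrightarrow> T g = T g') \<and>
     (\<forall>x\<in>topspace X. T (\<lambda>_. x) = 1) \<and>
     (\<forall>s. continuous_map (top_of_set ({0..1} \<times> {0..1})) X s \<longrightarrow>
        T (\<lambda>t. s (0, t)) * T (\<lambda>t. s (t, 1)) = T (\<lambda>t. s (t, 0)) * T (\<lambda>t. s (1, t)))"

lemma flat_transport_cong:
  "flat_transport X T \<Longrightarrow> (\<And>t. t \<in> {0..1} \<Longrightarrow> g t = g' t) \<Longrightarrow> T g = T g'"
  by (auto simp: flat_transport_def)

lemma flat_transport_const: "flat_transport X T \<Longrightarrow> x \<in> topspace X \<Longrightarrow> T (\<lambda>_. x) = 1"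
  by (auto simp: flat_transport_def)

lemma flat_transport_square:
  "flat_transport X T \<Longrightarrow> continuous_map (top_of_set ({0..1} \<times> {0..1})) X s \<Longrightarrow>
     T (\<lambda>t. s (0, t)) * T (\<lambda>t. s (t, 1)) = T (\<lambda>t. s (t, 0)) * T (\<lambda>t. s (1, t))"
  by (auto simp: flat_transport_def)

text \<open>The morphism of local systems over \<open>f\<close> multiplies by \<open>u x\<close> in the fibre over \<open>x\<close>.\<close>

definition transport_morphism ::
    "'m topology \<Rightarrow> 'm transport \<Rightarrow> 'x transport \<Rightarrow> ('m \<Rightarrow> 'x) \<Rightarrow> ('m \<Rightarrow> laurent) \<Rightarrow> bool" where
  "transport_morphism M T' T f u \<longleftrightarrow>
     (\<forall>g. pathin M g \<longrightarrow> T' g * u (g 1) = u (g 0) * T (f \<circ> g))"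

definition base_vertex :: "nat \<Rightarrow> real" where
  "base_vertex = (\<lambda>i. if i = 0 then 1 else 0)"

text \<open>A coefficient lives in the fibre over vertex 0 of its simplex, so the morphism of local
  systems multiplies it by the value of \<open>u\<close> at that vertex.\<close>

definition push :: "nat \<Rightarrow> ('m \<Rightarrow> laurent) \<Rightarrow> ('m \<Rightarrow> 'x) \<Rightarrow> 'm tchain \<Rightarrow> 'x tchain" where
  "push p u f = lextend (\<lambda>\<tau>. Poly_Mapping.single (simplex_map p f \<tau>) (u (\<tau> base_vertex)))"

lemma push_0 [simp]: "push p u f 0 = 0"
  and push_add: "push p u f (a + b) = push p u f a + push p u f b"
  and push_diff: "push p u f (a - b) = push p u f a - push p u f b"
  and push_scale: "push p u f (chain_scale r a) = chain_scale r (push p u f a)"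
  and push_sum: "push p u f (\<Sum>i\<in>I. h i) = (\<Sum>i\<in>I. push p u f (h i))"
  by (simp_all add: push_def lextend_add lextend_diff lextend_scale lextend_sum)

lemma push_single [simp]:
  "push p u f (Poly_Mapping.single \<tau> r) = Poly_Mapping.single (simplex_map p f \<tau>) (r * u (\<tau> base_vertex))"
  by (simp add: push_def)

lemma base_vertex_simplex [simp]: "base_vertex \<in> standard_simplex p"
  by (simp add: base_vertex_def)

lemma twisted_chains_push:
  assumes "c \<in> twisted_chains p M" "continuous_map M X f"
  shows "push p u f c \<in> twisted_chains p X"
  unfolding push_def using assms
  by (intro twisted_chains_lextend twisted_chains_single singular_simplex_simplex_map)
     (auto simp: twisted_chains_iff)

lemma keys_push:
  "Poly_Mapping.keys (push p u f c) \<subseteq> simplex_map p f ` Poly_Mapping.keys c"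
  unfolding push_def using keys_lextend by (fastforce split: if_splits)

lemma push_push:
  assumes "c \<in> twisted_chains p M"
  shows "push p v g (push p u f c) = push p (\<lambda>x. u x * v (f x)) (g \<circ> f) c"
  unfolding push_def lextend_lextend
  by (rule lextend_cong) (simp add: simplex_map_compose, simp add: simplex_map_def)

lemma push_cong:
  assumes "c \<in> twisted_chains p M" "\<And>x. x \<in> topspace M \<Longrightarrow> f x = f' x" "\<And>x. x \<in> topspace M \<Longrightarrow> u x = u' x"
  shows "push p u f c = push p u' f' c"
  unfolding push_def
proof (rule lextend_cong)
  fix \<sigma> assume "\<sigma> \<in> Poly_Mapping.keys c"
  then have s: "singular_simplex p M \<sigma>"
    using assms(1) by (auto simp: twisted_chains_iff)
  then have "\<sigma> base_vertex \<in> topspace M"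
    by (auto simp: singular_simplex_def continuous_map_def Pi_iff)
  then show "Poly_Mapping.single (simplex_map p f \<sigma>) (u (\<sigma> base_vertex)) =
      Poly_Mapping.single (simplex_map p f' \<sigma>) (u' (\<sigma> base_vertex))"
    using simplex_map_eq[OF s, of f f'] assms by simp
qed

lemma push_id:
  assumes "c \<in> twisted_chains p M"
  shows "push p (\<lambda>_. 1) id c = c"
proof -
  have "push p (\<lambda>_. 1) id c = lextend (\<lambda>\<sigma>. Poly_Mapping.single \<sigma> 1) c"
    unfolding push_def using assms
    by (intro lextend_cong) (auto simp: twisted_chains_iff singular_simplex_def extensional_restrict)
  then show ?thesis
    by (simp add: lextend_single_one)
qed

lemma pathin_first_edge:
  assumes "singular_simplex p M \<tau>" "0 < p"
  shows "pathin M (first_edge \<tau>)"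
proof -
  let ?e = "\<lambda>t i. if i = (0::nat) then 1 - t else if i = 1 then t else (0::real)"
  have "continuous_map (top_of_set {0..1}) (powertop_real UNIV) ?e"
    unfolding continuous_map_componentwise_UNIV
  proof
    fix k :: nat
    show "continuous_map (top_of_set {0..1}) euclideanreal (\<lambda>t. ?e t k)"
      by (cases "k = 0"; cases "k = 1") (auto intro!: continuous_intros)
  qed
  moreover have "?e t \<in> standard_simplex p" if "t \<in> {0..1}" for t
  proof -
    have "(\<Sum>i\<le>p. ?e t i) = (\<Sum>i\<in>{0,1}. ?e t i)"
      using assms(2) by (intro sum.mono_neutral_right) auto
    then show ?thesis
      using that assms(2) by (auto simp: standard_simplex_def)
  qed
  ultimately have "continuous_map (top_of_set {0..1}) (subtopology (powertop_real UNIV) (standard_simplex p)) ?e"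
    by (auto simp: continuous_map_in_subtopology)
  from continuous_map_compose[OF this, of M \<tau>] assms(1)
  have "continuous_map (top_of_set {0..1}) M (\<tau> \<circ> ?e)"
    by (simp add: singular_simplex_def)
  moreover have "first_edge \<tau> = \<tau> \<circ> ?e"
    by (auto simp: first_edge_def fun_eq_iff)
  ultimately show ?thesis
    by (simp add: pathin_def)
qed

text \<open>Faces with \<open>k > 0\<close> keep vertex 0, so both sides carry the same factor. Face
  0 starts at vertex 1; there the identity is the morphism law along the first edge.\<close>

lemma face_sum_push:
  assumes T: "flat_transport X T" and f: "transport_morphism M T' T f u" and \<tau>: "singular_simplex p M \<tau>"
  shows "chain_scale (u (\<tau> base_vertex)) (face_sum T p (simplex_map p f \<tau>)) = push (p - 1) u f (face_sum T' p \<tau>)"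
proof (cases "p = 0")
  case False
  have e1: "(\<lambda>i. if i = 0 then 1 - t else if i = 1 then t else 0) \<in> standard_simplex p"
    if "t \<in> {0..1}" for t :: real
  proof -
    have "(\<Sum>i\<le>p. if i = 0 then 1 - t else if i = 1 then t else 0) = (\<Sum>i\<in>{0,1}. if i = 0 then 1 - t else if i = (1::nat) then t else 0)"
      using False by (intro sum.mono_neutral_right) auto
    then show ?thesis
      using that False by (auto simp: standard_simplex_def)
  qed
  have cong: "T (first_edge (simplex_map p f \<tau>)) = T (f \<circ> first_edge \<tau>)"
    using e1 by (intro flat_transport_cong[OF T]) (auto simp: simplex_map_def first_edge_def)
  have f0: "first_edge \<tau> 0 = \<tau> base_vertex"
    by (auto simp: first_edge_def base_vertex_def intro!: arg_cong[of _ _ \<tau>])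
  have fk: "singular_face p k \<tau> base_vertex = (if k = 0 then first_edge \<tau> 1 else \<tau> base_vertex)" if "k \<le> p" for k
  proof -
    have "singular_face p k \<tau> base_vertex = \<tau> (simplical_face k base_vertex)"
      by (simp add: singular_face_def)
    also have "simplical_face k base_vertex = (if k = 0 then (\<lambda>i. if i = 0 then 1 - 1 else if i = 1 then 1 else 0) else base_vertex)"
      by (auto simp: simplical_face_def base_vertex_def fun_eq_iff)
    finally show ?thesis
      by (simp add: first_edge_def)
  qed
  have m: "T' (first_edge \<tau>) * u (first_edge \<tau> 1) = u (\<tau> base_vertex) * T (first_edge (simplex_map p f \<tau>))"
    using f pathin_first_edge[OF \<tau>] False unfolding transport_morphism_def cong f0[symmetric] by auto
  have faces: "singular_face p k (simplex_map p f \<tau>) = simplex_map (p - 1) f (singular_face p k \<tau>)" if "k \<le> p" for k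
    using that False singular_face_simplex_map[of p k f \<tau>]
    by (auto simp: simplex_map_def singular_face_def fun_eq_iff)
  show ?thesis
    using False unfolding face_sum_def
    by (auto simp: chain_scale_sum push_sum faces fk m mult_ac intro!: sum.cong arg_cong2[of _ _ _ _ Poly_Mapping.single])
qed (simp add: face_sum_def)

lemma twisted_boundary_push:
  assumes "flat_transport X T" "transport_morphism M T' T f u" "c \<in> twisted_chains p M"
  shows "twisted_boundary T p (push p u f c) = push (p - 1) u f (twisted_boundary T' p c)"
  unfolding push_def[of p] push_def[of "p - 1"] twisted_boundary_lextend lextend_lextend
  using face_sum_push[OF assms(1,2)] assms(3)
  by (intro lextend_cong) (auto simp: twisted_chains_iff push_def)

lemma subtopology_push:
  assumes "c \<in> twisted_chains p (subtopology M B)" "continuous_map M X f" "f ` (topspace M \<inter> B) \<subseteq> A"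
  shows "push p u f c \<in> twisted_chains p (subtopology X A)"
proof (rule twisted_chains_push[OF assms(1)])
  show "continuous_map (subtopology M B) (subtopology X A) f"
    using assms(2,3) by (auto simp: continuous_map_in_subtopology continuous_map_from_subtopology)
qed

lemma twisted_relcycles_push:
  assumes "flat_transport X T" "transport_morphism M T' T f u" "c \<in> twisted_relcycles T' p M B"
    "continuous_map M X f" "f ` (topspace M \<inter> B) \<subseteq> A"
  shows "push p u f c \<in> twisted_relcycles T p X A"
  using assms twisted_boundary_push[OF assms(1,2), of c p]
  by (auto simp: twisted_relcycles_def intro: twisted_chains_push subtopology_push)

lemma twisted_relboundaries_push:
  assumes "flat_transport X T" "transport_morphism M T' T f u" "c \<in> twisted_relboundaries T' p M B"
    "continuous_map M X f" "f ` (topspace M \<inter> B) \<subseteq> A"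
  shows "push p u f c \<in> twisted_relboundaries T p X A"
proof -
  obtain e a where *: "e \<in> twisted_chains (Suc p) M" "a \<in> twisted_chains p (subtopology M B)"
    "c = twisted_boundary T' (Suc p) e + a"
    using assms(3) by (rule twisted_relboundariesE)
  show ?thesis
    by (rule twisted_relboundariesI[of "push (Suc p) u f e" _ _ "push p u f a"])
      (use * twisted_boundary_push[OF assms(1,2) *(1)] subtopology_push[OF *(2) assms(4,5)] in
        \<open>auto simp: push_add intro: twisted_chains_push assms\<close>)
qed

section \<open>Integral chains inside twisted chains\<close>

definition int_chain :: "'x chain \<Rightarrow> 'x tchain" where
  "int_chain c = Poly_Mapping.map of_int c"

lemma lookup_int_chain [simp]: "Poly_Mapping.lookup (int_chain c) \<sigma> = of_int (Poly_Mapping.lookup c \<sigma>)"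
  unfolding int_chain_def by transfer (simp add: when_def)

lemma int_chain_0 [simp]: "int_chain 0 = 0"
  and int_chain_add: "int_chain (a + b) = int_chain a + int_chain b"
  and int_chain_diff: "int_chain (a - b) = int_chain a - int_chain b"
  and int_chain_cmul: "int_chain (frag_cmul k a) = chain_scale (of_int k) (int_chain a)"
  and int_chain_of [simp]: "int_chain (frag_of \<sigma>) = Poly_Mapping.single \<sigma> 1"
  by (rule poly_mapping_eqI; simp add: lookup_add lookup_minus lookup_single when_def)+

lemma int_chain_sum: "int_chain (\<Sum>i\<in>I. f i) = (\<Sum>i\<in>I. int_chain (f i))"
  by (induction I rule: infinite_finite_induct) (simp_all add: int_chain_add)

lemma keys_int_chain: "Poly_Mapping.keys (int_chain c) \<subseteq> Poly_Mapping.keys c"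
  by (auto simp: in_keys_iff)

lemma int_chain_chains: "singular_chain p X c \<Longrightarrow> int_chain c \<in> twisted_chains p X"
  using keys_int_chain[of c] by (auto simp: twisted_chains_iff singular_chain_def)

lemma int_chain_extend: "int_chain (frag_extend g c) = lextend (\<lambda>\<sigma>. int_chain (g \<sigma>)) (int_chain c)"
proof -
  have "lextend (\<lambda>\<sigma>. int_chain (g \<sigma>)) (int_chain c)
      = (\<Sum>\<sigma>\<in>Poly_Mapping.keys c. chain_scale (Poly_Mapping.lookup (int_chain c) \<sigma>) (int_chain (g \<sigma>)))"
    by (rule lextend_superset) (simp_all add: keys_int_chain)
  then show ?thesis
    by (simp add: frag_extend_def int_chain_sum int_chain_cmul)
qed

lemma int_chain_boundary:
  "int_chain (chain_boundary p c) = twisted_boundary (\<lambda>_. 1) p (int_chain c)"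
  by (cases "p = 0")
    (simp_all add: chain_boundary_def int_chain_extend twisted_boundary_lextend face_sum_def
      int_chain_sum int_chain_cmul lextend_def)

lemma int_chain_chain_map:
  "int_chain (chain_map p f c) = push p (\<lambda>_. 1) f (int_chain c)"
  by (simp add: chain_map_def int_chain_extend push_def)

lemma push_int_chain_map:
  "push p u f (int_chain (chain_map p g c)) = push p (u \<circ> g) (f \<circ> g) (int_chain c)"
  unfolding int_chain_chain_map push_def lextend_lextend
  by (rule lextend_cong) (simp add: simplex_map_compose, simp add: simplex_map_def)

text \<open>The paths \<open>k (_, y)\<close> are a continuous choice of paths from \<open>b\<close>
  to all points. Keeping \<open>b\<close> fixed makes the chosen path to \<open>b\<close> itself
  constant.\<close>

definition star_contraction :: "'m topology \<Rightarrow> 'm \<Rightarrow> (real \<times> 'm \<Rightarrow> 'm) \<Rightarrow> bool" where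
  "star_contraction M b k \<longleftrightarrow>
     continuous_map (prod_topology (top_of_set {0..1}) M) M k \<and> b \<in> topspace M \<and>
     (\<forall>y\<in>topspace M. k (0, y) = b \<and> k (1, y) = y) \<and> (\<forall>t\<in>{0..1}. k (t, b) = b)"

lemma star_contraction_contractible:
  assumes "star_contraction M b k"
  shows "contractible_space M"
proof -
  have "homotopic_with (\<lambda>x. True) M M (\<lambda>x. b) id"
    using assms by (subst homotopic_with) (auto simp: star_contraction_def)
  then show ?thesis
    by (auto simp: contractible_space_def homotopic_with_sym)
qed

text \<open>Parallel transport from \<open>b\<close> to \<open>y\<close> along the chosen path. It
  trivialises the pullback of the local system along \<open>f\<close>, normalised to 1 at
  \<open>b\<close>.\<close>

definition straight_potential ::
    "'x transport \<Rightarrow> (real \<times> 'm \<Rightarrow> 'm) \<Rightarrow> ('m \<Rightarrow> 'x) \<Rightarrow> 'm \<Rightarrow> laurent" where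
  "straight_potential T k f y = T (\<lambda>t. f (k (t, y)))"

lemma continuous_map_square:
  assumes "continuous_map (prod_topology (top_of_set {0..1}) (top_of_set {0..1})) X s"
  shows "continuous_map (top_of_set ({0..1::real} \<times> {0..1::real})) X s"
  using assms by (simp add: prod_topology_subtopology_eu)

text \<open>The square law for \<open>f (k (a, g t))\<close>: the side \<open>a = 0\<close> is
  constant at \<open>f b\<close>, the side \<open>a = 1\<close> is \<open>f\<close> along
  \<open>g\<close>, and the remaining two are the chosen paths to the end points of
  \<open>g\<close>.\<close>

lemma straight_potential_morphism:
  assumes T: "flat_transport X T" and k: "star_contraction M b k" and f: "continuous_map M X f"
  shows "transport_morphism M (\<lambda>_. 1) T f (straight_potential T k f)"
  unfolding transport_morphism_def
proof (intro allI impI)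
  fix g assume g: "pathin M g"
  let ?I = "top_of_set {0..1::real}"
  define s where "s = (\<lambda>(a, t). f (k (a, g t)))"
  have "continuous_map (prod_topology ?I ?I) (prod_topology ?I M) (\<lambda>(a, t). (a, g t))"
    unfolding case_prod_unfold using g
    by (intro continuous_map_pairedI continuous_map_fst continuous_map_compose[OF continuous_map_snd, unfolded o_def])
      (simp add: pathin_def)
  then have "continuous_map (prod_topology ?I ?I) X (f \<circ> (k \<circ> (\<lambda>(a, t). (a, g t))))"
    using k f by (auto simp: star_contraction_def intro!: continuous_map_compose)
  then have "continuous_map (top_of_set ({0..1} \<times> {0..1})) X s"
    by (intro continuous_map_square) (simp add: s_def o_def case_prod_unfold)
  note sq = flat_transport_square[OF T this]
  have gM: "g t \<in> topspace M" if "t \<in> {0..1}" for t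
    using g that by (auto simp: pathin_def continuous_map_def Pi_iff)
  have "T (\<lambda>t. s (0, t)) = T (\<lambda>_. f b)"
    using k gM by (intro flat_transport_cong[OF T]) (auto simp: s_def star_contraction_def)
  also have "\<dots> = 1"
    using k f by (intro flat_transport_const[OF T]) (auto simp: star_contraction_def continuous_map_def Pi_iff)
  finally have 1: "T (\<lambda>t. s (0, t)) = 1" .
  have 2: "T (\<lambda>t. s (1, t)) = T (f \<circ> g)"
    using k gM by (intro flat_transport_cong[OF T]) (auto simp: s_def star_contraction_def)
  show "1 * straight_potential T k f (g 1) = straight_potential T k f (g 0) * T (f \<circ> g)"
    using sq unfolding 1 2 by (simp add: s_def straight_potential_def)
qed

lemma straight_potential_base:
  assumes T: "flat_transport X T" and k: "star_contraction M b k" and f: "continuous_map M X f"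
  shows "straight_potential T k f b = 1"
proof -
  have "straight_potential T k f b = T (\<lambda>_. f b)"
    unfolding straight_potential_def
    using k by (intro flat_transport_cong[OF T]) (auto simp: star_contraction_def)
  also have "\<dots> = 1"
    using k f by (intro flat_transport_const[OF T]) (auto simp: star_contraction_def continuous_map_def Pi_iff)
  finally show ?thesis .
qed

text \<open>The morphism law along the chosen path from \<open>b\<close> to \<open>y\<close>. This
  uniqueness is what later compares the potentials of a simplex and of its faces.\<close>

lemma straight_potential_unique:
  assumes k: "star_contraction M b k"
    and v: "transport_morphism M (\<lambda>_. 1) T f v" and y: "y \<in> topspace M"
  shows "v y = v b * straight_potential T k f y"
proof -
  let ?I = "top_of_set {0..1::real}"
  have "continuous_map ?I (prod_topology ?I M) (\<lambda>t. (t, y))"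
    using y by (auto intro!: continuous_map_pairedI)
  then have "continuous_map ?I M (k \<circ> (\<lambda>t. (t, y)))"
    using k by (auto simp: star_contraction_def intro!: continuous_map_compose)
  then have "pathin M (\<lambda>t. k (t, y))"
    by (simp add: pathin_def o_def)
  then have "1 * v (k (1, y)) = v (k (0, y)) * T (f \<circ> (\<lambda>t. k (t, y)))"
    using v unfolding transport_morphism_def by blast
  then show ?thesis
    using k y by (simp add: star_contraction_def straight_potential_def o_def)
qed

text \<open>In the square \<open>f (k (a * (1 - t), y))\<close> the sides \<open>a = 0\<close> and
  \<open>t = 1\<close> are constant at \<open>f b\<close>; the other two are the chosen path and its
  reverse.\<close>

lemma straight_potential_inverse:
  assumes T: "flat_transport X T" and k: "star_contraction M b k" and f: "continuous_map M X f"
    and y: "y \<in> topspace M"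
  shows "straight_potential T k f y * T (\<lambda>t. f (k (1 - t, y))) = 1"
proof -
  let ?I = "top_of_set {0..1::real}"
  define s where "s = (\<lambda>(a, t). f (k (a * (1 - t), y)))"
  have "continuous_map (prod_topology ?I ?I) ?I (\<lambda>(a, t). a * (1 - t))"
    unfolding continuous_map_in_subtopology case_prod_unfold
    by (auto intro!: continuous_intros continuous_map_fst[THEN continuous_map_into_fulltopology]
        continuous_map_snd[THEN continuous_map_into_fulltopology] simp: mult_le_one)
  then have "continuous_map (prod_topology ?I ?I) (prod_topology ?I M) (\<lambda>(a, t). (a * (1 - t), y))"
    using y by (auto simp: case_prod_unfold intro!: continuous_map_pairedI)
  then have "continuous_map (prod_topology ?I ?I) X (f \<circ> (k \<circ> (\<lambda>(a, t). (a * (1 - t), y))))"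
    using k f by (auto simp: star_contraction_def intro!: continuous_map_compose)
  then have "continuous_map (top_of_set ({0..1} \<times> {0..1})) X s"
    by (intro continuous_map_square) (simp add: s_def o_def case_prod_unfold)
  note sq = flat_transport_square[OF T this]
  have *: "T (\<lambda>_. f b) = 1"
    using k f by (intro flat_transport_const[OF T]) (auto simp: star_contraction_def continuous_map_def Pi_iff)
  have **: "k (0, y) = b" "k (1, y) = y"
    using k y by (auto simp: star_contraction_def)
  show ?thesis
    using sq by (simp add: s_def straight_potential_def * **)
qed

section \<open>Universal prisms and iterated subdivision\<close>

abbreviation simplex_space :: "nat \<Rightarrow> (nat \<Rightarrow> real) topology" where
  "simplex_space p \<equiv> subtopology (powertop_real UNIV) (standard_simplex p)"

definition prism :: "nat \<Rightarrow> (real \<times> (nat \<Rightarrow> real)) topology" where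
  "prism p = prod_topology (top_of_set {0..1}) (simplex_space p)"

text \<open>The straight contraction to the corner over vertex 0 at time 0. That corner is where the
  coefficient of a simplex lives before the homotopy starts.\<close>

definition prism_contraction :: "real \<times> real \<times> (nat \<Rightarrow> real) \<Rightarrow> real \<times> (nat \<Rightarrow> real)" where
  "prism_contraction = (\<lambda>(t, s, x). (t * s, \<lambda>i. (1 - t) * base_vertex i + t * x i))"

lemma topspace_prism: "topspace (prism p) = {0..1} \<times> standard_simplex p"
  by (simp add: prism_def)

lemma star_contraction_prism: "star_contraction (prism p) (0, base_vertex) prism_contraction"
  unfolding star_contraction_def
proof (intro conjI ballI)
  let ?I = "top_of_set {0..1::real}"
  let ?Y = "prod_topology ?I (prism p)"
  have a: "continuous_map ?Y euclideanreal (\<lambda>z. fst z)"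
    by (rule continuous_map_into_fulltopology[OF continuous_map_fst])
  have b: "continuous_map ?Y (prism p) snd"
    by (rule continuous_map_snd)
  have c: "continuous_map ?Y euclideanreal (\<lambda>z. fst (snd z))"
    using continuous_map_into_fulltopology[OF continuous_map_compose[OF b[unfolded prism_def] continuous_map_fst]]
    by (simp add: o_def prism_def)
  have d: "continuous_map ?Y (powertop_real UNIV) (\<lambda>z. snd (snd z))"
    using continuous_map_into_fulltopology[OF continuous_map_compose[OF b[unfolded prism_def] continuous_map_snd]]
    by (simp add: o_def prism_def)
  have e: "continuous_map ?Y euclideanreal (\<lambda>z. snd (snd z) i)" for i
    using d by (simp add: continuous_map_componentwise_UNIV)
  have "continuous_map ?Y (powertop_real UNIV) (\<lambda>z. \<lambda>i. (1 - fst z) * base_vertex i + fst z * snd (snd z) i)"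
    unfolding continuous_map_componentwise_UNIV using a e by (auto intro!: continuous_intros)
  then have "continuous_map ?Y (simplex_space p) (\<lambda>z. \<lambda>i. (1 - fst z) * base_vertex i + fst z * snd (snd z) i)"
    by (auto simp: continuous_map_in_subtopology prism_def intro!: convex_standard_simplex)
  moreover have "continuous_map ?Y ?I (\<lambda>z. fst z * fst (snd z))"
    using a c by (auto simp: continuous_map_in_subtopology topspace_prism mult_le_one intro!: continuous_intros)
  ultimately show "continuous_map ?Y (prism p) prism_contraction"
    unfolding prism_contraction_def case_prod_unfold prism_def[of p] by (intro continuous_map_pairedI) (auto simp: prism_def)
qed (auto simp: prism_contraction_def topspace_prism algebra_simps)

text \<open>In positive degree reduced and ordinary homology agree, and the triviality of the group
  is read back as a statement about chains.\<close>

lemma contractible_cycle_is_boundary: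
  assumes "contractible_space X" "singular_relcycle p X {} c" "0 < p"
  shows "singular_relboundary p X {} c"
proof -
  have "trivial_group (reduced_homology_group (int p) X)"
    using assms(1) by (rule trivial_reduced_homology_group_contractible_space)
  then have "trivial_group (homology_group (int p) X)"
    using assms(3) by (simp add: un_reduced_homology_group)
  then have "carrier (homology_group (int p) X) = {singular_relboundary_set p X {}}"
    by (simp add: trivial_group_def)
  moreover have "homologous_rel_set p X {} c \<in> carrier (homology_group (int p) X)"
    unfolding carrier_relative_homology_group using assms(2) by (intro imageI) simp
  ultimately have "homologous_rel_set p X {} c = singular_relboundary_set p X {}"
    by simp
  then show ?thesis
    by (simp add: homologous_rel_set_eq_relboundary)
qed

definition top_simplex :: "nat \<Rightarrow> (nat \<Rightarrow> real) \<Rightarrow> (nat \<Rightarrow> real)" where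
  "top_simplex p = restrict id (standard_simplex p)"

text \<open>The universal case: by naturality the image of this chain under a singular simplex is
  the \<open>n\<close>-fold subdivision of that simplex.\<close>

definition subdivided_simplex :: "nat \<Rightarrow> nat \<Rightarrow> (nat \<Rightarrow> real) chain" where
  "subdivided_simplex n p = (simplicial_subdivision p ^^ n) (frag_of (top_simplex p))"

lemma singular_simplex_top_simplex [simp]: "singular_simplex p (simplex_space p) (top_simplex p)"
  by (simp add: top_simplex_def singular_simplex_def continuous_map_id[unfolded id_def] id_def)

lemma singular_chain_boundary_top_simplex:
  "singular_chain (p - 1) (simplex_space p) (chain_boundary p (frag_of (top_simplex p)))"
  using singular_chain_boundary[of p "simplex_space p" "frag_of (top_simplex p)"]
  by (simp add: singular_chain_of)

lemma singular_chain_subdivided_simplex: "singular_chain p (simplex_space p) (subdivided_simplex n p)"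
proof -
  have "simplicial_chain p (standard_simplex p) ((simplicial_subdivision p ^^ n) (frag_of (top_simplex p)))"
  proof (induction n)
    case 0
    have "simplicial_simplex p (standard_simplex p) (top_simplex p)"
      unfolding top_simplex_def by (simp only: simplicial_simplex_id)
    then show ?case
      by simp
  qed (simp add: simplicial_chain_simplicial_subdivision)
  then show ?thesis
    unfolding subdivided_simplex_def by (rule simplicial_imp_singular_chain)
qed

lemma iterated_subdivision_simplex:
  assumes "singular_simplex p X f"
  shows "(singular_subdivision p ^^ n) (frag_of f) = chain_map p f (subdivided_simplex n p)"
  using iterated_singular_subdivision[of p X "frag_of f" n] assms
  by (simp add: singular_chain_of subdivided_simplex_def top_simplex_def)

lemma iterated_subdivision_top_simplex:
  "(singular_subdivision p ^^ n) (frag_of (top_simplex p)) = subdivided_simplex n p"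
proof -
  have "(singular_subdivision p ^^ n) (frag_of (top_simplex p)) = chain_map p (top_simplex p) (subdivided_simplex n p)"
    by (rule iterated_subdivision_simplex[OF singular_simplex_top_simplex])
  also have "\<dots> = chain_map p id (subdivided_simplex n p)"
    by (rule chain_map_eq[OF singular_chain_subdivided_simplex]) (simp add: top_simplex_def)
  also have "\<dots> = subdivided_simplex n p"
    by (rule chain_map_ident[OF singular_chain_subdivided_simplex])
  finally show ?thesis .
qed

lemma chain_boundary_iterated_subdivision:
  assumes "singular_chain p X c"
  shows "chain_boundary p ((singular_subdivision p ^^ n) c) = (singular_subdivision (p - 1) ^^ n) (chain_boundary p c)
    \<and> singular_chain p X ((singular_subdivision p ^^ n) c)"
  by (induction n) (auto simp: assms chain_boundary_singular_subdivision singular_chain_singular_subdivision)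

text \<open>Subdivision commutes with the boundary, and a subdivided face is the image of the
  universal chain one dimension lower.\<close>

lemma chain_boundary_subdivided_simplex:
  "chain_boundary p (subdivided_simplex n p) =
     frag_extend (\<lambda>f. chain_map (p - 1) f (subdivided_simplex n (p - 1))) (chain_boundary p (frag_of (top_simplex p)))"
proof -
  have "singular_chain p (simplex_space p) (frag_of (top_simplex p))"
    by (simp add: singular_chain_of)
  from chain_boundary_iterated_subdivision[OF this, of n]
  have "chain_boundary p (subdivided_simplex n p) = (singular_subdivision (p - 1) ^^ n) (chain_boundary p (frag_of (top_simplex p)))"
    by (simp add: iterated_subdivision_top_simplex)
  then show ?thesis
    using iterated_singular_subdivision[OF singular_chain_boundary_top_simplex]
    by (simp add: subdivided_simplex_def top_simplex_def)
qed

lemma chain_map_extend: "chain_map p f (frag_extend g c) = frag_extend (\<lambda>\<sigma>. chain_map p f (g \<sigma>)) c"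
  by (rule frag_induction[of c UNIV]) (auto simp: chain_map_diff frag_extend_diff)

lemma chain_boundary_extend: "chain_boundary p (frag_extend g c) = frag_extend (\<lambda>\<sigma>. chain_boundary p (g \<sigma>)) c"
  by (rule frag_induction[of c UNIV]) (auto simp: chain_boundary_diff frag_extend_diff)

lemma frag_extend_extend: "frag_extend f (frag_extend g c) = frag_extend (\<lambda>\<sigma>. frag_extend f (g \<sigma>)) c"
  by (rule frag_induction[of c UNIV]) (auto simp: frag_extend_diff)

lemma frag_extend_diff_fun: "frag_extend (\<lambda>\<sigma>. f \<sigma> - g \<sigma>) c = frag_extend f c - frag_extend g c"
  by (rule frag_induction[of c UNIV]) (auto simp: frag_extend_diff)

definition prism_map :: "(('a \<Rightarrow> 'b)) \<Rightarrow> real \<times> 'a \<Rightarrow> real \<times> 'b" where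
  "prism_map \<sigma> = (\<lambda>(t, x). (t, \<sigma> x))"

lemma continuous_map_prism_map:
  assumes "singular_simplex q (simplex_space p) \<sigma>"
  shows "continuous_map (prism q) (prism p) (prism_map \<sigma>)"
proof -
  have "continuous_map (prism q) (simplex_space p) (\<sigma> \<circ> snd)"
    using assms unfolding prism_def singular_simplex_def
    by (blast intro: continuous_map_compose continuous_map_snd)
  then show ?thesis
    unfolding prism_map_def case_prod_unfold prism_def[of p]
    by (intro continuous_map_pairedI) (auto simp: prism_def o_def continuous_map_fst)
qed

lemma continuous_map_prism_end:
  assumes "t \<in> {0..1}"
  shows "continuous_map (simplex_space p) (prism p) (Pair t)"
  using assms unfolding prism_def by (auto intro!: continuous_map_pairedI)

text \<open>The chains are the values of a natural chain homotopy on the universal simplices: acyclicity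
  of the prisms lets one choose them degree by degree.\<close>

lemma prism_chains_exist:
  obtains N :: "nat \<Rightarrow> (real \<times> (nat \<Rightarrow> real)) chain" where
    "\<And>p. singular_chain (Suc p) (prism p) (N p)"
    "\<And>p. chain_boundary (Suc p) (N p) =
        chain_map p (Pair 1) (subdivided_simplex n p) - chain_map p (Pair 0) (frag_of (top_simplex p))
        - frag_extend (\<lambda>\<sigma>. chain_map p (prism_map \<sigma>) (N (p - 1))) (chain_boundary p (frag_of (top_simplex p)))"
proof -
  \<comment> \<open>The prescribed boundary in degree \<open>p\<close>: subdivided top minus plain
    bottom minus side walls, where the walls are copies of the prism chain \<open>M\<close> of
    degree one less.\<close>
  define R where "R p M = chain_map p (Pair 1) (subdivided_simplex n p) - chain_map p (Pair 0) (frag_of (top_simplex p))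
        - frag_extend (\<lambda>\<sigma>. chain_map p (prism_map \<sigma>) M) (chain_boundary p (frag_of (top_simplex p)))" for p M
  \<comment> \<open>Besides being a chain, \<open>N\<close> must remember that its own boundary had
    the prescribed form; the next degree needs this to differentiate the side walls.\<close>
  define Q where "Q p N \<longleftrightarrow> singular_chain (Suc p) (prism p) N \<and>
      (\<exists>M. (0 < p \<longrightarrow> singular_chain p (prism (p - 1)) M) \<and> chain_boundary (Suc p) N = R p M)" for p N
  have R0: "R 0 M = chain_map 0 (Pair 1) (frag_of (top_simplex 0)) - chain_map 0 (Pair 0) (frag_of (top_simplex 0))" for M
  proof -
    have "(id ^^ n) x = x" for x :: "(nat \<Rightarrow> real) chain"
      by (induction n) auto
    then show ?thesis
      by (simp add: R_def subdivided_simplex_def chain_boundary_def)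
  qed
  \<comment> \<open>In degree 0 the chain is a path from the bottom to the top of the prism over a
    point.\<close>
  have ex: "\<exists>N. Q 0 N \<and> chain_boundary (Suc 0) N = R 0 0"
  proof -
    have "path_connected_space (prism 0)"
      by (rule contractible_imp_path_connected_space[OF star_contraction_contractible[OF star_contraction_prism]])
    moreover have "singular_simplex 0 (prism 0) (simplex_map 0 (Pair t) (top_simplex 0))" if "t \<in> {0..1}" for t
      by (rule singular_simplex_simplex_map[OF singular_simplex_top_simplex continuous_map_prism_end[OF that]])
    ultimately have "homologous_rel 0 (prism 0) {} (frag_of (simplex_map 0 (Pair 1) (top_simplex 0))) (frag_of (simplex_map 0 (Pair 0) (top_simplex 0)))"
      by (intro iso_integer_zeroth_homology_group_aux) auto
    then show ?thesis
      by (auto simp: homologous_rel_def singular_boundary Q_def R0)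
  qed
  have step: "\<exists>N'. Q (Suc q) N' \<and> chain_boundary (Suc (Suc q)) N' = R (Suc q) N" if "Q q N" for q N
  proof -
    let ?p = "Suc q"
    let ?d = "chain_boundary ?p (frag_of (top_simplex ?p))"
    obtain M where M: "0 < q \<longrightarrow> singular_chain q (prism (q - 1)) M" "chain_boundary ?p N = R q M"
      using \<open>Q q N\<close> by (auto simp: Q_def)
    have N: "singular_chain ?p (prism q) N"
      using \<open>Q q N\<close> by (auto simp: Q_def)
    have dc: "singular_chain q (simplex_space ?p) ?d"
      using singular_chain_boundary_top_simplex[of ?p] by simp
    have ds: "singular_simplex q (simplex_space ?p) \<sigma>" if "\<sigma> \<in> Poly_Mapping.keys ?d" for \<sigma>
      using dc that by (auto simp: singular_chain_def)
    have chain: "singular_chain ?p (prism ?p) (R ?p N)"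
      unfolding R_def
      by (intro singular_chain_diff singular_chain_extend singular_chain_chain_map[OF N] continuous_map_prism_map ds
          singular_chain_chain_map[OF singular_chain_subdivided_simplex] continuous_map_prism_end
          singular_chain_chain_map[of ?p "simplex_space ?p"]) (auto simp: singular_chain_of)
    \<comment> \<open>Naturality carries the boundary formula of \<open>N\<close> from the standard
      \<open>q\<close>-simplex to a face \<open>\<sigma>\<close> of the next simplex.\<close>
    have per: "chain_boundary ?p (chain_map ?p (prism_map \<sigma>) N) =
        chain_map q (Pair 1) (chain_map q \<sigma> (subdivided_simplex n q)) - chain_map q (Pair 0) (frag_of \<sigma>)
        - frag_extend (\<lambda>\<tau>. chain_map q (prism_map \<tau>) M) (chain_boundary q (frag_of \<sigma>))"
      if "\<sigma> \<in> Poly_Mapping.keys ?d" for \<sigma>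
    proof -
      have s: "singular_simplex q (simplex_space ?p) \<sigma>"
        by (rule ds[OF that])
      have comm: "chain_map q (prism_map \<sigma>) (chain_map q (Pair t) c) = chain_map q (Pair t) (chain_map q \<sigma> c)" for t c
        using chain_map_compose[of q "prism_map \<sigma>" "Pair t"] chain_map_compose[of q "Pair t" \<sigma>]
        by (simp add: prism_map_def o_def fun_eq_iff)
      have top: "chain_map q \<sigma> (frag_of (top_simplex q)) = frag_of \<sigma>"
        using singular_simplex_chain_map_id[OF s] by (simp add: top_simplex_def)
      have bd: "chain_map (q - 1) \<sigma> (chain_boundary q (frag_of (top_simplex q))) = chain_boundary q (frag_of \<sigma>)"
        using chain_boundary_chain_map[of q "simplex_space q" "frag_of (top_simplex q)" \<sigma>] top
        by (simp add: singular_chain_of)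
      have "chain_map q (prism_map \<sigma>) (frag_extend (\<lambda>\<tau>. chain_map q (prism_map \<tau>) M) (chain_boundary q (frag_of (top_simplex q))))
          = frag_extend (\<lambda>\<tau>. chain_map q (prism_map (simplex_map (q - 1) \<sigma> \<tau>)) M) (chain_boundary q (frag_of (top_simplex q)))"
      proof (cases "q = 0")
        case False
        have eq: "chain_map q (prism_map \<sigma>) (chain_map q (prism_map \<tau>) M) = chain_map q (prism_map (simplex_map (q - 1) \<sigma> \<tau>)) M" for \<tau>
        proof -
          have "chain_map q (prism_map \<sigma>) (chain_map q (prism_map \<tau>) M) = chain_map q (prism_map \<sigma> \<circ> prism_map \<tau>) M"
            by (simp add: chain_map_compose)
          also have "\<dots> = chain_map q (prism_map (simplex_map (q - 1) \<sigma> \<tau>)) M"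
            by (rule chain_map_eq[of _ "prism (q - 1)"])
              (use M False in \<open>auto simp: prism_map_def topspace_prism simplex_map_def\<close>)
          finally show ?thesis .
        qed
        show ?thesis
          by (simp add: chain_map_extend eq)
      qed (simp add: chain_boundary_def)
      also have "\<dots> = frag_extend (\<lambda>\<tau>. chain_map q (prism_map \<tau>) M) (chain_map (q - 1) \<sigma> (chain_boundary q (frag_of (top_simplex q))))"
        unfolding chain_map_def[of "q - 1"] frag_extend_extend by (simp add: o_def)
      finally show ?thesis
        using chain_boundary_chain_map[OF N, of "prism_map \<sigma>"]
        by (simp add: M(2) R_def chain_map_diff comm top bd[unfolded One_nat_def] del: chain_map_of)
    qed
    have exp: "frag_extend (\<lambda>\<sigma>. chain_map q (Pair 0) (frag_of \<sigma>)) ?d = chain_map q (Pair 0) ?d"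
      unfolding chain_map_def frag_extend_of comp_def by (rule refl)
    \<comment> \<open>The walls of the walls cancel, because the boundary of the boundary of the
      universal simplex is zero.\<close>
    have dd: "frag_extend (\<lambda>\<sigma>. chain_boundary q (frag_of \<sigma>)) ?d = 0"
    proof -
      have "frag_extend (\<lambda>\<sigma>. chain_boundary q (frag_of \<sigma>)) ?d = chain_boundary q (frag_extend frag_of ?d)"
        by (simp add: chain_boundary_extend)
      also have "frag_extend frag_of ?d = ?d"
        by (rule frag_expansion[symmetric])
      also have "chain_boundary q ?d = 0"
        by (rule chain_boundary_boundary_alt[of _ "simplex_space ?p"]) (simp add: singular_chain_of)
      finally show ?thesis .
    qed
    have "chain_boundary ?p (frag_extend (\<lambda>\<sigma>. chain_map ?p (prism_map \<sigma>) N) ?d) =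
        frag_extend (\<lambda>\<sigma>. chain_map q (Pair 1) (chain_map q \<sigma> (subdivided_simplex n q)) - chain_map q (Pair 0) (frag_of \<sigma>)
        - frag_extend (\<lambda>\<tau>. chain_map q (prism_map \<tau>) M) (chain_boundary q (frag_of \<sigma>))) ?d"
      unfolding chain_boundary_extend by (rule frag_extend_eq) (rule per)
    also have "\<dots> = chain_map q (Pair 1) (chain_boundary ?p (subdivided_simplex n ?p)) - chain_map q (Pair 0) ?d"
      unfolding frag_extend_diff_fun exp frag_extend_extend[of _ "\<lambda>\<sigma>. chain_boundary q (frag_of \<sigma>)", symmetric] dd
      by (simp add: chain_boundary_subdivided_simplex[of ?p] chain_map_extend)
    finally have G: "chain_boundary ?p (frag_extend (\<lambda>\<sigma>. chain_map ?p (prism_map \<sigma>) N) ?d) =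
        chain_map q (Pair 1) (chain_boundary ?p (subdivided_simplex n ?p)) - chain_map q (Pair 0) ?d" .
    have e1: "chain_boundary ?p (chain_map ?p (Pair 1) (subdivided_simplex n ?p)) =
        chain_map q (Pair 1) (chain_boundary ?p (subdivided_simplex n ?p))"
      using chain_boundary_chain_map[OF singular_chain_subdivided_simplex[of ?p n]] by simp
    have "singular_chain ?p (simplex_space ?p) (frag_of (top_simplex ?p))"
      by (simp add: singular_chain_of)
    from chain_boundary_chain_map[OF this]
    have e0: "chain_boundary ?p (chain_map ?p (Pair 0) (frag_of (top_simplex ?p))) = chain_map q (Pair 0) ?d"
      by (simp only: diff_Suc_1 diff_Suc_Suc diff_zero)
    \<comment> \<open>The prescribed boundary is a cycle of positive degree in a contractible prism,
      so it bounds; any chain that it bounds will do as the next one.\<close>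
    have "chain_boundary ?p (R ?p N) = 0"
      unfolding R_def chain_boundary_diff G e1 e0 by simp
    then have "singular_relboundary ?p (prism ?p) {} (R ?p N)"
      using chain by (intro contractible_cycle_is_boundary star_contraction_contractible[OF star_contraction_prism])
        (auto simp: singular_cycle)
    then obtain N' where "singular_chain (Suc ?p) (prism ?p) N'" "chain_boundary (Suc ?p) N' = R ?p N"
      by (auto simp: singular_boundary)
    moreover from this have "Q ?p N'"
      unfolding Q_def using N by (intro conjI exI[of _ N]) simp_all
    ultimately show ?thesis
      by blast
  qed
  \<comment> \<open>Dependent choice: the equation in degree \<open>q + 1\<close> refers to the very
    chain chosen in degree \<open>q\<close>.\<close>
  obtain f where f: "f 0 = (SOME N. Q 0 N \<and> chain_boundary (Suc 0) N = R 0 0)"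
      "\<And>q. f (Suc q) = (SOME N'. Q (Suc q) N' \<and> chain_boundary (Suc (Suc q)) N' = R (Suc q) (f q))"
    by (rule that[of "rec_nat (SOME N. Q 0 N \<and> chain_boundary (Suc 0) N = R 0 0)
        (\<lambda>q N. SOME N'. Q (Suc q) N' \<and> chain_boundary (Suc (Suc q)) N' = R (Suc q) N)"]) simp_all
  have f0: "Q 0 (f 0) \<and> chain_boundary (Suc 0) (f 0) = R 0 0"
    unfolding f(1) by (rule someI_ex[OF ex])
  have fS: "Q (Suc q) (f (Suc q)) \<and> chain_boundary (Suc (Suc q)) (f (Suc q)) = R (Suc q) (f q)" if "Q q (f q)" for q
    unfolding f(2) by (rule someI_ex[OF step[OF that]])
  have Qf: "Q q (f q)" for q
  proof (induction q)
    case 0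
    show ?case using f0 by (rule conjunct1)
  next
    case (Suc q)
    show ?case using fS[OF Suc] by (rule conjunct1)
  qed
  show ?thesis
  proof (rule that[of f])
    show "singular_chain (Suc p) (prism p) (f p)" for p
      using Qf[of p] by (simp add: Q_def)
    show "chain_boundary (Suc p) (f p) = chain_map p (Pair 1) (subdivided_simplex n p) - chain_map p (Pair 0) (frag_of (top_simplex p))
        - frag_extend (\<lambda>\<sigma>. chain_map p (prism_map \<sigma>) (f (p - 1))) (chain_boundary p (frag_of (top_simplex p)))" for p
    proof -
      \<comment> \<open>For \<open>p = 0\<close> truncated subtraction turns
        \<open>f (p - 1)\<close> into \<open>f 0\<close>; this is harmless since \<open>R 0\<close>
        does not depend on its chain argument.\<close>
      have "chain_boundary (Suc p) (f p) = R p (f (p - 1))"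
      proof (cases p)
        case 0
        have "R 0 0 = R 0 (f (0 - 1))"
          by (simp only: R0)
        then show ?thesis
          using f0 unfolding 0 by simp
      next
        case (Suc q)
        then show ?thesis
          using fS[OF Qf[of q]] by simp
      qed
      then show ?thesis
        unfolding R_def .
    qed
  qed
qed

section \<open>Homotopy and excision\<close>

definition chain_part :: "(((nat \<Rightarrow> real) \<Rightarrow> 'x) \<Rightarrow> bool) \<Rightarrow> 'x tchain \<Rightarrow> 'x tchain" where
  "chain_part Q = lextend (\<lambda>\<sigma>. if Q \<sigma> then Poly_Mapping.single \<sigma> 1 else 0)"

lemma lookup_chain_part [simp]:
  "Poly_Mapping.lookup (chain_part Q c) \<tau> = (if Q \<tau> then Poly_Mapping.lookup c \<tau> else 0)"
proof -
  have "Poly_Mapping.lookup (chain_part Q c) \<tau> =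
      (\<Sum>\<sigma>\<in>Poly_Mapping.keys c. if \<sigma> = \<tau> then (if Q \<tau> then Poly_Mapping.lookup c \<tau> else 0) else 0)"
    unfolding chain_part_def lextend_def lookup_sum
    by (intro sum.cong) (auto simp: lookup_single when_def)
  also have "\<dots> = (if Q \<tau> then Poly_Mapping.lookup c \<tau> else 0)"
    by (simp add: in_keys_iff)
  finally show ?thesis .
qed

lemma chain_part_add_not: "chain_part Q c + chain_part (\<lambda>\<sigma>. \<not> Q \<sigma>) c = c"
  by (rule poly_mapping_eqI) (simp add: lookup_add)

lemma keys_chain_part: "Poly_Mapping.keys (chain_part Q c) = {\<sigma> \<in> Poly_Mapping.keys c. Q \<sigma>}"
  by (auto simp: in_keys_iff split: if_splits)

lemma push_scale_potential: "push p (\<lambda>x. a * u x) f c = chain_scale a (push p u f c)"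
  unfolding push_def lextend_def by (auto simp: chain_scale_sum mult_ac intro!: sum.cong)

lemma transport_morphism_compose:
  assumes "transport_morphism M (\<lambda>_. 1) T f u" "continuous_map M' M k"
  shows "transport_morphism M' (\<lambda>_. 1) T (f \<circ> k) (u \<circ> k)"
  using assms unfolding transport_morphism_def pathin_def
  by (auto simp: o_assoc dest: continuous_map_compose[of _ _ _ M k])

lemma straight_potential_cong:
  assumes "flat_transport X T" "star_contraction M b k" "y \<in> topspace M"
    "\<And>x. x \<in> topspace M \<Longrightarrow> f x = f' x"
  shows "straight_potential T k f y = straight_potential T k f' y"
  unfolding straight_potential_def
  using assms(2-4) by (intro flat_transport_cong[OF assms(1)])
    (auto simp: star_contraction_def continuous_map_def Pi_iff)

text \<open>The track of \<open>\<sigma>\<close> under the homotopy, as a map on the prism. The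
  potential defined next trivialises the local system along this track.\<close>

definition homotopy_slot :: "(real \<times> 'x \<Rightarrow> 'x) \<Rightarrow> ((nat \<Rightarrow> real) \<Rightarrow> 'x) \<Rightarrow> real \<times> (nat \<Rightarrow> real) \<Rightarrow> 'x" where
  "homotopy_slot h \<sigma> = h \<circ> prism_map \<sigma>"

definition slot_potential ::
    "'x transport \<Rightarrow> (real \<times> 'x \<Rightarrow> 'x) \<Rightarrow> ((nat \<Rightarrow> real) \<Rightarrow> 'x) \<Rightarrow> real \<times> (nat \<Rightarrow> real) \<Rightarrow> laurent" where
  "slot_potential T h \<sigma> = straight_potential T prism_contraction (homotopy_slot h \<sigma>)"

text \<open>The operator on twisted chains with the value \<open>C\<close> on the universal simplex.\<close>

definition prism_operator ::
    "'x transport \<Rightarrow> (real \<times> 'x \<Rightarrow> 'x) \<Rightarrow> nat \<Rightarrow> (real \<times> (nat \<Rightarrow> real)) chain \<Rightarrow> 'x tchain \<Rightarrow> 'x tchain" where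
  "prism_operator T h r C = lextend (\<lambda>\<sigma>. push r (slot_potential T h \<sigma>) (homotopy_slot h \<sigma>) (int_chain C))"

lemma prism_operator_0 [simp]: "prism_operator T h r C 0 = 0"
  and prism_operator_add: "prism_operator T h r C (a + b) = prism_operator T h r C a + prism_operator T h r C b"
  by (simp_all add: prism_operator_def lextend_add)

lemma prism_operator_diff_left:
  "prism_operator T h r (C - C') c = prism_operator T h r C c - prism_operator T h r C' c"
  unfolding prism_operator_def by (simp add: int_chain_diff push_diff lextend_diff_fun)

locale twisted_homotopy =
  fixes X :: "'x topology" and T :: "'x transport" and h :: "real \<times> 'x \<Rightarrow> 'x"
  assumes flat: "flat_transport X T"
    and hcont: "continuous_map (prod_topology (top_of_set {0..1}) X) X h"
    and h0: "\<And>x. x \<in> topspace X \<Longrightarrow> h (0, x) = x"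
begin

lemma continuous_homotopy_slot:
  assumes "singular_simplex p X \<sigma>"
  shows "continuous_map (prism p) X (homotopy_slot h \<sigma>)"
proof -
  have "continuous_map (prism p) X (\<sigma> \<circ> snd)"
    using assms unfolding prism_def singular_simplex_def
    by (blast intro: continuous_map_compose continuous_map_snd)
  moreover have "continuous_map (prism p) (top_of_set {0..1}) fst"
    unfolding prism_def by (rule continuous_map_fst)
  ultimately have "continuous_map (prism p) (prod_topology (top_of_set {0..1}) X) (prism_map \<sigma>)"
    unfolding prism_map_def case_prod_unfold by (intro continuous_map_pairedI) (auto simp: o_def)
  then show ?thesis
    unfolding homotopy_slot_def by (rule continuous_map_compose[OF _ hcont])
qed

lemma slot_potential_morphism:
  assumes "singular_simplex p X \<sigma>"
  shows "transport_morphism (prism p) (\<lambda>_. 1) T (homotopy_slot h \<sigma>) (slot_potential T h \<sigma>)"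
  unfolding slot_potential_def
  by (rule straight_potential_morphism[OF flat star_contraction_prism continuous_homotopy_slot[OF assms]])

text \<open>The contraction path ends at vertex 0 of the \<open>k\<close>-th face, and at time 0 the
  homotopy is the identity. So the path is the first edge of \<open>\<sigma>\<close> for
  \<open>k = 0\<close>, where that vertex is vertex 1, and constant otherwise.\<close>

lemma slot_potential_face:
  assumes \<sigma>: "singular_simplex p X \<sigma>" and k: "k \<le> p" "0 < p"
  shows "slot_potential T h \<sigma> (0, singular_face p k (top_simplex p) base_vertex) =
    (if k = 0 then T (first_edge \<sigma>) else 1)"
proof -
  define v where "v = singular_face p k (top_simplex p) base_vertex"
  have s: "singular_simplex (p - 1) (simplex_space p) (singular_face p k (top_simplex p))"
    using singular_simplex_singular_face[OF singular_simplex_top_simplex, of p k] k by simp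
  then have vS: "v \<in> standard_simplex p"
    unfolding v_def singular_simplex_subtopology using base_vertex_simplex by (metis image_subset_iff)
  have v: "v = (if k = 0 then (\<lambda>i. if i = 1 then 1 else 0) else base_vertex)"
  proof -
    have "simplical_face k base_vertex \<in> standard_simplex p"
      using simplical_face_in_standard_simplex[of p k base_vertex] k by simp
    then have "v = simplical_face k base_vertex"
      by (simp add: v_def singular_face_def top_simplex_def)
    then show ?thesis
      by (auto simp: simplical_face_def base_vertex_def fun_eq_iff)
  qed
  have "slot_potential T h \<sigma> (0, v) = T (\<lambda>t. h (0, \<sigma> (\<lambda>i. (1 - t) * base_vertex i + t * v i)))"
    by (simp add: slot_potential_def straight_potential_def homotopy_slot_def prism_map_def prism_contraction_def)
  also have "\<dots> = T (\<lambda>t. \<sigma> (\<lambda>i. (1 - t) * base_vertex i + t * v i))"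
  proof (rule flat_transport_cong[OF flat])
    fix t :: real assume "t \<in> {0..1}"
    then have "(\<lambda>i. (1 - t) * base_vertex i + t * v i) \<in> standard_simplex p"
      using vS by (intro convex_standard_simplex) auto
    then show "h (0, \<sigma> (\<lambda>i. (1 - t) * base_vertex i + t * v i)) = \<sigma> (\<lambda>i. (1 - t) * base_vertex i + t * v i)"
      using \<sigma> by (intro h0) (auto simp: singular_simplex_def continuous_map_def Pi_iff)
  qed
  also have "\<dots> = (if k = 0 then T (first_edge \<sigma>) else 1)"
  proof (cases "k = 0")
    case True
    have "(\<lambda>i. (1 - t) * base_vertex i + t * v i) = (\<lambda>i. if i = 0 then 1 - t else if i = 1 then t else 0)" for t
      using True by (auto simp: v base_vertex_def fun_eq_iff)
    then show ?thesis
      using True by (simp add: first_edge_def[abs_def])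
  next
    case False
    have "(\<lambda>i. (1 - t) * base_vertex i + t * v i) = base_vertex" for t
      using False by (auto simp: v algebra_simps)
    moreover have "\<sigma> base_vertex \<in> topspace X"
      using \<sigma> by (auto simp: singular_simplex_def continuous_map_def Pi_iff)
    ultimately show ?thesis
      using False flat_transport_const[OF flat] by simp
  qed
  finally show ?thesis
    by (simp add: v_def)
qed

text \<open>Restricted to the wall over the \<open>k\<close>-th face, the potential of
  \<open>\<sigma>\<close> is again a potential. By uniqueness it is that of the face times its value
  at the corner of the wall, and this value is exactly the transport factor in the twisted
  boundary.\<close>

lemma push_prism_face:
  assumes \<sigma>: "singular_simplex p X \<sigma>" and k: "k \<le> p" "0 < p" and C: "singular_chain r (prism (p - 1)) C"
  shows "push r (slot_potential T h \<sigma>) (homotopy_slot h \<sigma>)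
      (int_chain (chain_map r (prism_map (singular_face p k (top_simplex p))) C)) =
    chain_scale (if k = 0 then T (first_edge \<sigma>) else 1)
      (push r (slot_potential T h (singular_face p k \<sigma>)) (homotopy_slot h (singular_face p k \<sigma>)) (int_chain C))"
proof -
  let ?\<tau> = "singular_face p k (top_simplex p)"
  let ?a = "if k = 0 then T (first_edge \<sigma>) else 1"
  have s: "singular_simplex (p - 1) (simplex_space p) ?\<tau>"
    using singular_simplex_singular_face[OF singular_simplex_top_simplex, of p k] k by simp
  note cm = continuous_map_prism_map[OF s]
  have slot: "(homotopy_slot h \<sigma> \<circ> prism_map ?\<tau>) y = homotopy_slot h (singular_face p k \<sigma>) y"
    if y': "y \<in> topspace (prism (p - 1))" for y
  proof -
    obtain t x where y: "y = (t, x)" "x \<in> standard_simplex (p - 1)"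
      using y' by (auto simp: topspace_prism)
    have "simplical_face k x \<in> standard_simplex p"
      using simplical_face_in_standard_simplex[of p k x] k y by simp
    then show ?thesis
      using y by (simp add: homotopy_slot_def prism_map_def singular_face_def top_simplex_def)
  qed
  have pot: "(slot_potential T h \<sigma> \<circ> prism_map ?\<tau>) y = ?a * slot_potential T h (singular_face p k \<sigma>) y"
    if y: "y \<in> topspace (prism (p - 1))" for y
  proof -
    have "(slot_potential T h \<sigma> \<circ> prism_map ?\<tau>) y = (slot_potential T h \<sigma> \<circ> prism_map ?\<tau>) (0, base_vertex) *
        straight_potential T prism_contraction (homotopy_slot h \<sigma> \<circ> prism_map ?\<tau>) y"
      by (rule straight_potential_unique[OF star_contraction_prism
            transport_morphism_compose[OF slot_potential_morphism[OF \<sigma>] cm] y])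
    also have "(slot_potential T h \<sigma> \<circ> prism_map ?\<tau>) (0, base_vertex) = ?a"
      using slot_potential_face[OF \<sigma> k] by (simp add: prism_map_def)
    also have "straight_potential T prism_contraction (homotopy_slot h \<sigma> \<circ> prism_map ?\<tau>) y = slot_potential T h (singular_face p k \<sigma>) y"
      unfolding slot_potential_def
      by (rule straight_potential_cong[OF flat star_contraction_prism y]) (rule slot)
    finally show ?thesis .
  qed
  have "push r (slot_potential T h \<sigma>) (homotopy_slot h \<sigma>) (int_chain (chain_map r (prism_map ?\<tau>) C)) =
      push r (slot_potential T h \<sigma> \<circ> prism_map ?\<tau>) (homotopy_slot h \<sigma> \<circ> prism_map ?\<tau>) (int_chain C)"
    by (rule push_int_chain_map)
  also have "\<dots> = push r (\<lambda>y. ?a * slot_potential T h (singular_face p k \<sigma>) y) (homotopy_slot h (singular_face p k \<sigma>)) (int_chain C)"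
    by (rule push_cong[OF int_chain_chains[OF C] slot pot])
  also have "\<dots> = chain_scale ?a (push r (slot_potential T h (singular_face p k \<sigma>)) (homotopy_slot h (singular_face p k \<sigma>)) (int_chain C))"
    by (rule push_scale_potential)
  finally show ?thesis .
qed

lemma push_prism_faces:
  assumes \<sigma>: "singular_simplex p X \<sigma>" and C: "0 < p \<Longrightarrow> singular_chain r (prism (p - 1)) C"
  shows "push r (slot_potential T h \<sigma>) (homotopy_slot h \<sigma>)
      (int_chain (frag_extend (\<lambda>\<tau>. chain_map r (prism_map \<tau>) C) (chain_boundary p (frag_of (top_simplex p))))) =
    prism_operator T h r C (face_sum T p \<sigma>)"
proof (cases "p = 0")
  case False
  have "frag_extend (\<lambda>\<tau>. chain_map r (prism_map \<tau>) C) (chain_boundary p (frag_of (top_simplex p))) =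
      (\<Sum>k\<le>p. frag_cmul ((-1) ^ k) (chain_map r (prism_map (singular_face p k (top_simplex p))) C))"
    using False by (simp add: chain_boundary_of frag_extend_sum frag_extend_cmul o_def)
  then show ?thesis
    using False C push_prism_face[OF \<sigma>]
    by (auto simp: int_chain_sum push_sum int_chain_cmul push_scale prism_operator_def face_sum_def lextend_sum intro!: sum.cong)
qed (simp add: chain_boundary_def face_sum_def)

lemma prism_operator_faces:
  assumes "c \<in> twisted_chains p X" and C: "0 < p \<Longrightarrow> singular_chain r (prism (p - 1)) C"
  shows "prism_operator T h r (frag_extend (\<lambda>\<tau>. chain_map r (prism_map \<tau>) C) (chain_boundary p (frag_of (top_simplex p)))) c =
    prism_operator T h r C (twisted_boundary T p c)"
proof -
  have "prism_operator T h r C (twisted_boundary T p c) = lextend (\<lambda>\<sigma>. prism_operator T h r C (face_sum T p \<sigma>)) c"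
    by (simp add: prism_operator_def twisted_boundary_lextend lextend_lextend)
  then show ?thesis
    using assms(1) push_prism_faces[OF _ C] unfolding prism_operator_def[of T h r "frag_extend _ _"]
    by (auto simp: twisted_chains_iff intro!: lextend_cong)
qed

lemma twisted_boundary_prism_operator:
  assumes c: "c \<in> twisted_chains p X" and C: "singular_chain r (prism p) C"
  shows "twisted_boundary T r (prism_operator T h r C c) = prism_operator T h (r - 1) (chain_boundary r C) c"
  unfolding prism_operator_def twisted_boundary_lextend lextend_lextend
proof (rule lextend_cong)
  fix \<sigma> assume "\<sigma> \<in> Poly_Mapping.keys c"
  then have \<sigma>: "singular_simplex p X \<sigma>"
    using c by (auto simp: twisted_chains_iff)
  show "lextend (face_sum T r) (push r (slot_potential T h \<sigma>) (homotopy_slot h \<sigma>) (int_chain C)) =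
      push (r - 1) (slot_potential T h \<sigma>) (homotopy_slot h \<sigma>) (int_chain (chain_boundary r C))"
    using twisted_boundary_push[OF flat slot_potential_morphism[OF \<sigma>] int_chain_chains[OF C]]
    by (simp add: twisted_boundary_lextend int_chain_boundary)
qed

text \<open>At the bottom the homotopy is the identity and the potential at vertex 0 equals
  1.\<close>

lemma prism_operator_bottom:
  assumes c: "c \<in> twisted_chains p X"
  shows "prism_operator T h p (chain_map p (Pair 0) (frag_of (top_simplex p))) c = c"
proof -
  have "prism_operator T h p (chain_map p (Pair 0) (frag_of (top_simplex p))) c = lextend (\<lambda>\<sigma>. Poly_Mapping.single \<sigma> 1) c"
    unfolding prism_operator_def
  proof (rule lextend_cong)
    fix \<sigma> assume "\<sigma> \<in> Poly_Mapping.keys c"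
    then have \<sigma>: "singular_simplex p X \<sigma>"
      using c by (auto simp: twisted_chains_iff)
    have "slot_potential T h \<sigma> (0, base_vertex) = 1"
      unfolding slot_potential_def
      by (rule straight_potential_base[OF flat star_contraction_prism continuous_homotopy_slot[OF \<sigma>]])
    moreover have "simplex_map p (homotopy_slot h \<sigma> \<circ> Pair 0) (top_simplex p) = \<sigma>"
    proof
      fix x
      show "simplex_map p (homotopy_slot h \<sigma> \<circ> Pair 0) (top_simplex p) x = \<sigma> x"
      proof (cases "x \<in> standard_simplex p")
        case True
        then have "\<sigma> x \<in> topspace X"
          using \<sigma> by (auto simp: singular_simplex_def continuous_map_def Pi_iff)
        then show ?thesis
          using True by (simp add: simplex_map_def homotopy_slot_def prism_map_def top_simplex_def h0)
      next
        case False
        then show ?thesis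
          using \<sigma> by (simp add: simplex_map_def singular_simplex_def extensional_def)
      qed
    qed
    ultimately show "push p (slot_potential T h \<sigma>) (homotopy_slot h \<sigma>) (int_chain (chain_map p (Pair 0) (frag_of (top_simplex p)))) = Poly_Mapping.single \<sigma> 1"
      unfolding push_int_chain_map int_chain_of push_single by (simp add: top_simplex_def)
  qed
  then show ?thesis
    by (simp add: lextend_single_one)
qed

lemma prism_operator_chains:
  assumes c: "c \<in> twisted_chains p (subtopology X B)" and C: "singular_chain r (prism p) C"
    and hB: "\<And>t x. t \<in> {0..1} \<Longrightarrow> x \<in> topspace X \<inter> B \<Longrightarrow> h (t, x) \<in> B'"
  shows "prism_operator T h r C c \<in> twisted_chains r (subtopology X B')"
  unfolding prism_operator_def
proof (rule twisted_chains_lextend)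
  fix \<sigma> assume "\<sigma> \<in> Poly_Mapping.keys c"
  then have \<sigma>: "singular_simplex p X \<sigma>" "\<sigma> ` standard_simplex p \<subseteq> B"
    using c by (auto simp: twisted_chains_iff singular_simplex_subtopology)
  have "homotopy_slot h \<sigma> y \<in> B'" if "y \<in> topspace (prism p)" for y
    using that \<sigma> by (auto simp: topspace_prism homotopy_slot_def prism_map_def singular_simplex_def continuous_map_def Pi_iff intro!: hB)
  then have "continuous_map (prism p) (subtopology X B') (homotopy_slot h \<sigma>)"
    using continuous_homotopy_slot[OF \<sigma>(1)] by (auto simp: continuous_map_in_subtopology)
  then show "push r (slot_potential T h \<sigma>) (homotopy_slot h \<sigma>) (int_chain C) \<in> twisted_chains r (subtopology X B')"
    by (rule twisted_chains_push[OF int_chain_chains[OF C]])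
qed

text \<open>\<open>S\<close> subdivides \<open>n\<close> times and then applies the end
  \<open>h (1, _)\<close> of the homotopy; \<open>P\<close> joins it to the identity. The support
  clause is stated for arbitrary \<open>B\<close> and \<open>B'\<close>, because it is applied to
  the whole space, to \<open>U\<close>, to \<open>A\<close> and to their intersection. The last
  clause locates each simplex of \<open>S p c\<close> as the image at time 1 of a small piece of a
  simplex of \<open>c\<close>.\<close>

lemma subdivision_homotopy:
  obtains S P where
    "\<And>p c. c \<in> twisted_chains p X \<Longrightarrow> twisted_boundary T (Suc p) (P p c) + P (p - 1) (twisted_boundary T p c) = S p c - c"
    "\<And>p c. c \<in> twisted_chains p X \<Longrightarrow> twisted_boundary T p (S p c) = S (p - 1) (twisted_boundary T p c)"
    "\<And>p. P p 0 = 0" "\<And>p a b. S p (a + b) = S p a + S p b"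
    "\<And>p c B B'. c \<in> twisted_chains p (subtopology X B) \<Longrightarrow> (\<And>t x. t \<in> {0..1} \<Longrightarrow> x \<in> topspace X \<inter> B \<Longrightarrow> h (t, x) \<in> B') \<Longrightarrow>
       P p c \<in> twisted_chains (Suc p) (subtopology X B') \<and> S p c \<in> twisted_chains p (subtopology X B')"
    "\<And>p c \<rho>. c \<in> twisted_chains p X \<Longrightarrow> \<rho> \<in> Poly_Mapping.keys (S p c) \<Longrightarrow>
       \<exists>\<sigma>\<in>Poly_Mapping.keys c. \<exists>\<tau>\<in>Poly_Mapping.keys (subdivided_simplex n p).
         \<rho> ` standard_simplex p = (\<lambda>x. h (1, \<sigma> (\<tau> x))) ` standard_simplex p"
proof -
  obtain N :: "nat \<Rightarrow> (real \<times> (nat \<Rightarrow> real)) chain" where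
    N: "\<And>p. singular_chain (Suc p) (prism p) (N p)" and
    dN: "\<And>p. chain_boundary (Suc p) (N p) =
        chain_map p (Pair 1) (subdivided_simplex n p) - chain_map p (Pair 0) (frag_of (top_simplex p))
        - frag_extend (\<lambda>\<sigma>. chain_map p (prism_map \<sigma>) (N (p - 1))) (chain_boundary p (frag_of (top_simplex p)))"
    using prism_chains_exist[of n] by blast
  define E where "E p = chain_map p (Pair (1::real)) (subdivided_simplex n p)" for p
  have E: "singular_chain p (prism p) (E p)" for p
    unfolding E_def by (rule singular_chain_chain_map[OF singular_chain_subdivided_simplex continuous_map_prism_end]) simp
  have dE: "chain_boundary p (E p) = frag_extend (\<lambda>\<tau>. chain_map (p - 1) (prism_map \<tau>) (E (p - 1))) (chain_boundary p (frag_of (top_simplex p)))" for p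
  proof -
    have "chain_boundary p (E p) = chain_map (p - 1) (Pair 1) (chain_boundary p (subdivided_simplex n p))"
      unfolding E_def using chain_boundary_chain_map[OF singular_chain_subdivided_simplex[of p n]] by simp
    also have "\<dots> = frag_extend (\<lambda>\<tau>. chain_map (p - 1) (Pair 1) (chain_map (p - 1) \<tau> (subdivided_simplex n (p - 1)))) (chain_boundary p (frag_of (top_simplex p)))"
      unfolding chain_boundary_subdivided_simplex chain_map_extend ..
    also have "\<dots> = frag_extend (\<lambda>\<tau>. chain_map (p - 1) (prism_map \<tau>) (E (p - 1))) (chain_boundary p (frag_of (top_simplex p)))"
    proof (rule frag_extend_eq)
      fix \<tau> :: "(nat \<Rightarrow> real) \<Rightarrow> nat \<Rightarrow> real"
      have "Pair (1::real) \<circ> \<tau> = prism_map \<tau> \<circ> Pair 1"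
        by (simp add: prism_map_def o_def)
      then show "chain_map (p - 1) (Pair 1) (chain_map (p - 1) \<tau> (subdivided_simplex n (p - 1))) = chain_map (p - 1) (prism_map \<tau>) (E (p - 1))"
        unfolding E_def by (metis chain_map_compose comp_apply)
    qed
    finally show ?thesis .
  qed
  show ?thesis
  proof (rule that[of "\<lambda>p. prism_operator T h (Suc p) (N p)" "\<lambda>p. prism_operator T h p (E p)"])
    fix p c assume c: "c \<in> twisted_chains p X"
    have "twisted_boundary T (Suc p) (prism_operator T h (Suc p) (N p) c) = prism_operator T h p (E p) c - c
        - prism_operator T h p (frag_extend (\<lambda>\<sigma>. chain_map p (prism_map \<sigma>) (N (p - 1))) (chain_boundary p (frag_of (top_simplex p)))) c"
      unfolding twisted_boundary_prism_operator[OF c N] dN E_def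
      by (simp add: prism_operator_diff_left prism_operator_bottom[OF c] del: chain_map_of)
    moreover have "prism_operator T h p (frag_extend (\<lambda>\<sigma>. chain_map p (prism_map \<sigma>) (N (p - 1))) (chain_boundary p (frag_of (top_simplex p)))) c =
        prism_operator T h p (N (p - 1)) (twisted_boundary T p c)"
      using N[of "p - 1"] by (intro prism_operator_faces[OF c]) simp
    \<comment> \<open>For \<open>p = 0\<close> the index \<open>Suc (p - 1)\<close> is 1 instead of
      0, but then the boundary is zero and so are both sides.\<close>
    moreover have "prism_operator T h p (N (p - 1)) (twisted_boundary T p c) = prism_operator T h (Suc (p - 1)) (N (p - 1)) (twisted_boundary T p c)"
      by (cases "p = 0") (simp_all add: twisted_boundary_def)
    ultimately show "twisted_boundary T (Suc p) (prism_operator T h (Suc p) (N p) c) + prism_operator T h (Suc (p - 1)) (N (p - 1)) (twisted_boundary T p c) = prism_operator T h p (E p) c - c"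
      by simp
    show "twisted_boundary T p (prism_operator T h p (E p) c) = prism_operator T h (p - 1) (E (p - 1)) (twisted_boundary T p c)"
      unfolding twisted_boundary_prism_operator[OF c E] dE by (rule prism_operator_faces[OF c E])
    fix \<rho> assume "\<rho> \<in> Poly_Mapping.keys (prism_operator T h p (E p) c)"
    then obtain \<sigma> where \<sigma>: "\<sigma> \<in> Poly_Mapping.keys c"
      "\<rho> \<in> Poly_Mapping.keys (push p (slot_potential T h \<sigma>) (homotopy_slot h \<sigma>) (int_chain (E p)))"
      unfolding prism_operator_def using keys_lextend by fast
    then obtain \<tau>' where \<tau>': "\<tau>' \<in> Poly_Mapping.keys (E p)" "\<rho> = simplex_map p (homotopy_slot h \<sigma>) \<tau>'"
      using keys_push keys_int_chain by fast
    obtain \<tau> where \<tau>: "\<tau> \<in> Poly_Mapping.keys (subdivided_simplex n p)" "\<tau>' = simplex_map p (Pair 1) \<tau>"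
      using \<tau>'(1) keys_frag_extend[of "frag_of \<circ> simplex_map p (Pair 1)" "subdivided_simplex n p"]
      unfolding E_def chain_map_def by fastforce
    have "\<rho> ` standard_simplex p = (\<lambda>x. h (1, \<sigma> (\<tau> x))) ` standard_simplex p"
      unfolding \<tau>' \<tau> by (rule image_cong) (simp_all add: simplex_map_def homotopy_slot_def prism_map_def)
    then show "\<exists>\<sigma>\<in>Poly_Mapping.keys c. \<exists>\<tau>\<in>Poly_Mapping.keys (subdivided_simplex n p).
         \<rho> ` standard_simplex p = (\<lambda>x. h (1, \<sigma> (\<tau> x))) ` standard_simplex p"
      using \<sigma> \<tau> by blast
  qed (auto simp: prism_operator_add intro: prism_operator_chains N E)
qed

end

text \<open>For one simplex this is the Lebesgue number argument, applied to the identity simplex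
  and the preimages of \<open>U\<close> and \<open>V\<close>. It holds for all sufficiently fine
  subdivisions, so a maximum serves the finite set \<open>\<Sigma>\<close>.\<close>

lemma small_subdivision_exists:
  assumes "finite \<Sigma>" "\<And>\<sigma>. \<sigma> \<in> \<Sigma> \<Longrightarrow> singular_simplex p X \<sigma>"
    and UV: "openin X U" "openin X V" "topspace X \<subseteq> U \<union> V"
  obtains n where "\<And>\<sigma> \<tau>. \<sigma> \<in> \<Sigma> \<Longrightarrow> \<tau> \<in> Poly_Mapping.keys (subdivided_simplex n p) \<Longrightarrow>
      (\<forall>x\<in>standard_simplex p. \<sigma> (\<tau> x) \<in> U) \<or> (\<forall>x\<in>standard_simplex p. \<sigma> (\<tau> x) \<in> V)"
proof -
  have "\<exists>n. \<forall>m\<ge>n. \<forall>\<tau>\<in>Poly_Mapping.keys (subdivided_simplex m p).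
      (\<forall>x\<in>standard_simplex p. \<sigma> (\<tau> x) \<in> U) \<or> (\<forall>x\<in>standard_simplex p. \<sigma> (\<tau> x) \<in> V)" if "\<sigma> \<in> \<Sigma>" for \<sigma>
  proof -
    have \<sigma>: "continuous_map (simplex_space p) X \<sigma>"
      using assms(2)[OF that] by (simp add: singular_simplex_def)
    define \<C> where "\<C> = (\<lambda>W. {x \<in> topspace (simplex_space p). \<sigma> x \<in> W}) ` {U, V}"
    have 1: "openin (simplex_space p) W" if "W \<in> \<C>" for W
      using that openin_continuous_map_preimage[OF \<sigma>] UV by (auto simp: \<C>_def)
    have 2: "topspace (simplex_space p) \<subseteq> \<Union> \<C>"
      using \<sigma> UV(3) by (fastforce simp: \<C>_def continuous_map_def Pi_iff)
    have 3: "singular_chain p (simplex_space p) (frag_of (top_simplex p))"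
      by (simp add: singular_chain_of)
    obtain n where n: "\<And>m f. n \<le> m \<Longrightarrow> f \<in> Poly_Mapping.keys ((singular_subdivision p ^^ m) (frag_of (top_simplex p))) \<Longrightarrow>
        \<exists>V \<in> \<C>. f \<in> standard_simplex p \<rightarrow> V"
      using sufficient_iterated_singular_subdivision_exists[of \<C>, OF 1 2 3] by blast
    show ?thesis
      using n by (intro exI[of _ n]) (fastforce simp: iterated_subdivision_top_simplex \<C>_def)
  qed
  then obtain n where n: "\<And>\<sigma> m \<tau>. \<sigma> \<in> \<Sigma> \<Longrightarrow> n \<sigma> \<le> m \<Longrightarrow> \<tau> \<in> Poly_Mapping.keys (subdivided_simplex m p) \<Longrightarrow>
      (\<forall>x\<in>standard_simplex p. \<sigma> (\<tau> x) \<in> U) \<or> (\<forall>x\<in>standard_simplex p. \<sigma> (\<tau> x) \<in> V)"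
    by metis
  show ?thesis
  proof (rule that[of "Max (insert 0 (n ` \<Sigma>))"])
    fix \<sigma> \<tau> assume "\<sigma> \<in> \<Sigma>" "\<tau> \<in> Poly_Mapping.keys (subdivided_simplex (Max (insert 0 (n ` \<Sigma>))) p)"
    then show "(\<forall>x\<in>standard_simplex p. \<sigma> (\<tau> x) \<in> U) \<or> (\<forall>x\<in>standard_simplex p. \<sigma> (\<tau> x) \<in> V)"
      using assms(1) by (intro n[of \<sigma>]) auto
  qed
qed

text \<open>Excision for a subset that becomes absorbed by \<open>A\<close> only at the end of a homotopy.\<close>

locale squeeze_excision = twisted_homotopy +
  fixes A U V
  assumes U: "openin X U" and V: "openin X V" and UV: "topspace X \<subseteq> U \<union> V"
    and hA: "\<And>t x. t \<in> {0..1} \<Longrightarrow> x \<in> topspace X \<inter> A \<Longrightarrow> h (t, x) \<in> A"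
    and hU: "\<And>t x. t \<in> {0..1} \<Longrightarrow> x \<in> U \<Longrightarrow> h (t, x) \<in> U"
    and hV: "\<And>x. x \<in> V \<Longrightarrow> h (1, x) \<in> A"
begin

text \<open>A small piece in \<open>U\<close> is still in \<open>U\<close> at time 1, and one in
  \<open>V\<close> has reached \<open>A\<close>. So every simplex of \<open>c'\<close> that leaves
  \<open>U\<close> lies in \<open>A\<close>.\<close>

lemma split_subdivision:
  assumes small: "\<And>\<sigma> \<tau>. \<sigma> \<in> Poly_Mapping.keys c \<Longrightarrow> \<tau> \<in> Poly_Mapping.keys (subdivided_simplex n p) \<Longrightarrow>
      (\<forall>x\<in>standard_simplex p. \<sigma> (\<tau> x) \<in> U) \<or> (\<forall>x\<in>standard_simplex p. \<sigma> (\<tau> x) \<in> V)"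
    and keys: "\<And>\<rho>. \<rho> \<in> Poly_Mapping.keys c' \<Longrightarrow>
       \<exists>\<sigma>\<in>Poly_Mapping.keys c. \<exists>\<tau>\<in>Poly_Mapping.keys (subdivided_simplex n p).
         \<rho> ` standard_simplex p = (\<lambda>x. h (1, \<sigma> (\<tau> x))) ` standard_simplex p"
    and c': "c' \<in> twisted_chains p X"
  obtains u a where "c' = u + a" "u \<in> twisted_chains p (subtopology X U)" "a \<in> twisted_chains p (subtopology X A)"
proof -
  let ?Q = "\<lambda>\<rho>. \<rho> ` standard_simplex p \<subseteq> U"
  have "\<rho> ` standard_simplex p \<subseteq> A" if \<rho>: "\<rho> \<in> Poly_Mapping.keys c'" "\<not> ?Q \<rho>" for \<rho>
  proof -
    obtain \<sigma> \<tau> where *: "\<sigma> \<in> Poly_Mapping.keys c" "\<tau> \<in> Poly_Mapping.keys (subdivided_simplex n p)"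
        "\<rho> ` standard_simplex p = (\<lambda>x. h (1, \<sigma> (\<tau> x))) ` standard_simplex p"
      using keys[OF \<rho>(1)] by blast
    consider "\<forall>x\<in>standard_simplex p. \<sigma> (\<tau> x) \<in> U" | "\<forall>x\<in>standard_simplex p. \<sigma> (\<tau> x) \<in> V"
      using small[OF *(1,2)] by blast
    then show ?thesis
    proof cases
      case 1
      then have "(\<lambda>x. h (1, \<sigma> (\<tau> x))) ` standard_simplex p \<subseteq> U"
        using hU[of 1] by auto
      then show ?thesis
        using \<rho>(2) *(3) by simp
    next
      case 2
      then show ?thesis
        unfolding *(3) using hV by auto
    qed
  qed
  then have "chain_part (\<lambda>\<rho>. \<not> ?Q \<rho>) c' \<in> twisted_chains p (subtopology X A)"
    using c' by (auto simp: twisted_chains_iff singular_simplex_subtopology keys_chain_part)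
  moreover have "chain_part ?Q c' \<in> twisted_chains p (subtopology X U)"
    using c' by (auto simp: twisted_chains_iff singular_simplex_subtopology keys_chain_part)
  ultimately show ?thesis
    using that[OF chain_part_add_not[of ?Q c', symmetric]] by blast
qed

lemma U_subset: "U \<subseteq> topspace X"
  using U by (rule openin_subset)

theorem excision_surjective:
  assumes c: "c \<in> twisted_relcycles T p X A"
  obtains c' where "c' \<in> twisted_relcycles T p (subtopology X U) A" "c - c' \<in> twisted_relboundaries T p X A"
proof -
  have c1: "c \<in> twisted_chains p X" "twisted_boundary T p c \<in> twisted_chains (p - 1) (subtopology X A)"
    using c by (auto simp: twisted_relcycles_def)
  obtain n where n: "\<And>\<sigma> \<tau>. \<sigma> \<in> Poly_Mapping.keys c \<Longrightarrow> \<tau> \<in> Poly_Mapping.keys (subdivided_simplex n p) \<Longrightarrow>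
      (\<forall>x\<in>standard_simplex p. \<sigma> (\<tau> x) \<in> U) \<or> (\<forall>x\<in>standard_simplex p. \<sigma> (\<tau> x) \<in> V)"
    using small_subdivision_exists[of "Poly_Mapping.keys c" p X U V] c1(1) U V UV
    by (auto simp: twisted_chains_iff)
  obtain S P where
    hom: "\<And>p c. c \<in> twisted_chains p X \<Longrightarrow> twisted_boundary T (Suc p) (P p c) + P (p - 1) (twisted_boundary T p c) = S p c - c"
    and dS: "\<And>p c. c \<in> twisted_chains p X \<Longrightarrow> twisted_boundary T p (S p c) = S (p - 1) (twisted_boundary T p c)"
    and P0: "\<And>p. P p 0 = 0"
    and sub: "\<And>p c B B'. c \<in> twisted_chains p (subtopology X B) \<Longrightarrow> (\<And>t x. t \<in> {0..1} \<Longrightarrow> x \<in> topspace X \<inter> B \<Longrightarrow> h (t, x) \<in> B') \<Longrightarrow>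
       P p c \<in> twisted_chains (Suc p) (subtopology X B') \<and> S p c \<in> twisted_chains p (subtopology X B')"
    and keys: "\<And>p c \<rho>. c \<in> twisted_chains p X \<Longrightarrow> \<rho> \<in> Poly_Mapping.keys (S p c) \<Longrightarrow>
       \<exists>\<sigma>\<in>Poly_Mapping.keys c. \<exists>\<tau>\<in>Poly_Mapping.keys (subdivided_simplex n p).
         \<rho> ` standard_simplex p = (\<lambda>x. h (1, \<sigma> (\<tau> x))) ` standard_simplex p"
    by (rule subdivision_homotopy[of n]) blast
  have all: "P q e \<in> twisted_chains (Suc q) X \<and> S q e \<in> twisted_chains q X" if "e \<in> twisted_chains q X" for q e
    using sub[of e q UNIV UNIV] that by simp
  obtain u a where ua: "S p c = u + a" "u \<in> twisted_chains p (subtopology X U)" "a \<in> twisted_chains p (subtopology X A)"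
    by (rule split_subdivision[of c n p "S p c"]) (use n keys[OF c1(1)] all[OF c1(1)] in \<open>blast+\<close>)
  \<comment> \<open>In degree 0 the index \<open>p - 1\<close> makes \<open>P (p - 1)\<close> raise
    to degree 1 instead of 0; there the boundary vanishes, and \<open>P0\<close> settles the
    case.\<close>
  have dS': "S (p - 1) (twisted_boundary T p c) \<in> twisted_chains (p - 1) (subtopology X A)"
    and Pd: "P (p - 1) (twisted_boundary T p c) \<in> twisted_chains p (subtopology X A)"
    using sub[OF c1(2), of A] hA P0 by (auto, cases "p = 0", auto simp: twisted_boundary_def)
  have "twisted_boundary T p u = S (p - 1) (twisted_boundary T p c) - twisted_boundary T p a"
    using dS[OF c1(1)] ua(1) by (simp add: twisted_boundary_add algebra_simps)
  then have "twisted_boundary T p u \<in> twisted_chains (p - 1) (subtopology X A)"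
    using dS' twisted_boundary_chains[OF ua(3)] by (simp add: twisted_chains_diff)
  moreover have "twisted_boundary T p u \<in> twisted_chains (p - 1) (subtopology X U)"
    by (rule twisted_boundary_chains[OF ua(2)])
  ultimately have "u \<in> twisted_relcycles T p (subtopology X U) A"
    using ua(2) unfolding twisted_relcycles_def by (simp add: twisted_chains_subtopology)
  moreover have "c - u \<in> twisted_relboundaries T p X A"
  proof (rule twisted_relboundariesI)
    show "- P p c \<in> twisted_chains (Suc p) X"
      using all[OF c1(1)] by (simp add: twisted_chains_minus)
    show "a - P (p - 1) (twisted_boundary T p c) \<in> twisted_chains p (subtopology X A)"
      using ua Pd by (simp add: twisted_chains_diff)
    show "c - u = twisted_boundary T (Suc p) (- P p c) + (a - P (p - 1) (twisted_boundary T p c))"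
      using hom[OF c1(1)] ua(1) twisted_boundary_diff[of T "Suc p" 0 "P p c"] by (simp add: algebra_simps)
  qed
  ultimately show ?thesis
    by (rule that)
qed

text \<open>The operator is applied to a bounding chain \<open>e\<close>, and \<open>S e\<close>
  splits into \<open>u\<close> in \<open>U\<close> and \<open>v\<close> in \<open>A\<close>. The
  error \<open>S c - du\<close> lies in \<open>U\<close> because both terms do, and in
  \<open>A\<close> because it equals \<open>dv + S a\<close>. That \<open>P c\<close> stays in
  \<open>U\<close> uses that \<open>h\<close> preserves \<open>U\<close> at all times, not only at
  the end.\<close>

theorem excision_injective:
  assumes c: "c \<in> twisted_relcycles T p (subtopology X U) A" and cb: "c \<in> twisted_relboundaries T p X A"
  shows "c \<in> twisted_relboundaries T p (subtopology X U) A"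
proof -
  have c1: "c \<in> twisted_chains p (subtopology X U)" "twisted_boundary T p c \<in> twisted_chains (p - 1) (subtopology X (U \<inter> A))"
    using c by (auto simp: twisted_relcycles_def subtopology_subtopology)
  then have cX: "c \<in> twisted_chains p X"
    by (auto simp: twisted_chains_subtopology)
  obtain e a where ea: "e \<in> twisted_chains (Suc p) X" "a \<in> twisted_chains p (subtopology X A)"
    "c = twisted_boundary T (Suc p) e + a"
    using cb by (rule twisted_relboundariesE)
  obtain n where n: "\<And>\<sigma> \<tau>. \<sigma> \<in> Poly_Mapping.keys e \<Longrightarrow> \<tau> \<in> Poly_Mapping.keys (subdivided_simplex n (Suc p)) \<Longrightarrow>
      (\<forall>x\<in>standard_simplex (Suc p). \<sigma> (\<tau> x) \<in> U) \<or> (\<forall>x\<in>standard_simplex (Suc p). \<sigma> (\<tau> x) \<in> V)"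
    using small_subdivision_exists[of "Poly_Mapping.keys e" "Suc p" X U V] ea(1) U V UV
    by (auto simp: twisted_chains_iff)
  obtain S P where
    hom: "\<And>p c. c \<in> twisted_chains p X \<Longrightarrow> twisted_boundary T (Suc p) (P p c) + P (p - 1) (twisted_boundary T p c) = S p c - c"
    and dS: "\<And>p c. c \<in> twisted_chains p X \<Longrightarrow> twisted_boundary T p (S p c) = S (p - 1) (twisted_boundary T p c)"
    and P0: "\<And>p. P p 0 = 0" and S_add: "\<And>p a b. S p (a + b) = S p a + S p b"
    and sub: "\<And>p c B B'. c \<in> twisted_chains p (subtopology X B) \<Longrightarrow> (\<And>t x. t \<in> {0..1} \<Longrightarrow> x \<in> topspace X \<inter> B \<Longrightarrow> h (t, x) \<in> B') \<Longrightarrow>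
       P p c \<in> twisted_chains (Suc p) (subtopology X B') \<and> S p c \<in> twisted_chains p (subtopology X B')"
    and keys: "\<And>p c \<rho>. c \<in> twisted_chains p X \<Longrightarrow> \<rho> \<in> Poly_Mapping.keys (S p c) \<Longrightarrow>
       \<exists>\<sigma>\<in>Poly_Mapping.keys c. \<exists>\<tau>\<in>Poly_Mapping.keys (subdivided_simplex n p).
         \<rho> ` standard_simplex p = (\<lambda>x. h (1, \<sigma> (\<tau> x))) ` standard_simplex p"
    by (rule subdivision_homotopy[of n]) blast
  have "S (Suc p) e \<in> twisted_chains (Suc p) X"
    using sub[of e "Suc p" UNIV UNIV] ea(1) by simp
  then obtain u v where uv: "S (Suc p) e = u + v" "u \<in> twisted_chains (Suc p) (subtopology X U)"
      "v \<in> twisted_chains (Suc p) (subtopology X A)"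
    by (rule split_subdivision[of e n "Suc p" "S (Suc p) e", rotated 2]) (use n keys[OF ea(1)] in \<open>blast+\<close>)
  have "S p c = twisted_boundary T (Suc p) u + (twisted_boundary T (Suc p) v + S p a)"
    using dS[OF ea(1)] uv(1) unfolding ea(3) S_add by (simp add: twisted_boundary_add algebra_simps)
  then have b: "S p c - twisted_boundary T (Suc p) u = twisted_boundary T (Suc p) v + S p a"
    by simp
  have PU: "P p c \<in> twisted_chains (Suc p) (subtopology X U)" "S p c \<in> twisted_chains p (subtopology X U)"
    using sub[OF c1(1), of U] hU by auto
  have "S p c - twisted_boundary T (Suc p) u \<in> twisted_chains p (subtopology X U)"
    using PU twisted_boundary_chains[OF uv(2)] by (simp add: twisted_chains_diff)
  moreover have "S p c - twisted_boundary T (Suc p) u \<in> twisted_chains p (subtopology X A)"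
    unfolding b using sub[OF ea(2), of A] hA twisted_boundary_chains[OF uv(3)] by (auto intro!: twisted_chains_add)
  ultimately have bU: "S p c - twisted_boundary T (Suc p) u \<in> twisted_chains p (subtopology (subtopology X U) A)"
    by (simp add: twisted_chains_subtopology)
  have Pd: "P (p - 1) (twisted_boundary T p c) \<in> twisted_chains p (subtopology (subtopology X U) A)"
  proof (cases "p = 0")
    case False
    then show ?thesis
      using sub[OF c1(2), of "U \<inter> A"] hA hU U_subset by (auto simp: subtopology_subtopology)
  qed (simp add: twisted_boundary_def P0)
  show ?thesis
  proof (rule twisted_relboundariesI)
    show "u - P p c \<in> twisted_chains (Suc p) (subtopology X U)"
      using uv PU by (simp add: twisted_chains_diff)
    show "(S p c - twisted_boundary T (Suc p) u) - P (p - 1) (twisted_boundary T p c) \<in> twisted_chains p (subtopology (subtopology X U) A)"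
      using bU Pd by (rule twisted_chains_diff)
    show "c = twisted_boundary T (Suc p) (u - P p c) + ((S p c - twisted_boundary T (Suc p) u) - P (p - 1) (twisted_boundary T p c))"
      using hom[OF cX] by (simp add: twisted_boundary_diff algebra_simps)
  qed
qed

end

section \<open>The homology of a simplex modulo its boundary\<close>

text \<open>This and the next lemma unpack an isomorphism of homology groups into statements about
  chains, the form in which the coefficients can later be changed from integers to Laurent
  polynomials.\<close>

lemma hom_induced_iso_surjective:
  assumes iso: "hom_induced (int p) X S Y T f \<in> iso (relative_homology_group (int p) X S) (relative_homology_group (int p) Y T)"
    and f: "continuous_map X Y f" "f \<in> S \<rightarrow> T" and c': "singular_relcycle p Y T c'"
  obtains c where "singular_relcycle p X S c" "homologous_rel p Y T (chain_map p f c) c'"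
proof -
  have "homologous_rel_set p Y T c' \<in> carrier (relative_homology_group (int p) Y T)"
    unfolding carrier_relative_homology_group using c' by (intro imageI) simp
  then have "homologous_rel_set p Y T c' \<in> hom_induced (int p) X S Y T f ` carrier (relative_homology_group (int p) X S)"
    using iso by (simp add: iso_def bij_betw_def)
  then obtain c where c: "singular_relcycle p X S c"
      "homologous_rel_set p Y T c' = hom_induced (int p) X S Y T f (homologous_rel_set p X S c)"
    unfolding carrier_relative_homology_group by blast
  then have "homologous_rel_set p Y T (chain_map p f c) = homologous_rel_set p Y T c'"
    using hom_induced_chain_map[OF f c(1)] by simp
  then show ?thesis
    using c(1) that by (simp only: homologous_rel_set_eq)
qed

lemma hom_induced_iso_injective:
  assumes iso: "hom_induced (int p) X S Y T f \<in> iso (relative_homology_group (int p) X S) (relative_homology_group (int p) Y T)"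
    and f: "continuous_map X Y f" "f \<in> S \<rightarrow> T" and c: "singular_relcycle p X S c"
    and b: "singular_relboundary p Y T (chain_map p f c)"
  shows "singular_relboundary p X S c"
proof -
  have z: "singular_relcycle p X S 0"
    by simp
  have "homologous_rel_set p Y T (chain_map p f c) = homologous_rel_set p Y T (chain_map p f 0)"
    by (subst homologous_rel_set_eq) (use b in \<open>simp add: homologous_rel_def\<close>)
  then have "hom_induced (int p) X S Y T f (homologous_rel_set p X S c) = hom_induced (int p) X S Y T f (homologous_rel_set p X S 0)"
    by (simp only: hom_induced_chain_map[OF f c] hom_induced_chain_map[OF f z])
  moreover have "inj_on (hom_induced (int p) X S Y T f) (carrier (relative_homology_group (int p) X S))"
    using iso by (simp add: iso_def bij_betw_def)
  moreover have "homologous_rel_set p X S e \<in> carrier (relative_homology_group (int p) X S)" if "singular_relcycle p X S e" for e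
    unfolding carrier_relative_homology_group using that by (intro imageI) simp
  ultimately have "homologous_rel_set p X S c = homologous_rel_set p X S 0"
    using c z by (meson inj_onD)
  then show ?thesis
    by (subst (asm) homologous_rel_set_eq) (simp add: homologous_rel_def)
qed

lemma hom_relboundary_chain:
  assumes "singular_relcycle (Suc p) X S c" "T \<subseteq> S"
  shows "hom_relboundary (int (Suc p)) X S T (homologous_rel_set (Suc p) X S c) =
    homologous_rel_set p (subtopology X S) T (chain_boundary (Suc p) c)"
proof -
  have ch: "singular_chain p (subtopology X S) (chain_boundary (Suc p) c)"
    using assms(1) by (simp add: singular_relcycle)
  have cy: "singular_relcycle p (subtopology X S) {} (chain_boundary (Suc p) c)"
    using ch assms(1) unfolding singular_cycle
    by (auto simp: singular_relcycle intro: chain_boundary_boundary_alt)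
  have "hom_boundary (int (Suc p)) X S (homologous_rel_set (Suc p) X S c) =
      homologous_rel_set p (subtopology X S) {} (chain_boundary (Suc p) c)"
    using hom_boundary_chain_boundary[OF assms(1)] by simp
  moreover have "hom_induced (int p) (subtopology X S) {} (subtopology X S) T id (homologous_rel_set p (subtopology X S) {} (chain_boundary (Suc p) c)) =
      homologous_rel_set p (subtopology X S) T (chain_map p id (chain_boundary (Suc p) c))"
    by (rule hom_induced_chain_map[OF continuous_map_id _ cy]) auto
  ultimately show ?thesis
    by (simp add: hom_relboundary_def chain_map_ident[OF ch])
qed

lemma hom_relboundary_iso_injective:
  assumes iso: "hom_relboundary (int (Suc p)) X S T \<in> iso (relative_homology_group (int (Suc p)) X S) (relative_homology_group (int p) (subtopology X S) T)"
    and TS: "T \<subseteq> S" and c: "singular_relcycle (Suc p) X S c"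
    and b: "singular_relboundary p (subtopology X S) T (chain_boundary (Suc p) c)"
  shows "singular_relboundary (Suc p) X S c"
proof -
  have z: "singular_relcycle (Suc p) X S 0"
    by simp
  have "homologous_rel_set p (subtopology X S) T (chain_boundary (Suc p) c) = homologous_rel_set p (subtopology X S) T (chain_boundary (Suc p) 0)"
    by (subst homologous_rel_set_eq) (use b in \<open>simp add: homologous_rel_def\<close>)
  then have "hom_relboundary (int (Suc p)) X S T (homologous_rel_set (Suc p) X S c) = hom_relboundary (int (Suc p)) X S T (homologous_rel_set (Suc p) X S 0)"
    by (simp only: hom_relboundary_chain[OF c TS] hom_relboundary_chain[OF z TS])
  moreover have "inj_on (hom_relboundary (int (Suc p)) X S T) (carrier (relative_homology_group (int (Suc p)) X S))"
    using iso by (simp add: iso_def bij_betw_def)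
  moreover have "homologous_rel_set (Suc p) X S e \<in> carrier (relative_homology_group (int (Suc p)) X S)" if "singular_relcycle (Suc p) X S e" for e
    unfolding carrier_relative_homology_group using that by (intro imageI) simp
  ultimately have "homologous_rel_set (Suc p) X S c = homologous_rel_set (Suc p) X S 0"
    using c z by (meson inj_onD)
  then show ?thesis
    by (subst (asm) homologous_rel_set_eq) (simp add: homologous_rel_def)
qed

section \<open>The simplex, its boundary and its horn\<close>

definition simplex_boundary :: "nat \<Rightarrow> (nat \<Rightarrow> real) set" where
  "simplex_boundary m = {x \<in> standard_simplex m. \<exists>i\<le>m. x i = 0}"

text \<open>The union of the facets that contain \<open>base_vertex\<close>, that is, of all facets
  but the one with index 0.\<close>

definition simplex_horn :: "nat \<Rightarrow> (nat \<Rightarrow> real) set" where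
  "simplex_horn m = {x \<in> standard_simplex m. \<exists>i\<in>{1..m}. x i = 0}"

lemma continuous_map_linear_homotopy:
  assumes f: "continuous_map X (powertop_real UNIV) f" and g: "continuous_map X (powertop_real UNIV) g"
  shows "continuous_map (prod_topology (top_of_set {0..1::real}) X) (powertop_real UNIV)
     (\<lambda>(t, x). \<lambda>i. (1 - t) * f x i + t * g x i)"
proof -
  let ?Y = "prod_topology (top_of_set {0..1::real}) X"
  have a: "continuous_map ?Y euclideanreal (\<lambda>z. fst z)"
    by (rule continuous_map_into_fulltopology[OF continuous_map_fst])
  have c: "continuous_map ?Y euclideanreal (\<lambda>z. u (snd z) i)" if "continuous_map X (powertop_real UNIV) u" for u i
    using that continuous_map_compose[OF continuous_map_snd, of X "powertop_real UNIV" u "top_of_set {0..1::real}"]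
    by (simp add: o_def continuous_map_componentwise_UNIV)
  show ?thesis
    unfolding continuous_map_componentwise_UNIV case_prod_unfold using a c[OF f] c[OF g] by (auto intro!: continuous_intros)
qed

lemma star_contraction_standard:
  assumes "b \<in> S" "\<And>t x. t \<in> {0..1} \<Longrightarrow> x \<in> S \<Longrightarrow> (\<lambda>i. (1 - t) * b i + t * x i) \<in> S"
  shows "star_contraction (subtopology (powertop_real UNIV) S) b (\<lambda>(t, x). \<lambda>i. (1 - t) * b i + t * x i)"
proof -
  let ?X = "subtopology (powertop_real UNIV) S"
  have 1: "continuous_map ?X (powertop_real UNIV) (\<lambda>x. b)"
    by simp
  have 2: "continuous_map ?X (powertop_real UNIV) (\<lambda>x. x)"
    by (intro continuous_map_from_subtopology continuous_map_id[unfolded id_def])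
  have "continuous_map (prod_topology (top_of_set {0..1::real}) ?X) (powertop_real UNIV) (\<lambda>(t, x). \<lambda>i. (1 - t) * b i + t * x i)"
    by (rule continuous_map_linear_homotopy[OF 1 2])
  then have "continuous_map (prod_topology (top_of_set {0..1::real}) ?X) ?X (\<lambda>(t, x). \<lambda>i. (1 - t) * b i + t * x i)"
    using assms(2) by (auto simp: continuous_map_in_subtopology)
  then show ?thesis
    using assms(1) by (auto simp: star_contraction_def algebra_simps)
qed

lemma homotopic_with_linear:
  assumes f: "continuous_map X Y f" and g: "continuous_map X Y g" and Y: "Y = subtopology (powertop_real UNIV) S"
    and S: "\<And>t x. t \<in> {0..1} \<Longrightarrow> x \<in> topspace X \<Longrightarrow> (\<lambda>i. (1 - t) * f x i + t * g x i) \<in> S"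
    and P: "\<And>t. t \<in> {0..1} \<Longrightarrow> P (\<lambda>x i. (1 - t) * f x i + t * g x i)"
    and cong: "\<And>h k. (\<And>x. x \<in> topspace X \<Longrightarrow> h x = k x) \<Longrightarrow> P h = P k"
  shows "homotopic_with P X Y f g"
proof -
  have "continuous_map X (powertop_real UNIV) f" "continuous_map X (powertop_real UNIV) g"
    using f g by (auto simp: Y continuous_map_in_subtopology)
  from continuous_map_linear_homotopy[OF this]
  have "continuous_map (prod_topology (top_of_set {0..1}) X) Y (\<lambda>(t, x). \<lambda>i. (1 - t) * f x i + t * g x i)"
    using S by (auto simp: Y continuous_map_in_subtopology)
  then show ?thesis
    using P by (subst homotopic_with) (auto intro!: exI[of _ "\<lambda>(t, x). \<lambda>i. (1 - t) * f x i + t * g x i"] cong)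
qed

lemma contractible_simplex: "contractible_space (simplex_space m)"
  by (rule star_contraction_contractible[OF star_contraction_standard[of base_vertex]])
    (auto intro: convex_standard_simplex)

text \<open>The horn is star-shaped about \<open>base_vertex\<close>: a coordinate of positive index
  that vanishes at \<open>x\<close> vanishes along the whole segment.\<close>

lemma contractible_horn:
  assumes "0 < m"
  shows "contractible_space (subtopology (simplex_space m) (simplex_horn m))"
proof -
  have "base_vertex \<in> simplex_horn m"
    using assms by (auto simp: simplex_horn_def base_vertex_def intro!: bexI[of _ 1])
  moreover have "(\<lambda>i. (1 - t) * base_vertex i + t * x i) \<in> simplex_horn m" if tx: "t \<in> {0..1}" "x \<in> simplex_horn m" for t x
  proof -
    obtain j where "j \<in> {1..m}" "x j = 0"
      using tx(2) by (auto simp: simplex_horn_def)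
    then have "(1 - t) * base_vertex j + t * x j = 0"
      by (auto simp: base_vertex_def)
    then show ?thesis
      using tx \<open>j \<in> {1..m}\<close> convex_standard_simplex[OF base_vertex_simplex, of x m t]
      unfolding simplex_horn_def by auto
  qed
  moreover have "simplex_horn m \<subseteq> standard_simplex m"
    by (auto simp: simplex_horn_def)
  ultimately show ?thesis
    using star_contraction_contractible[OF star_contraction_standard[of base_vertex "simplex_horn m"]]
    by (simp add: subtopology_subtopology inf.absorb2)
qed

text \<open>Central projection from \<open>base_vertex\<close> onto the facet with index 0, read in
  the coordinates of the simplex of one dimension less.\<close>

definition face_retraction :: "(nat \<Rightarrow> real) \<Rightarrow> nat \<Rightarrow> real" where
  "face_retraction x i = x (Suc i) / (1 - x 0)"

lemma simplex_sum_Suc: "x \<in> standard_simplex (Suc m) \<Longrightarrow> x 0 + (\<Sum>i\<le>m. x (Suc i)) = 1"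
  by (simp add: standard_simplex_def sum.atMost_Suc_shift del: sum.atMost_Suc)

lemma standard_simplex_first_eq_1:
  assumes "x \<in> standard_simplex (Suc m)" "x 0 = 1"
  shows "x = base_vertex"
proof -
  have "(\<Sum>i\<le>m. x (Suc i)) = 0"
    using simplex_sum_Suc[OF assms(1)] assms(2) by simp
  moreover have nn: "x i \<ge> 0" for i
    using assms(1) by (auto simp: standard_simplex_def)
  ultimately have "x (Suc i) = 0" if "i \<le> m" for i
    using that by (subst (asm) sum_nonneg_eq_0_iff) auto
  moreover have "x (Suc i) = 0" if "\<not> i \<le> m" for i
    using assms(1) that by (auto simp: standard_simplex_def)
  ultimately have "x (Suc i) = 0" for i
    by blast
  then show ?thesis
    using assms(2) by (auto simp: base_vertex_def fun_eq_iff gr0_conv_Suc)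
qed

lemma simplical_face_0: "simplical_face 0 x = (\<lambda>i. if i = 0 then 0 else x (i - 1))"
  by (auto simp: simplical_face_def fun_eq_iff)

lemma face_retraction_simplex:
  assumes x: "x \<in> standard_simplex (Suc m)" "x \<noteq> base_vertex"
  shows "face_retraction x \<in> standard_simplex m" "x 0 < 1"
proof -
  have le: "0 \<le> x i \<and> x i \<le> 1" for i
    using x by (auto simp: standard_simplex_def)
  show lt: "x 0 < 1"
    using le[of 0] standard_simplex_first_eq_1[OF x(1)] x(2) by force
  have nn: "face_retraction x i \<ge> 0" for i
    using le lt by (simp add: face_retraction_def)
  have "(\<Sum>i\<le>m. face_retraction x i) = (\<Sum>i\<le>m. x (Suc i)) / (1 - x 0)"
    by (simp add: face_retraction_def sum_divide_distrib)
  moreover have "(\<Sum>i\<le>m. x (Suc i)) = 1 - x 0"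
    using simplex_sum_Suc[OF x(1)] by simp
  ultimately have sum: "(\<Sum>i\<le>m. face_retraction x i) = 1"
    using lt by simp
  have out: "face_retraction x i = 0" if "i > m" for i
    using x that by (simp add: face_retraction_def standard_simplex_def)
  have "face_retraction x i \<le> 1" for i
  proof (cases "i \<le> m")
    case True
    then show ?thesis
      using member_le_sum[of i "{..m}" "face_retraction x"] nn sum by simp
  qed (simp add: out)
  then show "face_retraction x \<in> standard_simplex m"
    using nn sum out by (simp add: standard_simplex_def)
qed

text \<open>The boundary without the vertex opposite to the facet 0 is contracted onto that facet by
  rescaling.\<close>

lemma facet_iso:
  fixes m :: nat
  defines "Y \<equiv> subtopology (simplex_space (Suc m)) (simplex_boundary (Suc m) - {base_vertex})"
  shows "hom_induced p (simplex_space m) (simplex_boundary m) Y (simplex_horn (Suc m) - {base_vertex}) (simplical_face 0) \<in>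
    iso (relative_homology_group p (simplex_space m) (simplex_boundary m)) (relative_homology_group p Y (simplex_horn (Suc m) - {base_vertex}))"
proof -
  let ?H = "simplex_horn (Suc m) - {base_vertex}"
  let ?D = "simplex_boundary (Suc m) - {base_vertex}"
  have DS: "?D \<subseteq> standard_simplex (Suc m)"
    by (auto simp: simplex_boundary_def)
  have Y: "Y = subtopology (powertop_real UNIV) ?D"
    unfolding Y_def using DS by (simp add: subtopology_subtopology inf.absorb2)
  have tY: "topspace Y = ?D"
    by (simp add: Y)
  have face: "simplical_face 0 x \<in> ?D" if "x \<in> standard_simplex m" for x :: "nat \<Rightarrow> real"
  proof -
    have "simplical_face 0 x \<in> standard_simplex (Suc m)"
      using simplical_face_in_standard_simplex[of "Suc m" 0 x] that by simp
    then show ?thesis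
      by (auto simp: simplex_boundary_def simplical_face_0 base_vertex_def fun_eq_iff)
  qed
  have "continuous_map (powertop_real UNIV) (powertop_real UNIV) (simplical_face 0 :: (nat \<Rightarrow> real) \<Rightarrow> _)"
    unfolding continuous_map_componentwise_UNIV simplical_face_0
    by (auto intro: continuous_map_product_projection)
  then have c1: "continuous_map (simplex_space m) Y (simplical_face 0)"
    using face by (auto simp: Y continuous_map_in_subtopology intro: continuous_map_from_subtopology)
  have facial: "simplical_face 0 \<in> simplex_boundary m \<rightarrow> ?H"
  proof
    fix x assume x: "x \<in> simplex_boundary m"
    then obtain i where "i \<le> m" "x i = 0"
      by (auto simp: simplex_boundary_def)
    then have "simplical_face 0 x (Suc i) = 0" "Suc i \<in> {1..Suc m}"
      by (auto simp: simplical_face_0)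
    then show "simplical_face 0 x \<in> ?H"
      using face[of x] x by (auto simp: simplex_boundary_def simplex_horn_def)
  qed
  have retr: "face_retraction x \<in> standard_simplex m" "x 0 < 1" if "x \<in> ?D" for x
    using face_retraction_simplex[of x m] that by (auto simp: simplex_boundary_def)
  have proj: "continuous_map Y euclideanreal (\<lambda>x. x i)" for i
    unfolding Y by (intro continuous_map_from_subtopology continuous_map_product_projection) auto
  have "continuous_map Y (powertop_real UNIV) face_retraction"
    unfolding continuous_map_componentwise_UNIV face_retraction_def[abs_def]
    using proj retr(2) unfolding tY[symmetric] by (fastforce intro!: continuous_map_real_divide continuous_intros)
  then have c2: "continuous_map Y (simplex_space m) face_retraction"
    using retr(1) by (auto simp: continuous_map_in_subtopology tY)
  have retr_horn: "face_retraction \<in> ?H \<rightarrow> simplex_boundary m"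
  proof
    fix x assume x: "x \<in> ?H"
    then have "x \<in> ?D"
      by (auto simp: simplex_horn_def simplex_boundary_def)
    moreover obtain i where "i \<in> {1..Suc m}" "x i = 0"
      using x by (auto simp: simplex_horn_def)
    then have "face_retraction x (i - 1) = 0" "i - 1 \<le> m"
      by (auto simp: face_retraction_def)
    ultimately show "face_retraction x \<in> simplex_boundary m"
      using retr by (auto simp: simplex_boundary_def)
  qed
  have fr: "face_retraction (simplical_face 0 x) = x" for x
    by (simp add: face_retraction_def simplical_face_0 fun_eq_iff)
  have h1: "homotopic_with (\<lambda>h. h \<in> simplex_boundary m \<rightarrow> simplex_boundary m) (simplex_space m) (simplex_space m) (face_retraction \<circ> simplical_face 0) id"
    by (rule homotopic_with_equal) (auto simp: fr intro: continuous_map_compose[OF c1 c2])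
  \<comment> \<open>The projection rescales the later coordinates and kills the first, so zeros
    persist along the segment. This keeps both the boundary and the horn invariant.\<close>
  have lin0: "(1 - t) * simplical_face 0 (face_retraction x) i + t * x i = 0" if "x i = 0" for x t and i :: nat
    using that by (auto simp: simplical_face_0 face_retraction_def)
  have mem: "(\<lambda>i. (1 - t) * simplical_face 0 (face_retraction x) i + t * x i) \<in> ?D" if t: "t \<in> {0..1}" and x: "x \<in> ?D" for t x
  proof -
    let ?z = "\<lambda>i. (1 - t) * simplical_face 0 (face_retraction x) i + t * x i"
    have S: "?z \<in> standard_simplex (Suc m)"
      using face[OF retr(1)[OF x]] x t DS by (intro convex_standard_simplex) auto
    obtain i where i: "i \<le> Suc m" "x i = 0"
      using x by (auto simp: simplex_boundary_def)
    have "?z i = 0"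
      by (rule lin0[where x = x and i = i, OF i(2)])
    then have B: "?z \<in> simplex_boundary (Suc m)"
      using S i(1) by (auto simp: simplex_boundary_def)
    \<comment> \<open>The first coordinate stays below 1, so the segment avoids the removed
      vertex.\<close>
    have "?z 0 = t * x 0"
      by (simp add: simplical_face_0)
    moreover have "0 \<le> x 0"
      using x DS by (auto simp: standard_simplex_def)
    ultimately have "?z 0 < 1"
      using retr(2)[OF x] t mult_right_le_one_le[of "x 0" t] by (auto simp: mult.commute)
    then have "?z \<noteq> base_vertex"
      by (metis base_vertex_def less_irrefl)
    then show ?thesis
      using B by simp
  qed
  have h2: "homotopic_with (\<lambda>k. k \<in> ?H \<rightarrow> ?H) Y Y (simplical_face 0 \<circ> face_retraction) id"
  proof (rule homotopic_with_linear[OF continuous_map_compose[OF c2 c1] continuous_map_id Y])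
    fix t :: real assume t: "t \<in> {0..1}"
    show "(\<lambda>i. (1 - t) * (simplical_face 0 \<circ> face_retraction) x i + t * id x i) \<in> ?D" if "x \<in> topspace Y" for x
      using mem[OF t] that by (simp add: tY)
    show "(\<lambda>x i. (1 - t) * (simplical_face 0 \<circ> face_retraction) x i + t * id x i) \<in> ?H \<rightarrow> ?H"
    proof
      fix x assume x: "x \<in> ?H"
      then have "x \<in> ?D"
        by (auto simp: simplex_horn_def simplex_boundary_def)
      note m = mem[OF t this]
      obtain i where i: "i \<in> {1..Suc m}" "x i = 0"
        using x by (auto simp: simplex_horn_def)
      show "(\<lambda>i. (1 - t) * (simplical_face 0 \<circ> face_retraction) x i + t * id x i) \<in> ?H"
        using m lin0[where x = x and i = i and t = t, OF i(2)] i(1) unfolding simplex_horn_def simplex_boundary_def by (auto intro!: bexI[of _ i])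
    qed
  next
    fix h k :: "(nat \<Rightarrow> real) \<Rightarrow> nat \<Rightarrow> real"
    assume "\<And>x. x \<in> topspace Y \<Longrightarrow> h x = k x"
    moreover have "?H \<subseteq> topspace Y"
      by (auto simp: tY simplex_horn_def simplex_boundary_def)
    ultimately show "(h \<in> ?H \<rightarrow> ?H) = (k \<in> ?H \<rightarrow> ?H)"
      by (auto simp: Pi_iff subset_iff)
  qed
  show ?thesis
    by (rule homotopy_equivalence_relative_homology_group_isomorphism[OF c1 facial c2 retr_horn h1 h2])
qed

text \<open>A boundary point with positive first coordinate must have a later coordinate equal to 0.
  So near \<open>base_vertex\<close> the boundary coincides with the horn, and this closed point
  lies in the interior of the horn relative to the boundary.\<close>

lemma boundary_horn_excision:
  "hom_induced p (subtopology (simplex_space (Suc m)) (simplex_boundary (Suc m) - {base_vertex})) (simplex_horn (Suc m) - {base_vertex})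
     (subtopology (simplex_space (Suc m)) (simplex_boundary (Suc m))) (simplex_horn (Suc m)) id \<in>
   iso (relative_homology_group p (subtopology (simplex_space (Suc m)) (simplex_boundary (Suc m) - {base_vertex})) (simplex_horn (Suc m) - {base_vertex}))
     (relative_homology_group p (subtopology (simplex_space (Suc m)) (simplex_boundary (Suc m))) (simplex_horn (Suc m)))"
proof -
  let ?B = "simplex_boundary (Suc m)" and ?H = "simplex_horn (Suc m)"
  let ?K = "subtopology (simplex_space (Suc m)) ?B"
  have BS: "?B \<subseteq> standard_simplex (Suc m)"
    by (auto simp: simplex_boundary_def)
  then have tK: "topspace ?K = ?B"
    by auto
  have proj: "continuous_map ?K euclideanreal (\<lambda>x. x 0)"
    by (intro continuous_map_from_subtopology continuous_map_product_projection) auto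
  have "openin ?K {x \<in> topspace ?K. x 0 \<in> {0<..}}"
    by (rule openin_continuous_map_preimage[OF proj]) auto
  moreover have "{x \<in> topspace ?K. x 0 \<in> {0<..}} \<subseteq> ?H"
  proof
    fix x assume x: "x \<in> {x \<in> topspace ?K. x 0 \<in> {0<..}}"
    then obtain i where i: "x \<in> standard_simplex (Suc m)" "i \<le> Suc m" "x i = 0"
      unfolding tK by (auto simp: simplex_boundary_def)
    moreover from this x have "i \<noteq> 0"
      by (metis (no_types, lifting) greaterThan_iff less_irrefl mem_Collect_eq)
    ultimately show "x \<in> ?H"
      by (auto simp: simplex_horn_def intro!: bexI[of _ i])
  qed
  ultimately have int: "{x \<in> topspace ?K. x 0 \<in> {0<..}} \<subseteq> ?K interior_of ?H"
    by (intro interior_of_maximal)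
  have bv: "base_vertex \<in> ?B" "base_vertex 0 = 1"
    using base_vertex_simplex[of "Suc m"] by (auto simp: simplex_boundary_def base_vertex_def intro!: exI[of _ 1])
  have "closedin ?K {x \<in> topspace ?K. x 0 \<in> {1}}"
    by (rule closedin_continuous_map_preimage[OF proj]) auto
  then have "?K closure_of {base_vertex} \<subseteq> {x \<in> topspace ?K. x 0 \<in> {1}}"
    using bv unfolding tK by (intro closure_of_minimal) auto
  also have "\<dots> \<subseteq> {base_vertex}"
    unfolding tK using BS standard_simplex_first_eq_1 by auto
  also have "\<dots> \<subseteq> ?K interior_of ?H"
    using int bv unfolding tK by auto
  finally have "?K closure_of {base_vertex} \<subseteq> ?K interior_of ?H" .
  moreover have HB: "?H \<subseteq> ?B"
    by (auto simp: simplex_horn_def simplex_boundary_def)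
  ultimately have "hom_induced p (subtopology ?K (?B - {base_vertex})) (?H - {base_vertex}) (subtopology ?K ?B) ?H id \<in>
     iso (relative_homology_group p (subtopology ?K (?B - {base_vertex})) (?H - {base_vertex})) (relative_homology_group p (subtopology ?K ?B) ?H)"
    by (rule homology_excision_axiom)
  moreover have "subtopology ?K (?B - {base_vertex}) = subtopology (simplex_space (Suc m)) (?B - {base_vertex})"
    using subtopology_subtopology[of "simplex_space (Suc m)" ?B "?B - {base_vertex}"]
    by (metis Diff_subset inf.absorb2)
  moreover have "subtopology ?K ?B = ?K"
    by (metis subtopology_subtopology inf.idem)
  ultimately show ?thesis
    by (simp only:)
qed

text \<open>The integral homology of the pair is infinite cyclic on the class of \<open>g\<close> in
  degree \<open>m\<close> and zero elsewhere, spelled out on chains.\<close>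

definition simplex_pair :: "nat \<Rightarrow> 'x topology \<Rightarrow> 'x set \<Rightarrow> ((nat \<Rightarrow> real) \<Rightarrow> 'x) \<Rightarrow> bool" where
  "simplex_pair m X A g \<longleftrightarrow> singular_relcycle m X A (frag_of g) \<and>
     (\<forall>c. singular_relcycle m X A c \<longrightarrow> (\<exists>n. singular_relboundary m X A (c - frag_cmul n (frag_of g)))) \<and>
     (\<forall>p c. p \<noteq> m \<longrightarrow> singular_relcycle p X A c \<longrightarrow> singular_relboundary p X A c) \<and>
     (\<forall>n. singular_relboundary m X A (frag_cmul n (frag_of g)) \<longrightarrow> n = 0)"

lemma simplex_pair_relcycle: "simplex_pair m X A g \<Longrightarrow> singular_relcycle m X A (frag_of g)"
  and simplex_pair_generates: "simplex_pair m X A g \<Longrightarrow> singular_relcycle m X A c \<Longrightarrow>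
     \<exists>n. singular_relboundary m X A (c - frag_cmul n (frag_of g))"
  and simplex_pair_vanishes: "simplex_pair m X A g \<Longrightarrow> p \<noteq> m \<Longrightarrow> singular_relcycle p X A c \<Longrightarrow> singular_relboundary p X A c"
  and simplex_pair_independent: "simplex_pair m X A g \<Longrightarrow> singular_relboundary m X A (frag_cmul n (frag_of g)) \<Longrightarrow> n = 0"
  unfolding simplex_pair_def by simp_all

text \<open>Surjectivity of the isomorphism carries over generation and vanishing, injectivity
  carries over independence.\<close>

lemma simplex_pair_transfer:
  assumes g: "simplex_pair m X A g" and f: "continuous_map X Y f" "f \<in> A \<rightarrow> B"
    and iso: "\<And>p. hom_induced (int p) X A Y B f \<in> iso (relative_homology_group (int p) X A) (relative_homology_group (int p) Y B)"
  shows "simplex_pair m Y B (simplex_map m f g)"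
  unfolding simplex_pair_def
proof (intro conjI allI impI)
  have gc: "singular_relcycle m X A (frag_of g)"
    using g by (simp add: simplex_pair_def)
  show "singular_relcycle m Y B (frag_of (simplex_map m f g))"
    using singular_relcycle_chain_map[OF gc f] by simp
  show "\<exists>n. singular_relboundary m Y B (c' - frag_cmul n (frag_of (simplex_map m f g)))" if c': "singular_relcycle m Y B c'" for c'
  proof -
    obtain c where c: "singular_relcycle m X A c" "homologous_rel m Y B (chain_map m f c) c'"
      by (rule hom_induced_iso_surjective[OF iso f c'])
    obtain n where n: "singular_relboundary m X A (c - frag_cmul n (frag_of g))"
      using simplex_pair_generates[OF g c(1)] by (rule exE)
    have 1: "singular_relboundary m Y B (chain_map m f c - frag_cmul n (frag_of (simplex_map m f g)))"
      using singular_relboundary_chain_map[OF n f] by (simp add: chain_map_diff)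
    have 2: "singular_relboundary m Y B (c' - chain_map m f c)"
      using iffD1[OF homologous_rel_sym c(2)] by (simp only: homologous_rel_def)
    have "(c' - chain_map m f c) + (chain_map m f c - e) = c' - e" for e
      by (rule poly_mapping_eqI) (simp add: lookup_add lookup_minus)
    then show ?thesis
      using singular_relboundary_add[OF 2 1] by (intro exI[of _ n]) (simp only:)
  qed
  show "singular_relboundary p Y B c'" if p: "p \<noteq> m" and c': "singular_relcycle p Y B c'" for p c'
  proof -
    obtain c where c: "singular_relcycle p X A c" "homologous_rel p Y B (chain_map p f c) c'"
      by (rule hom_induced_iso_surjective[OF iso f c'])
    have "singular_relboundary p X A c"
      by (rule simplex_pair_vanishes[OF g p c(1)])
    then have 1: "singular_relboundary p Y B (chain_map p f c)"
      using f by (rule singular_relboundary_chain_map)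
    have 2: "singular_relboundary p Y B (c' - chain_map p f c)"
      using iffD1[OF homologous_rel_sym c(2)] by (simp only: homologous_rel_def)
    show ?thesis
      using singular_relboundary_add[OF 2 1] by simp
  qed
  show "n = 0" if n: "singular_relboundary m Y B (frag_cmul n (frag_of (simplex_map m f g)))" for n
  proof -
    have "singular_relboundary m Y B (chain_map m f (frag_cmul n (frag_of g)))"
      using n by simp
    then have "singular_relboundary m X A (frag_cmul n (frag_of g))"
      by (rule hom_induced_iso_injective[OF iso f singular_relcycle_cmul[OF gc]])
    then show ?thesis
      by (rule simplex_pair_independent[OF g])
  qed
qed

lemma simplex_pair_0: "simplex_pair 0 (simplex_space 0) (simplex_boundary 0) (top_simplex 0)"
proof -
  have t: "topspace (simplex_space 0) = {base_vertex}"
    by (simp add: standard_simplex_0 base_vertex_def)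
  have b: "simplex_boundary 0 = {}"
    by (auto simp: simplex_boundary_def standard_simplex_0)
  have top: "restrict (\<lambda>x. base_vertex) (standard_simplex 0) = top_simplex 0"
    using singular_simplex_singleton[OF t, of 0 "top_simplex 0"] by simp
  have tc: "singular_chain 0 (simplex_space 0) (frag_of (top_simplex 0))"
    by (simp add: singular_chain_of)
  show ?thesis
    unfolding simplex_pair_def b
  proof (intro conjI allI impI)
    show "singular_relcycle 0 (simplex_space 0) {} (frag_of (top_simplex 0))"
      using tc by (simp add: singular_cycle chain_boundary_def)
    show "\<exists>n. singular_relboundary 0 (simplex_space 0) {} (c - frag_cmul n (frag_of (top_simplex 0)))"
      if "singular_relcycle 0 (simplex_space 0) {} c" for c
    proof -
      have "singular_chain 0 (simplex_space 0) c"
        using that by (simp add: singular_relcycle)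
      then obtain n where "c = frag_cmul n (frag_of (top_simplex 0))"
        using singular_chain_singleton[OF t, of 0 c] top by auto
      then show ?thesis
        by (intro exI[of _ n]) simp
    qed
    show "singular_relboundary p (simplex_space 0) {} c" if "p \<noteq> 0" "singular_relcycle p (simplex_space 0) {} c" for p c
      using singular_boundary_eq_cycle_singleton[OF t, of p c] that by simp
    show "n = 0" if n: "singular_relboundary 0 (simplex_space 0) {} (frag_cmul n (frag_of (top_simplex 0)))" for n
    proof -
      obtain d where d: "singular_chain 1 (simplex_space 0) d" "chain_boundary 1 d = frag_cmul n (frag_of (top_simplex 0))"
        using n by (auto simp: singular_boundary)
      have "chain_boundary 1 d = 0"
        using chain_boundary_of_singleton[OF t d(1)] by simp
      then show ?thesis
        using d(2) by simp
    qed
  qed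
qed

lemma singular_face_top_simplex:
  assumes "k \<le> Suc m"
  shows "singular_simplex m (subtopology (simplex_space (Suc m)) (simplex_boundary (Suc m))) (singular_face (Suc m) k (top_simplex (Suc m)))"
    "0 < k \<Longrightarrow> singular_face (Suc m) k (top_simplex (Suc m)) ` standard_simplex m \<subseteq> simplex_horn (Suc m)"
proof -
  let ?f = "singular_face (Suc m) k (top_simplex (Suc m))"
  have face: "simplical_face k x \<in> standard_simplex (Suc m)" if "x \<in> standard_simplex m" for x :: "nat \<Rightarrow> real"
    using simplical_face_in_standard_simplex[of "Suc m" k x] that assms by simp
  have eq: "?f x = simplical_face k x" if "x \<in> standard_simplex m" for x
    using face[OF that] that by (simp add: singular_face_def top_simplex_def)
  have z: "simplical_face k x k = 0" for x :: "nat \<Rightarrow> real"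
    by (simp add: simplical_face_def)
  have "?f ` standard_simplex m \<subseteq> simplex_boundary (Suc m)"
    using eq face z assms by (auto simp: simplex_boundary_def)
  moreover have "singular_simplex m (simplex_space (Suc m)) ?f"
    using singular_simplex_singular_face[OF singular_simplex_top_simplex, of "Suc m" k] assms by simp
  ultimately show "singular_simplex m (subtopology (simplex_space (Suc m)) (simplex_boundary (Suc m))) ?f"
    by (simp only: singular_simplex_subtopology[of m "simplex_space (Suc m)"])
  show "?f ` standard_simplex m \<subseteq> simplex_horn (Suc m)" if "0 < k"
    using eq face z assms that by (auto simp: simplex_horn_def intro!: bexI[of _ k])
qed

text \<open>Simplex and horn are contractible, so the connecting map of the triple simplex,
  boundary, horn is an isomorphism. Excising \<open>base_vertex\<close> and projecting identify its
  target with the homology of the pair one dimension lower. The boundary of the top simplex is,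
  modulo the horn, its facet 0 with sign \<open>+1\<close>, so generators correspond.\<close>

lemma simplex_pair_step:
  assumes "simplex_pair m (simplex_space m) (simplex_boundary m) (top_simplex m)"
  shows "simplex_pair (Suc m) (simplex_space (Suc m)) (simplex_boundary (Suc m)) (top_simplex (Suc m))"
proof -
  let ?X = "simplex_space (Suc m)" and ?S = "simplex_boundary (Suc m)" and ?H = "simplex_horn (Suc m)"
  let ?K = "subtopology ?X ?S" and ?Y = "subtopology (simplex_space (Suc m)) (simplex_boundary (Suc m) - {base_vertex})"
  let ?t = "top_simplex (Suc m)"
  let ?f0 = "singular_face (Suc m) 0 ?t"
  have HS: "?H \<subseteq> ?S"
    by (auto simp: simplex_horn_def simplex_boundary_def)
  have fm: "simplical_face 0 x \<in> standard_simplex (Suc m) \<and> simplical_face 0 x \<in> ?S - {base_vertex}" if "x \<in> standard_simplex m" for x :: "nat \<Rightarrow> real"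
  proof -
    have "simplical_face 0 x \<in> standard_simplex (Suc m)"
      using simplical_face_in_standard_simplex[of "Suc m" 0 x] that by simp
    moreover have "simplical_face 0 x 0 = 0"
      by (simp add: simplical_face_def)
    ultimately show ?thesis
      by (auto simp: simplex_boundary_def base_vertex_def dest: fun_cong[of _ _ 0])
  qed
  have cY: "continuous_map (simplex_space m) ?Y (simplical_face 0)"
  proof -
    have "continuous_map (powertop_real UNIV) (powertop_real UNIV) (simplical_face 0 :: (nat \<Rightarrow> real) \<Rightarrow> _)"
      unfolding continuous_map_componentwise_UNIV simplical_face_0
      by (auto intro: continuous_map_product_projection)
    then show ?thesis
      using fm by (auto simp: continuous_map_in_subtopology intro: continuous_map_from_subtopology)
  qed
  have bY: "simplical_face 0 \<in> simplex_boundary m \<rightarrow> ?H - {base_vertex}"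
  proof
    fix x assume x: "x \<in> simplex_boundary m"
    then obtain i where "i \<le> m" "x i = 0"
      by (auto simp: simplex_boundary_def)
    then have "simplical_face 0 x (Suc i) = 0" "Suc i \<in> {1..Suc m}"
      by (auto simp: simplical_face_0)
    then show "simplical_face 0 x \<in> ?H - {base_vertex}"
      using fm[of x] x by (auto simp: simplex_boundary_def simplex_horn_def)
  qed
  have "simplex_pair m ?Y (?H - {base_vertex}) (simplex_map m (simplical_face 0) (top_simplex m))"
    by (rule simplex_pair_transfer[OF assms cY bY facet_iso])
  moreover have "continuous_map ?Y ?K id" "id \<in> (?H - {base_vertex}) \<rightarrow> ?H"
    by (auto simp: continuous_map_in_subtopology intro!: continuous_map_from_subtopology)
  ultimately have "simplex_pair m ?K ?H (simplex_map m id (simplex_map m (simplical_face 0) (top_simplex m)))"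
    using simplex_pair_transfer[OF _ _ _ boundary_horn_excision] by blast
  moreover have "simplex_map m id (simplex_map m (simplical_face 0) (top_simplex m)) = ?f0"
    using fm by (auto simp: simplex_map_def singular_face_def top_simplex_def fun_eq_iff)
  ultimately have K: "simplex_pair m ?K ?H ?f0"
    by simp
  \<comment> \<open>All facets but the one with index 0, which lie in the horn.\<close>
  define rest where "rest = (\<Sum>k\<le>m. frag_cmul ((-1) ^ Suc k) (frag_of (singular_face (Suc m) (Suc k) ?t)))"
  have dt: "chain_boundary (Suc m) (frag_of ?t) = frag_of ?f0 + rest"
    unfolding chain_boundary_of rest_def by (simp add: sum.atMost_Suc_shift del: sum.atMost_Suc)
  have rest: "singular_chain m (subtopology ?K ?H) rest"
    unfolding rest_def
  proof (intro singular_chain_sum singular_chain_cmul)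
    fix k assume "k \<in> {..m}"
    then show "singular_chain m (subtopology ?K ?H) (frag_of (singular_face (Suc m) (Suc k) ?t))"
      using singular_face_top_simplex[of "Suc k" m]
      by (simp add: singular_chain_of singular_simplex_subtopology[of _ ?K])
  qed
  have dtK: "singular_chain m ?K (chain_boundary (Suc m) (frag_of ?t))"
    unfolding dt using rest singular_face_top_simplex(1)[of 0 m]
    by (intro singular_chain_add) (simp_all add: singular_chain_of singular_chain_subtopology[of _ ?K])
  have tcyc: "singular_relcycle (Suc m) ?X ?S (frag_of ?t)"
    using dtK by (simp add: singular_relcycle singular_chain_of)
  have rel: "singular_relboundary m ?K ?H (frag_cmul n (chain_boundary (Suc m) (frag_of ?t)) - frag_cmul n (frag_of ?f0))" for n
    using singular_relboundary_cmul[OF singular_chain_imp_relboundary[OF rest], of n]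
    by (simp add: dt frag_cmul_distrib2)
  have ne: "topspace ?X \<inter> ?H \<noteq> {}"
  proof -
    have "base_vertex \<in> ?H"
      by (auto simp: simplex_horn_def base_vertex_def intro!: bexI[of _ 1])
    then show ?thesis
      using base_vertex_simplex[of "Suc m"] unfolding topspace_standard_simplex by blast
  qed
  have iso: "hom_relboundary p ?X ?S ?H \<in> iso (relative_homology_group p ?X ?S) (relative_homology_group (p - 1) ?K ?H)" for p
    using contractible_horn[of "Suc m"] by (intro iso_hom_relboundary_contractible contractible_simplex HS ne) simp
  have isoS: "hom_relboundary (int (Suc p)) ?X ?S ?H \<in> iso (relative_homology_group (int (Suc p)) ?X ?S) (relative_homology_group (int p) ?K ?H)" for p
    using iso[of "int (Suc p)"] by simp
  have bd: "singular_relcycle p ?K ?H (chain_boundary (Suc p) c)" if "singular_relcycle (Suc p) ?X ?S c" for p c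
  proof -
    have "singular_chain p ?K (chain_boundary (Suc p) c)" "singular_chain (Suc p) ?X c"
      using that by (simp_all add: singular_relcycle)
    then show ?thesis
      using chain_boundary_boundary_alt[of p ?X c] by (simp add: singular_relcycle)
  qed
  show ?thesis
    unfolding simplex_pair_def
  proof (intro conjI allI impI)
    show "singular_relcycle (Suc m) ?X ?S (frag_of ?t)"
      by (rule tcyc)
    show "\<exists>n. singular_relboundary (Suc m) ?X ?S (c - frag_cmul n (frag_of ?t))" if c: "singular_relcycle (Suc m) ?X ?S c" for c
    proof -
      obtain n where n: "singular_relboundary m ?K ?H (chain_boundary (Suc m) c - frag_cmul n (frag_of ?f0))"
        using simplex_pair_generates[OF K bd[OF c]] by (rule exE)
      have "singular_relboundary m ?K ?H (chain_boundary (Suc m) (c - frag_cmul n (frag_of ?t)))"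
        using singular_relboundary_diff[OF n rel[of n]] by (simp add: chain_boundary_diff chain_boundary_cmul)
      then have "singular_relboundary (Suc m) ?X ?S (c - frag_cmul n (frag_of ?t))"
        by (rule hom_relboundary_iso_injective[OF isoS HS singular_relcycle_diff[OF c singular_relcycle_cmul[OF tcyc]]])
      then show ?thesis ..
    qed
    show "singular_relboundary p ?X ?S c" if p: "p \<noteq> Suc m" and c: "singular_relcycle p ?X ?S c" for p c
    proof (cases p)
      \<comment> \<open>The connecting map now lands in degree \<open>-1\<close>, where homology is
        trivial, so its injectivity kills the source.\<close>
      case 0
      have inj: "inj_on (hom_relboundary 0 ?X ?S ?H) (carrier (relative_homology_group 0 ?X ?S))"
        and im: "hom_relboundary 0 ?X ?S ?H ` carrier (relative_homology_group 0 ?X ?S) = carrier (relative_homology_group (-1) ?K ?H)"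
        using iso[of 0] by (simp_all add: iso_def bij_betw_def)
      have triv: "carrier (relative_homology_group (-1) ?K ?H) = {\<one>\<^bsub>relative_homology_group (-1) ?K ?H\<^esub>}"
        using trivial_relative_homology_group[of "-1" ?K ?H] by (simp add: trivial_group_def)
      have in0: "homologous_rel_set 0 ?X ?S e \<in> carrier (relative_homology_group 0 ?X ?S)" if "singular_relcycle 0 ?X ?S e" for e
        unfolding carrier_relative_homology_group_0 using that by (intro imageI) simp
      have z: "singular_relcycle 0 ?X ?S 0"
        by simp
      have c0: "singular_relcycle 0 ?X ?S c"
        using c 0 by simp
      have "hom_relboundary 0 ?X ?S ?H (homologous_rel_set 0 ?X ?S e) = \<one>\<^bsub>relative_homology_group (-1) ?K ?H\<^esub>" if "singular_relcycle 0 ?X ?S e" for e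
        using im triv in0[OF that] by blast
      then have "homologous_rel_set 0 ?X ?S c = homologous_rel_set 0 ?X ?S 0"
        using inj in0[OF c0] in0[OF z] c0 z by (metis inj_onD)
      then have "singular_relboundary 0 ?X ?S c"
        by (subst (asm) homologous_rel_set_eq) (simp add: homologous_rel_def)
      then show ?thesis
        using 0 by simp
    next
      case (Suc q)
      then have c': "singular_relcycle (Suc q) ?X ?S c" and "q \<noteq> m"
        using p c by auto
      then have "singular_relboundary q ?K ?H (chain_boundary (Suc q) c)"
        by (intro simplex_pair_vanishes[OF K] bd)
      then show ?thesis
        unfolding Suc by (rule hom_relboundary_iso_injective[OF isoS HS c'])
    qed
    show "n = 0" if n: "singular_relboundary (Suc m) ?X ?S (frag_cmul n (frag_of ?t))" for n
    proof -
      obtain d e where de: "singular_chain (Suc (Suc m)) ?X d" "singular_chain (Suc m) ?K e"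
        "chain_boundary (Suc (Suc m)) d + e = frag_cmul n (frag_of ?t)"
        using n unfolding singular_relboundary by blast
      \<comment> \<open>The bounding chain \<open>d\<close> disappears after one more boundary; what
        is left comes from \<open>e\<close>, which lies in the boundary of the simplex and so bounds
        there.\<close>
      have "chain_boundary (Suc m) (frag_cmul n (frag_of ?t)) = chain_boundary (Suc m) e"
        unfolding de(3)[symmetric] chain_boundary_add using chain_boundary_boundary_alt[OF de(1)] by simp
      moreover have "singular_relboundary m ?K ?H (chain_boundary (Suc m) e)"
        unfolding singular_relboundary using de(2) by (intro exI[of _ e] exI[of _ 0]) simp
      ultimately have "singular_relboundary m ?K ?H (frag_cmul n (chain_boundary (Suc m) (frag_of ?t)))"
        by (simp add: chain_boundary_cmul)
      from singular_relboundary_diff[OF this rel[of n]]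
      have "singular_relboundary m ?K ?H (frag_cmul n (frag_of ?f0))"
        by simp
      then show ?thesis
        by (rule simplex_pair_independent[OF K])
    qed
  qed
qed

theorem simplex_pair_standard: "simplex_pair m (simplex_space m) (simplex_boundary m) (top_simplex m)"
  by (induction m) (simp_all add: simplex_pair_0 simplex_pair_step)

section \<open>From integral to Laurent coefficients\<close>

lemma chain_scale_sum_left: "chain_scale (\<Sum>i\<in>I. f i) a = (\<Sum>i\<in>I. chain_scale (f i) a)"
  by (induction I rule: infinite_finite_induct) (simp_all add: chain_scale_add_left)

text \<open>Over Laurent polynomials: with constant transport, each exponent contributes a copy of the
  integral chain complex.\<close>

definition coeff_chain :: "int \<Rightarrow> 'x tchain \<Rightarrow> 'x chain" where
  "coeff_chain k c = Poly_Mapping.map (\<lambda>r. Poly_Mapping.lookup r k) c"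

lemma lookup_coeff_chain [simp]:
  "Poly_Mapping.lookup (coeff_chain k c) \<sigma> = Poly_Mapping.lookup (Poly_Mapping.lookup c \<sigma>) k"
  by (simp add: coeff_chain_def Poly_Mapping.map.rep_eq when_def)

lemma coeff_chain_add: "coeff_chain k (a + b) = coeff_chain k a + coeff_chain k b"
  by (rule poly_mapping_eqI) (simp add: lookup_add)

lemma coeff_chain_0 [simp]: "coeff_chain k 0 = 0"
  by (rule poly_mapping_eqI) simp

lemma coeff_chain_sum: "coeff_chain k (\<Sum>i\<in>I. f i) = (\<Sum>i\<in>I. coeff_chain k (f i))"
  by (induction I rule: infinite_finite_induct) (simp_all add: coeff_chain_add)

lemma keys_coeff_chain: "Poly_Mapping.keys (coeff_chain k c) \<subseteq> Poly_Mapping.keys c"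
  by (auto simp: in_keys_iff)

lemma lookup_laurent_of_int: "Poly_Mapping.lookup (r * of_int n :: laurent) k = Poly_Mapping.lookup r k * n"
proof (induction n rule: int_induct[of _ 0])
  case (step1 i)
  then show ?case
    by (simp add: distrib_left lookup_add)
next
  case (step2 i)
  then show ?case
    by (simp add: right_diff_distrib lookup_minus)
qed simp

lemma coeff_chain_scale_int: "coeff_chain k (chain_scale r (int_chain a)) = frag_cmul (Poly_Mapping.lookup r k) a"
  by (rule poly_mapping_eqI) (simp add: lookup_laurent_of_int)

lemma face_sum_trivial: "face_sum (\<lambda>_. 1) p \<sigma> = int_chain (chain_boundary p (frag_of \<sigma>))"
  by (simp add: int_chain_boundary twisted_boundary_lextend)

lemma coeff_chain_boundary: "coeff_chain k (twisted_boundary (\<lambda>_. 1) p c) = chain_boundary p (coeff_chain k c)"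
proof -
  have "frag_extend (\<lambda>\<sigma>. chain_boundary p (frag_of \<sigma>)) (coeff_chain k c) =
      (\<Sum>\<sigma>\<in>Poly_Mapping.keys c. frag_cmul (Poly_Mapping.lookup (coeff_chain k c) \<sigma>) (chain_boundary p (frag_of \<sigma>)))"
    unfolding frag_extend_def by (rule sum.mono_neutral_left) (auto simp: keys_coeff_chain in_keys_iff)
  then have "coeff_chain k (twisted_boundary (\<lambda>_. 1) p c) = frag_extend (\<lambda>\<sigma>. chain_boundary p (frag_of \<sigma>)) (coeff_chain k c)"
    by (simp add: twisted_boundary_lextend lextend_def coeff_chain_sum face_sum_trivial coeff_chain_scale_int)
  also have "\<dots> = chain_boundary p (frag_extend frag_of (coeff_chain k c))"
    by (simp add: chain_boundary_extend)
  also have "frag_extend frag_of (coeff_chain k c) = coeff_chain k c"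
    by (rule frag_expansion[symmetric])
  finally show ?thesis .
qed

lemma coeff_chain_chains: "c \<in> twisted_chains p X \<Longrightarrow> singular_chain p X (coeff_chain k c)"
  using keys_coeff_chain[of k c] by (auto simp: twisted_chains_iff singular_chain_def)

definition chain_exponents :: "'x tchain \<Rightarrow> int set" where
  "chain_exponents c = (\<Union>\<sigma>\<in>Poly_Mapping.keys c. Poly_Mapping.keys (Poly_Mapping.lookup c \<sigma>))"

lemma finite_chain_exponents: "finite (chain_exponents c)"
  by (simp add: chain_exponents_def)

lemma q_half_pow_of_int: "q_half_pow k * of_int n = Poly_Mapping.single k n"
  by (rule poly_mapping_eqI) (simp add: lookup_laurent_of_int q_half_pow_def lookup_single when_def)

lemma chain_exponent_expansion:
  "c = (\<Sum>k\<in>chain_exponents c. chain_scale (q_half_pow k) (int_chain (coeff_chain k c)))"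
proof (rule poly_mapping_eqI, rule poly_mapping_eqI)
  fix \<sigma> j
  have "Poly_Mapping.lookup (Poly_Mapping.lookup (\<Sum>k\<in>chain_exponents c. chain_scale (q_half_pow k) (int_chain (coeff_chain k c))) \<sigma>) j =
      (\<Sum>k\<in>chain_exponents c. if k = j then Poly_Mapping.lookup (Poly_Mapping.lookup c \<sigma>) j else 0)"
    by (auto simp: lookup_sum q_half_pow_of_int lookup_single when_def intro!: sum.cong)
  also have "\<dots> = (if j \<in> chain_exponents c then Poly_Mapping.lookup (Poly_Mapping.lookup c \<sigma>) j else 0)"
    by (simp add: finite_chain_exponents)
  also have "\<dots> = Poly_Mapping.lookup (Poly_Mapping.lookup c \<sigma>) j"
    by (force simp: chain_exponents_def in_keys_iff)
  finally show "Poly_Mapping.lookup (Poly_Mapping.lookup c \<sigma>) j =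
      Poly_Mapping.lookup (Poly_Mapping.lookup (\<Sum>k\<in>chain_exponents c. chain_scale (q_half_pow k) (int_chain (coeff_chain k c))) \<sigma>) j"
    by simp
qed

lemma coeff_chain_relcycle:
  "c \<in> twisted_relcycles (\<lambda>_. 1) p X A \<Longrightarrow> singular_relcycle p X A (coeff_chain k c)"
  using coeff_chain_chains[of _ "p - 1" "subtopology X A" k]
  by (auto simp: twisted_relcycles_def singular_relcycle coeff_chain_chains simp flip: coeff_chain_boundary)

lemma int_chain_relboundary:
  assumes "singular_relboundary p X A c"
  shows "int_chain c \<in> twisted_relboundaries (\<lambda>_. 1) p X A"
proof -
  obtain d e where "singular_chain (Suc p) X d" "singular_chain p (subtopology X A) e" "chain_boundary (Suc p) d + e = c"
    using assms unfolding singular_relboundary by blast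
  then show ?thesis
    by (intro twisted_relboundariesI[of "int_chain d" _ _ "int_chain e"])
      (auto simp: int_chain_chains int_chain_add int_chain_boundary)
qed

lemma coeff_chain_relboundary:
  assumes "c \<in> twisted_relboundaries (\<lambda>_. 1) p X A"
  shows "singular_relboundary p X A (coeff_chain k c)"
proof -
  obtain e a where "e \<in> twisted_chains (Suc p) X" "a \<in> twisted_chains p (subtopology X A)"
    "c = twisted_boundary (\<lambda>_. 1) (Suc p) e + a"
    using assms by (rule twisted_relboundariesE)
  then show ?thesis
    unfolding singular_relboundary
    by (intro exI[of _ "coeff_chain k e"] exI[of _ "coeff_chain k a"])
      (auto simp: coeff_chain_chains coeff_chain_add coeff_chain_boundary)
qed

text \<open>The analogue of \<open>simplex_pair\<close> over the Laurent polynomials: homology free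
  of rank one on \<open>z\<close> in degree \<open>m\<close> and zero in the other degrees.\<close>

definition twisted_simplex_pair ::
    "'x transport \<Rightarrow> nat \<Rightarrow> 'x topology \<Rightarrow> 'x set \<Rightarrow> 'x tchain \<Rightarrow> bool" where
  "twisted_simplex_pair T m X A z \<longleftrightarrow> z \<in> twisted_relcycles T m X A \<and>
     (\<forall>c\<in>twisted_relcycles T m X A. \<exists>r. c - chain_scale r z \<in> twisted_relboundaries T m X A) \<and>
     (\<forall>p. p \<noteq> m \<longrightarrow> twisted_relcycles T p X A \<subseteq> twisted_relboundaries T p X A) \<and>
     (\<forall>r. chain_scale r z \<in> twisted_relboundaries T m X A \<longrightarrow> r = 0)"

text \<open>Taking the coefficient of one power commutes with the boundary when transport is
  constant. A chain involves finitely many powers, so the integral statement is applied to each and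
  the results are added up; an independence relation is likewise tested power by power.\<close>

theorem simplex_pair_laurent:
  assumes "simplex_pair m X A g"
  shows "twisted_simplex_pair (\<lambda>_. 1) m X A (Poly_Mapping.single g 1)"
  unfolding twisted_simplex_pair_def
proof (intro conjI allI ballI impI subsetI)
  have gc: "singular_relcycle m X A (frag_of g)"
    using assms by (simp add: simplex_pair_def)
  then show "Poly_Mapping.single g 1 \<in> twisted_relcycles (\<lambda>_. 1) m X A"
    using int_chain_chains[of m X "frag_of g"] int_chain_chains[of "m - 1" "subtopology X A" "chain_boundary m (frag_of g)"]
    by (simp add: twisted_relcycles_def singular_relcycle int_chain_boundary)
next
  fix c assume c: "c \<in> twisted_relcycles (\<lambda>_. 1) m X A"
  have "\<exists>n. singular_relboundary m X A (coeff_chain k c - frag_cmul n (frag_of g))" for k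
    by (rule simplex_pair_generates[OF assms coeff_chain_relcycle[OF c]])
  then obtain n where n: "\<And>k. singular_relboundary m X A (coeff_chain k c - frag_cmul (n k) (frag_of g))"
    by metis
  define r where "r = (\<Sum>k\<in>chain_exponents c. q_half_pow k * of_int (n k))"
  have "chain_scale r (Poly_Mapping.single g 1) =
      (\<Sum>k\<in>chain_exponents c. chain_scale (q_half_pow k) (int_chain (frag_cmul (n k) (frag_of g))))"
    unfolding r_def chain_scale_sum_left by (simp add: int_chain_cmul)
  then have "c - chain_scale r (Poly_Mapping.single g 1) =
      (\<Sum>k\<in>chain_exponents c. chain_scale (q_half_pow k) (int_chain (coeff_chain k c))) -
      (\<Sum>k\<in>chain_exponents c. chain_scale (q_half_pow k) (int_chain (frag_cmul (n k) (frag_of g))))"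
    using chain_exponent_expansion[of c] by (simp only:)
  also have "\<dots> = (\<Sum>k\<in>chain_exponents c. chain_scale (q_half_pow k) (int_chain (coeff_chain k c - frag_cmul (n k) (frag_of g))))"
    unfolding sum_subtractf[symmetric] int_chain_diff chain_scale_diff ..
  also have "\<dots> \<in> twisted_relboundaries (\<lambda>_. 1) m X A"
    by (intro twisted_relboundaries_sum twisted_relboundaries_scale int_chain_relboundary n)
  finally show "\<exists>r. c - chain_scale r (Poly_Mapping.single g 1) \<in> twisted_relboundaries (\<lambda>_. 1) m X A" ..
next
  fix p c assume p: "p \<noteq> m" and c: "c \<in> twisted_relcycles (\<lambda>_. 1) p X A"
  have "singular_relboundary p X A (coeff_chain k c)" for k
    by (rule simplex_pair_vanishes[OF assms p coeff_chain_relcycle[OF c]])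
  then show "c \<in> twisted_relboundaries (\<lambda>_. 1) p X A"
    by (subst chain_exponent_expansion) (intro twisted_relboundaries_sum twisted_relboundaries_scale int_chain_relboundary)
next
  fix r assume r: "chain_scale r (Poly_Mapping.single g 1) \<in> twisted_relboundaries (\<lambda>_. 1) m X A"
  have "Poly_Mapping.lookup r k = 0" for k
  proof -
    have "coeff_chain k (chain_scale r (Poly_Mapping.single g 1)) = frag_cmul (Poly_Mapping.lookup r k) (frag_of g)"
      using coeff_chain_scale_int[of k r "frag_of g"] by simp
    then show ?thesis
      using simplex_pair_independent[OF assms] coeff_chain_relboundary[OF r, of k] by simp
  qed
  then show "r = 0"
    by (intro poly_mapping_eqI) simp
qed

section \<open>The topology of the configuration space\<close>

lemma openin_Collect_all:
  assumes "finite S" "\<And>s. s \<in> S \<Longrightarrow> openin X {x \<in> topspace X. P s x}"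
  shows "openin X {x \<in> topspace X. \<forall>s\<in>S. P s x}"
  using assms
proof (induction S rule: finite_induct)
  case (insert s S)
  have "{x \<in> topspace X. \<forall>s\<in>insert s S. P s x} = {x \<in> topspace X. P s x} \<inter> {x \<in> topspace X. \<forall>s\<in>S. P s x}"
    by auto
  then show ?case
    using insert by auto
qed simp

lemma openin_Collect_ex:
  assumes "\<And>s. s \<in> S \<Longrightarrow> openin X {x \<in> topspace X. P s x}"
  shows "openin X {x \<in> topspace X. \<exists>s\<in>S. P s x}"
proof -
  have "{x \<in> topspace X. \<exists>s\<in>S. P s x} = (\<Union>s\<in>S. {x \<in> topspace X. P s x})"
    by auto
  then show ?thesis
    using assms by auto
qed

text \<open>Products of quotient maps need not be quotient maps, but openness survives taking the
  product with an interval. This allows homotopies of unordered configurations to be checked on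
  ordered ones.\<close>

lemma open_map_prod_id:
  assumes "open_map Y Z q"
  shows "open_map (prod_topology I Y) (prod_topology I Z) (\<lambda>(t, y). (t, q y))"
  unfolding open_map_def
proof (intro allI impI)
  fix W assume W: "openin (prod_topology I Y) W"
  show "openin (prod_topology I Z) ((\<lambda>(t, y). (t, q y)) ` W)"
    unfolding openin_prod_topology_alt
  proof (intro allI impI)
    fix t z assume "(t, z) \<in> (\<lambda>(t, y). (t, q y)) ` W"
    then obtain y where y: "(t, y) \<in> W" "z = q y"
      by auto
    then obtain A B where AB: "openin I A" "openin Y B" "t \<in> A" "y \<in> B" "A \<times> B \<subseteq> W"
      using W[unfolded openin_prod_topology_alt, rule_format, OF y(1)] by metis
    have "openin Z (q ` B)"
      using assms AB(2) unfolding open_map_def by blast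
    moreover have "A \<times> q ` B = (\<lambda>(t, y). (t, q y)) ` (A \<times> B)"
      using image_paired_Times[of "\<lambda>t. t" q A B] by (simp only: image_ident)
    then have "A \<times> q ` B \<subseteq> (\<lambda>(t, y). (t, q y)) ` W"
      using image_mono[OF AB(5), of "\<lambda>(t, y). (t, q y)"] by (simp only:)
    moreover have "z \<in> q ` B"
      using y AB by blast
    ultimately show "\<exists>U V. openin I U \<and> openin Z V \<and> t \<in> U \<and> z \<in> V \<and> U \<times> V \<subseteq> (\<lambda>(t, y). (t, q y)) ` W"
      using AB by blast
  qed
qed

section \<open>Ordered and unordered configurations\<close>

definition config_points :: "nat \<Rightarrow> config \<Rightarrow> complex set" where
  "config_points l Z = (\<Union>i\<in>{1..l}. Z i)"

locale configurations =
  fixes l :: nat and c :: "nat \<Rightarrow> nat"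
begin

abbreviation "lab \<equiv> point_labels l c"
abbreviation "OC \<equiv> ordered_conf l c"
abbreviation "fo \<equiv> forget_order l c"
abbreviation "CX \<equiv> Conf l c"
abbreviation "pts \<equiv> config_points l"

lemma finite_lab: "finite lab"
  by (simp add: point_labels_def)

lemma card_lab: "card lab = coloring_size l c"
  by (simp add: point_labels_def coloring_size_def)

lemma topspace_OC: "topspace OC = {z \<in> Pi\<^sub>E lab (\<lambda>_. square). inj_on z lab}"
  by (auto simp: ordered_conf_def PiE_def)

lemma topspace_CX: "topspace CX = fo ` topspace OC"
  by (simp add: Conf_def topspace_quotient_topology)

lemma quotient_map_fo: "quotient_map OC CX fo"
  unfolding Conf_def by (rule quotient_map_quotient_topology)

lemma continuous_map_fo: "continuous_map OC CX fo"
  using quotient_map_fo by (rule quotient_imp_continuous_map)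

lemma continuous_map_OC_proj: "a \<in> lab \<Longrightarrow> continuous_map OC euclidean (\<lambda>z. z a)"
  unfolding ordered_conf_def by (intro continuous_map_from_subtopology continuous_map_product_projection)

lemma continuous_map_into_OC:
  assumes "\<And>a. a \<in> lab \<Longrightarrow> continuous_map Y euclidean (\<lambda>y. f y a)" "\<And>y. y \<in> topspace Y \<Longrightarrow> f y \<in> topspace OC"
  shows "continuous_map Y OC f"
  unfolding ordered_conf_def continuous_map_in_subtopology continuous_map_componentwise
  using assms by (auto simp: topspace_OC PiE_def)

lemma fo_eq: "fo z i = (\<lambda>k. z (i, k)) ` {k. (i, k) \<in> lab}"
  by (auto simp: forget_order_def)

lemma fo_lessThan: "i \<in> {1..l} \<Longrightarrow> fo z i = (\<lambda>k. z (i, k)) ` {..<c i}"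
  by (auto simp: forget_order_def point_labels_def)

lemma pts_fo: "pts (fo z) = z ` lab"
  by (auto simp: config_points_def fo_eq point_labels_def)

lemma fo_permute:
  assumes \<pi>: "bij_betw \<pi> lab lab" "\<And>a. a \<in> lab \<Longrightarrow> fst (\<pi> a) = fst a"
  shows "fo (restrict (z \<circ> \<pi>) lab) = fo z"
proof
  fix i
  have "{a \<in> lab. fst a = i} = \<pi> ` {a \<in> lab. fst a = i}"
  proof (intro equalityI subsetI)
    fix b assume b: "b \<in> {a \<in> lab. fst a = i}"
    then have "b \<in> \<pi> ` lab"
      using \<pi>(1) by (simp add: bij_betw_def)
    then obtain a where a: "a \<in> lab" "b = \<pi> a"
      by blast
    then show "b \<in> \<pi> ` {a \<in> lab. fst a = i}"
      using b \<pi>(2)[OF a(1)] by auto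
  next
    fix b assume "b \<in> \<pi> ` {a \<in> lab. fst a = i}"
    then show "b \<in> {a \<in> lab. fst a = i}"
      using \<pi> by (auto simp: bij_betw_def)
  qed
  then have "z ` {a \<in> lab. fst a = i} = (z \<circ> \<pi>) ` {a \<in> lab. fst a = i}"
    by (metis image_comp)
  moreover have f: "fo w i = w ` {a \<in> lab. fst a = i}" for w
    by (force simp: fo_eq)
  ultimately show "fo (restrict (z \<circ> \<pi>) lab) i = fo z i"
    unfolding f by (auto simp: image_iff)
qed

text \<open>Each label of \<open>w\<close> is sent to a label of the same color that carries the
  same point in \<open>z\<close>. This is injective because \<open>w\<close> is, and hence a
  permutation of the finite set of labels.\<close>

lemma fo_eqD:
  assumes z: "z \<in> topspace OC" and w: "w \<in> topspace OC" and eq: "fo z = fo w"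
  obtains \<pi> where "bij_betw \<pi> lab lab" "\<And>a. a \<in> lab \<Longrightarrow> fst (\<pi> a) = fst a" "w = restrict (z \<circ> \<pi>) lab"
proof -
  have "\<exists>b. b \<in> lab \<and> fst b = fst a \<and> w a = z b" if a: "a \<in> lab" for a
  proof -
    have "w a \<in> fo w (fst a)"
      using a by (auto simp: fo_eq intro!: image_eqI[of _ _ "snd a"])
    then have "w a \<in> fo z (fst a)"
      using eq by simp
    then show ?thesis
      by (auto simp: fo_eq)
  qed
  then obtain \<pi> where \<pi>: "\<And>a. a \<in> lab \<Longrightarrow> \<pi> a \<in> lab \<and> fst (\<pi> a) = fst a \<and> w a = z (\<pi> a)"
    by metis
  have "inj_on \<pi> lab"
  proof (rule inj_onI)
    fix a b assume "a \<in> lab" "b \<in> lab" "\<pi> a = \<pi> b"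
    then show "a = b"
      using \<pi> w by (metis (no_types, lifting) inj_onD mem_Collect_eq topspace_OC)
  qed
  moreover have "\<pi> ` lab \<subseteq> lab"
    using \<pi> by blast
  ultimately have "bij_betw \<pi> lab lab"
    using endo_inj_surj[OF finite_lab, of \<pi>] by (simp add: bij_betw_def)
  moreover have "w = restrict (z \<circ> \<pi>) lab"
    using \<pi> w by (auto simp: topspace_OC PiE_def extensional_def fun_eq_iff)
  ultimately show ?thesis
    using \<pi> that by blast
qed

lemma permute_OC:
  assumes \<pi>: "bij_betw \<pi> lab lab" and z: "z \<in> topspace OC"
  shows "restrict (z \<circ> \<pi>) lab \<in> topspace OC"
proof -
  have "inj_on (z \<circ> \<pi>) lab"
    using \<pi> z by (intro comp_inj_on) (auto simp: bij_betw_def topspace_OC)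
  then show ?thesis
    using \<pi> z by (auto simp: topspace_OC bij_betw_def PiE_def Pi_iff inj_on_def)
qed

text \<open>The saturation of an open set is the union of its preimages under the color-preserving
  permutations of the labels, which act continuously.\<close>

lemma open_map_fo: "open_map OC CX fo"
  unfolding open_map_def
proof (intro allI impI)
  fix U assume U: "openin OC U"
  let ?\<Pi> = "{\<pi>. bij_betw \<pi> lab lab \<and> (\<forall>a\<in>lab. fst (\<pi> a) = fst a)}"
  have U': "U \<subseteq> topspace OC"
    using U by (rule openin_subset)
  have "{z \<in> topspace OC. fo z \<in> fo ` U} = {z \<in> topspace OC. \<exists>\<pi>\<in>?\<Pi>. restrict (z \<circ> \<pi>) lab \<in> U}"
  proof (intro Collect_cong conj_cong refl iffI)
    fix z assume z: "z \<in> topspace OC" and "fo z \<in> fo ` U"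
    then obtain w where w: "w \<in> U" "fo z = fo w"
      by auto
    obtain \<pi> where "bij_betw \<pi> lab lab" "\<And>a. a \<in> lab \<Longrightarrow> fst (\<pi> a) = fst a" "w = restrict (z \<circ> \<pi>) lab"
      using fo_eqD[OF z _ w(2)] w(1) U' by blast
    then show "\<exists>\<pi>\<in>?\<Pi>. restrict (z \<circ> \<pi>) lab \<in> U"
      using w by (intro bexI[of _ \<pi>]) auto
  next
    fix z assume "z \<in> topspace OC" and "\<exists>\<pi>\<in>?\<Pi>. restrict (z \<circ> \<pi>) lab \<in> U"
    then show "fo z \<in> fo ` U"
      using fo_permute by (metis (mono_tags, lifting) image_eqI mem_Collect_eq)
  qed
  moreover have "openin OC {z \<in> topspace OC. \<exists>\<pi>\<in>?\<Pi>. restrict (z \<circ> \<pi>) lab \<in> U}"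
  proof (rule openin_Collect_ex)
    fix \<pi> assume \<pi>: "\<pi> \<in> ?\<Pi>"
    have "continuous_map OC OC (\<lambda>z. restrict (z \<circ> \<pi>) lab)"
    proof (rule continuous_map_into_OC)
      show "continuous_map OC euclidean (\<lambda>z. restrict (z \<circ> \<pi>) lab a)" if "a \<in> lab" for a
        using that \<pi> continuous_map_OC_proj[of "\<pi> a"] by (auto simp: bij_betw_def)
      show "restrict (z \<circ> \<pi>) lab \<in> topspace OC" if "z \<in> topspace OC" for z
        using \<pi> that by (intro permute_OC) auto
    qed
    then show "openin OC {z \<in> topspace OC. restrict (z \<circ> \<pi>) lab \<in> U}"
      using U by (rule openin_continuous_map_preimage)
  qed
  ultimately show "openin CX (fo ` U)"
    using U' by (simp add: Conf_def openin_quotient_topology image_mono)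
qed

lemma openin_CX_Collect:
  assumes "openin OC {z \<in> topspace OC. P (fo z)}"
  shows "openin CX {Z \<in> topspace CX. P Z}"
proof -
  have "{z \<in> topspace OC. fo z \<in> {Z \<in> topspace CX. P Z}} = {z \<in> topspace OC. P (fo z)}"
    by (auto simp: topspace_CX)
  then show ?thesis
    using assms unfolding Conf_def openin_quotient_topology topspace_quotient_topology by auto
qed

lemma continuous_map_from_CX: "continuous_map OC Y (f \<circ> fo) \<Longrightarrow> continuous_map CX Y f"
  by (rule continuous_compose_quotient_map[OF quotient_map_fo])

definition distinct_reals :: "config set" where
  "distinct_reals = {Z \<in> topspace CX. inj_on Re (pts Z)}"

definition nearly_aligned :: "real \<Rightarrow> config set" where
  "nearly_aligned e = {Z \<in> topspace CX. \<exists>z\<in>pts Z. \<exists>w\<in>pts Z. z \<noteq> w \<and> \<bar>Re z - Re w\<bar> < e}"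

definition close_points :: "real \<Rightarrow> config set" where
  "close_points e = {Z \<in> topspace CX. \<exists>z\<in>pts Z. \<exists>w\<in>pts Z. z \<noteq> w \<and> dist z w < e}"

lemma inj_on_Re_OC:
  assumes "z \<in> topspace OC"
  shows "inj_on Re (z ` lab) \<longleftrightarrow> (\<forall>a\<in>lab. \<forall>b\<in>lab. a = b \<or> Re (z a) \<noteq> Re (z b))"
proof -
  have "inj_on z lab"
    using assms by (simp add: topspace_OC)
  then have "inj_on Re (z ` lab) \<longleftrightarrow> inj_on (Re \<circ> z) lab"
    by (rule comp_inj_on_iff)
  then show ?thesis
    unfolding inj_on_def comp_def by blast
qed

lemma openin_distinct_reals: "openin CX distinct_reals"
  unfolding distinct_reals_def
proof (rule openin_CX_Collect)
  have "openin OC {z \<in> topspace OC. \<forall>a\<in>lab. \<forall>b\<in>lab. a = b \<or> Re (z a) \<noteq> Re (z b)}"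
  proof (intro openin_Collect_all finite_lab)
    fix a b assume ab: "a \<in> lab" "b \<in> lab"
    show "openin OC {z \<in> topspace OC. a = b \<or> Re (z a) \<noteq> Re (z b)}"
    proof (cases "a = b")
      case False
      have "continuous_map OC euclideanreal (\<lambda>z. Re (z a) - Re (z b))"
        using continuous_map_OC_proj[OF ab(1)] continuous_map_OC_proj[OF ab(2)]
        by (auto intro!: continuous_intros continuous_map_compose[of OC euclidean _ euclidean Re, unfolded o_def])
      from openin_continuous_map_preimage[OF this, of "- {0}"] False show ?thesis
        by (auto simp: open_Compl elim!: back_subst[of "openin OC"])
    qed simp
  qed
  moreover have "{z \<in> topspace OC. inj_on Re (pts (fo z))} = {z \<in> topspace OC. \<forall>a\<in>lab. \<forall>b\<in>lab. a = b \<or> Re (z a) \<noteq> Re (z b)}"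
    using inj_on_Re_OC unfolding pts_fo by blast
  ultimately show "openin OC {z \<in> topspace OC. inj_on Re (pts (fo z))}"
    by (simp only:)
qed

lemma openin_nearly_aligned: "openin CX (nearly_aligned e)"
  unfolding nearly_aligned_def
proof (rule openin_CX_Collect)
  have "openin OC {z \<in> topspace OC. \<exists>a\<in>lab. \<exists>b\<in>lab. z a \<noteq> z b \<and> \<bar>Re (z a) - Re (z b)\<bar> < e}"
  proof (intro openin_Collect_ex)
    fix a b assume ab: "a \<in> lab" "b \<in> lab"
    show "openin OC {z \<in> topspace OC. z a \<noteq> z b \<and> \<bar>Re (z a) - Re (z b)\<bar> < e}"
    proof (cases "a = b")
      case False
      have "continuous_map OC euclideanreal (\<lambda>z. \<bar>Re (z a) - Re (z b)\<bar>)"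
        using continuous_map_OC_proj[OF ab(1)] continuous_map_OC_proj[OF ab(2)]
        by (auto intro!: continuous_intros continuous_map_compose[of OC euclidean _ euclidean Re, unfolded o_def])
      from openin_continuous_map_preimage[OF this, of "{..<e}"]
      have "openin OC {z \<in> topspace OC. \<bar>Re (z a) - Re (z b)\<bar> < e}"
        by auto
      moreover have "z a \<noteq> z b" if "z \<in> topspace OC" for z
        using that ab False unfolding topspace_OC by (metis (mono_tags, lifting) inj_onD mem_Collect_eq)
      ultimately show ?thesis
        by (auto elim!: back_subst[of "openin OC"])
    qed simp
  qed
  then show "openin OC {z \<in> topspace OC. \<exists>x\<in>pts (fo z). \<exists>w\<in>pts (fo z). x \<noteq> w \<and> \<bar>Re x - Re w\<bar> < e}"
    by (simp only: pts_fo bex_simps)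
qed

lemma distinct_or_aligned: "0 < e \<Longrightarrow> topspace CX \<subseteq> distinct_reals \<union> nearly_aligned e"
  unfolding distinct_reals_def nearly_aligned_def inj_on_def by (smt (verit) Un_iff mem_Collect_eq subsetI)

section \<open>Compressing the heights\<close>

definition flatten :: "real \<Rightarrow> real \<Rightarrow> complex \<Rightarrow> complex" where
  "flatten \<delta> t z = Complex (Re z) ((1 - t * (1 - \<delta>)) * Im z)"

definition squeeze :: "real \<Rightarrow> real \<times> config \<Rightarrow> config" where
  "squeeze \<delta> = (\<lambda>(t, Z). \<lambda>i. flatten \<delta> t ` Z i)"

lemma flatten_factor:
  fixes \<delta> t :: real
  assumes "0 < \<delta>" "\<delta> \<le> 1" "t \<in> {0..1}"
  shows "0 < 1 - t * (1 - \<delta>)" "1 - t * (1 - \<delta>) \<le> 1"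
proof -
  have "t * (1 - \<delta>) \<le> 1 - \<delta>"
    using assms mult_left_le_one_le[of "1 - \<delta>" t] by simp
  then show "0 < 1 - t * (1 - \<delta>)"
    using assms(1) by linarith
  show "1 - t * (1 - \<delta>) \<le> 1"
    using assms by simp
qed

lemma flatten_simps [simp]: "Re (flatten \<delta> t z) = Re z" "flatten \<delta> 0 z = z"
  by (simp_all add: flatten_def)

lemma flatten_eq_iff:
  assumes "0 < \<delta>" "\<delta> \<le> 1" "t \<in> {0..1}"
  shows "flatten \<delta> t z = flatten \<delta> t w \<longleftrightarrow> z = w"
  using flatten_factor[OF assms] by (auto simp: flatten_def complex_eq_iff)

lemma flatten_square:
  assumes "0 < \<delta>" "\<delta> \<le> 1" "t \<in> {0..1}" "z \<in> square"
  shows "flatten \<delta> t z \<in> square"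
proof -
  have "\<bar>(1 - t * (1 - \<delta>)) * Im z\<bar> \<le> \<bar>Im z\<bar>"
    unfolding abs_mult using flatten_factor[OF assms(1-3)] by (simp add: mult_left_le_one_le)
  then show ?thesis
    using assms(4) by (auto simp: flatten_def square_def)
qed

lemma dist_flatten:
  assumes "0 < \<delta>" "\<delta> \<le> 1" "t \<in> {0..1}"
  shows "dist (flatten \<delta> t z) (flatten \<delta> t w) \<le> dist z w"
proof -
  have "Im (flatten \<delta> t z - flatten \<delta> t w) = (1 - t * (1 - \<delta>)) * Im (z - w)"
    by (simp add: flatten_def algebra_simps)
  then have "\<bar>Im (flatten \<delta> t z - flatten \<delta> t w)\<bar> \<le> \<bar>Im (z - w)\<bar>"
    using flatten_factor[OF assms] by (simp add: abs_mult mult_left_le_one_le)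
  then show ?thesis
    unfolding dist_norm cmod_def by (intro real_sqrt_le_mono add_mono) (auto simp: abs_le_square_iff)
qed

lemma flatten_OC:
  assumes "0 < \<delta>" "\<delta> \<le> 1" "t \<in> {0..1}" "z \<in> topspace OC"
  shows "(\<lambda>a\<in>lab. flatten \<delta> t (z a)) \<in> topspace OC"
  using assms flatten_square[OF assms(1-3)] flatten_eq_iff[OF assms(1-3)]
  by (auto simp: topspace_OC inj_on_def PiE_def Pi_iff)

lemma squeeze_fo: "squeeze \<delta> (t, fo z) = fo (\<lambda>a\<in>lab. flatten \<delta> t (z a))"
  by (auto simp: squeeze_def fo_eq fun_eq_iff image_iff)

lemma pts_squeeze: "pts (squeeze \<delta> (t, Z)) = flatten \<delta> t ` pts Z"
  by (auto simp: squeeze_def config_points_def)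

lemma squeeze_CX:
  assumes "0 < \<delta>" "\<delta> \<le> 1" "t \<in> {0..1}" "Z \<in> topspace CX"
  shows "squeeze \<delta> (t, Z) \<in> topspace CX"
  using assms(4) flatten_OC[OF assms(1-3)] unfolding topspace_CX by (auto simp: squeeze_fo)

text \<open>Forgetting the order times the identity of the interval is an open surjection, hence a
  quotient map, and upstairs the compression acts on each point separately.\<close>

lemma continuous_map_squeeze:
  assumes "0 < \<delta>" "\<delta> \<le> 1"
  shows "continuous_map (prod_topology (top_of_set {0..1}) CX) CX (squeeze \<delta>)"
proof -
  let ?I = "top_of_set {0..1::real}"
  let ?Q = "\<lambda>(t, z). (t, fo z)"
  have Q: "quotient_map (prod_topology ?I OC) (prod_topology ?I CX) ?Q"
  proof (rule continuous_open_imp_quotient_map)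
    show "continuous_map (prod_topology ?I OC) (prod_topology ?I CX) ?Q"
      unfolding case_prod_unfold
      by (intro continuous_map_pairedI continuous_map_fst continuous_map_compose[OF continuous_map_snd continuous_map_fo, unfolded o_def])
    show "open_map (prod_topology ?I OC) (prod_topology ?I CX) ?Q"
      by (rule open_map_prod_id[OF open_map_fo])
    show "?Q ` topspace (prod_topology ?I OC) = topspace (prod_topology ?I CX)"
      by (auto simp: topspace_CX)
  qed
  have "continuous_map (prod_topology ?I OC) OC (\<lambda>(t, z). \<lambda>a\<in>lab. flatten \<delta> t (z a))"
  proof (rule continuous_map_into_OC)
    fix a assume a: "a \<in> lab"
    have 1: "continuous_map (prod_topology ?I OC) euclideanreal fst"
      by (rule continuous_map_into_fulltopology[OF continuous_map_fst])
    have 2: "continuous_map (prod_topology ?I OC) euclidean (\<lambda>p. snd p a)"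
      using continuous_map_compose[OF continuous_map_snd continuous_map_OC_proj[OF a]] by (simp add: o_def)
    have "continuous_map (prod_topology ?I OC) euclidean (\<lambda>p. of_real (Re (snd p a)) + \<i> * of_real ((1 - fst p * (1 - \<delta>)) * Im (snd p a)))"
      using 1 2 unfolding continuous_map_atin by (auto intro!: tendsto_intros)
    then show "continuous_map (prod_topology ?I OC) euclidean (\<lambda>y. (case y of (t, z) \<Rightarrow> \<lambda>a\<in>lab. flatten \<delta> t (z a)) a)"
      using a by (simp add: case_prod_unfold flatten_def Complex_eq)
  next
    show "(case y of (t, z) \<Rightarrow> \<lambda>a\<in>lab. flatten \<delta> t (z a)) \<in> topspace OC" if "y \<in> topspace (prod_topology ?I OC)" for y
      using that flatten_OC[OF assms] by auto
  qed
  from continuous_map_compose[OF this continuous_map_fo]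
  have "continuous_map (prod_topology ?I OC) CX (squeeze \<delta> \<circ> ?Q)"
    by (simp add: o_def case_prod_unfold squeeze_fo)
  then show ?thesis
    by (rule continuous_compose_quotient_map[OF Q])
qed

lemma squeeze_0 [simp]: "squeeze \<delta> (0, Z) = Z"
  by (simp add: squeeze_def)

text \<open>The set \<open>A_e\<close> of the overview. By \<open>off_compact_spread\<close> below
  it is what \<open>off_compact\<close> assigns to the compact set \<open>spread e\<close>.\<close>

definition far_from :: "real \<Rightarrow> config set" where
  "far_from e = Conf_side l c \<union> close_points e"

lemma Conf_side_iff: "Z \<in> Conf_side l c \<longleftrightarrow> Z \<in> topspace CX \<and> (\<exists>z\<in>pts Z. \<bar>Re z\<bar> = 1)"
proof -
  have "z \<in> square" if "Z \<in> topspace CX" "z \<in> pts Z" for z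
    using that by (auto simp: topspace_CX pts_fo topspace_OC PiE_def Pi_iff)
  then show ?thesis
    by (auto simp: Conf_side_def vertical_sides_def config_points_def)
qed

text \<open>Compression preserves real parts, shrinks distances and keeps distinct points distinct,
  so neither contact with the vertical sides nor closeness of two points is lost.\<close>

lemma squeeze_far_from:
  assumes "0 < \<delta>" "\<delta> \<le> 1" "t \<in> {0..1}" "Z \<in> far_from e"
  shows "squeeze \<delta> (t, Z) \<in> far_from e"
proof -
  have Z: "Z \<in> topspace CX"
    using assms(4) by (auto simp: far_from_def Conf_side_iff close_points_def)
  note sq = squeeze_CX[OF assms(1-3) Z]
  consider z where "z \<in> pts Z" "\<bar>Re z\<bar> = 1"
    | z w where "z \<in> pts Z" "w \<in> pts Z" "z \<noteq> w" "dist z w < e"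
    using assms(4) by (auto simp: far_from_def Conf_side_iff close_points_def)
  then show ?thesis
  proof cases
    case 1
    then show ?thesis
      using sq by (auto simp: far_from_def Conf_side_iff pts_squeeze)
  next
    case 2
    then have "flatten \<delta> t z \<noteq> flatten \<delta> t w" "dist (flatten \<delta> t z) (flatten \<delta> t w) < e"
      using flatten_eq_iff[OF assms(1-3)] dist_flatten[OF assms(1-3), of z w] by auto
    then show ?thesis
      using 2 sq by (auto simp: far_from_def close_points_def pts_squeeze)
  qed
qed

lemma squeeze_distinct_reals:
  assumes "0 < \<delta>" "\<delta> \<le> 1" "t \<in> {0..1}" "Z \<in> distinct_reals"
  shows "squeeze \<delta> (t, Z) \<in> distinct_reals"
proof -
  have "inj_on Re (flatten \<delta> t ` pts Z)"
    using assms(4) by (auto simp: distinct_reals_def inj_on_def)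
  then show ?thesis
    using assms squeeze_CX[OF assms(1-3)] by (auto simp: distinct_reals_def pts_squeeze)
qed

text \<open>The two real parts differ by less than \<open>e / 2\<close>. The heights differ by at
  most 2, so after compression by at most \<open>2 * \<delta>\<close>, which is at most
  \<open>e / 2\<close>.\<close>

lemma squeeze_nearly_aligned:
  assumes \<delta>: "0 < \<delta>" "\<delta> \<le> 1" "4 * \<delta> \<le> e" and Z: "Z \<in> nearly_aligned (e / 2)"
  shows "squeeze \<delta> (1, Z) \<in> far_from e"
proof -
  obtain z w where zw: "z \<in> pts Z" "w \<in> pts Z" "z \<noteq> w" "\<bar>Re z - Re w\<bar> < e / 2" and ZX: "Z \<in> topspace CX"
    using Z by (auto simp: nearly_aligned_def)
  have sq: "\<bar>Im z\<bar> \<le> 1" "\<bar>Im w\<bar> \<le> 1"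
    using ZX zw by (auto simp: topspace_CX pts_fo topspace_OC PiE_def Pi_iff square_def)
  have "Im (flatten \<delta> 1 z - flatten \<delta> 1 w) = \<delta> * (Im z - Im w)"
    by (simp add: flatten_def algebra_simps)
  then have "\<bar>Im (flatten \<delta> 1 z - flatten \<delta> 1 w)\<bar> \<le> \<delta> * 2"
    using sq \<delta>(1) by (simp add: abs_mult)
  moreover have "\<bar>Re (flatten \<delta> 1 z - flatten \<delta> 1 w)\<bar> < e / 2"
    using zw by simp
  ultimately have "dist (flatten \<delta> 1 z) (flatten \<delta> 1 w) < e"
    using cmod_le[of "flatten \<delta> 1 z - flatten \<delta> 1 w"] \<delta>(3) unfolding dist_norm by linarith
  moreover have "flatten \<delta> 1 z \<noteq> flatten \<delta> 1 w"
    using flatten_eq_iff[OF \<delta>(1,2), of 1] zw by simp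
  ultimately show ?thesis
    using zw squeeze_CX[OF \<delta>(1,2) _ ZX, of 1] by (auto simp: far_from_def close_points_def pts_squeeze)
qed

end

section \<open>Flatness of the local system\<close>

lemma laurent_ring_simps [simp]:
  "carrier laurent_ring = UNIV" "x \<otimes>\<^bsub>laurent_ring\<^esub> y = x * y" "\<one>\<^bsub>laurent_ring\<^esub> = 1"
  "\<zero>\<^bsub>laurent_ring\<^esub> = 0" "x \<oplus>\<^bsub>laurent_ring\<^esub> y = x + y"
  by (simp_all add: laurent_ring_def)

section \<open>Units and integer powers of Laurent polynomials\<close>

lemma cring_laurent_ring: "cring laurent_ring"
proof (rule cringI)
  show "abelian_group laurent_ring"
  proof (rule abelian_groupI)
    show "\<exists>y\<in>carrier laurent_ring. y \<oplus>\<^bsub>laurent_ring\<^esub> x = \<zero>\<^bsub>laurent_ring\<^esub>" for x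
      by (intro bexI[of _ "- x"]) simp_all
  qed (simp_all add: algebra_simps)
  show "comm_monoid laurent_ring"
    by (rule comm_monoidI) (simp_all add: algebra_simps)
qed (simp_all add: algebra_simps)

lemma laurent_nat_pow: "x [^]\<^bsub>laurent_ring\<^esub> (n::nat) = x ^ n"
  by (induction n) (simp_all add: nat_pow_def laurent_ring_def mult.commute)

text \<open>Negative powers in \<open>laurent_ring\<close> are formed with its abstract inverse; for
  a unit \<open>u\<close> this makes them explicit.\<close>

lemma laurent_int_pow:
  assumes "u * v = 1"
  shows "u [^]\<^bsub>laurent_ring\<^esub> (n::int) = (if n < 0 then v ^ nat (- n) else u ^ nat n)"
proof -
  interpret R: cring laurent_ring
    by (rule cring_laurent_ring)
  have "u ^ k * v ^ k = 1" for k
    using assms by (simp flip: power_mult_distrib)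
  then have "inv\<^bsub>laurent_ring\<^esub> (u ^ k) = v ^ k" for k
    by (intro R.comm_inv_char) simp_all
  then show ?thesis
    by (simp add: int_pow_def2 laurent_nat_pow)
qed

lemma laurent_int_pow_Suc:
  assumes "u * v = 1"
  shows "u [^]\<^bsub>laurent_ring\<^esub> (n + 1 :: int) = u [^]\<^bsub>laurent_ring\<^esub> n * u"
proof (cases "n < 0")
  case True
  then have "nat (- n) = Suc (nat (- (n + 1)))"
    by simp
  then have "v ^ nat (- n) * u = v ^ nat (- (n + 1))"
    using assms by (simp add: mult_ac)
  then show ?thesis
    using True unfolding laurent_int_pow[OF assms] by (cases "n = -1") auto
next
  case False
  then have "nat (n + 1) = Suc (nat n)"
    by simp
  then show ?thesis
    using False unfolding laurent_int_pow[OF assms] by (simp add: mult.commute)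
qed

lemma laurent_int_pow_add:
  assumes uv: "u * v = 1"
  shows "u [^]\<^bsub>laurent_ring\<^esub> (a + b :: int) = u [^]\<^bsub>laurent_ring\<^esub> a * u [^]\<^bsub>laurent_ring\<^esub> b"
proof (induction b rule: int_induct[of _ 0])
  case base
  show ?case
    by (simp add: laurent_int_pow[OF uv, of 0])
next
  case (step1 i)
  then show ?case
    using laurent_int_pow_Suc[OF uv, of "a + i"] laurent_int_pow_Suc[OF uv, of i] by (simp only: add.assoc mult.assoc)
next
  case (step2 i)
  have cancel: "x = y" if "x * u = y * u" for x y
    using that uv by (metis mult.assoc mult.right_neutral)
  have i: "i - 1 + 1 = i" "a + (i - 1) + 1 = a + i"
    by simp_all
  have "u [^]\<^bsub>laurent_ring\<^esub> (a + (i - 1)) * u = u [^]\<^bsub>laurent_ring\<^esub> (a + i)"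
    using laurent_int_pow_Suc[OF uv, of "a + (i - 1)"] by (simp only: i)
  also have "\<dots> = u [^]\<^bsub>laurent_ring\<^esub> a * (u [^]\<^bsub>laurent_ring\<^esub> (i - 1) * u)"
    using laurent_int_pow_Suc[OF uv, of "i - 1"] step2(2) by (simp only: i)
  finally show ?case
    by (rule cancel[OF trans]) (simp only: mult.assoc)
qed

lemma monodromy_unit: "\<exists>v. monodromy a d p * v = 1"
proof -
  have q: "q_half_pow k * q_half_pow (- k) = 1" for k
    by (simp add: q_half_pow_def mult_single)
  show ?thesis
  proof (cases "fst p = snd p")
    case True
    then show ?thesis
      using q[of "2 * d (fst p)"] by (intro exI[of _ "- q_half_pow (- (2 * d (fst p)))"]) (auto simp: monodromy_def split: prod.splits)
  next
    case False
    then show ?thesis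
      using q[of "root_form a d (fst p) (snd p)"] by (intro exI[of _ "q_half_pow (- root_form a d (fst p) (snd p))"]) (auto simp: monodromy_def split: prod.splits)
  qed
qed

lemma crossings_cong:
  assumes "\<And>t. t \<in> {0..1} \<Longrightarrow> g t = g' t"
  shows "crossings g = crossings g'"
proof -
  have "(\<lambda>\<theta>. continuous_on {0..1} \<theta> \<and> (\<forall>t\<in>{0..1}. g t = cis (2 * pi * \<theta> t))) =
      (\<lambda>\<theta>. continuous_on {0..1} \<theta> \<and> (\<forall>t\<in>{0..1}. g' t = cis (2 * pi * \<theta> t)))"
    using assms by simp
  then show ?thesis
    unfolding crossings_def by (simp only:)
qed

lemma crossings_const:
  assumes "cmod w = 1" "\<And>t. t \<in> {0..1} \<Longrightarrow> g t = w"
  shows "crossings g = 0"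
proof -
  have "w = cis (2 * pi * (Arg w / (2 * pi)))"
    using rcis_cmod_Arg[of w] assms(1) by (simp add: rcis_def)
  then show ?thesis
    using crossings_eq[of "\<lambda>t. Arg w / (2 * pi)" g] assms(2) by simp
qed

text \<open>The square is contractible, so \<open>f\<close> has a continuous logarithm and the four
  sides share one lift \<open>\<theta>\<close> of the angle. Each crossing number is a difference of
  floors at two corners, and both sums telescope to the difference between opposite corners.\<close>

lemma crossings_square:
  fixes f :: "real \<times> real \<Rightarrow> complex"
  assumes f: "continuous_on ({0..1} \<times> {0..1}) f" and n: "\<And>x. x \<in> {0..1} \<times> {0..1} \<Longrightarrow> cmod (f x) = 1"
  shows "crossings (\<lambda>t. f (0, t)) + crossings (\<lambda>t. f (t, 1)) = crossings (\<lambda>t. f (t, 0)) + crossings (\<lambda>t. f (1, t))"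
proof -
  let ?S = "{0..1::real} \<times> {0..1::real}"
  have "contractible ?S"
    by (intro convex_imp_contractible convex_Times) auto
  moreover have "f x \<noteq> 0" if "x \<in> ?S" for x
    using n[OF that] by auto
  ultimately obtain g where g: "continuous_on ?S g" "\<And>x. x \<in> ?S \<Longrightarrow> f x = exp (g x)"
    using continuous_logarithm_on_contractible[OF f] by blast
  define \<theta> where "\<theta> x = Im (g x) / (2 * pi)" for x
  have \<theta>: "continuous_on ?S \<theta>"
    unfolding \<theta>_def by (intro continuous_intros g) simp
  have eq: "f x = cis (2 * pi * \<theta> x)" if "x \<in> ?S" for x
  proof -
    have "exp (Re (g x)) = 1"
      using n[OF that] g(2)[OF that] by simp
    then have "Re (g x) = 0"
      by simp
    then show ?thesis
      using g(2)[OF that] by (simp add: \<theta>_def exp_eq_polar)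
  qed
  have e: "crossings (\<lambda>t. f (p t)) = \<lfloor>\<theta> (p 1)\<rfloor> - \<lfloor>\<theta> (p 0)\<rfloor>"
    if p: "continuous_on {0..1} p" "\<And>t. t \<in> {0..1} \<Longrightarrow> p t \<in> ?S" for p
  proof (rule crossings_eq)
    show "continuous_on {0..1} (\<lambda>t. \<theta> (p t))"
      by (rule continuous_on_compose2[OF \<theta> p(1)]) (rule image_subsetI, rule p(2))
    show "f (p t) = cis (2 * pi * \<theta> (p t))" if "t \<in> {0..1}" for t
      using p(2)[OF that] by (rule eq)
  qed
  have "crossings (\<lambda>t. f (0, t)) = \<lfloor>\<theta> (0, 1)\<rfloor> - \<lfloor>\<theta> (0, 0)\<rfloor>"
       "crossings (\<lambda>t. f (t, 1)) = \<lfloor>\<theta> (1, 1)\<rfloor> - \<lfloor>\<theta> (0, 1)\<rfloor>"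
       "crossings (\<lambda>t. f (t, 0)) = \<lfloor>\<theta> (1, 0)\<rfloor> - \<lfloor>\<theta> (0, 0)\<rfloor>"
       "crossings (\<lambda>t. f (1, t)) = \<lfloor>\<theta> (1, 1)\<rfloor> - \<lfloor>\<theta> (1, 0)\<rfloor>"
    by (rule e; auto intro!: continuous_intros)+
  then show ?thesis
    by simp
qed

text \<open>The squared direction does not change when the two points are exchanged, so the
  lexicographic order of the points may be replaced by the order of the indices.\<close>

lemma self_phase_image:
  fixes f :: "nat \<Rightarrow> complex"
  assumes "inj_on f {..<n}"
  shows "self_phase (f ` {..<n}) = (\<Prod>(j, k)\<in>{(j, k). j < k \<and> k < n}. (sgn (f k - f j))\<^sup>2)"
proof -
  define lt where "lt z w \<longleftrightarrow> Re z < Re w \<or> (Re z = Re w \<and> Im z < Im w)" for z w :: complex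
  have lt_total: "lt z w \<or> lt w z" if "z \<noteq> w" for z w
    using that by (auto simp: lt_def complex_eq_iff)
  have lt_asym: "\<not> lt w z" if "lt z w" for z w
    using that by (auto simp: lt_def)
  \<comment> \<open>Sorts the two points of an index pair lexicographically; a bijection onto the
    pairs used in \<open>self_phase\<close>.\<close>
  define \<phi> where "\<phi> = (\<lambda>(j, k). if lt (f j) (f k) then (f j, f k) else (f k, f j))"
  let ?P = "{(j, k). j < k \<and> k < n}" and ?Q = "{(z, w) \<in> f ` {..<n} \<times> f ` {..<n}. lt z w}"
  have "inj_on \<phi> ?P"
  proof (rule inj_onI, clarify)
    fix j k j' k' assume *: "j < k" "k < n" "j' < k'" "k' < n" "\<phi> (j, k) = \<phi> (j', k')"
    have "(f j = f j' \<and> f k = f k') \<or> (f j = f k' \<and> f k = f j')"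
      using *(5) by (auto simp: \<phi>_def split: if_splits)
    then have "(j = j' \<and> k = k') \<or> (j = k' \<and> k = j')"
      using inj_onD[OF assms] * by (metis lessThan_iff less_trans)
    then show "j = j' \<and> k = k'"
      using * by auto
  qed
  moreover have "\<phi> ` ?P = ?Q"
  proof (intro equalityI subsetI)
    fix x assume "x \<in> \<phi> ` ?P"
    then obtain j k where jk: "x = \<phi> (j, k)" "j < k" "k < n"
      by auto
    then have "f j \<noteq> f k"
      using inj_onD[OF assms] by fastforce
    then show "x \<in> ?Q"
      using jk lt_total[of "f j" "f k"] by (auto simp: \<phi>_def)
  next
    fix x assume "x \<in> ?Q"
    then obtain j k where jk: "x = (f j, f k)" "lt (f j) (f k)" "j < n" "k < n"
      by auto
    have "j \<noteq> k"
      using jk(2) lt_asym by blast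
    then consider "j < k" | "k < j"
      by linarith
    then show "x \<in> \<phi> ` ?P"
    proof cases
      case 1
      then show ?thesis
        using jk by (intro image_eqI[of _ _ "(j, k)"]) (auto simp: \<phi>_def)
    next
      case 2
      then show ?thesis
        using jk lt_asym[OF jk(2)] by (intro image_eqI[of _ _ "(k, j)"]) (auto simp: \<phi>_def)
    qed
  qed
  ultimately have bij: "bij_betw \<phi> ?P ?Q"
    by (simp add: bij_betw_def)
  have "self_phase (f ` {..<n}) = (\<Prod>x\<in>?Q. case x of (z, w) \<Rightarrow> (sgn (w - z))\<^sup>2)"
    by (simp add: self_phase_def lt_def)
  also have "\<dots> = (\<Prod>x\<in>?P. case \<phi> x of (z, w) \<Rightarrow> (sgn (w - z))\<^sup>2)"
    by (rule prod.reindex_bij_betw[OF bij, symmetric])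
  also have "\<dots> = (\<Prod>(j, k)\<in>?P. (sgn (f k - f j))\<^sup>2)"
  proof (rule prod.cong[OF refl], clarify)
    fix j k
    have "(sgn (f k - f j))\<^sup>2 = (sgn (f j - f k))\<^sup>2"
      by (metis minus_diff_eq power2_minus sgn_minus)
    then show "(case \<phi> (j, k) of (z, w) \<Rightarrow> (sgn (w - z))\<^sup>2) = (sgn (f k - f j))\<^sup>2"
      by (simp add: \<phi>_def)
  qed
  finally show ?thesis .
qed

lemma mixed_phase_image:
  assumes "inj_on f A" "inj_on g B"
  shows "mixed_phase (f ` A) (g ` B) = (\<Prod>(j, k)\<in>A \<times> B. (sgn (g k - f j))\<^sup>2)"
proof -
  have "inj_on (map_prod f g) (A \<times> B)"
    using assms by (rule map_prod_inj_on)
  moreover have "f ` A \<times> g ` B = map_prod f g ` (A \<times> B)"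
    by (simp add: map_prod_surj_on)
  ultimately show ?thesis
    unfolding mixed_phase_def by (simp add: prod.reindex o_def case_prod_unfold)
qed

context configurations
begin

text \<open>The factors of a torus coordinate as pairs of labels: a diagonal coordinate lists each
  pair within a color once, an off-diagonal one all pairs between the two colors.\<close>

definition pair_labels :: "nat \<times> nat \<Rightarrow> ((nat \<times> nat) \<times> (nat \<times> nat)) set" where
  "pair_labels = (\<lambda>(i, j). if i = j then {((i, k), (i, k')) | k k'. k < k' \<and> k' < c i}
     else {((i, k), (j, k')) | k k'. k < c i \<and> k' < c j})"

lemma pair_labelsD:
  assumes "p \<in> torus_coords l" "(a, b) \<in> pair_labels p"
  shows "a \<in> lab" "b \<in> lab" "a \<noteq> b"
  using assms by (auto simp: pair_labels_def torus_coords_def point_labels_def split: if_splits)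

text \<open>Upstairs the index set of the product no longer depends on the configuration, which
  gives continuity and modulus 1 factor by factor.\<close>

lemma phase_fo:
  assumes z: "z \<in> topspace OC" and p: "p \<in> torus_coords l"
  shows "phase_map (rotate_config (fo z)) p = (\<Prod>(a, b)\<in>pair_labels p. (sgn (\<i> * z b - \<i> * z a))\<^sup>2)"
proof -
  obtain i j where ij: "p = (i, j)" "i \<in> {1..l}" "j \<in> {1..l}"
    using p by (auto simp: torus_coords_def)
  have inj: "inj_on (\<lambda>k. \<i> * z (i', k)) {..<c i'}" if "i' \<in> {1..l}" for i'
  proof (rule inj_onI)
    fix k k' assume "k \<in> {..<c i'}" "k' \<in> {..<c i'}" "\<i> * z (i', k) = \<i> * z (i', k')"
    moreover from this have "(i', k) \<in> lab" "(i', k') \<in> lab"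
      using that by (auto simp: point_labels_def)
    ultimately show "k = k'"
      using z by (auto simp: topspace_OC dest!: inj_onD)
  qed
  have img: "rotate_config (fo z) i' = (\<lambda>k. \<i> * z (i', k)) ` {..<c i'}" if "i' \<in> {1..l}" for i'
    using that by (simp add: rotate_config_def fo_lessThan image_image)
  show ?thesis
  proof (cases "i = j")
    case True
    have "pair_labels p = (\<lambda>(k, k'). ((i, k), (i, k'))) ` {(k, k'). k < k' \<and> k' < c i}"
      using True by (auto simp: ij pair_labels_def image_def)
    moreover have "inj_on (\<lambda>(k, k'). ((i, k), (i, k'))) {(k, k'). k < k' \<and> k' < c i}"
      by (auto simp: inj_on_def)
    ultimately have "(\<Prod>(a, b)\<in>pair_labels p. (sgn (\<i> * z b - \<i> * z a))\<^sup>2) =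
        (\<Prod>(k, k')\<in>{(k, k'). k < k' \<and> k' < c i}. (sgn (\<i> * z (i, k') - \<i> * z (i, k)))\<^sup>2)"
      by (simp add: prod.reindex case_prod_unfold)
    then show ?thesis
      using True by (simp add: ij phase_map_def img[OF ij(2)] img[OF ij(3)] self_phase_image[OF inj[OF ij(3)]])
  next
    case False
    have "pair_labels p = (\<lambda>(k, k'). ((i, k), (j, k'))) ` ({..<c i} \<times> {..<c j})"
      using False by (auto simp: ij pair_labels_def image_def)
    moreover have "inj_on (\<lambda>(k, k'). ((i, k), (j, k'))) ({..<c i} \<times> {..<c j})"
      by (auto simp: inj_on_def)
    ultimately have "(\<Prod>(a, b)\<in>pair_labels p. (sgn (\<i> * z b - \<i> * z a))\<^sup>2) =
        (\<Prod>(k, k')\<in>{..<c i} \<times> {..<c j}. (sgn (\<i> * z (j, k') - \<i> * z (i, k)))\<^sup>2)"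
      by (simp add: prod.reindex case_prod_unfold)
    then show ?thesis
      using False by (simp add: ij phase_map_def img[OF ij(2)] img[OF ij(3)] mixed_phase_image[OF inj[OF ij(2)] inj[OF ij(3)]])
  qed
qed

lemma OC_distinct: "z \<in> topspace OC \<Longrightarrow> a \<in> lab \<Longrightarrow> b \<in> lab \<Longrightarrow> a \<noteq> b \<Longrightarrow> z a \<noteq> z b"
  by (auto simp: topspace_OC dest: inj_onD)

lemma continuous_map_phase:
  assumes p: "p \<in> torus_coords l"
  shows "continuous_map CX euclidean (\<lambda>Z. phase_map (rotate_config Z) p)"
proof (rule continuous_map_from_CX)
  have "continuous_map OC euclidean (\<lambda>z. \<Prod>x\<in>pair_labels p. (sgn (\<i> * z (snd x) - \<i> * z (fst x)))\<^sup>2)"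
    unfolding continuous_map_atin
  proof (intro ballI, simp only: limitin_canonical_iff, intro tendsto_intros)
    fix z x assume z: "z \<in> topspace OC" and "x \<in> pair_labels p"
    then have x: "fst x \<in> lab" "snd x \<in> lab" "fst x \<noteq> snd x"
      using pair_labelsD[OF p, of "fst x" "snd x"] by auto
    show "((\<lambda>z. z (fst x)) \<longlongrightarrow> z (fst x)) (atin OC z)" "((\<lambda>z. z (snd x)) \<longlongrightarrow> z (snd x)) (atin OC z)"
      using continuous_map_OC_proj[OF x(1)] continuous_map_OC_proj[OF x(2)] z by (auto simp: continuous_map_atin)
    show "\<i> * z (snd x) - \<i> * z (fst x) \<noteq> 0"
      using OC_distinct[OF z x] by auto
  qed
  then show "continuous_map OC euclidean ((\<lambda>Z. phase_map (rotate_config Z) p) \<circ> fo)"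
    by (rule continuous_map_eq) (simp add: phase_fo p case_prod_unfold)
qed

lemma cmod_phase:
  assumes p: "p \<in> torus_coords l" and Z: "Z \<in> topspace CX"
  shows "cmod (phase_map (rotate_config Z) p) = 1"
proof -
  obtain z where z: "Z = fo z" "z \<in> topspace OC"
    using Z by (auto simp: topspace_CX)
  have "cmod (\<Prod>(a, b)\<in>pair_labels p. (sgn (\<i> * z b - \<i> * z a))\<^sup>2) = (\<Prod>x\<in>pair_labels p. 1)"
    unfolding prod_norm[symmetric]
  proof (rule prod.cong[OF refl], clarify)
    fix i k j k' assume "((i, k), (j, k')) \<in> pair_labels p"
    from pair_labelsD[OF p this] have "z (j, k') \<noteq> z (i, k)"
      using OC_distinct[OF z(2)] by metis
    then show "cmod ((sgn (\<i> * z (j, k') - \<i> * z (i, k)))\<^sup>2) = 1"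
      by (simp add: norm_power norm_sgn)
  qed
  then show ?thesis
    by (simp add: z phase_fo p)
qed

text \<open>After the rotation the difference of two real points is imaginary, so each squared
  direction equals \<open>-1\<close>, whatever the positions are.\<close>

lemma phase_real:
  assumes p: "p \<in> torus_coords l" and z: "z \<in> topspace OC" and re: "\<And>a. a \<in> lab \<Longrightarrow> Im (z a) = 0"
  shows "phase_map (rotate_config (fo z)) p = (- 1) ^ card (pair_labels p)"
proof -
  have "(\<Prod>(a, b)\<in>pair_labels p. (sgn (\<i> * z b - \<i> * z a))\<^sup>2) = (\<Prod>x\<in>pair_labels p. - 1)"
  proof (rule prod.cong[OF refl], clarify)
    fix i k j k' assume "((i, k), (j, k')) \<in> pair_labels p"
    note x = pair_labelsD[OF p this]
    define t where "t = Re (z (j, k')) - Re (z (i, k))"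
    have "z (j, k') \<noteq> z (i, k)"
      using OC_distinct[OF z x] by metis
    then have "t \<noteq> 0"
      using re[OF x(1)] re[OF x(2)] by (auto simp: t_def complex_eq_iff)
    have "\<i> * z (j, k') - \<i> * z (i, k) = \<i> * of_real t"
      using re[OF x(1)] re[OF x(2)] by (auto simp: t_def complex_eq_iff)
    then have "sgn (\<i> * z (j, k') - \<i> * z (i, k)) = \<i> * of_real (sgn t)"
      by (simp add: sgn_mult sgn_of_real) (simp add: sgn_eq)
    then show "(sgn (\<i> * z (j, k') - \<i> * z (i, k)))\<^sup>2 = - 1"
      using \<open>t \<noteq> 0\<close> by (simp add: power_mult_distrib sgn_if split: if_splits)
  qed
  then show ?thesis
    by (simp add: phase_fo p z)
qed

lemma Conf_transport_eq:
  "Conf_transport l a d \<gamma> =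
    (\<Prod>p\<in>torus_coords l. monodromy a d p [^]\<^bsub>laurent_ring\<^esub> crossings (\<lambda>t. phase_map (rotate_config (\<gamma> t)) p))"
  by (simp add: Conf_transport_def pullback_transport_def torus_transport_def)

theorem flat_Conf_transport: "flat_transport CX (Conf_transport l a d)"
  unfolding flat_transport_def
proof (intro conjI allI impI ballI)
  show "Conf_transport l a d g = Conf_transport l a d g'" if "\<forall>t\<in>{0..1}. g t = g' t" for g g'
    unfolding Conf_transport_eq using that by (intro prod.cong refl arg_cong2[of _ _ _ _ "([^]\<^bsub>laurent_ring\<^esub>)"] crossings_cong) auto
next
  fix Z assume Z: "Z \<in> topspace CX"
  have "monodromy a d p [^]\<^bsub>laurent_ring\<^esub> crossings (\<lambda>t. phase_map (rotate_config Z) p) = 1" if "p \<in> torus_coords l" for p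
    using crossings_const[OF cmod_phase[OF that Z]] monodromy_unit[of a d p] by (auto simp: laurent_int_pow)
  then show "Conf_transport l a d (\<lambda>_. Z) = 1"
    by (simp add: Conf_transport_eq)
next
  fix s :: "real \<times> real \<Rightarrow> config"
  assume s: "continuous_map (top_of_set ({0..1} \<times> {0..1})) CX s"
  show "Conf_transport l a d (\<lambda>t. s (0, t)) * Conf_transport l a d (\<lambda>t. s (t, 1)) =
      Conf_transport l a d (\<lambda>t. s (t, 0)) * Conf_transport l a d (\<lambda>t. s (1, t))"
    unfolding Conf_transport_eq prod.distrib[symmetric]
  proof (rule prod.cong[OF refl])
    fix p assume p: "p \<in> torus_coords l"
    obtain v where v: "monodromy a d p * v = 1"
      using monodromy_unit by blast
    let ?f = "\<lambda>x. phase_map (rotate_config (s x)) p"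
    have "continuous_on ({0..1} \<times> {0..1}) ?f"
      using continuous_map_compose[OF s continuous_map_phase[OF p]] by (simp add: o_def)
    moreover have "cmod (?f x) = 1" if "x \<in> {0..1} \<times> {0..1}" for x
      using s that by (intro cmod_phase[OF p]) (auto simp: continuous_map_def Pi_iff)
    ultimately have "crossings (\<lambda>t. ?f (0, t)) + crossings (\<lambda>t. ?f (t, 1)) = crossings (\<lambda>t. ?f (t, 0)) + crossings (\<lambda>t. ?f (1, t))"
      by (rule crossings_square)
    then show "monodromy a d p [^]\<^bsub>laurent_ring\<^esub> crossings (\<lambda>t. ?f (0, t)) * monodromy a d p [^]\<^bsub>laurent_ring\<^esub> crossings (\<lambda>t. ?f (t, 1)) =
        monodromy a d p [^]\<^bsub>laurent_ring\<^esub> crossings (\<lambda>t. ?f (t, 0)) * monodromy a d p [^]\<^bsub>laurent_ring\<^esub> crossings (\<lambda>t. ?f (1, t))"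
      by (simp flip: laurent_int_pow_add[OF v])
  qed
qed

text \<open>Makes the handle coefficient of a necklace chain invertible.\<close>

lemma Conf_transport_unit: "\<exists>w. Conf_transport l a d \<gamma> * w = 1"
proof -
  have ex: "\<exists>w. \<forall>p. monodromy a d p [^]\<^bsub>laurent_ring\<^esub> (n p :: int) * w p = 1" for n
  proof -
    have "monodromy a d p [^]\<^bsub>laurent_ring\<^esub> (n p) * monodromy a d p [^]\<^bsub>laurent_ring\<^esub> (- n p) = 1" for p
    proof -
      obtain v where v: "monodromy a d p * v = 1"
        using monodromy_unit by blast
      show ?thesis
        using laurent_int_pow_add[OF v, of "n p" "- n p"] laurent_int_pow[OF v, of 0] by simp
    qed
    then show ?thesis
      by (intro exI[of _ "\<lambda>p. monodromy a d p [^]\<^bsub>laurent_ring\<^esub> (- n p)"] allI)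
  qed
  obtain w where "\<forall>p. monodromy a d p [^]\<^bsub>laurent_ring\<^esub> crossings (\<lambda>t. phase_map (rotate_config (\<gamma> t)) p) * w p = 1"
    using ex[of "\<lambda>p. crossings (\<lambda>t. phase_map (rotate_config (\<gamma> t)) p)"] by (rule exE)
  then have "Conf_transport l a d \<gamma> * (\<Prod>p\<in>torus_coords l. w p) = 1"
    unfolding Conf_transport_eq prod.distrib[symmetric] by (intro prod.neutral) blast
  then show ?thesis ..
qed

text \<open>The phases stay at one point of the torus by \<open>phase_real\<close>, so nothing is
  crossed. This lets base vertices move along the real segment at no cost.\<close>

lemma Conf_transport_real:
  assumes "\<And>t. t \<in> {0..1} \<Longrightarrow> z t \<in> topspace OC" "\<And>t a. t \<in> {0..1} \<Longrightarrow> a \<in> lab \<Longrightarrow> Im (z t a) = 0"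
  shows "Conf_transport l a d (\<lambda>t. fo (z t)) = 1"
proof -
  have "monodromy a d p [^]\<^bsub>laurent_ring\<^esub> crossings (\<lambda>t. phase_map (rotate_config (fo (z t))) p) = 1" if p: "p \<in> torus_coords l" for p
  proof -
    have "crossings (\<lambda>t. phase_map (rotate_config (fo (z t))) p) = 0"
      by (rule crossings_const[of "(- 1) ^ card (pair_labels p)"]) (auto simp: norm_power intro!: phase_real[OF p] assms)
    then show ?thesis
      using monodromy_unit[of a d p] by (auto simp: laurent_int_pow)
  qed
  then show ?thesis
    by (simp add: Conf_transport_eq)
qed

end

section \<open>The chambers of configurations with distinct real parts\<close>

lemma count_list_card: "count_list xs x = card {j. j < length xs \<and> xs ! j = x}"
proof -
  have "count_list xs x = length (filter ((=) x) xs)"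
    by (rule count_list_eq_length_filter)
  also have "\<dots> = card {j. j < length xs \<and> x = xs ! j}"
    by (rule length_filter_conv_card)
  finally show ?thesis
    by (simp add: eq_commute[of x])
qed

lemma count_list_take_Suc: "j < length xs \<Longrightarrow> count_list (take (Suc j) xs) x = count_list (take j xs) x + (if xs ! j = x then 1 else 0)"
  by (simp add: take_Suc_conv_app_nth)

lemma count_list_take_mono: "i \<le> j \<Longrightarrow> count_list (take i xs) x \<le> count_list (take j xs) x"
proof -
  assume "i \<le> j"
  then have "take j xs = take i xs @ take (j - i) (drop i xs)"
    by (metis le_add_diff_inverse take_add)
  then show ?thesis
    by simp
qed

lemma strict_mono_enumeration_unique:
  fixes f g :: "nat \<Rightarrow> real"
  assumes f: "\<And>i j. i < j \<Longrightarrow> j < n \<Longrightarrow> f i < f j" and g: "\<And>i j. i < j \<Longrightarrow> j < n \<Longrightarrow> g i < g j"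
    and im: "f ` {..<n} = g ` {..<n}" and j: "j < n"
  shows "f j = g j"
proof -
  have s: "sorted (map h [0..<n])" "distinct (map h [0..<n])" if "\<And>i j. i < j \<Longrightarrow> j < n \<Longrightarrow> h i < h j" for h :: "nat \<Rightarrow> real"
  proof -
    have "sorted_wrt (<) (map h [0..<n])"
      unfolding sorted_wrt_iff_nth_less using that by simp
    then show "sorted (map h [0..<n])" "distinct (map h [0..<n])"
      by (simp_all add: strict_sorted_iff)
  qed
  have "map f [0..<n] = map g [0..<n]"
    by (rule sorted_distinct_set_unique) (use s[OF f] s[OF g] im in \<open>auto simp: atLeast0LessThan\<close>)
  then show ?thesis
    using j by (simp add: list_eq_iff_nth_eq)
qed

lemma real_enumeration_exists:
  fixes h :: "'a \<Rightarrow> real"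
  assumes "finite A" "inj_on h A"
  obtains b where "bij_betw b {..<card A} A" "\<And>i j. i < j \<Longrightarrow> j < card A \<Longrightarrow> h (b i) < h (b j)"
proof -
  let ?xs = "sorted_list_of_set (h ` A)"
  have len: "length ?xs = card A"
    using assms by (simp add: card_image)
  have set: "set ?xs = h ` A"
    using assms by simp
  have "bij_betw (\<lambda>j. ?xs ! j) {..<card A} (h ` A)"
    using bij_betw_nth[of ?xs "{..<card A}" "h ` A"] len set by simp
  moreover have "bij_betw (inv_into A h) (h ` A) A"
    using assms(2) by (simp add: bij_betw_inv_into inj_on_imp_bij_betw)
  ultimately have b: "bij_betw (inv_into A h \<circ> (\<lambda>j. ?xs ! j)) {..<card A} A"
    by (rule bij_betw_trans)
  have "h ((inv_into A h \<circ> (\<lambda>j. ?xs ! j)) i) = ?xs ! i" if "i < card A" for i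
    using that len set by (metis comp_apply f_inv_into_f nth_mem)
  moreover have "?xs ! i < ?xs ! j" if "i < j" "j < card A" for i j
    using strict_sorted_list_of_set[of "h ` A"] that len by (simp add: sorted_wrt_iff_nth_less)
  ultimately show ?thesis
    using b by (intro that) auto
qed

context configurations
begin

section \<open>Words, slots and chambers\<close>

abbreviation "m \<equiv> coloring_size l c"
abbreviation "words \<equiv> color_words l c"

text \<open>The label given to the \<open>j\<close>-th point of the word: its color, and as rank the
  number of earlier points of that color.\<close>

definition slot :: "nat list \<Rightarrow> nat \<Rightarrow> nat \<times> nat" where
  "slot r j = (r ! j, count_list (take j r) (r ! j))"

lemma word_length: "r \<in> words \<Longrightarrow> length r = m"
  by (simp add: color_words_def)

lemma finite_words: "finite words"
proof (rule finite_subset)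
  show "words \<subseteq> {r. set r \<subseteq> {1..l} \<and> length r = m}"
    by (auto simp: color_words_def)
  show "finite {r. set r \<subseteq> {1..l} \<and> length r = m}"
    by (rule finite_lists_length_eq) simp
qed

text \<open>The rank of a color grows strictly at each occurrence, which gives injectivity; the
  letter counts of the word keep the ranks in range, and equal cardinality does the rest.\<close>

lemma slot_bij:
  assumes r: "r \<in> words"
  shows "bij_betw (slot r) {..<m} lab"
proof -
  have len: "length r = m"
    using r by (rule word_length)
  have lt: "count_list (take j r) (r ! j) < count_list (take k r) (r ! j)" if "j < k" "k \<le> m" for j k
    using count_list_take_Suc[of j r "r ! j"] count_list_take_mono[of "Suc j" k r "r ! j"] that len by simp
  have inj: "inj_on (slot r) {..<m}"
  proof (rule inj_onI)
    fix j k assume *: "j \<in> {..<m}" "k \<in> {..<m}" "slot r j = slot r k"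
    then show "j = k"
      using lt[of j k] lt[of k j] by (cases j k rule: linorder_cases) (auto simp: slot_def)
  qed
  have "slot r ` {..<m} \<subseteq> lab"
  proof
    fix a assume "a \<in> slot r ` {..<m}"
    then obtain j where j: "a = slot r j" "j < m"
      by auto
    then have "r ! j \<in> {1..l}"
      using r len by (force simp: color_words_def)
    moreover from this have "count_list (take j r) (r ! j) < c (r ! j)"
      using lt[of j m] j len r by (simp add: color_words_def)
    ultimately show "a \<in> lab"
      using j by (auto simp: slot_def point_labels_def)
  qed
  then have "slot r ` {..<m} = lab"
    using inj by (intro card_subset_eq finite_lab) (auto simp: card_image card_lab)
  then show ?thesis
    using inj by (simp add: bij_betw_def)
qed

lemma slot_lab: "r \<in> words \<Longrightarrow> j < m \<Longrightarrow> slot r j \<in> lab"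
  using slot_bij[of r] by (auto simp: bij_betw_def)

lemma slot_cases:
  assumes "r \<in> words" "a \<in> lab"
  obtains j where "j < m" "a = slot r j"
proof -
  have "a \<in> slot r ` {..<m}"
    using slot_bij[OF assms(1)] assms(2) by (simp add: bij_betw_def)
  then show ?thesis
    using that by auto
qed

lemma slot_inj: "r \<in> words \<Longrightarrow> i < m \<Longrightarrow> j < m \<Longrightarrow> slot r i = slot r j \<longleftrightarrow> i = j"
  using slot_bij[of r] by (auto simp: bij_betw_def dest: inj_onD)

definition arrange :: "nat list \<Rightarrow> (nat \<Rightarrow> complex) \<Rightarrow> nat \<times> nat \<Rightarrow> complex" where
  "arrange r p = (\<lambda>a\<in>lab. p (inv_into {..<m} (slot r) a))"

lemma arrange_slot [simp]:
  assumes "r \<in> words" "j < m"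
  shows "arrange r p (slot r j) = p j"
proof -
  have "inv_into {..<m} (slot r) (slot r j) = j"
    using slot_bij[OF assms(1)] assms(2) by (intro inv_into_f_f) (auto simp: bij_betw_def)
  then show ?thesis
    using slot_lab[OF assms] by (simp add: arrange_def)
qed

lemma fo_slots:
  assumes r: "r \<in> words"
  shows "fo z = place_points r (\<lambda>j. z (slot r j))"
proof
  fix i
  have len: "length r = m"
    using r by (rule word_length)
  show "fo z i = place_points r (\<lambda>j. z (slot r j)) i"
  proof (intro equalityI subsetI)
    fix x assume "x \<in> fo z i"
    then obtain k where k: "x = z (i, k)" "(i, k) \<in> lab"
      by (auto simp: fo_eq)
    obtain j where "j < m" "(i, k) = slot r j"
      by (rule slot_cases[OF r k(2)])
    then show "x \<in> place_points r (\<lambda>j. z (slot r j)) i"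
      using k(1) len by (auto simp: place_points_def slot_def intro!: exI[of _ j])
  next
    fix x assume "x \<in> place_points r (\<lambda>j. z (slot r j)) i"
    then obtain j where "x = z (slot r j)" "j < m" "r ! j = i"
      using len by (auto simp: place_points_def)
    then show "x \<in> fo z i"
      using slot_lab[OF r, of j] by (auto simp: fo_eq slot_def)
  qed
qed

lemma place_points_cong: "(\<And>j. j < length r \<Longrightarrow> p j = p' j) \<Longrightarrow> place_points r p = place_points r p'"
  by (force simp: place_points_def)

lemma fo_arrange:
  assumes r: "r \<in> words"
  shows "fo (arrange r p) = place_points r p"
  unfolding fo_slots[OF r] using r by (intro place_points_cong) (simp add: word_length)

text \<open>Defined upstairs: ordering the points by real part singles out one ordered lift of every
  configuration whose colors read \<open>r\<close> from left to right.\<close>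

definition chamber :: "nat list \<Rightarrow> (nat \<times> nat \<Rightarrow> complex) set" where
  "chamber r = {z \<in> topspace OC. \<forall>j. Suc j < m \<longrightarrow> Re (z (slot r j)) < Re (z (slot r (Suc j)))}"

lemma chamber_OC: "z \<in> chamber r \<Longrightarrow> z \<in> topspace OC"
  by (simp add: chamber_def)

lemma chamber_less:
  assumes "z \<in> chamber r" "i < j" "j < m"
  shows "Re (z (slot r i)) < Re (z (slot r j))"
  using assms(2,3)
proof (induction j)
  case (Suc j)
  have "Re (z (slot r j)) < Re (z (slot r (Suc j)))"
    using assms(1) Suc.prems by (simp add: chamber_def)
  then show ?case
    using Suc by (cases "i = j") auto
qed simp

lemma chamber_le:
  assumes "z \<in> chamber r" "i \<le> j" "j < m"
  shows "Re (z (slot r i)) \<le> Re (z (slot r j))"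
  using chamber_less[OF assms(1)] assms by (cases "i = j") (auto simp: less_imp_le)

lemma chamberI:
  assumes r: "r \<in> words" and ext: "z \<in> extensional lab" and sq: "\<And>j. j < m \<Longrightarrow> z (slot r j) \<in> square"
    and less: "\<And>j. Suc j < m \<Longrightarrow> Re (z (slot r j)) < Re (z (slot r (Suc j)))"
  shows "z \<in> chamber r"
proof -
  have lt: "Re (z (slot r i)) < Re (z (slot r j))" if "i < j" "j < m" for i j
    using that
  proof (induction j)
    case (Suc j)
    then show ?case
      using less[of j] by (cases "i = j") auto
  qed simp
  have "inj_on z lab"
  proof (rule inj_onI)
    fix a b assume ab: "a \<in> lab" "b \<in> lab" "z a = z b"
    obtain i j where "i < m" "a = slot r i" "j < m" "b = slot r j"
      using slot_cases[OF r ab(1)] slot_cases[OF r ab(2)] by metis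
    then show "a = b"
      using lt[of i j] lt[of j i] ab(3) by (cases i j rule: linorder_cases) auto
  qed
  moreover have "z a \<in> square" if a: "a \<in> lab" for a
    using slot_cases[OF r a] sq by metis
  ultimately show ?thesis
    using less ext by (auto simp: chamber_def topspace_OC PiE_def)
qed

lemma OC_arb:
  assumes "z \<in> topspace OC" "a \<notin> lab"
  shows "z a = undefined"
proof -
  have "z \<in> Pi\<^sub>E lab (\<lambda>_. square)"
    using assms(1) unfolding topspace_OC by blast
  then show ?thesis
    using assms(2) by (rule PiE_arb)
qed

text \<open>The increasing real parts recover which point sits in which slot, and membership in the
  color classes then recovers the letters. So different chambers have disjoint images, and
  \<open>fo\<close> is injective on each.\<close>

lemma chamber_word:
  assumes r: "r \<in> words" and r': "r' \<in> words" and z: "z \<in> chamber r" and w: "w \<in> chamber r'" and eq: "fo z = fo w"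
  shows "r = r'" "z = w"
proof -
  have img: "(\<lambda>j. x (slot s j)) ` {..<m} = x ` lab" if "s \<in> words" for x :: "nat \<times> nat \<Rightarrow> complex" and s
  proof -
    have "x ` lab = x ` slot s ` {..<m}"
      using slot_bij[OF that] by (simp add: bij_betw_def)
    then show ?thesis
      by (simp add: image_image)
  qed
  have pts: "z ` lab = w ` lab"
    using eq by (metis pts_fo)
  have j: "z (slot r j) = w (slot r' j)" if j: "j < m" for j
  proof -
    have "(\<lambda>j. Re (z (slot r j))) ` {..<m} = (\<lambda>j. Re (w (slot r' j))) ` {..<m}"
      using img[OF r, of z] img[OF r', of w] pts by (metis image_image)
    then have Re: "Re (z (slot r j)) = Re (w (slot r' j))"
      using chamber_less[OF z] chamber_less[OF w] j by (intro strict_mono_enumeration_unique[of m "\<lambda>j. Re (z (slot r j))" "\<lambda>j. Re (w (slot r' j))"]) auto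
    have "w (slot r' j) \<in> z ` lab"
      using pts slot_lab[OF r' j] by blast
    then obtain a where a: "a \<in> lab" "w (slot r' j) = z a"
      by blast
    obtain k where k: "k < m" "a = slot r k"
      by (rule slot_cases[OF r a(1)])
    have "Re (z (slot r k)) = Re (z (slot r j))"
      using Re a(2) k(2) by (simp only:)
    then have "\<not> k < j" "\<not> j < k"
      using chamber_less[OF z _ j, of k] chamber_less[OF z _ k(1), of j] by auto
    then have "k = j"
      by simp
    then show ?thesis
      using a(2) k(2) by (simp only:)
  qed
  have "r ! j = r' ! j" if jm: "j < m" for j
  proof -
    have "w (slot r' j) \<in> fo w (r' ! j)"
      using slot_lab[OF r' jm] by (auto simp: fo_eq slot_def)
    then have "z (slot r j) \<in> fo z (r' ! j)"
      using j[OF jm] eq by (simp only:)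
    then obtain k where k: "z (slot r j) = z (r' ! j, k)" "(r' ! j, k) \<in> lab"
      unfolding fo_eq by blast
    then have "slot r j = (r' ! j, k)"
      using OC_distinct[OF chamber_OC[OF z]] slot_lab[OF r jm] by metis
    then show ?thesis
      by (simp add: slot_def)
  qed
  then show rr: "r = r'"
    using word_length[OF r] word_length[OF r'] by (simp add: list_eq_iff_nth_eq)
  show "z = w"
  proof
    fix a
    show "z a = w a"
    proof (cases "a \<in> lab")
      case True
      obtain k where "k < m" "a = slot r k"
        by (rule slot_cases[OF r True])
      then show ?thesis
        using j rr by simp
    next
      case False
      then show ?thesis
        using OC_arb[OF chamber_OC[OF z]] OC_arb[OF chamber_OC[OF w]] by simp
    qed
  qed
qed

lemma openin_chamber:
  assumes r: "r \<in> words"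
  shows "openin OC (chamber r)"
proof -
  have "openin OC {z \<in> topspace OC. \<forall>j\<in>{j. Suc j < m}. Re (z (slot r j)) < Re (z (slot r (Suc j)))}"
  proof (rule openin_Collect_all)
    show "finite {j. Suc j < m}"
      by (rule finite_subset[of _ "{..<m}"]) auto
    fix j assume j: "j \<in> {j. Suc j < m}"
    have "continuous_map OC euclideanreal (\<lambda>z. Re (z (slot r (Suc j))) - Re (z (slot r j)))"
      using continuous_map_OC_proj[OF slot_lab[OF r, of j]] continuous_map_OC_proj[OF slot_lab[OF r, of "Suc j"]] j
      by (auto intro!: continuous_intros continuous_map_compose[of OC euclidean _ euclidean Re, unfolded o_def])
    from openin_continuous_map_preimage[OF this, of "{0<..}"]
    show "openin OC {z \<in> topspace OC. Re (z (slot r j)) < Re (z (slot r (Suc j)))}"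
      by auto
  qed
  then show ?thesis
    by (simp add: chamber_def)
qed

lemma openin_chamber_image: "r \<in> words \<Longrightarrow> openin CX (fo ` chamber r)"
  using open_map_fo openin_chamber unfolding open_map_def by blast

text \<open>Injective by \<open>chamber_word\<close> and open because \<open>fo\<close> is; from
  here on a chamber is studied through its ordered lifts.\<close>

lemma homeomorphic_map_chamber:
  assumes r: "r \<in> words"
  shows "homeomorphic_map (subtopology OC (chamber r)) (subtopology CX (fo ` chamber r)) fo"
proof (rule bijective_open_imp_homeomorphic_map)
  have t: "topspace (subtopology OC (chamber r)) = chamber r"
    using openin_subset[OF openin_chamber[OF r]] by auto
  have t': "topspace (subtopology CX (fo ` chamber r)) = fo ` chamber r"
    using openin_subset[OF openin_chamber_image[OF r]] by auto
  show "continuous_map (subtopology OC (chamber r)) (subtopology CX (fo ` chamber r)) fo"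
    using continuous_map_fo by (auto simp: continuous_map_in_subtopology continuous_map_from_subtopology)
  show "fo ` topspace (subtopology OC (chamber r)) = topspace (subtopology CX (fo ` chamber r))"
    unfolding t t' ..
  show "inj_on fo (topspace (subtopology OC (chamber r)))"
    unfolding t using chamber_word(2)[OF r r] by (rule inj_onI)
  show "open_map (subtopology OC (chamber r)) (subtopology CX (fo ` chamber r)) fo"
    unfolding open_map_def
  proof (intro allI impI)
    fix V assume V: "openin (subtopology OC (chamber r)) V"
    then have "openin OC V" "V \<subseteq> chamber r"
      using openin_open_subtopology[OF openin_chamber[OF r]] by auto
    then show "openin (subtopology CX (fo ` chamber r)) (fo ` V)"
      using open_map_fo openin_open_subtopology[OF openin_chamber_image[OF r]] by (simp add: open_map_def image_mono)
  qed
qed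

lemma distinct_reals_eq: "distinct_reals = (\<Union>r\<in>words. fo ` chamber r)"
proof (intro equalityI subsetI)
  fix Z assume "Z \<in> distinct_reals"
  then obtain z where z: "Z = fo z" "z \<in> topspace OC" "inj_on Re (z ` lab)"
    by (auto simp: distinct_reals_def topspace_CX pts_fo)
  have "inj_on (\<lambda>a. Re (z a)) lab"
    using comp_inj_on[of z lab Re] z by (simp add: topspace_OC o_def)
  then obtain b where b: "bij_betw b {..<m} lab" "\<And>i j. i < j \<Longrightarrow> j < m \<Longrightarrow> Re (z (b i)) < Re (z (b j))"
    using real_enumeration_exists[OF finite_lab, of "\<lambda>a. Re (z a)"] unfolding card_lab by blast
  \<comment> \<open>\<open>b\<close> lists the labels by increasing real part and \<open>r\<close>
    records their colors. Moving the points to the slots of \<open>r\<close> changes only ranks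
    within a color, so the unordered configuration is the same.\<close>
  define r where "r = map (\<lambda>j. fst (b j)) [0..<m]"
  have bl: "b j \<in> lab" if "j < m" for j
    using b(1) that by (auto simp: bij_betw_def)
  have "count_list r i = c i" if i: "i \<in> {1..l}" for i
  proof -
    have "count_list r i = card {j. j < m \<and> fst (b j) = i}"
      unfolding count_list_card by (intro arg_cong[of _ _ card]) (auto simp: r_def)
    also have "\<dots> = card (b ` {j. j < m \<and> fst (b j) = i})"
      by (rule card_image[symmetric], rule inj_on_subset[of b "{..<m}"]) (use b(1) in \<open>auto simp: bij_betw_def\<close>)
    also have "b ` {j. j < m \<and> fst (b j) = i} = Pair i ` {..<c i}"
    proof (intro equalityI subsetI)
      fix a assume "a \<in> b ` {j. j < m \<and> fst (b j) = i}"
      then obtain j where "a = b j" "j < m" "fst (b j) = i"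
        by auto
      then show "a \<in> Pair i ` {..<c i}"
        using bl[of j] by (cases a) (auto simp: point_labels_def)
    next
      fix a assume "a \<in> Pair i ` {..<c i}"
      then have a: "a \<in> lab" "fst a = i"
        using i by (auto simp: point_labels_def)
      then obtain j where "j < m" "a = b j"
        using b(1) by (auto simp: bij_betw_def)
      then show "a \<in> b ` {j. j < m \<and> fst (b j) = i}"
        using a by auto
    qed
    also have "card (Pair i ` {..<c i}) = c i"
      by (simp add: card_image inj_on_def)
    finally show ?thesis .
  qed
  moreover have "set r \<subseteq> {1..l}"
  proof
    fix i assume "i \<in> set r"
    then obtain j where "j < m" "i = fst (b j)"
      by (auto simp: r_def)
    then show "i \<in> {1..l}"
      using bl[of j] by (cases "b j") (auto simp: point_labels_def)
  qed
  ultimately have r: "r \<in> words"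
    by (simp add: color_words_def r_def)
  let ?w = "arrange r (\<lambda>j. z (b j))"
  have "?w \<in> chamber r"
  proof (rule chamberI[OF r])
    show "?w \<in> extensional lab"
      by (simp add: arrange_def)
    show "?w (slot r j) \<in> square" if "j < m" for j
      using z(2) bl[OF that] that r by (auto simp: topspace_OC)
    show "Re (?w (slot r j)) < Re (?w (slot r (Suc j)))" if "Suc j < m" for j
      using b(2)[of j "Suc j"] that r by simp
  qed
  moreover have "fo ?w = fo z"
  proof
    fix i
    have "fo z i = z ` {a \<in> lab. fst a = i}"
      by (force simp: fo_eq)
    moreover have "{a \<in> lab. fst a = i} = b ` {j. j < m \<and> fst (b j) = i}"
    proof (intro equalityI subsetI)
      fix a assume a: "a \<in> {a \<in> lab. fst a = i}"
      then obtain j where "j < m" "a = b j"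
        using b(1) by (auto simp: bij_betw_def)
      then show "a \<in> b ` {j. j < m \<and> fst (b j) = i}"
        using a by auto
    qed (use bl in auto)
    ultimately show "fo ?w i = fo z i"
      unfolding fo_arrange[OF r] by (auto simp: place_points_def r_def)
  qed
  ultimately show "Z \<in> (\<Union>r\<in>words. fo ` chamber r)"
    using r z(1) by (metis UN_I image_eqI)
next
  fix Z assume "Z \<in> (\<Union>r\<in>words. fo ` chamber r)"
  then obtain r z where rz: "r \<in> words" "z \<in> chamber r" "Z = fo z"
    by auto
  have "a = b \<or> Re (z a) \<noteq> Re (z b)" if ab: "a \<in> lab" "b \<in> lab" for a b
  proof -
    obtain i where i: "i < m" "a = slot r i"
      by (rule slot_cases[OF rz(1) ab(1)])
    obtain j where j: "j < m" "b = slot r j"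
      by (rule slot_cases[OF rz(1) ab(2)])
    show ?thesis
      using chamber_less[OF rz(2), of i j] chamber_less[OF rz(2), of j i] i j by (cases i j rule: linorder_cases) auto
  qed
  then show "Z \<in> distinct_reals"
    using chamber_OC[OF rz(2)] rz(3) inj_on_Re_OC[OF chamber_OC[OF rz(2)]]
    by (auto simp: distinct_reals_def topspace_CX pts_fo)
qed

end

section \<open>Each chamber is a simplex modulo its boundary\<close>

text \<open>A step of \<open>\<epsilon>\<close> in the coordinates of a necklace is
  \<open>2 * \<epsilon>\<close> in the square, whence the factor 2: up to \<open>m\<close> forced
  steps together stay below \<open>e\<close>. The bound on \<open>e\<close> is consumed in
  \<open>sum_excess\<close>.\<close>

locale necklace = configurations l c for l c +
  fixes r :: "nat list" and e \<epsilon> :: real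
  assumes r: "r \<in> color_words l c" and \<epsilon>: "0 < \<epsilon>" "2 * real (coloring_size l c) * \<epsilon> < e"
    and e: "(real (coloring_size l c) + 1) * e \<le> 1"
begin

text \<open>The part of the unit interval left to the simplex coordinates after \<open>m - 1\<close>
  forced spacings of size \<open>\<epsilon>\<close>.\<close>

definition \<kappa> :: real where
  "\<kappa> = 1 - (real m - 1) * \<epsilon>"

lemma e_pos: "0 < e"
  using \<epsilon> by (smt (verit) mult_nonneg_nonneg of_nat_0_le_iff)

lemma e_le_1: "e \<le> 1"
proof -
  have "1 * e \<le> (real m + 1) * e"
    using e_pos by (intro mult_right_mono) auto
  then show ?thesis
    using e by simp
qed

lemma \<kappa>_pos: "0 < \<kappa>"
proof -
  have "(real m - 1) * \<epsilon> \<le> real m * \<epsilon>"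
    using \<epsilon>(1) by (intro mult_right_mono) auto
  then show ?thesis
    unfolding \<kappa>_def using \<epsilon>(2) e_le_1 by linarith
qed

text \<open>The lift of \<open>necklace_simplex\<close> to ordered configurations.\<close>

definition beads :: "(nat \<Rightarrow> real) \<Rightarrow> nat \<times> nat \<Rightarrow> complex" where
  "beads x = arrange r (\<lambda>j. complex_of_real (- 1 + 2 * necklace_coords m \<epsilon> x j))"

lemma beads_slot: "j < m \<Longrightarrow> beads x (slot r j) = complex_of_real (- 1 + 2 * (\<kappa> * (\<Sum>k\<le>j. x k) + real j * \<epsilon>))"
  by (simp add: beads_def r necklace_coords_def \<kappa>_def)

lemma simplex_partial_sum:
  assumes "x \<in> standard_simplex m" "j \<le> m"
  shows "0 \<le> (\<Sum>k\<le>j. x k)" "(\<Sum>k\<le>j. x k) \<le> 1"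
proof -
  have nn: "0 \<le> x k" for k
    using assms(1) by (auto simp: standard_simplex_def)
  show "0 \<le> (\<Sum>k\<le>j. x k)"
    by (rule sum_nonneg) (rule nn)
  have "(\<Sum>k\<le>j. x k) \<le> (\<Sum>k\<le>m. x k)"
    using assms(2) nn by (intro sum_mono2) auto
  then show "(\<Sum>k\<le>j. x k) \<le> 1"
    using assms(1) by (simp add: standard_simplex_def)
qed

lemma beads_chamber:
  assumes x: "x \<in> standard_simplex m"
  shows "beads x \<in> chamber r"
proof (rule chamberI[OF r])
  show "beads x \<in> extensional lab"
    by (simp add: beads_def arrange_def)
  show "beads x (slot r j) \<in> square" if j: "j < m" for j
  proof -
    note s = simplex_partial_sum[OF x, of j]
    have "\<kappa> * (\<Sum>k\<le>j. x k) \<le> \<kappa> * 1"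
      using s j \<kappa>_pos by (intro mult_left_mono) auto
    moreover have "0 \<le> \<kappa> * (\<Sum>k\<le>j. x k)"
      using s j \<kappa>_pos by simp
    moreover have "real j * \<epsilon> \<le> (real m - 1) * \<epsilon>"
      using j \<epsilon>(1) by (intro mult_right_mono) auto
    moreover have "0 \<le> real j * \<epsilon>"
      using \<epsilon>(1) by simp
    moreover have "\<kappa> + (real m - 1) * \<epsilon> = 1"
      by (simp add: \<kappa>_def)
    ultimately have "0 \<le> \<kappa> * (\<Sum>k\<le>j. x k) + real j * \<epsilon>" "\<kappa> * (\<Sum>k\<le>j. x k) + real j * \<epsilon> \<le> 1"
      by linarith+
    then show ?thesis
      by (simp add: beads_slot[OF j] square_def)
  qed
  show "Re (beads x (slot r j)) < Re (beads x (slot r (Suc j)))" if j: "Suc j < m" for j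
  proof -
    have "0 \<le> \<kappa> * x (Suc j)"
      using x \<kappa>_pos by (auto simp: standard_simplex_def)
    then show ?thesis
      using j \<epsilon>(1) by (simp add: beads_slot algebra_simps)
  qed
qed

lemma topspace_chamber: "topspace (subtopology OC (chamber r)) = chamber r"
  using openin_subset[OF openin_chamber[OF r]] by auto

lemma continuous_map_into_chamber:
  assumes "\<And>j. j < m \<Longrightarrow> continuous_map Y euclidean (\<lambda>y. f y (slot r j))" "\<And>y. y \<in> topspace Y \<Longrightarrow> f y \<in> chamber r"
  shows "continuous_map Y (subtopology OC (chamber r)) f"
proof -
  have "continuous_map Y OC f"
  proof (rule continuous_map_into_OC)
    show "continuous_map Y euclidean (\<lambda>y. f y a)" if a: "a \<in> lab" for a
      using slot_cases[OF r a] assms(1) by metis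
  qed (use assms(2) chamber_OC in auto)
  then show ?thesis
    using assms(2) by (auto simp: continuous_map_in_subtopology)
qed

lemma continuous_map_simplex_coordinate: "continuous_map (simplex_space p) euclideanreal (\<lambda>x. x k)"
  by (intro continuous_map_from_subtopology continuous_map_product_projection) auto

lemma continuous_map_beads: "continuous_map (simplex_space m) (subtopology OC (chamber r)) beads"
proof (rule continuous_map_into_chamber)
  fix j assume j: "j < m"
  have "continuous_map (simplex_space m) euclidean (\<lambda>x. complex_of_real (- 1 + 2 * (\<kappa> * (\<Sum>k\<le>j. x k) + real j * \<epsilon>)))"
    using continuous_map_simplex_coordinate[of m] unfolding continuous_map_atin
    by (auto intro!: tendsto_intros)
  then show "continuous_map (simplex_space m) euclidean (\<lambda>x. beads x (slot r j))"
    by (simp add: beads_slot[OF j])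
qed (use beads_chamber in simp)

text \<open>The real parts from left to right, with the two vertical sides added as positions 0 and
  \<open>m + 1\<close>; the index shift makes all gaps, outer ones included, differences of
  neighbours.\<close>

definition edge :: "(nat \<times> nat \<Rightarrow> complex) \<Rightarrow> nat \<Rightarrow> real" where
  "edge z j = (if j = 0 then - 1 else if j \<le> m then Re (z (slot r (j - 1))) else 1)"

definition gap :: "(nat \<times> nat \<Rightarrow> complex) \<Rightarrow> nat \<Rightarrow> real" where
  "gap z j = edge z (Suc j) - edge z j"

text \<open>Subtracting \<open>e\<close> from the inner gaps puts all configurations with two neighbours that are
  horizontally closer than \<open>e\<close> on the boundary of the simplex.  Since \<open>(m + 1) e \<le> 1\<close>, the excesses
  cannot all vanish.\<close>

definition excess :: "(nat \<times> nat \<Rightarrow> complex) \<Rightarrow> nat \<Rightarrow> real" where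
  "excess z j = max 0 (gap z j - (if 0 < j \<and> j < m then e else 0))"

definition gap_map :: "(nat \<times> nat \<Rightarrow> complex) \<Rightarrow> nat \<Rightarrow> real" where
  "gap_map z j = (if j \<le> m then excess z j / (\<Sum>k\<le>m. excess z k) else 0)"

text \<open>The gaps telescope to the width 2, and the thresholds take away at most
  \<open>(m + 1) * e\<close>, which is at most 1. So the denominator of \<open>gap_map\<close> stays
  away from 0.\<close>

lemma sum_excess: "1 \<le> (\<Sum>k\<le>m. excess z k)"
proof -
  have "(\<Sum>k\<le>m. gap z k) = edge z (Suc m) - edge z 0"
    unfolding gap_def lessThan_Suc_atMost[symmetric] by (rule sum_lessThan_telescope)
  also have "\<dots> = 2"
    by (simp add: edge_def)
  finally have "(\<Sum>k\<le>m. gap z k) = 2" .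
  moreover have "(\<Sum>k\<le>m. if 0 < k \<and> k < m then e else 0) \<le> (\<Sum>k\<le>m. e)"
    using e_pos by (intro sum_mono) auto
  moreover have "(\<Sum>k\<le>m. e) \<le> 1"
    using e by (simp add: algebra_simps)
  moreover have "(\<Sum>k\<le>m. gap z k - (if 0 < k \<and> k < m then e else 0)) \<le> (\<Sum>k\<le>m. excess z k)"
    unfolding excess_def by (intro sum_mono) auto
  ultimately show ?thesis
    unfolding sum_subtractf by linarith
qed

lemma excess_nonneg: "0 \<le> excess z k"
  by (simp add: excess_def)

lemma gap_map_simplex: "gap_map z \<in> standard_simplex m"
proof -
  have pos: "0 < (\<Sum>k\<le>m. excess z k)"
    using sum_excess[of z] by linarith
  have nn: "0 \<le> gap_map z j" for j
    using pos excess_nonneg[of z j] by (simp add: gap_map_def)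
  have "(\<Sum>j\<le>m. gap_map z j) = (\<Sum>j\<le>m. excess z j) / (\<Sum>k\<le>m. excess z k)"
    unfolding sum_divide_distrib by (intro sum.cong) (auto simp: gap_map_def)
  then have s: "(\<Sum>j\<le>m. gap_map z j) = 1"
    using pos by simp
  have "gap_map z j \<le> 1" for j
  proof (cases "j \<le> m")
    case True
    then show ?thesis
      using member_le_sum[of j "{..m}" "gap_map z"] nn s by simp
  qed (simp add: gap_map_def)
  then show ?thesis
    using nn s by (simp add: standard_simplex_def gap_map_def)
qed

lemma gap_map_0: "excess z j = 0 \<Longrightarrow> gap_map z j = 0"
  by (simp add: gap_map_def)

lemma continuous_map_gap_map: "continuous_map (subtopology OC (chamber r)) (simplex_space m) gap_map"
proof -
  let ?W = "subtopology OC (chamber r)"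
  have edge: "continuous_map ?W euclideanreal (\<lambda>z. edge z j)" for j
  proof (cases "j = 0 \<or> \<not> j \<le> m")
    case False
    then have "continuous_map ?W euclidean (\<lambda>z. z (slot r (j - 1)))"
      by (intro continuous_map_from_subtopology continuous_map_OC_proj slot_lab[OF r]) auto
    then have "continuous_map ?W euclideanreal (\<lambda>z. Re (z (slot r (j - 1))))"
      by (auto intro!: continuous_map_compose[of ?W euclidean _ euclidean Re, unfolded o_def] continuous_intros)
    then show ?thesis
      using False by (simp add: edge_def)
  qed (auto simp: edge_def)
  have excess: "continuous_map ?W euclideanreal (\<lambda>z. excess z j)" for j
    unfolding excess_def gap_def by (intro continuous_intros continuous_map_real_max edge) auto
  have "continuous_map ?W euclideanreal (\<lambda>z. gap_map z j)" for j
  proof (cases "j \<le> m")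
    case True
    have "(\<Sum>k\<le>m. excess z k) \<noteq> 0" for z
      using sum_excess[of z] by linarith
    then have "continuous_map ?W euclideanreal (\<lambda>z. excess z j / (\<Sum>k\<le>m. excess z k))"
      by (intro continuous_map_real_divide excess continuous_map_sum) auto
    then show ?thesis
      using True by (simp add: gap_map_def)
  qed (simp add: gap_map_def)
  then show ?thesis
    using gap_map_simplex by (auto simp: continuous_map_in_subtopology continuous_map_componentwise_UNIV)
qed

definition far_chamber :: "(nat \<times> nat \<Rightarrow> complex) set" where
  "far_chamber = {z \<in> chamber r. fo z \<in> far_from e}"

lemma fo_far_from:
  assumes z: "z \<in> topspace OC"
  shows "fo z \<in> far_from e' \<longleftrightarrow> (\<exists>a\<in>lab. \<bar>Re (z a)\<bar> = 1) \<or> (\<exists>a\<in>lab. \<exists>b\<in>lab. a \<noteq> b \<and> dist (z a) (z b) < e')"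
proof -
  have "fo z \<in> topspace CX"
    using z by (simp add: topspace_CX)
  moreover have "z a \<noteq> z b \<longleftrightarrow> a \<noteq> b" if "a \<in> lab" "b \<in> lab" for a b
    using OC_distinct[OF z that] by auto
  ultimately show ?thesis
    unfolding far_from_def close_points_def Conf_side_iff Un_iff mem_Collect_eq pts_fo bex_simps by blast
qed

text \<open>Real parts increase along the slots, so as soon as some point touches a vertical side
  the outermost point does.\<close>

lemma far_cases:
  assumes "z \<in> far_chamber"
  obtains "0 < m" "Re (z (slot r 0)) = - 1" | "0 < m" "Re (z (slot r (m - 1))) = 1"
    | i j where "i < j" "j < m" "dist (z (slot r i)) (z (slot r j)) < e"
proof -
  have z: "z \<in> chamber r" and zO: "z \<in> topspace OC"
    using assms chamber_OC by (auto simp: far_chamber_def)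
  have sq: "- 1 \<le> Re (z (slot r j)) \<and> Re (z (slot r j)) \<le> 1" if "j < m" for j
  proof -
    have "z (slot r j) \<in> square"
      using zO slot_lab[OF r that] by (auto simp: topspace_OC)
    then show ?thesis
      by (auto simp: square_def)
  qed
  have "fo z \<in> far_from e"
    using assms by (simp add: far_chamber_def)
  then consider a where "a \<in> lab" "\<bar>Re (z a)\<bar> = 1" | a b where "a \<in> lab" "b \<in> lab" "a \<noteq> b" "dist (z a) (z b) < e"
    unfolding fo_far_from[OF zO] by blast
  then show ?thesis
  proof cases
    case 1
    obtain j where j: "j < m" "a = slot r j"
      by (rule slot_cases[OF r 1(1)])
    have "Re (z (slot r j)) = - 1 \<or> Re (z (slot r j)) = 1"
      using 1(2) j(2) by (auto simp: abs_if split: if_splits)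
    then show ?thesis
    proof
      assume "Re (z (slot r j)) = - 1"
      then have "Re (z (slot r 0)) = - 1"
        using chamber_le[OF z, of 0 j] sq[of 0] j(1) by force
      then show ?thesis
        using that(1) j(1) by simp
    next
      assume "Re (z (slot r j)) = 1"
      then have "Re (z (slot r (m - 1))) = 1"
        using chamber_le[OF z, of j "m - 1"] sq[of "m - 1"] j(1) by force
      then show ?thesis
        using that(2) j(1) by simp
    qed
  next
    case 2
    obtain i where i: "i < m" "a = slot r i"
      by (rule slot_cases[OF r 2(1)])
    obtain j where j: "j < m" "b = slot r j"
      by (rule slot_cases[OF r 2(2)])
    have "i \<noteq> j"
      using 2(3) i j by auto
    then consider "i < j" | "j < i"
      by linarith
    then show ?thesis
    proof cases
      case 1
      then show ?thesis
        using that(3)[of i j] i j 2(4) by simp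
    next
      case 2
      then show ?thesis
        using that(3)[of j i] i j \<open>dist (z a) (z b) < e\<close> by (simp add: dist_commute)
    qed
  qed
qed

lemma far_chamberI:
  assumes z: "z \<in> chamber r"
    and "(0 < m \<and> Re (z (slot r 0)) = - 1) \<or> (0 < m \<and> Re (z (slot r (m - 1))) = 1) \<or>
      (\<exists>i j. i < j \<and> j < m \<and> dist (z (slot r i)) (z (slot r j)) < e)"
  shows "z \<in> far_chamber"
proof -
  note zO = chamber_OC[OF z]
  have "(\<exists>a\<in>lab. \<bar>Re (z a)\<bar> = 1) \<or> (\<exists>a\<in>lab. \<exists>b\<in>lab. a \<noteq> b \<and> dist (z a) (z b) < e)"
    using assms(2)
  proof (elim disjE conjE exE)
    assume "0 < m" "Re (z (slot r 0)) = - 1"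
    then show ?thesis
      using slot_lab[OF r, of 0] by (intro disjI1 bexI[of _ "slot r 0"]) auto
  next
    assume "0 < m" "Re (z (slot r (m - 1))) = 1"
    then show ?thesis
      using slot_lab[OF r, of "m - 1"] by (intro disjI1 bexI[of _ "slot r (m - 1)"]) auto
  next
    fix i j assume "i < j" "j < m" "dist (z (slot r i)) (z (slot r j)) < e"
    then show ?thesis
      using slot_lab[OF r, of i] slot_lab[OF r, of j] slot_inj[OF r, of i j]
      by (intro disjI2 bexI[of _ "slot r i"] bexI[of _ "slot r j"]) auto
  qed
  then show ?thesis
    using z fo_far_from[OF zO] by (simp add: far_chamber_def)
qed

lemma excess_left: "0 < m \<Longrightarrow> Re (z (slot r 0)) = - 1 \<Longrightarrow> excess z 0 = 0"
  by (simp add: excess_def gap_def edge_def)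

lemma excess_right: "0 < m \<Longrightarrow> Re (z (slot r (m - 1))) = 1 \<Longrightarrow> excess z m = 0"
  by (simp add: excess_def gap_def edge_def)

text \<open>Every gap strictly inside the range from \<open>i\<close> to \<open>j\<close> is bounded
  by the difference of the outer real parts, hence by the distance.\<close>

lemma excess_inner:
  assumes z: "z \<in> chamber r" and ij: "i < k" "k \<le> j" "j < m" and d: "dist (z (slot r i)) (z (slot r j)) < e"
  shows "excess z k = 0"
proof -
  have "Re (z (slot r j)) - Re (z (slot r i)) \<le> dist (z (slot r i)) (z (slot r j))"
    using complex_Re_le_cmod[of "z (slot r j) - z (slot r i)"] by (simp add: dist_norm norm_minus_commute)
  moreover have "Re (z (slot r k)) \<le> Re (z (slot r j))" "Re (z (slot r i)) \<le> Re (z (slot r (k - 1)))"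
    using chamber_le[OF z] ij by auto
  ultimately have "gap z k < e"
    using d ij by (simp add: gap_def edge_def)
  then show ?thesis
    using ij by (simp add: excess_def)
qed

lemma gap_map_far: "gap_map \<in> far_chamber \<rightarrow> simplex_boundary m"
proof
  fix z assume z: "z \<in> far_chamber"
  then have zc: "z \<in> chamber r"
    by (simp add: far_chamber_def)
  have "\<exists>k\<le>m. excess z k = 0"
    using z
  proof (cases rule: far_cases)
    case 1
    then show ?thesis
      using excess_left by (intro exI[of _ 0]) simp
  next
    case 2
    then show ?thesis
      using excess_right by (intro exI[of _ m]) simp
  next
    case (3 i j)
    then show ?thesis
      using excess_inner[OF zc, of i j j] by (intro exI[of _ j]) simp
  qed
  then show "gap_map z \<in> simplex_boundary m"
    using gap_map_simplex gap_map_0 by (auto simp: simplex_boundary_def)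
qed

lemma beads_gap:
  assumes x: "x \<in> standard_simplex m" and m0: "0 < m"
  shows "gap (beads x) 0 = 2 * \<kappa> * x 0"
    "0 < k \<Longrightarrow> k < m \<Longrightarrow> gap (beads x) k = 2 * (\<kappa> * x k + \<epsilon>)"
    "gap (beads x) m = 2 * \<kappa> * x m"
proof -
  show "gap (beads x) 0 = 2 * \<kappa> * x 0"
    using m0 by (simp add: gap_def edge_def beads_slot)
  show "gap (beads x) k = 2 * (\<kappa> * x k + \<epsilon>)" if "0 < k" "k < m"
  proof -
    obtain k' where k': "k = Suc k'"
      using \<open>0 < k\<close> by (cases k) auto
    show ?thesis
      using that unfolding k' by (simp add: gap_def edge_def beads_slot algebra_simps)
  qed
  obtain m' where m': "m = Suc m'"
    using m0 by (cases m) auto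
  have "(\<Sum>k\<le>m'. x k) = 1 - x m"
    using x by (simp add: standard_simplex_def m')
  then show "gap (beads x) m = 2 * \<kappa> * x m"
  proof -
    assume sum: "(\<Sum>k\<le>m'. x k) = 1 - x m"
    have b: "Re (beads x (slot r (m - 1))) = - 1 + 2 * (\<kappa> * (1 - x m) + real m' * \<epsilon>)"
      using beads_slot[of m' x] sum m' by simp
    have "\<kappa> + real m' * \<epsilon> = 1"
      by (simp add: \<kappa>_def m')
    moreover have "gap (beads x) m = 2 * (1 - (\<kappa> + real m' * \<epsilon>)) + 2 * \<kappa> * x m"
      using m0 by (simp only: gap_def edge_def b) (simp add: algebra_simps)
    ultimately show ?thesis
      by simp
  qed
qed

text \<open>With \<open>x k = 0\<close> an outer gap is 0 and an inner gap is
  \<open>2 * \<epsilon>\<close>, below the threshold \<open>e\<close>. So the composite of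
  \<open>beads\<close> and \<open>gap_map\<close> preserves every facet.\<close>

lemma excess_beads_0:
  assumes x: "x \<in> standard_simplex m" and k: "k \<le> m" "x k = 0"
  shows "excess (beads x) k = 0"
proof -
  have m0: "0 < m"
  proof (rule ccontr)
    assume "\<not> 0 < m"
    then have "x 0 = 1"
      using x by (simp add: standard_simplex_def)
    then show False
      using k \<open>\<not> 0 < m\<close> by simp
  qed
  consider "k = 0" | "0 < k" "k < m" | "k = m"
    using k by linarith
  then show ?thesis
  proof cases
    case 2
    have "2 * \<epsilon> \<le> 2 * real m * \<epsilon>"
      using m0 \<epsilon>(1) by simp
    then have "2 * \<epsilon> < e"
      using \<epsilon>(2) by linarith
    then show ?thesis
      using 2 beads_gap(2)[OF x m0 2] k by (simp add: excess_def)
  qed (use beads_gap(1,3)[OF x m0] k m0 in \<open>auto simp: excess_def\<close>)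
qed

text \<open>If the coordinates in between vanish, only the forced spacings remain, at most
  \<open>2 * m * \<epsilon>\<close> in total.\<close>

lemma dist_beads:
  assumes x: "x \<in> standard_simplex m" and ij: "i < j" "j < m" and z: "\<And>k. i < k \<Longrightarrow> k \<le> j \<Longrightarrow> x k = 0"
  shows "dist (beads x (slot r i)) (beads x (slot r j)) < e"
proof -
  have "(\<Sum>k\<le>j. x k) = (\<Sum>k\<le>i. x k)"
    using ij z by (intro sum.mono_neutral_right) auto
  then have "beads x (slot r j) - beads x (slot r i) = complex_of_real (2 * (real j - real i) * \<epsilon>)"
    using ij by (simp add: beads_slot algebra_simps)
  then have "dist (beads x (slot r j)) (beads x (slot r i)) = \<bar>2 * (real j - real i) * \<epsilon>\<bar>"
    unfolding dist_norm by (simp only: norm_of_real)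
  then have "dist (beads x (slot r i)) (beads x (slot r j)) = 2 * (real j - real i) * \<epsilon>"
    using ij \<epsilon>(1) by (simp add: dist_commute abs_mult)
  also have "\<dots> \<le> 2 * real m * \<epsilon>"
    using ij \<epsilon>(1) by simp
  finally show ?thesis
    using \<epsilon>(2) by linarith
qed

lemma beads_left: "0 < m \<Longrightarrow> x 0 = 0 \<Longrightarrow> Re (beads x (slot r 0)) = - 1"
  by (simp add: beads_slot)

lemma beads_right:
  assumes "x \<in> standard_simplex m" "0 < m" "x m = 0"
  shows "Re (beads x (slot r (m - 1))) = 1"
  using beads_gap(3)[OF assms(1,2)] assms(2,3) by (simp add: gap_def edge_def)

lemma beads_far: "beads \<in> simplex_boundary m \<rightarrow> far_chamber"
proof
  fix x assume "x \<in> simplex_boundary m"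
  then obtain k where x: "x \<in> standard_simplex m" and k: "k \<le> m" "x k = 0"
    by (auto simp: simplex_boundary_def)
  have m0: "0 < m"
  proof (rule ccontr)
    assume "\<not> 0 < m"
    then have "x 0 = 1"
      using x by (simp add: standard_simplex_def)
    then show False
      using k \<open>\<not> 0 < m\<close> by simp
  qed
  show "beads x \<in> far_chamber"
  proof (rule far_chamberI[OF beads_chamber[OF x]])
    consider "k = 0" | "0 < k" "k < m" | "k = m"
      using k by linarith
    then show "(0 < m \<and> Re (beads x (slot r 0)) = - 1) \<or> (0 < m \<and> Re (beads x (slot r (m - 1))) = 1) \<or>
      (\<exists>i j. i < j \<and> j < m \<and> dist (beads x (slot r i)) (beads x (slot r j)) < e)"
    proof cases
      case 1
      then show ?thesis
        using k m0 beads_left by simp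
    next
      case 2
      have "x k' = 0" if "k - 1 < k'" "k' \<le> k" for k'
      proof -
        have "k' = k"
          using that by linarith
        then show ?thesis
          using k by simp
      qed
      then have "dist (beads x (slot r (k - 1))) (beads x (slot r k)) < e"
        using 2 by (intro dist_beads[OF x]) auto
      then show ?thesis
        using 2 by (intro disjI2 exI[of _ "k - 1"] exI[of _ k]) auto
    next
      case 3
      then show ?thesis
        using k m0 beads_right[OF x] by simp
    qed
  qed
qed

section \<open>Straight-line homotopies in a chamber\<close>

definition blend :: "real \<Rightarrow> (nat \<times> nat \<Rightarrow> complex) \<Rightarrow> (nat \<times> nat \<Rightarrow> complex) \<Rightarrow> nat \<times> nat \<Rightarrow> complex" where
  "blend t z w = (\<lambda>a\<in>lab. of_real (1 - t) * z a + of_real t * w a)"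

lemma blend_slot: "j < m \<Longrightarrow> blend t z w (slot r j) = of_real (1 - t) * z (slot r j) + of_real t * w (slot r j)"
  using slot_lab[OF r] by (simp add: blend_def)

lemma Re_blend_slot: "j < m \<Longrightarrow> Re (blend t z w (slot r j)) = (1 - t) * Re (z (slot r j)) + t * Re (w (slot r j))"
  by (simp add: blend_slot)

lemma convex_combination_bound:
  fixes t a b B :: real
  assumes "t \<in> {0..1}" "a \<le> B" "b \<le> B"
  shows "(1 - t) * a + t * b \<le> B"
proof -
  have "(1 - t) * a + t * b \<le> (1 - t) * B + t * B"
    using assms by (intro add_mono mult_left_mono) auto
  then show ?thesis
    by (simp add: algebra_simps)
qed

lemma convex_combination_strict:
  fixes t a b B :: real
  assumes "t \<in> {0..1}" "a < B" "b < B"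
  shows "(1 - t) * a + t * b < B"
  using convex_combination_bound[OF assms(1), of a "max a b" b] assms(2,3) by simp

text \<open>Strict inequalities between successive real parts survive convex combinations, and they
  already force the points to be distinct.\<close>

lemma blend_chamber:
  assumes t: "t \<in> {0..1}" and z: "z \<in> chamber r" and w: "w \<in> chamber r"
  shows "blend t z w \<in> chamber r"
proof (rule chamberI[OF r])
  show "blend t z w \<in> extensional lab"
    by (simp add: blend_def)
  show "blend t z w (slot r j) \<in> square" if j: "j < m" for j
  proof -
    have "z (slot r j) \<in> square" "w (slot r j) \<in> square"
      using chamber_OC[OF z] chamber_OC[OF w] slot_lab[OF r j] by (auto simp: topspace_OC)
    then show ?thesis
      using convex_combination_bound[OF t, of "Re (z (slot r j))" 1 "Re (w (slot r j))"]
        convex_combination_bound[OF t, of "- Re (z (slot r j))" 1 "- Re (w (slot r j))"]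
        convex_combination_bound[OF t, of "Im (z (slot r j))" 1 "Im (w (slot r j))"]
        convex_combination_bound[OF t, of "- Im (z (slot r j))" 1 "- Im (w (slot r j))"]
      by (simp add: blend_slot[OF j] square_def abs_le_iff)
  qed
  show "Re (blend t z w (slot r j)) < Re (blend t z w (slot r (Suc j)))" if j: "Suc j < m" for j
  proof -
    have "Re (z (slot r j)) - Re (z (slot r (Suc j))) < 0" "Re (w (slot r j)) - Re (w (slot r (Suc j))) < 0"
      using chamber_less[OF z, of j "Suc j"] chamber_less[OF w, of j "Suc j"] j by auto
    from convex_combination_strict[OF t this] show ?thesis
      using j by (simp add: Re_blend_slot algebra_simps)
  qed
qed

lemma continuous_map_blend:
  assumes "continuous_map Y (subtopology OC (chamber r)) f" "continuous_map Y (subtopology OC (chamber r)) g"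
  shows "continuous_map (prod_topology (top_of_set {0..1}) Y) (subtopology OC (chamber r)) (\<lambda>(t, y). blend t (f y) (g y))"
proof (rule continuous_map_into_chamber)
  let ?IY = "prod_topology (top_of_set {0..1::real}) Y"
  fix j assume j: "j < m"
  have p: "continuous_map (subtopology OC (chamber r)) euclidean (\<lambda>z. z (slot r j))"
    by (intro continuous_map_from_subtopology continuous_map_OC_proj slot_lab[OF r j])
  have 1: "continuous_map ?IY euclideanreal fst"
    by (rule continuous_map_into_fulltopology[OF continuous_map_fst])
  have 2: "continuous_map ?IY euclidean (\<lambda>p. h (snd p) (slot r j))" if "continuous_map Y (subtopology OC (chamber r)) h" for h
    using continuous_map_compose[OF continuous_map_snd continuous_map_compose[OF that p]] by (simp add: o_def)
  have "continuous_map ?IY euclidean (\<lambda>p. of_real (1 - fst p) * f (snd p) (slot r j) + of_real (fst p) * g (snd p) (slot r j))"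
    using 1 2[OF assms(1)] 2[OF assms(2)] unfolding continuous_map_atin by (auto intro!: tendsto_intros)
  then show "continuous_map ?IY euclidean (\<lambda>y. (case y of (t, y) \<Rightarrow> blend t (f y) (g y)) (slot r j))"
    by (simp add: case_prod_unfold blend_slot[OF j])
next
  show "(case y of (t, y) \<Rightarrow> blend t (f y) (g y)) \<in> chamber r" if y': "y \<in> topspace (prod_topology (top_of_set {0..1}) Y)" for y
  proof -
    obtain t x where y: "y = (t, x)" "t \<in> {0..1}" "x \<in> topspace Y"
      using y' by auto
    have "f x \<in> chamber r" "g x \<in> chamber r"
      using assms y(3) by (auto simp: continuous_map_def Pi_iff topspace_chamber)
    then show ?thesis
      using blend_chamber y by simp
  qed
qed

lemma blend_ends:
  assumes "z \<in> topspace OC" "w \<in> topspace OC"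
  shows "blend 0 z w = z" "blend 1 z w = w"
proof -
  show "blend 0 z w = z"
  proof
    fix a show "blend 0 z w a = z a"
      using OC_arb[OF assms(1), of a] by (simp add: blend_def restrict_def)
  qed
  show "blend 1 z w = w"
  proof
    fix a show "blend 1 z w a = w a"
      using OC_arb[OF assms(2), of a] by (simp add: blend_def restrict_def)
  qed
qed

text \<open>\<open>far_chamber\<close> is not convex, but \<open>z\<close> and its image lie in it
  for the same reason: the same outermost point touches the same side, or the same two points are
  closer than \<open>e\<close>. Each of these conditions is convex.\<close>

lemma blend_far:
  assumes t: "t \<in> {0..1}" and z: "z \<in> far_chamber"
  shows "blend t (beads (gap_map z)) z \<in> far_chamber"
proof (rule far_chamberI)
  have zc: "z \<in> chamber r"
    using z by (simp add: far_chamber_def)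
  note gm = gap_map_simplex[of z]
  show "blend t (beads (gap_map z)) z \<in> chamber r"
    by (rule blend_chamber[OF t beads_chamber[OF gm] zc])
  let ?b = "blend t (beads (gap_map z)) z"
  show "(0 < m \<and> Re (?b (slot r 0)) = - 1) \<or> (0 < m \<and> Re (?b (slot r (m - 1))) = 1) \<or>
      (\<exists>i j. i < j \<and> j < m \<and> dist (?b (slot r i)) (?b (slot r j)) < e)"
    using z
  proof (cases rule: far_cases)
    case 1
    have "Re (beads (gap_map z) (slot r 0)) = - 1"
      by (rule beads_left[where x = "gap_map z", OF 1(1) gap_map_0[OF excess_left[where z = z, OF 1]]])
    then show ?thesis
      using 1 by (simp add: Re_blend_slot)
  next
    case 2
    have "Re (beads (gap_map z) (slot r (m - 1))) = 1"
      by (rule beads_right[OF gm 2(1) gap_map_0[OF excess_right[where z = z, OF 2]]])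
    then show ?thesis
      using 2 by (simp add: Re_blend_slot)
  next
    case (3 i j)
    have "gap_map z k = 0" if "i < k" "k \<le> j" for k
      by (rule gap_map_0[OF excess_inner[OF zc that 3(2,3)]])
    then have d: "dist (beads (gap_map z) (slot r i)) (beads (gap_map z) (slot r j)) < e"
      by (rule dist_beads[OF gm 3(1,2)])
    have "?b (slot r i) - ?b (slot r j) = of_real (1 - t) * (beads (gap_map z) (slot r i) - beads (gap_map z) (slot r j))
        + of_real t * (z (slot r i) - z (slot r j))"
      using 3 by (simp add: blend_slot algebra_simps)
    then have "dist (?b (slot r i)) (?b (slot r j)) \<le>
        norm (of_real (1 - t) * (beads (gap_map z) (slot r i) - beads (gap_map z) (slot r j)))
        + norm (of_real t * (z (slot r i) - z (slot r j)))"
      unfolding dist_norm by (metis norm_triangle_ineq)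
    also have "\<dots> = (1 - t) * dist (beads (gap_map z) (slot r i)) (beads (gap_map z) (slot r j)) + t * dist (z (slot r i)) (z (slot r j))"
      using t by (simp add: norm_mult dist_norm del: of_real_diff)
    also have "\<dots> < e"
      by (rule convex_combination_strict[OF t d 3(3)])
    finally show ?thesis
      using 3 by blast
  qed
qed

text \<open>\<open>beads\<close> and \<open>gap_map\<close> are homotopy inverse maps of pairs:
  straight lines join both composites to the identity, by \<open>excess_beads_0\<close> on the
  simplex and by \<open>blend_far\<close> on the chamber.\<close>

theorem chamber_simplex_pair:
  "simplex_pair m (subtopology OC (chamber r)) far_chamber (restrict beads (standard_simplex m))"
proof -
  let ?W = "subtopology OC (chamber r)"
  have h1: "homotopic_with (\<lambda>h. h \<in> simplex_boundary m \<rightarrow> simplex_boundary m) (simplex_space m) (simplex_space m) (gap_map \<circ> beads) id"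
  proof (rule homotopic_with_linear[OF continuous_map_compose[OF continuous_map_beads continuous_map_gap_map] continuous_map_id refl])
    fix t :: real assume t: "t \<in> {0..1}"
    have S: "(\<lambda>i. (1 - t) * gap_map (beads x) i + t * x i) \<in> standard_simplex m" if "x \<in> standard_simplex m" for x
      using that t gap_map_simplex by (intro convex_standard_simplex) auto
    then show "(\<lambda>i. (1 - t) * (gap_map \<circ> beads) x i + t * id x i) \<in> standard_simplex m" if "x \<in> topspace (simplex_space m)" for x
      using that by simp
    show "(\<lambda>x i. (1 - t) * (gap_map \<circ> beads) x i + t * id x i) \<in> simplex_boundary m \<rightarrow> simplex_boundary m"
    proof
      fix x assume "x \<in> simplex_boundary m"
      then obtain k where x: "x \<in> standard_simplex m" and k: "k \<le> m" "x k = 0"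
        by (auto simp: simplex_boundary_def)
      have "gap_map (beads x) k = 0"
        by (rule gap_map_0[OF excess_beads_0[OF x k]])
      then show "(\<lambda>i. (1 - t) * (gap_map \<circ> beads) x i + t * id x i) \<in> simplex_boundary m"
        using S[OF x] k by (auto simp: simplex_boundary_def intro!: exI[of _ k])
    qed
  next
    fix h k :: "(nat \<Rightarrow> real) \<Rightarrow> nat \<Rightarrow> real"
    assume "\<And>x. x \<in> topspace (simplex_space m) \<Longrightarrow> h x = k x"
    moreover have "simplex_boundary m \<subseteq> topspace (simplex_space m)"
      by (auto simp: simplex_boundary_def)
    ultimately show "(h \<in> simplex_boundary m \<rightarrow> simplex_boundary m) = (k \<in> simplex_boundary m \<rightarrow> simplex_boundary m)"
      by (auto simp: Pi_iff subset_iff)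
  qed
  have far_sub: "far_chamber \<subseteq> chamber r"
    by (auto simp: far_chamber_def)
  have h2: "homotopic_with (\<lambda>h. h \<in> far_chamber \<rightarrow> far_chamber) ?W ?W (beads \<circ> gap_map) id"
  proof (subst homotopic_with)
    show "(h \<in> far_chamber \<rightarrow> far_chamber) = (k \<in> far_chamber \<rightarrow> far_chamber)" if hk: "\<And>x. x \<in> topspace ?W \<Longrightarrow> h x = k x" for h k
    proof -
      have "\<forall>z\<in>far_chamber. h z = k z"
        using hk far_sub unfolding topspace_chamber by blast
      then show ?thesis
        by (simp add: Pi_iff)
    qed
    have bg: "(beads \<circ> gap_map) z \<in> topspace OC" for z
      using chamber_OC[OF beads_chamber[OF gap_map_simplex]] by simp
    define H where "H = (\<lambda>(t, z). blend t ((beads \<circ> gap_map) z) (id z))"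
    have "continuous_map (prod_topology (top_of_set {0..1}) ?W) ?W H"
      unfolding H_def
      by (rule continuous_map_blend[OF continuous_map_compose[OF continuous_map_gap_map continuous_map_beads] continuous_map_id])
    moreover have "H (0, z) = (beads \<circ> gap_map) z \<and> H (1, z) = id z" if "z \<in> topspace ?W" for z
      using that blend_ends[OF bg, of z z] chamber_OC[of z r] by (simp add: H_def topspace_chamber)
    moreover have "H (t, z) \<in> far_chamber" if "t \<in> {0..1}" "z \<in> far_chamber" for t z
      using blend_far[OF that] by (simp add: H_def)
    ultimately show "\<exists>h. continuous_map (prod_topology (top_of_set {0..1::real}) ?W) ?W h \<and>
        (\<forall>x\<in>topspace ?W. h (0, x) = (beads \<circ> gap_map) x) \<and> (\<forall>x\<in>topspace ?W. h (1, x) = id x) \<and>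
        (\<forall>t\<in>{0..1}. (\<lambda>x. h (t, x)) \<in> far_chamber \<rightarrow> far_chamber)"
      by (intro exI[of _ H]) simp
  qed
  have "hom_induced p (simplex_space m) (simplex_boundary m) ?W far_chamber beads \<in>
      iso (relative_homology_group p (simplex_space m) (simplex_boundary m)) (relative_homology_group p ?W far_chamber)" for p
    by (rule homotopy_equivalence_relative_homology_group_isomorphism[OF continuous_map_beads beads_far continuous_map_gap_map gap_map_far h1 h2])
  then have "simplex_pair m ?W far_chamber (simplex_map m beads (top_simplex m))"
    by (rule simplex_pair_transfer[OF simplex_pair_standard continuous_map_beads beads_far])
  moreover have "simplex_map m beads (top_simplex m) = restrict beads (standard_simplex m)"
    by (auto simp: simplex_map_def top_simplex_def)
  ultimately show ?thesis
    by simp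
qed

end

section \<open>The relative homology of the configuration space\<close>

lemma flat_transport_trivial: "flat_transport X (\<lambda>_. 1)"
  by (simp add: flat_transport_def)

lemma flat_transport_subtopology:
  assumes "flat_transport X T"
  shows "flat_transport (subtopology X S) T"
  using assms by (auto simp: flat_transport_def continuous_map_in_subtopology)

lemma twisted_simplex_pair_relcycle: "twisted_simplex_pair T m X A z \<Longrightarrow> z \<in> twisted_relcycles T m X A"
  and twisted_simplex_pair_generates: "twisted_simplex_pair T m X A z \<Longrightarrow> c \<in> twisted_relcycles T m X A \<Longrightarrow>
     \<exists>r. c - chain_scale r z \<in> twisted_relboundaries T m X A"
  and twisted_simplex_pair_vanishes: "twisted_simplex_pair T m X A z \<Longrightarrow> p \<noteq> m \<Longrightarrow> c \<in> twisted_relcycles T p X A \<Longrightarrow>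
     c \<in> twisted_relboundaries T p X A"
  and twisted_simplex_pair_independent: "twisted_simplex_pair T m X A z \<Longrightarrow> chain_scale r z \<in> twisted_relboundaries T m X A \<Longrightarrow> r = 0"
  unfolding twisted_simplex_pair_def by auto

text \<open>The two maps are inverse to each other and so are the factors \<open>u\<close> and
  \<open>v\<close>, so the pushforwards are inverse on chains and each clause moves across.\<close>

lemma twisted_simplex_pair_push:
  assumes P: "twisted_simplex_pair T1 m M B z"
    and flat: "flat_transport M T1" "flat_transport Y T"
    and f: "transport_morphism M T1 T f u" "continuous_map M Y f" "f ` (topspace M \<inter> B) \<subseteq> A"
    and g: "transport_morphism Y T T1 g v" "continuous_map Y M g" "g ` (topspace Y \<inter> A) \<subseteq> B"
    and gf: "\<And>x. x \<in> topspace M \<Longrightarrow> g (f x) = x" "\<And>x. x \<in> topspace M \<Longrightarrow> u x * v (f x) = 1"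
    and fg: "\<And>y. y \<in> topspace Y \<Longrightarrow> f (g y) = y"
  shows "twisted_simplex_pair T m Y A (push m u f z)"
proof -
  have gf_id: "push p v g (push p u f c) = c" if c: "c \<in> twisted_chains p M" for p c
  proof -
    have "push p v g (push p u f c) = push p (\<lambda>x. u x * v (f x)) (g \<circ> f) c"
      by (rule push_push[OF c])
    also have "\<dots> = push p (\<lambda>_. 1) id c"
      by (rule push_cong[OF c]) (simp_all add: gf)
    finally show ?thesis
      by (simp add: push_id[OF c])
  qed
  have fg_id: "push p u f (push p v g c) = c" if c: "c \<in> twisted_chains p Y" for p c
  proof -
    have inv: "v y * u (g y) = 1" if y: "y \<in> topspace Y" for y
    proof -
      have "g y \<in> topspace M"
        using g(2) y by (auto simp: continuous_map_def Pi_iff)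
      then show ?thesis
        using gf(2)[of "g y"] fg[OF y] by (simp add: mult.commute)
    qed
    have "push p u f (push p v g c) = push p (\<lambda>y. v y * u (g y)) (f \<circ> g) c"
      by (rule push_push[OF c])
    also have "\<dots> = push p (\<lambda>_. 1) id c"
      by (rule push_cong[OF c]) (simp_all add: fg inv)
    finally show ?thesis
      by (simp add: push_id[OF c])
  qed
  have zc: "z \<in> twisted_relcycles T1 m M B"
    by (rule twisted_simplex_pair_relcycle[OF P])
  have zz: "z \<in> twisted_chains m M"
    using zc by (simp add: twisted_relcycles_def)
  show ?thesis
    unfolding twisted_simplex_pair_def
  proof (intro conjI ballI allI impI subsetI)
    show "push m u f z \<in> twisted_relcycles T m Y A"
      by (rule twisted_relcycles_push[OF flat(2) f(1) zc f(2,3)])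
  next
    fix c assume c: "c \<in> twisted_relcycles T m Y A"
    have "push m v g c \<in> twisted_relcycles T1 m M B"
      by (rule twisted_relcycles_push[OF flat(1) g(1) c g(2,3)])
    then obtain r where "push m v g c - chain_scale r z \<in> twisted_relboundaries T1 m M B"
      using twisted_simplex_pair_generates[OF P] by blast
    from twisted_relboundaries_push[OF flat(2) f(1) this f(2,3)]
    have "push m u f (push m v g c) - chain_scale r (push m u f z) \<in> twisted_relboundaries T m Y A"
      by (simp add: push_diff push_scale)
    then show "\<exists>r. c - chain_scale r (push m u f z) \<in> twisted_relboundaries T m Y A"
      using fg_id c by (auto simp: twisted_relcycles_def)
  next
    fix p c assume p: "p \<noteq> m" and c: "c \<in> twisted_relcycles T p Y A"
    have "push p v g c \<in> twisted_relcycles T1 p M B"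
      by (rule twisted_relcycles_push[OF flat(1) g(1) c g(2,3)])
    then have "push p v g c \<in> twisted_relboundaries T1 p M B"
      by (rule twisted_simplex_pair_vanishes[OF P p])
    from twisted_relboundaries_push[OF flat(2) f(1) this f(2,3)]
    show "c \<in> twisted_relboundaries T p Y A"
      using fg_id c by (simp add: twisted_relcycles_def)
  next
    fix r assume "chain_scale r (push m u f z) \<in> twisted_relboundaries T m Y A"
    from twisted_relboundaries_push[OF flat(1) g(1) this g(2,3)]
    have "chain_scale r z \<in> twisted_relboundaries T1 m M B"
      by (simp add: push_scale gf_id[OF zz])
    then show "r = 0"
      by (rule twisted_simplex_pair_independent[OF P])
  qed
qed

lemma twisted_simplex_pair_unit:
  assumes P: "twisted_simplex_pair T m X A z" and w: "w * w' = 1"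
  shows "twisted_simplex_pair T m X A (chain_scale w z)"
  unfolding twisted_simplex_pair_def
proof (intro conjI ballI allI impI subsetI)
  show "chain_scale w z \<in> twisted_relcycles T m X A"
    by (intro twisted_relcycles_scale twisted_simplex_pair_relcycle[OF P])
next
  fix c assume "c \<in> twisted_relcycles T m X A"
  then obtain r where r: "c - chain_scale r z \<in> twisted_relboundaries T m X A"
    using twisted_simplex_pair_generates[OF P] by blast
  have "chain_scale (r * w') (chain_scale w z) = chain_scale r z"
    using w by (simp add: mult.assoc mult.commute[of w'])
  then show "\<exists>r. c - chain_scale r (chain_scale w z) \<in> twisted_relboundaries T m X A"
    using r by (intro exI[of _ "r * w'"]) (simp only:)
next
  fix p c assume "p \<noteq> m" "c \<in> twisted_relcycles T p X A"
  then show "c \<in> twisted_relboundaries T p X A"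
    by (rule twisted_simplex_pair_vanishes[OF P])
next
  fix r assume "chain_scale r (chain_scale w z) \<in> twisted_relboundaries T m X A"
  then have "r * w = 0"
    by (intro twisted_simplex_pair_independent[OF P]) simp
  then have "r * (w * w') = 0"
    by (simp flip: mult.assoc)
  then show "r = 0"
    using w by simp
qed

text \<open>The version of \<open>twisted_simplex_pair\<close> with a basis indexed by
  \<open>I\<close>.\<close>

definition twisted_free ::
    "'x transport \<Rightarrow> nat \<Rightarrow> 'x topology \<Rightarrow> 'x set \<Rightarrow> 'i set \<Rightarrow> ('i \<Rightarrow> 'x tchain) \<Rightarrow> bool" where
  "twisted_free T m X A I z \<longleftrightarrow> (\<forall>i\<in>I. z i \<in> twisted_relcycles T m X A) \<and>
     (\<forall>c\<in>twisted_relcycles T m X A. \<exists>f. c - (\<Sum>i\<in>I. chain_scale (f i) (z i)) \<in> twisted_relboundaries T m X A) \<and>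
     (\<forall>p. p \<noteq> m \<longrightarrow> twisted_relcycles T p X A \<subseteq> twisted_relboundaries T p X A) \<and>
     (\<forall>f. (\<Sum>i\<in>I. chain_scale (f i) (z i)) \<in> twisted_relboundaries T m X A \<longrightarrow> (\<forall>i\<in>I. f i = 0))"

lemma twisted_free_relcycle: "twisted_free T m X A I z \<Longrightarrow> i \<in> I \<Longrightarrow> z i \<in> twisted_relcycles T m X A"
  and twisted_free_generates: "twisted_free T m X A I z \<Longrightarrow> c \<in> twisted_relcycles T m X A \<Longrightarrow>
     \<exists>f. c - (\<Sum>i\<in>I. chain_scale (f i) (z i)) \<in> twisted_relboundaries T m X A"
  and twisted_free_vanishes: "twisted_free T m X A I z \<Longrightarrow> p \<noteq> m \<Longrightarrow> c \<in> twisted_relcycles T p X A \<Longrightarrow>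
     c \<in> twisted_relboundaries T p X A"
  and twisted_free_independent: "twisted_free T m X A I z \<Longrightarrow>
     (\<Sum>i\<in>I. chain_scale (f i) (z i)) \<in> twisted_relboundaries T m X A \<Longrightarrow> i \<in> I \<Longrightarrow> f i = 0"
  unfolding twisted_free_def by simp_all blast+

section \<open>Homology of a finite disjoint union of open sets\<close>

locale disjoint_opens =
  fixes X :: "'x topology" and I :: "'i set" and U :: "'i \<Rightarrow> 'x set"
  assumes finI: "finite I" and openU: "\<And>i. i \<in> I \<Longrightarrow> openin X (U i)"
    and disjU: "\<And>i j. i \<in> I \<Longrightarrow> j \<in> I \<Longrightarrow> i \<noteq> j \<Longrightarrow> U i \<inter> U j = {}"
begin

text \<open>The image of a simplex is connected, so it cannot meet both \<open>U i\<close> and the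
  union of the other sets.\<close>

lemma simplex_in_one:
  assumes \<sigma>: "singular_simplex p (subtopology X (\<Union>i\<in>I. U i)) \<sigma>"
  obtains i where "i \<in> I" "\<sigma> ` standard_simplex p \<subseteq> U i"
proof -
  have cont: "continuous_map (simplex_space p) X \<sigma>" and im: "\<sigma> ` standard_simplex p \<subseteq> (\<Union>i\<in>I. U i)"
    using \<sigma> unfolding singular_simplex_subtopology by (simp_all add: singular_simplex_def)
  have "connectedin (simplex_space p) (standard_simplex p)"
    using connectedin_standard_simplex by (simp add: connectedin_subtopology)
  then have con: "connectedin X (\<sigma> ` standard_simplex p)"
    by (rule connectedin_continuous_map_image[OF cont])
  have "\<sigma> base_vertex \<in> (\<Union>i\<in>I. U i)"
    using im base_vertex_simplex by blast
  then obtain i where i: "i \<in> I" "\<sigma> base_vertex \<in> U i"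
    by blast
  define V where "V = (\<Union>j\<in>I - {i}. U j)"
  have V: "openin X V"
    unfolding V_def using openU by auto
  have "U i \<inter> V = {}"
    unfolding V_def using disjU i(1) by blast
  moreover have cover: "\<sigma> ` standard_simplex p \<subseteq> U i \<union> V"
    using im unfolding V_def by blast
  moreover have "U i \<inter> \<sigma> ` standard_simplex p \<noteq> {}"
    using i(2) base_vertex_simplex by blast
  ultimately have "V \<inter> \<sigma> ` standard_simplex p = {}"
    using con openU[OF i(1)] V unfolding connectedin by blast
  then have "\<sigma> ` standard_simplex p \<subseteq> U i"
    using cover by blast
  then show ?thesis
    by (rule that[OF i(1)])
qed

lemma simplex_unique:
  assumes "i \<in> I" "j \<in> I" "\<sigma> ` standard_simplex p \<subseteq> U i" "\<sigma> ` standard_simplex p \<subseteq> U j"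
  shows "i = j"
  using disjU[OF assms(1,2)] assms(3,4) base_vertex_simplex[of p] by blast

definition component :: "nat \<Rightarrow> 'i \<Rightarrow> 'x tchain \<Rightarrow> 'x tchain" where
  "component p i = chain_part (\<lambda>\<sigma>. \<sigma> ` standard_simplex p \<subseteq> U i)"

abbreviation "XU \<equiv> subtopology X (\<Union>i\<in>I. U i)"

lemma component_add: "component p i (a + b) = component p i a + component p i b"
  and component_scale: "component p i (chain_scale r a) = chain_scale r (component p i a)"
  and component_sum: "component p i (\<Sum>j\<in>J. f j) = (\<Sum>j\<in>J. component p i (f j))"
  by (simp_all add: component_def chain_part_def lextend_add lextend_scale lextend_sum)

lemma component_chains:
  "c \<in> twisted_chains p (subtopology X B) \<Longrightarrow> component p i c \<in> twisted_chains p (subtopology (subtopology X (U i)) B)"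
  by (auto simp: component_def twisted_chains_iff keys_chain_part singular_simplex_subtopology)

lemma component_self:
  assumes "c \<in> twisted_chains p (subtopology X (U i))"
  shows "component p i c = c"
proof (rule poly_mapping_eqI)
  fix \<sigma>
  have "\<sigma> ` standard_simplex p \<subseteq> U i" if "\<sigma> \<in> Poly_Mapping.keys c"
    using assms that by (auto simp: twisted_chains_iff singular_simplex_subtopology)
  then show "Poly_Mapping.lookup (component p i c) \<sigma> = Poly_Mapping.lookup c \<sigma>"
    by (auto simp: component_def in_keys_iff)
qed

lemma component_other:
  assumes "i \<in> I" "j \<in> I" "i \<noteq> j" "c \<in> twisted_chains p (subtopology X (U j))"
  shows "component p i c = 0"
proof (rule poly_mapping_eqI)
  fix \<sigma>
  have "\<not> \<sigma> ` standard_simplex p \<subseteq> U i" if "\<sigma> \<in> Poly_Mapping.keys c"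
    using assms(4) that simplex_unique[OF assms(1,2), of \<sigma> p] assms(3)
    by (auto simp: twisted_chains_iff singular_simplex_subtopology)
  then show "Poly_Mapping.lookup (component p i c) \<sigma> = Poly_Mapping.lookup 0 \<sigma>"
    by (auto simp: component_def in_keys_iff)
qed

lemma component_expansion:
  assumes c: "c \<in> twisted_chains p XU"
  shows "c = (\<Sum>i\<in>I. component p i c)"
proof (rule poly_mapping_eqI)
  fix \<sigma>
  show "Poly_Mapping.lookup c \<sigma> = Poly_Mapping.lookup (\<Sum>i\<in>I. component p i c) \<sigma>"
  proof (cases "\<sigma> \<in> Poly_Mapping.keys c")
    case True
    then have "singular_simplex p XU \<sigma>"
      using c by (simp add: twisted_chains_iff)
    then obtain i where i: "i \<in> I" "\<sigma> ` standard_simplex p \<subseteq> U i"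
      by (rule simplex_in_one)
    have "(\<Sum>j\<in>I. Poly_Mapping.lookup (component p j c) \<sigma>) = (\<Sum>j\<in>I. if j = i then Poly_Mapping.lookup c \<sigma> else 0)"
    proof (rule sum.cong[OF refl])
      fix j assume "j \<in> I"
      then have "\<sigma> ` standard_simplex p \<subseteq> U j \<longleftrightarrow> j = i"
        using i simplex_unique[of j i \<sigma> p] by blast
      then show "Poly_Mapping.lookup (component p j c) \<sigma> = (if j = i then Poly_Mapping.lookup c \<sigma> else 0)"
        by (simp add: component_def)
    qed
    then show ?thesis
      using i finI by (simp add: lookup_sum)
  next
    case False
    then show ?thesis
      by (simp add: lookup_sum component_def in_keys_iff cong: if_cong)
  qed
qed

text \<open>A simplex and its faces lie in the same member of the family, so sorting by members
  commutes with the boundary.\<close>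

lemma component_face_sum:
  assumes \<sigma>: "singular_simplex p XU \<sigma>" and i: "i \<in> I"
  shows "component (p - 1) i (face_sum T p \<sigma>) = (if \<sigma> ` standard_simplex p \<subseteq> U i then face_sum T p \<sigma> else 0)"
proof (cases "p = 0")
  case True
  then show ?thesis
    by (simp add: face_sum_def component_def chain_part_def)
next
  case False
  obtain j where j: "j \<in> I" "\<sigma> ` standard_simplex p \<subseteq> U j"
    using \<sigma> by (rule simplex_in_one)
  have "singular_simplex p X \<sigma>"
    using \<sigma> by (simp add: singular_simplex_subtopology)
  then have "singular_simplex p (subtopology X (U j)) \<sigma>"
    using j by (simp add: singular_simplex_subtopology)
  then have fs: "face_sum T p \<sigma> \<in> twisted_chains (p - 1) (subtopology X (U j))"
    by (rule face_sum_chains)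
  show ?thesis
  proof (cases "i = j")
    case True
    then show ?thesis
      using j component_self[OF fs] by simp
  next
    case False
    then show ?thesis
      using component_other[OF i j(1) False fs] simplex_unique[OF i j(1), of \<sigma> p] j(2) by auto
  qed
qed

lemma component_boundary:
  assumes c: "c \<in> twisted_chains p XU" and i: "i \<in> I"
  shows "twisted_boundary T p (component p i c) = component (p - 1) i (twisted_boundary T p c)"
proof -
  have "component (p - 1) i (twisted_boundary T p c) = lextend (\<lambda>\<sigma>. component (p - 1) i (face_sum T p \<sigma>)) c"
    by (simp add: component_def chain_part_def twisted_boundary_lextend lextend_lextend)
  also have "\<dots> = lextend (\<lambda>\<sigma>. if \<sigma> ` standard_simplex p \<subseteq> U i then face_sum T p \<sigma> else 0) c"
    using c component_face_sum[OF _ i] by (intro lextend_cong) (auto simp: twisted_chains_iff)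
  also have "\<dots> = twisted_boundary T p (component p i c)"
    unfolding component_def chain_part_def twisted_boundary_lextend lextend_lextend
    by (rule lextend_cong) simp
  finally show ?thesis ..
qed

lemma component_chains': "c \<in> twisted_chains p (subtopology XU A) \<Longrightarrow> component p i c \<in> twisted_chains p (subtopology (subtopology X (U i)) A)"
  by (rule component_chains) (auto simp: twisted_chains_iff singular_simplex_subtopology)

lemma component_chains'': "c \<in> twisted_chains p XU \<Longrightarrow> component p i c \<in> twisted_chains p (subtopology X (U i))"
  by (auto simp: component_def twisted_chains_iff keys_chain_part singular_simplex_subtopology)

lemma component_relcycle:
  assumes c: "c \<in> twisted_relcycles T p XU A" and i: "i \<in> I"
  shows "component p i c \<in> twisted_relcycles T p (subtopology X (U i)) A"
  using c component_boundary[OF _ i, of c p T] component_chains'[of "twisted_boundary T p c" "p - 1" A i] component_chains''[of c p i]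
  by (simp add: twisted_relcycles_def)

lemma component_relboundary:
  assumes c: "c \<in> twisted_relboundaries T p XU A" and i: "i \<in> I"
  shows "component p i c \<in> twisted_relboundaries T p (subtopology X (U i)) A"
proof -
  obtain e a where ea: "e \<in> twisted_chains (Suc p) XU" "a \<in> twisted_chains p (subtopology XU A)"
    "c = twisted_boundary T (Suc p) e + a"
    using c by (rule twisted_relboundariesE)
  show ?thesis
    by (rule twisted_relboundariesI[of "component (Suc p) i e" _ _ "component p i a"])
      (use ea component_chains''[OF ea(1)] component_chains'[OF ea(2)] component_boundary[OF ea(1) i, of T] in \<open>auto simp: component_add\<close>)
qed

lemma chains_XU: "c \<in> twisted_chains p (subtopology X (U i)) \<Longrightarrow> i \<in> I \<Longrightarrow> c \<in> twisted_chains p XU"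
  by (erule twisted_chains_mono) blast

lemma chains_XU_sub: "c \<in> twisted_chains p (subtopology (subtopology X (U i)) A) \<Longrightarrow> i \<in> I \<Longrightarrow> c \<in> twisted_chains p (subtopology XU A)"
  unfolding subtopology_subtopology by (erule twisted_chains_mono) blast

lemma relcycles_XU: "c \<in> twisted_relcycles T p (subtopology X (U i)) A \<Longrightarrow> i \<in> I \<Longrightarrow> c \<in> twisted_relcycles T p XU A"
  unfolding twisted_relcycles_def using chains_XU chains_XU_sub by blast

lemma relboundaries_XU:
  assumes "c \<in> twisted_relboundaries T p (subtopology X (U i)) A" "i \<in> I"
  shows "c \<in> twisted_relboundaries T p XU A"
proof -
  obtain e a where "e \<in> twisted_chains (Suc p) (subtopology X (U i))" "a \<in> twisted_chains p (subtopology (subtopology X (U i)) A)"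
    "c = twisted_boundary T (Suc p) e + a"
    using assms(1) by (rule twisted_relboundariesE)
  then show ?thesis
    using chains_XU[OF _ assms(2)] chains_XU_sub[OF _ assms(2)] by (intro twisted_relboundariesI) auto
qed

text \<open>Cycles and relative boundaries split into components, so coefficients are found in each
  open set separately, and a relation is tested one component at a time.\<close>

theorem twisted_free_union:
  assumes P: "\<And>i. i \<in> I \<Longrightarrow> twisted_simplex_pair T m (subtopology X (U i)) A (z i)"
  shows "twisted_free T m XU A I z"
  unfolding twisted_free_def
proof (intro conjI ballI allI impI subsetI)
  have zc: "z i \<in> twisted_relcycles T m (subtopology X (U i)) A" if "i \<in> I" for i
    by (rule twisted_simplex_pair_relcycle[OF P[OF that]])
  then show "z i \<in> twisted_relcycles T m XU A" if "i \<in> I" for i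
    using relcycles_XU that by blast
  have zch: "z i \<in> twisted_chains m (subtopology X (U i))" if "i \<in> I" for i
    using zc[OF that] by (simp add: twisted_relcycles_def)
  show "\<exists>f. c - (\<Sum>i\<in>I. chain_scale (f i) (z i)) \<in> twisted_relboundaries T m XU A" if c: "c \<in> twisted_relcycles T m XU A" for c
  proof -
    have "\<forall>i\<in>I. \<exists>r. component m i c - chain_scale r (z i) \<in> twisted_relboundaries T m (subtopology X (U i)) A"
      using twisted_simplex_pair_generates[OF P component_relcycle[OF c]] by blast
    then obtain f where f: "\<forall>i\<in>I. component m i c - chain_scale (f i) (z i) \<in> twisted_relboundaries T m (subtopology X (U i)) A"
      by (rule bchoice[THEN exE])
    have "(\<Sum>i\<in>I. component m i c - chain_scale (f i) (z i)) \<in> twisted_relboundaries T m XU A"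
      using f by (intro twisted_relboundaries_sum relboundaries_XU) auto
    moreover have "c = (\<Sum>i\<in>I. component m i c)"
      using c by (intro component_expansion) (simp add: twisted_relcycles_def)
    ultimately have "c - (\<Sum>i\<in>I. chain_scale (f i) (z i)) \<in> twisted_relboundaries T m XU A"
      by (simp only: sum_subtractf)
    then show ?thesis
      by (rule exI[of _ f])
  qed
  show "c \<in> twisted_relboundaries T p XU A" if p: "p \<noteq> m" and c: "c \<in> twisted_relcycles T p XU A" for p c
  proof -
    have "(\<Sum>i\<in>I. component p i c) \<in> twisted_relboundaries T p XU A"
      using twisted_simplex_pair_vanishes[OF P p component_relcycle[OF c]]
      by (intro twisted_relboundaries_sum relboundaries_XU) auto
    moreover have "c = (\<Sum>i\<in>I. component p i c)"
      using c by (intro component_expansion) (simp add: twisted_relcycles_def)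
    ultimately show ?thesis
      by (simp only:)
  qed
  show "f j = 0" if f: "(\<Sum>i\<in>I. chain_scale (f i) (z i)) \<in> twisted_relboundaries T m XU A" and j: "j \<in> I" for f j
  proof -
    have "component m j (\<Sum>i\<in>I. chain_scale (f i) (z i)) = (\<Sum>i\<in>I. if i = j then chain_scale (f i) (z i) else 0)"
      unfolding component_sum component_scale
    proof (rule sum.cong[OF refl])
      fix i assume i: "i \<in> I"
      show "chain_scale (f i) (component m j (z i)) = (if i = j then chain_scale (f i) (z i) else 0)"
        using component_self[OF zch[OF i]] component_other[OF j i _ zch[OF i]] by (cases "i = j") auto
    qed
    also have "\<dots> = chain_scale (f j) (z j)"
      using j finI by simp
    finally have "chain_scale (f j) (z j) \<in> twisted_relboundaries T m (subtopology X (U j)) A"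
      using component_relboundary[OF f j] by simp
    then show ?thesis
      by (rule twisted_simplex_pair_independent[OF P[OF j]])
  qed
qed

end

lemma (in squeeze_excision) twisted_free_excision:
  assumes F: "twisted_free T m (subtopology X U) A I z"
  shows "twisted_free T m X A I z"
proof -
  have ch: "c \<in> twisted_chains p X" if "c \<in> twisted_chains p (subtopology X U)" for c p
    using that by (rule twisted_chains_subtopologyD)
  have chA: "c \<in> twisted_chains p (subtopology X A)" if "c \<in> twisted_chains p (subtopology (subtopology X U) A)" for c p
    using that unfolding subtopology_subtopology by (rule twisted_chains_mono) blast
  have cyc: "c \<in> twisted_relcycles T p X A" if "c \<in> twisted_relcycles T p (subtopology X U) A" for c p
    using that ch chA unfolding twisted_relcycles_def by blast
  have bnd: "c \<in> twisted_relboundaries T p X A" if "c \<in> twisted_relboundaries T p (subtopology X U) A" for c p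
    using that ch chA by (auto elim!: twisted_relboundariesE intro!: twisted_relboundariesI)
  have zc: "z i \<in> twisted_relcycles T m (subtopology X U) A" if "i \<in> I" for i
    by (rule twisted_free_relcycle[OF F that])
  show ?thesis
    unfolding twisted_free_def
  proof (intro conjI ballI allI impI subsetI)
    show "z i \<in> twisted_relcycles T m X A" if "i \<in> I" for i
      by (rule cyc[OF zc[OF that]])
    show "\<exists>f. c - (\<Sum>i\<in>I. chain_scale (f i) (z i)) \<in> twisted_relboundaries T m X A" if c: "c \<in> twisted_relcycles T m X A" for c
    proof -
      obtain c' where c': "c' \<in> twisted_relcycles T m (subtopology X U) A" "c - c' \<in> twisted_relboundaries T m X A"
        by (rule excision_surjective[OF c])
      obtain f where "c' - (\<Sum>i\<in>I. chain_scale (f i) (z i)) \<in> twisted_relboundaries T m (subtopology X U) A"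
        using twisted_free_generates[OF F c'(1)] by (rule exE)
      from twisted_relboundaries_trans[OF c'(2) bnd[OF this]] show ?thesis
        by (rule exI[of _ f])
    qed
    show "c \<in> twisted_relboundaries T p X A" if p: "p \<noteq> m" and c: "c \<in> twisted_relcycles T p X A" for p c
    proof -
      obtain c' where c': "c' \<in> twisted_relcycles T p (subtopology X U) A" "c - c' \<in> twisted_relboundaries T p X A"
        by (rule excision_surjective[OF c])
      have "c' \<in> twisted_relboundaries T p X A"
        by (rule bnd[OF twisted_free_vanishes[OF F p c'(1)]])
      from twisted_relboundaries_add[OF c'(2) this] show ?thesis
        by simp
    qed
    show "f i = 0" if f: "(\<Sum>i\<in>I. chain_scale (f i) (z i)) \<in> twisted_relboundaries T m X A" and i: "i \<in> I" for f i
    proof -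
      have "(\<Sum>i\<in>I. chain_scale (f i) (z i)) \<in> twisted_relcycles T m (subtopology X U) A"
        by (intro twisted_relcycles_sum twisted_relcycles_scale zc)
      then have "(\<Sum>i\<in>I. chain_scale (f i) (z i)) \<in> twisted_relboundaries T m (subtopology X U) A"
        using f by (rule excision_injective)
      then show ?thesis
        by (rule twisted_free_independent[OF F _ i])
    qed
  qed
qed

context necklace
begin

section \<open>Removing the twisting on a chamber\<close>

lemma star_contraction_chamber:
  assumes b: "b \<in> chamber r"
  shows "star_contraction (subtopology OC (chamber r)) b (\<lambda>(t, y). blend t b y)"
proof -
  let ?W = "subtopology OC (chamber r)"
  have "continuous_map ?W ?W (\<lambda>y. b)" "continuous_map ?W ?W (\<lambda>y. y)"
    using b topspace_chamber by (simp_all add: continuous_map_id[unfolded id_def])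
  from continuous_map_blend[OF this]
  have 1: "continuous_map (prod_topology (top_of_set {0..1}) ?W) ?W (\<lambda>(t, y). blend t b y)" .
  have "blend t b b = b" for t
  proof
    fix a show "blend t b b a = b a"
      using OC_arb[OF chamber_OC[OF b], of a] by (simp add: blend_def restrict_def algebra_simps)
  qed
  then show ?thesis
    using 1 b blend_ends[OF chamber_OC[OF b] chamber_OC]
    unfolding star_contraction_def topspace_chamber by simp
qed

lemma necklace_simplex_beads: "necklace_simplex r \<epsilon> = simplex_map m fo (restrict beads (standard_simplex m))"
  by (auto simp: necklace_simplex_def simplex_map_def segment_config_def beads_def fo_arrange[OF r] word_length[OF r])

text \<open>Centred at vertex 0 of the necklace simplex, so that pushing forward keeps the
  coefficient 1 of that simplex.\<close>

definition beads_potential :: "(nat \<Rightarrow> nat \<Rightarrow> int) \<Rightarrow> (nat \<Rightarrow> int) \<Rightarrow> (nat \<times> nat \<Rightarrow> complex) \<Rightarrow> laurent" where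
  "beads_potential a d = straight_potential (Conf_transport l a d) (\<lambda>(t, y). blend t (beads base_vertex) y) fo"

lemma beads_base: "beads base_vertex \<in> chamber r"
  by (rule beads_chamber[OF base_vertex_simplex])

lemma continuous_map_fo_chamber: "continuous_map (subtopology OC (chamber r)) CX fo"
  by (rule continuous_map_from_subtopology[OF continuous_map_fo])

lemma beads_potential_morphism:
  "transport_morphism (subtopology OC (chamber r)) (\<lambda>_. 1) (Conf_transport l a d) fo (beads_potential a d)"
  unfolding beads_potential_def
  by (rule straight_potential_morphism[OF flat_Conf_transport star_contraction_chamber[OF beads_base] continuous_map_fo_chamber])

lemma beads_potential_base: "beads_potential a d (beads base_vertex) = 1"
  unfolding beads_potential_def
  by (rule straight_potential_base[OF flat_Conf_transport star_contraction_chamber[OF beads_base] continuous_map_fo_chamber])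

text \<open>Together with the potential, the homeomorphism \<open>fo\<close> is an isomorphism from
  the trivial local system on ordered lifts to the given one on the chamber.\<close>

theorem chamber_twisted_pair:
  "twisted_simplex_pair (Conf_transport l a d) m (subtopology CX (fo ` chamber r)) (far_from e) (Poly_Mapping.single (necklace_simplex r \<epsilon>) 1)"
proof -
  let ?W = "subtopology OC (chamber r)" and ?Y = "subtopology CX (fo ` chamber r)" and ?T = "Conf_transport l a d"
  let ?u = "beads_potential a d"
  obtain g where g: "homeomorphic_maps ?W ?Y fo g"
    using homeomorphic_map_chamber[OF r] by (auto simp: homeomorphic_map_maps)
  have tY: "topspace ?Y = fo ` chamber r"
    using openin_subset[OF openin_chamber_image[OF r]] by auto
  have gc: "continuous_map ?Y ?W g" "continuous_map ?W ?Y fo" and gf: "\<And>x. x \<in> chamber r \<Longrightarrow> g (fo x) = x"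
    and fg: "\<And>y. y \<in> fo ` chamber r \<Longrightarrow> fo (g y) = y"
    using g unfolding homeomorphic_maps_def topspace_chamber tY by blast+
  have gW: "g y \<in> chamber r" if "y \<in> fo ` chamber r" for y
    using gf that by auto
  \<comment> \<open>Transport along the reversed contraction path, the inverse of the potential; the
    proof has to supply it as the factor of the inverse morphism.\<close>
  define v where "v y = ?T (\<lambda>t. fo (blend (1 - t) (beads base_vertex) (g y)))" for y
  have uv: "?u x * v (fo x) = 1" if x: "x \<in> chamber r" for x
    using straight_potential_inverse[OF flat_Conf_transport star_contraction_chamber[OF beads_base] continuous_map_fo_chamber, of x a d] x
    unfolding topspace_chamber v_def beads_potential_def by (simp add: gf)
  have mv: "transport_morphism ?Y ?T (\<lambda>_. 1) g v"
    unfolding transport_morphism_def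
  proof (intro allI impI)
    fix \<gamma> assume \<gamma>: "pathin ?Y \<gamma>"
    have \<gamma>Y: "\<gamma> t \<in> fo ` chamber r" if "t \<in> {0..1}" for t
      using \<gamma> that by (auto simp: pathin_def continuous_map_def Pi_iff tY)
    have "pathin ?W (g \<circ> \<gamma>)"
      using \<gamma> gc(1) by (auto simp: pathin_def intro: continuous_map_compose)
    then have "1 * ?u ((g \<circ> \<gamma>) 1) = ?u ((g \<circ> \<gamma>) 0) * ?T (fo \<circ> (g \<circ> \<gamma>))"
      using beads_potential_morphism unfolding transport_morphism_def by blast
    moreover have "?T (fo \<circ> (g \<circ> \<gamma>)) = ?T \<gamma>"
      using \<gamma>Y fg by (intro flat_transport_cong[OF flat_Conf_transport]) auto
    ultimately have eq: "?u (g (\<gamma> 1)) = ?u (g (\<gamma> 0)) * ?T \<gamma>"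
      by simp
    have inv: "?u (g (\<gamma> t)) * v (\<gamma> t) = 1" if "t \<in> {0..1}" for t
      using uv[OF gW[OF \<gamma>Y[OF that]]] fg[OF \<gamma>Y[OF that]] by simp
    have "v (\<gamma> 0) * ?u (g (\<gamma> 1)) * v (\<gamma> 1) = (?u (g (\<gamma> 0)) * v (\<gamma> 0)) * ?T \<gamma> * v (\<gamma> 1)"
      unfolding eq by (simp add: mult_ac)
    then show "?T \<gamma> * v (\<gamma> 1) = v (\<gamma> 0) * 1"
      using inv[of 0] inv[of 1] by (simp add: mult.assoc)
  qed
  have "twisted_simplex_pair (\<lambda>_. 1) m ?W far_chamber (Poly_Mapping.single (restrict beads (standard_simplex m)) 1)"
    by (rule simplex_pair_laurent[OF chamber_simplex_pair])
  then have "twisted_simplex_pair ?T m ?Y (far_from e) (push m ?u fo (Poly_Mapping.single (restrict beads (standard_simplex m)) 1))"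
  proof (rule twisted_simplex_pair_push)
    show "flat_transport ?W (\<lambda>_. 1)"
      by (rule flat_transport_trivial)
    show "flat_transport ?Y ?T"
      by (rule flat_transport_subtopology[OF flat_Conf_transport])
    show "transport_morphism ?W (\<lambda>_. 1) ?T fo ?u"
      by (rule beads_potential_morphism)
    show "fo ` (topspace ?W \<inter> far_chamber) \<subseteq> far_from e"
      by (auto simp: far_chamber_def)
    show "g ` (topspace ?Y \<inter> far_from e) \<subseteq> far_chamber"
      unfolding tY using gW fg by (auto simp: far_chamber_def)
  qed (use gc mv uv gf fg in \<open>auto simp: topspace_chamber tY\<close>)
  then show ?thesis
    by (simp add: necklace_simplex_beads beads_potential_base)
qed

text \<open>The sign and the transport along the handle are units, so only the generator
  changes.\<close>

theorem chamber_necklace_chain: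
  "twisted_simplex_pair (Conf_transport l a d) m (subtopology CX (fo ` chamber r)) (far_from e) (necklace_chain l a d r \<epsilon>)"
proof -
  let ?T = "Conf_transport l a d (handle r (necklace_coords (length r) \<epsilon> (\<lambda>i. if i = 0 then 1 else 0)))"
  obtain w' where "?T * w' = 1"
    using Conf_transport_unit by blast
  then have "((- 1) ^ length r * ?T) * ((- 1) ^ length r * w') = 1"
    by (simp add: mult_ac flip: power_mult_distrib)
  from twisted_simplex_pair_unit[OF chamber_twisted_pair this]
  show ?thesis
    by (simp add: necklace_chain_def)
qed

end

context configurations
begin

theorem necklaces_free:
  assumes \<epsilon>: "0 < \<epsilon>" "2 * real m * \<epsilon> < e" and e: "(real m + 1) * e \<le> 1"
  shows "twisted_free (Conf_transport l a d) m CX (far_from e) words (\<lambda>r. necklace_chain l a d r \<epsilon>)"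
proof -
  let ?T = "Conf_transport l a d"
  have e0: "0 < e"
    using \<epsilon> by (smt (verit) mult_nonneg_nonneg of_nat_0_le_iff)
  have "1 * e \<le> (real m + 1) * e"
    using e0 by (intro mult_right_mono) auto
  \<comment> \<open>The compression factor \<open>e / 4\<close> is the largest that
    \<open>squeeze_nearly_aligned\<close> admits.\<close>
  then have \<delta>: "0 < e / 4" "e / 4 \<le> 1" "4 * (e / 4) \<le> e"
    using e e0 by linarith+
  interpret D: disjoint_opens CX words "\<lambda>r. fo ` chamber r"
  proof
    show "finite words"
      by (rule finite_words)
    show "openin CX (fo ` chamber r)" if "r \<in> words" for r
      by (rule openin_chamber_image[OF that])
    show "fo ` chamber r \<inter> fo ` chamber r' = {}" if "r \<in> words" "r' \<in> words" "r \<noteq> r'" for r r'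
      using chamber_word(1)[OF that(1,2)] that(3) by blast
  qed
  interpret E: squeeze_excision CX ?T "squeeze (e / 4)" "far_from e" distinct_reals "nearly_aligned (e / 2)"
  proof
    show "flat_transport CX ?T"
      by (rule flat_Conf_transport)
    show "continuous_map (prod_topology (top_of_set {0..1}) CX) CX (squeeze (e / 4))"
      by (rule continuous_map_squeeze[OF \<delta>(1,2)])
    show "openin CX distinct_reals" "openin CX (nearly_aligned (e / 2))"
      by (rule openin_distinct_reals openin_nearly_aligned)+
    show "topspace CX \<subseteq> distinct_reals \<union> nearly_aligned (e / 2)"
      using e0 by (intro distinct_or_aligned) simp
    show "squeeze (e / 4) (t, Z) \<in> far_from e" if "t \<in> {0..1}" "Z \<in> topspace CX \<inter> far_from e" for t Z
      using squeeze_far_from[OF \<delta>(1,2)] that by blast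
    show "squeeze (e / 4) (t, Z) \<in> distinct_reals" if "t \<in> {0..1}" "Z \<in> distinct_reals" for t Z
      using squeeze_distinct_reals[OF \<delta>(1,2)] that by blast
    show "squeeze (e / 4) (1, Z) \<in> far_from e" if "Z \<in> nearly_aligned (e / 2)" for Z
      by (rule squeeze_nearly_aligned[OF \<delta> that])
  qed simp
  have "twisted_free ?T m (subtopology CX (\<Union>r\<in>words. fo ` chamber r)) (far_from e) words (\<lambda>r. necklace_chain l a d r \<epsilon>)"
  proof (rule D.twisted_free_union)
    fix r assume "r \<in> words"
    then interpret necklace l c r e \<epsilon>
      by unfold_locales (use \<epsilon> e in auto)
    show "twisted_simplex_pair ?T m (subtopology CX (fo ` chamber r)) (far_from e) (necklace_chain l a d r \<epsilon>)"
      by (rule chamber_necklace_chain)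
  qed
  then show ?thesis
    unfolding distinct_reals_eq[symmetric] by (rule E.twisted_free_excision)
qed

end

section \<open>Independence of the truncation of the necklaces\<close>

lemma (in necklace) simplex_map_beads: "simplex_map m beads (top_simplex m) = restrict beads (standard_simplex m)"
  by (auto simp: simplex_map_def top_simplex_def)

context configurations
begin

text \<open>The beads are affine in the truncation parameter, so blending two truncations passes
  through truncations only. The straight homotopy therefore keeps the boundary of the simplex in the
  far set, although that set is not convex.\<close>

lemma necklace_simplex_independent:
  assumes r: "r \<in> words" and \<epsilon>: "0 < \<epsilon>" "2 * real m * \<epsilon> < e" and \<epsilon>': "0 < \<epsilon>'" "2 * real m * \<epsilon>' < e"
    and e: "(real m + 1) * e \<le> 1"
  shows "Poly_Mapping.single (necklace_simplex r \<epsilon>) 1 - Poly_Mapping.single (necklace_simplex r \<epsilon>') 1 \<in>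
    twisted_relboundaries (Conf_transport l a d) m CX (far_from e)"
proof -
  let ?T = "Conf_transport l a d"
  interpret N: necklace l c r e \<epsilon>
    by unfold_locales (use assms in auto)
  interpret N': necklace l c r e \<epsilon>'
    by unfold_locales (use assms in auto)
  let ?W = "subtopology OC (chamber r)"
  have N_mix: "necklace l c r e ((1 - t) * \<epsilon> + t * \<epsilon>')" if t: "t \<in> {0..1}" for t
  proof unfold_locales
    have "(1 - t) * (- \<epsilon>) + t * (- \<epsilon>') < 0"
      using \<epsilon>(1) \<epsilon>'(1) by (intro N.convex_combination_strict[OF t]) auto
    then show "0 < (1 - t) * \<epsilon> + t * \<epsilon>'"
      by simp
    have "(1 - t) * (2 * real m * \<epsilon>) + t * (2 * real m * \<epsilon>') < e"
      using \<epsilon>(2) \<epsilon>'(2) by (intro N.convex_combination_strict[OF t])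
    then show "2 * real m * ((1 - t) * \<epsilon> + t * \<epsilon>') < e"
      by (simp add: algebra_simps)
  qed (use r e in auto)
  have mix: "N.blend t (N.beads x) (N'.beads x) = necklace.beads l c r ((1 - t) * \<epsilon> + t * \<epsilon>') x" if t: "t \<in> {0..1}" for t x
  proof
    fix b
    interpret Nt: necklace l c r e "(1 - t) * \<epsilon> + t * \<epsilon>'"
      by (rule N_mix[OF t])
    show "N.blend t (N.beads x) (N'.beads x) b = necklace.beads l c r ((1 - t) * \<epsilon> + t * \<epsilon>') x b"
    proof (cases "b \<in> lab")
      case True
      obtain j where j: "j < m" "b = slot r j"
        by (rule slot_cases[OF r True])
      have "necklace_coords m ((1 - t) * \<epsilon> + t * \<epsilon>') x j = (1 - t) * necklace_coords m \<epsilon> x j + t * necklace_coords m \<epsilon>' x j"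
        by (simp add: necklace_coords_def algebra_simps)
      then have "necklace.beads l c r ((1 - t) * \<epsilon> + t * \<epsilon>') x b =
          complex_of_real (- 1 + 2 * ((1 - t) * necklace_coords m \<epsilon> x j + t * necklace_coords m \<epsilon>' x j))"
        unfolding j(2) Nt.beads_def arrange_slot[OF r j(1)] by simp
      moreover have "N.blend t (N.beads x) (N'.beads x) b =
          of_real (1 - t) * complex_of_real (- 1 + 2 * necklace_coords m \<epsilon> x j) + of_real t * complex_of_real (- 1 + 2 * necklace_coords m \<epsilon>' x j)"
        unfolding j(2) N.blend_slot[OF j(1)] N.beads_def N'.beads_def arrange_slot[OF r j(1)] ..
      moreover have "of_real (1 - t) * complex_of_real A + of_real t * complex_of_real B = complex_of_real ((1 - t) * A + t * B)" for A B
        by simp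
      moreover have "(1 - t) * (- 1 + 2 * A) + t * (- 1 + 2 * B) = - 1 + 2 * ((1 - t) * A + t * B)" for A B :: real
        by (simp add: algebra_simps)
      ultimately show ?thesis
        by (simp only:)
    next
      case False
      then show ?thesis
        by (simp add: N.blend_def Nt.beads_def arrange_def)
    qed
  qed
  have "homotopic_with (\<lambda>h. h \<in> simplex_boundary m \<rightarrow> N.far_chamber) (simplex_space m) ?W N.beads N'.beads"
  proof (subst homotopic_with)
    show "(h \<in> simplex_boundary m \<rightarrow> N.far_chamber) = (k \<in> simplex_boundary m \<rightarrow> N.far_chamber)"
      if hk: "\<And>x. x \<in> topspace (simplex_space m) \<Longrightarrow> h x = k x" for h k
    proof -
      have "\<forall>x\<in>simplex_boundary m. h x = k x"
        using hk by (auto simp: simplex_boundary_def)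
      then show ?thesis
        by (simp add: Pi_iff)
    qed
    define H where "H = (\<lambda>(t, x). N.blend t (N.beads x) (N'.beads x))"
    have "continuous_map (prod_topology (top_of_set {0..1}) (simplex_space m)) ?W H"
      unfolding H_def by (rule N.continuous_map_blend[OF N.continuous_map_beads N'.continuous_map_beads])
    moreover have "H (0, x) = N.beads x \<and> H (1, x) = N'.beads x" for x
      using mix[of 0 x] mix[of 1 x] by (simp add: H_def)
    moreover have "H (t, x) \<in> N.far_chamber" if "t \<in> {0..1}" "x \<in> simplex_boundary m" for t x
    proof -
      interpret Nt: necklace l c r e "(1 - t) * \<epsilon> + t * \<epsilon>'"
        by (rule N_mix[OF that(1)])
      show ?thesis
        using Nt.beads_far that(2) mix[OF that(1)] by (auto simp: H_def)
    qed
    ultimately show "\<exists>h. continuous_map (prod_topology (top_of_set {0..1::real}) (simplex_space m)) ?W h \<and>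
        (\<forall>x\<in>topspace (simplex_space m). h (0, x) = N.beads x) \<and> (\<forall>x\<in>topspace (simplex_space m). h (1, x) = N'.beads x) \<and>
        (\<forall>t\<in>{0..1}. (\<lambda>x. h (t, x)) \<in> simplex_boundary m \<rightarrow> N.far_chamber)"
      by (intro exI[of _ H]) simp
  qed
  then have "homologous_rel m ?W N.far_chamber (chain_map m N.beads (frag_of (top_simplex m))) (chain_map m N'.beads (frag_of (top_simplex m)))"
    by (rule homotopic_imp_homologous_rel_chain_maps[OF _ simplex_pair_relcycle[OF simplex_pair_standard]])
  then have "singular_relboundary m ?W N.far_chamber (frag_of (restrict N.beads (standard_simplex m)) - frag_of (restrict N'.beads (standard_simplex m)))"
    by (simp add: homologous_rel_def N.simplex_map_beads N'.simplex_map_beads)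
  from int_chain_relboundary[OF this]
  have b: "Poly_Mapping.single (restrict N.beads (standard_simplex m)) 1 - Poly_Mapping.single (restrict N'.beads (standard_simplex m)) 1
      \<in> twisted_relboundaries (\<lambda>_. 1) m ?W N.far_chamber"
    by (simp add: int_chain_diff)
  have far: "fo ` (topspace ?W \<inter> N.far_chamber) \<subseteq> far_from e"
    by (auto simp: N.far_chamber_def)
  let ?u = "N.beads_potential a d"
  \<comment> \<open>The two simplices have different base vertices. They are joined by
    configurations on the real segment, along which transport is trivial, so both are pushed forward
    with coefficient 1.\<close>
  have "?u (N'.beads base_vertex) = ?T (\<lambda>t. fo (necklace.beads l c r ((1 - t) * \<epsilon> + t * \<epsilon>') base_vertex))"
    unfolding N.beads_potential_def straight_potential_def
    by (rule flat_transport_cong[OF flat_Conf_transport]) (simp add: mix)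
  also have "\<dots> = 1"
  proof (rule Conf_transport_real)
    fix t :: real assume t: "t \<in> {0..1}"
    interpret Nt: necklace l c r e "(1 - t) * \<epsilon> + t * \<epsilon>'"
      by (rule N_mix[OF t])
    show "Nt.beads base_vertex \<in> topspace OC"
      by (rule chamber_OC[OF Nt.beads_base])
    show "Im (Nt.beads base_vertex b) = 0" if b: "b \<in> lab" for b
    proof -
      obtain j where "j < m" "b = slot r j"
        by (rule slot_cases[OF r b])
      then show ?thesis
        by (simp add: Nt.beads_slot)
    qed
  qed
  finally have "?u (N'.beads base_vertex) = 1" .
  then show ?thesis
    using twisted_relboundaries_push[OF flat_Conf_transport[of a d] N.beads_potential_morphism[of a d] b N.continuous_map_fo_chamber far]
    by (simp add: push_diff N.necklace_simplex_beads N'.necklace_simplex_beads N.beads_potential_base)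
qed

text \<open>The handles of the interpolated truncations sweep out a square. Its starting side is
  constant, because the handles start at points that do not depend on the truncation, and its final
  side consists of real configurations. Transport along both is 1, so the square law equates the two
  handles.\<close>

lemma handle_independent:
  assumes r: "r \<in> words" and \<epsilon>: "0 < \<epsilon>" "2 * real m * \<epsilon> < e" and \<epsilon>': "0 < \<epsilon>'" "2 * real m * \<epsilon>' < e"
    and e: "(real m + 1) * e \<le> 1"
  shows "Conf_transport l a d (handle r (necklace_coords m \<epsilon> base_vertex)) = Conf_transport l a d (handle r (necklace_coords m \<epsilon>' base_vertex))"
proof -
  let ?T = "Conf_transport l a d"
  let ?I = "top_of_set {0..1::real}"
  interpret N: necklace l c r e \<epsilon>
    by unfold_locales (use assms in auto)
  define E where "E a = (1 - a) * \<epsilon> + a * \<epsilon>'" for a :: real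
  have N_mix: "necklace l c r e (E a)" if t: "a \<in> {0..1}" for a
  proof unfold_locales
    have "(1 - a) * (- \<epsilon>) + a * (- \<epsilon>') < 0"
      using \<epsilon>(1) \<epsilon>'(1) by (intro N.convex_combination_strict[OF t]) auto
    then show "0 < E a"
      by (simp add: E_def)
    have "(1 - a) * (2 * real m * \<epsilon>) + a * (2 * real m * \<epsilon>') < e"
      using \<epsilon>(2) \<epsilon>'(2) by (intro N.convex_combination_strict[OF t])
    then show "2 * real m * E a < e"
      by (simp add: E_def algebra_simps)
  qed (use r e in auto)
  have len: "length r = m"
    by (rule word_length[OF r])
  define X where "X a j = - 1 + 2 * necklace_coords m (E a) base_vertex j" for a j
  define Y where "Y j = - (real m - real j) / (real m + 1)" for j
  \<comment> \<open>The two cases of \<open>handle\<close> in one formula: the \<open>max\<close>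
    stops the horizontal motion and the \<open>min\<close> starts the vertical one at time
    \<open>1 / 2\<close>, which makes continuity evident.\<close>
  define point where "point = (\<lambda>(a, s) j. Complex (X a j + (1 - X a j) * max 0 (1 - 2 * s)) (Y j * min 1 (2 - 2 * s)))"
  have Xbeads: "complex_of_real (X a j) = necklace.beads l c r (E a) base_vertex (slot r j)" if "j < m" "a \<in> {0..1}" for a j
  proof -
    interpret Na: necklace l c r e "E a"
      by (rule N_mix[OF that(2)])
    show ?thesis
      unfolding Na.beads_def arrange_slot[OF r that(1)] X_def ..
  qed
  have Xsq: "- 1 \<le> X a j \<and> X a j \<le> 1" if "a \<in> {0..1}" "j < m" for a j
  proof -
    interpret Na: necklace l c r e "E a"
      by (rule N_mix[OF that(1)])
    have "complex_of_real (X a j) \<in> square"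
      unfolding Xbeads[OF that(2,1)] using chamber_OC[OF Na.beads_base] slot_lab[OF r that(2)] by (auto simp: topspace_OC)
    then show ?thesis
      by (auto simp: square_def)
  qed
  have Xless: "X a i < X a j" if "a \<in> {0..1}" "i < j" "j < m" for a i j
  proof -
    interpret Na: necklace l c r e "E a"
      by (rule N_mix[OF that(1)])
    show ?thesis
      using chamber_less[OF Na.beads_base that(2,3)] Xbeads[of i a] Xbeads[of j a] that by (metis Re_complex_of_real less_trans)
  qed
  have handle: "handle r (necklace_coords m (E a) base_vertex) s = fo (arrange r (point (a, s)))" if "s \<in> {0..1}" for a s
    unfolding fo_arrange[OF r] handle_def
  proof (rule place_points_cong)
    fix j
    show "(let x = - 1 + 2 * necklace_coords m (E a) base_vertex j; y = - (real (length r) - real j) / (real (length r) + 1)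
          in if s \<le> 1 / 2 then Complex (1 - 2 * s * (1 - x)) y else Complex x ((2 - 2 * s) * y)) = point (a, s) j"
      by (auto simp: Let_def point_def X_def Y_def len max_def min_def algebra_simps)
  qed
  have inOC: "arrange r (point (a, s)) \<in> topspace OC" if a: "a \<in> {0..1}" and s: "s \<in> {0..1}" for a s
  proof -
    have sq: "point (a, s) j \<in> square" if j: "j < m" for j
    proof -
      have b: "0 \<le> max 0 (1 - 2 * s)" "max 0 (1 - 2 * s) \<le> 1" "0 \<le> min 1 (2 - 2 * s)" "min 1 (2 - 2 * s) \<le> 1"
        using s by auto
      have "0 \<le> (1 - X a j) * max 0 (1 - 2 * s)" "(1 - X a j) * max 0 (1 - 2 * s) \<le> 1 - X a j"
        using Xsq[OF a j] b mult_left_le[of "max 0 (1 - 2 * s)" "1 - X a j"] by simp_all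
      then have "- 1 \<le> X a j + (1 - X a j) * max 0 (1 - 2 * s) \<and> X a j + (1 - X a j) * max 0 (1 - 2 * s) \<le> 1"
        using Xsq[OF a j] by (smt (verit))
      moreover have "\<bar>Y j * min 1 (2 - 2 * s)\<bar> \<le> 1"
      proof -
        have "\<bar>Y j\<bar> \<le> 1"
          using j by (simp add: Y_def)
        then show ?thesis
          unfolding abs_mult using b by (intro mult_le_one) auto
      qed
      ultimately show ?thesis
        by (simp add: point_def square_def abs_le_iff)
    qed
    \<comment> \<open>Until the last moment the heights are distinct; at the end, when all heights
      are 0, the real parts are.\<close>
    have ne: "point (a, s) i \<noteq> point (a, s) j" if ij: "i < j" "j < m" for i j
    proof (cases "s = 1")
      case True
      then show ?thesis
        using Xless[OF a ij] by (simp add: point_def)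
    next
      case False
      then have "0 < min 1 (2 - 2 * s)"
        using s by auto
      moreover have "Y i \<noteq> Y j"
        using ij by (simp add: Y_def field_simps)
      ultimately show ?thesis
        by (auto simp: point_def)
    qed
    have "inj_on (arrange r (point (a, s))) lab"
    proof (rule inj_onI)
      fix b b' assume bb: "b \<in> lab" "b' \<in> lab" "arrange r (point (a, s)) b = arrange r (point (a, s)) b'"
      obtain i where i: "i < m" "b = slot r i"
        by (rule slot_cases[OF r bb(1)])
      obtain j where j: "j < m" "b' = slot r j"
        by (rule slot_cases[OF r bb(2)])
      have "point (a, s) i = point (a, s) j"
        using bb(3) i j r by simp
      then have "i = j"
        using ne[of i j] ne[of j i] i j by (metis linorder_neqE_nat)
      then show "b = b'"
        using i j by simp
    qed
    moreover have "arrange r (point (a, s)) b \<in> square" if b: "b \<in> lab" for b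
    proof -
      obtain j where "j < m" "b = slot r j"
        by (rule slot_cases[OF r b])
      then show ?thesis
        using sq r by simp
    qed
    ultimately show ?thesis
      by (auto simp: topspace_OC arrange_def)
  qed
  define S where "S = (\<lambda>p. fo (arrange r (point p)))"
  have "continuous_map (prod_topology ?I ?I) OC (\<lambda>p. arrange r (point p))"
  proof (rule continuous_map_into_OC)
    fix b assume b: "b \<in> lab"
    obtain j where j: "j < m" "b = slot r j"
      by (rule slot_cases[OF r b])
    have "continuous_on ({0..1} \<times> {0..1}) (\<lambda>p. of_real (X (fst p) j + (1 - X (fst p) j) * max 0 (1 - 2 * snd p)) + \<i> * complex_of_real (Y j * min 1 (2 - 2 * snd p)))"
      unfolding X_def necklace_coords_def E_def by (intro continuous_intros)
    then have "continuous_map (prod_topology ?I ?I) euclidean (\<lambda>p. point p j)"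
      by (simp add: prod_topology_subtopology_eu point_def case_prod_unfold Complex_eq)
    then show "continuous_map (prod_topology ?I ?I) euclidean (\<lambda>p. arrange r (point p) b)"
      using j r by simp
  next
    show "arrange r (point p) \<in> topspace OC" if "p \<in> topspace (prod_topology ?I ?I)" for p
      using that inOC[of "fst p" "snd p"] by (cases p) auto
  qed
  from continuous_map_compose[OF this continuous_map_fo]
  have "continuous_map (top_of_set ({0..1} \<times> {0..1})) CX S"
    by (intro continuous_map_square) (simp add: S_def o_def)
  note sq = flat_transport_square[OF flat_Conf_transport this, of a d]
  have "?T (\<lambda>t. S (t, 0)) = ?T (\<lambda>t. S (0, 0))"
  proof (rule flat_transport_cong[OF flat_Conf_transport])
    show "S (t, 0) = S (0, 0)" for t
      unfolding S_def by (rule arg_cong[of _ _ "\<lambda>p. fo (arrange r p)"]) (simp add: point_def fun_eq_iff)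
  qed
  also have "\<dots> = 1"
    using continuous_map_fo inOC[of 0 0]
    by (intro flat_transport_const[OF flat_Conf_transport]) (auto simp: S_def topspace_CX)
  finally have bottom: "?T (\<lambda>t. S (t, 0)) = 1" .
  have top: "?T (\<lambda>t. S (t, 1)) = 1"
    unfolding S_def
  proof (rule Conf_transport_real)
    fix t :: real assume "t \<in> {0..1}"
    then show "arrange r (point (t, 1)) \<in> topspace OC"
      by (intro inOC) auto
    fix b assume b: "b \<in> lab"
    obtain j where "j < m" "b = slot r j"
      by (rule slot_cases[OF r b])
    then show "Im (arrange r (point (t, 1)) b) = 0"
      using r by (simp add: point_def)
  qed
  have side: "?T (\<lambda>t. S (x, t)) = ?T (handle r (necklace_coords m (E x) base_vertex))" for x
    by (rule flat_transport_cong[OF flat_Conf_transport]) (simp add: S_def handle)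
  show ?thesis
    using sq unfolding bottom top side by (simp add: E_def)
qed

theorem necklace_chain_independent:
  assumes r: "r \<in> words" and \<epsilon>: "0 < \<epsilon>" "2 * real m * \<epsilon> < e" and \<epsilon>': "0 < \<epsilon>'" "2 * real m * \<epsilon>' < e"
    and e: "(real m + 1) * e \<le> 1"
  shows "necklace_chain l a d r \<epsilon> - necklace_chain l a d r \<epsilon>' \<in> twisted_relboundaries (Conf_transport l a d) m CX (far_from e)"
proof -
  let ?w = "\<lambda>\<epsilon>. (- 1) ^ m * Conf_transport l a d (handle r (necklace_coords m \<epsilon> base_vertex))"
  have chain: "necklace_chain l a d r \<epsilon> = chain_scale (?w \<epsilon>) (Poly_Mapping.single (necklace_simplex r \<epsilon>) 1)" for \<epsilon>
    by (simp add: necklace_chain_def word_length[OF r] base_vertex_def)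
  have "?w \<epsilon>' = ?w \<epsilon>"
    using handle_independent[OF assms, of a d] by simp
  then have "necklace_chain l a d r \<epsilon> - necklace_chain l a d r \<epsilon>' =
      chain_scale (?w \<epsilon>) (Poly_Mapping.single (necklace_simplex r \<epsilon>) 1 - Poly_Mapping.single (necklace_simplex r \<epsilon>') 1)"
    unfolding chain chain_scale_diff by (simp only:)
  then show ?thesis
    using twisted_relboundaries_scale[OF necklace_simplex_independent[OF assms]] by (simp only:)
qed

end

section \<open>Exhaustion by compact sets\<close>

lemma closedin_Collect_all:
  assumes "\<And>s. s \<in> S \<Longrightarrow> closedin X {x \<in> topspace X. P s x}"
  shows "closedin X {x \<in> topspace X. \<forall>s\<in>S. P s x}"
proof -
  have "openin X {x \<in> topspace X. \<exists>s\<in>S. \<not> P s x}"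
  proof (rule openin_Collect_ex)
    fix s assume "s \<in> S"
    then have "openin X (topspace X - {x \<in> topspace X. P s x})"
      using assms by blast
    moreover have "topspace X - {x \<in> topspace X. P s x} = {x \<in> topspace X. \<not> P s x}"
      by blast
    ultimately show "openin X {x \<in> topspace X. \<not> P s x}"
      by simp
  qed
  moreover have "topspace X - {x \<in> topspace X. \<forall>s\<in>S. P s x} = {x \<in> topspace X. \<exists>s\<in>S. \<not> P s x}"
    by blast
  ultimately show ?thesis
    unfolding closedin_def by auto
qed

context configurations
begin

definition spread :: "real \<Rightarrow> config set" where
  "spread e = {Z \<in> topspace CX. \<forall>z\<in>pts Z. \<forall>w\<in>pts Z. z = w \<or> e \<le> dist z w}"

lemma off_compact_spread: "off_compact CX (Conf_side l c) (spread e) = far_from e"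
proof -
  have neg: "(\<not> (\<forall>z\<in>S. \<forall>w\<in>S. z = w \<or> e \<le> dist z w)) \<longleftrightarrow> (\<exists>z\<in>S. \<exists>w\<in>S. z \<noteq> w \<and> dist z w < e)" for S :: "complex set"
    by (simp add: not_le)
  have "topspace CX - spread e = {Z \<in> topspace CX. \<not> (\<forall>z\<in>pts Z. \<forall>w\<in>pts Z. z = w \<or> e \<le> dist z w)}"
    unfolding spread_def by blast
  also have "\<dots> = close_points e"
    unfolding close_points_def neg ..
  finally have "topspace CX - spread e = close_points e" .
  then show ?thesis
    by (simp add: off_compact_def far_from_def)
qed

lemma compact_square: "compact square"
proof -
  have "square = cbox (Complex (- 1) (- 1)) (Complex 1 1)"
    by (auto simp: square_def in_cbox_complex_iff abs_le_iff)
  then show ?thesis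
    by (metis compact_cbox)
qed

text \<open>In a compact product of squares the condition on distances is closed, and since
  \<open>e > 0\<close> it forces the points to be distinct, so no limit leaves the ordered
  configuration space.\<close>

lemma spread_compact:
  assumes e: "0 < e"
  shows "compactin CX (spread e)"
proof -
  let ?P = "product_topology (\<lambda>_. euclidean :: complex topology) lab"
  let ?B = "Pi\<^sub>E lab (\<lambda>_. square)"
  let ?C = "{z \<in> topspace ?P. \<forall>a\<in>lab. \<forall>b\<in>lab. a = b \<or> e \<le> dist (z a) (z b)}"
  have "closedin ?P ?C"
  proof (intro closedin_Collect_all)
    fix a b assume ab: "a \<in> lab" "b \<in> lab"
    show "closedin ?P {z \<in> topspace ?P. a = b \<or> e \<le> dist (z a) (z b)}"
    proof (cases "a = b")
      case True
      then show ?thesis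
        by (auto simp del: topspace_product_topology)
    next
      case False
      have "continuous_map ?P euclidean (\<lambda>z. z a)" "continuous_map ?P euclidean (\<lambda>z. z b)"
        using ab by (auto intro: continuous_map_product_projection)
      then have "continuous_map ?P euclideanreal (\<lambda>z. dist (z a) (z b))"
        unfolding continuous_map_atin by (auto intro!: tendsto_intros)
      from closedin_continuous_map_preimage[OF this, of "{e..}"] False show ?thesis
        by (simp del: topspace_product_topology)
    qed
  qed
  moreover have "compactin ?P ?B"
    unfolding compactin_PiE using compact_square by simp
  ultimately have "compactin ?P (?C \<inter> ?B)"
    by (rule closed_Int_compactin)
  moreover have CB: "?C \<inter> ?B = {z \<in> topspace OC. \<forall>a\<in>lab. \<forall>b\<in>lab. a = b \<or> e \<le> dist (z a) (z b)}" (is "_ = ?D")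
  proof (intro equalityI subsetI)
    fix z assume "z \<in> ?C \<inter> ?B"
    then have far: "\<forall>a\<in>lab. \<forall>b\<in>lab. a = b \<or> e \<le> dist (z a) (z b)" and zB: "z \<in> ?B"
      by simp_all
    have "inj_on z lab"
    proof (rule inj_onI)
      fix a b assume ab: "a \<in> lab" "b \<in> lab" "z a = z b"
      have "a = b \<or> e \<le> dist (z a) (z b)"
        using far ab(1,2) by blast
      then show "a = b"
        using e ab(3) by simp
    qed
    then show "z \<in> ?D"
      using far zB unfolding topspace_OC by simp
  next
    fix z assume "z \<in> ?D"
    then have "\<forall>a\<in>lab. \<forall>b\<in>lab. a = b \<or> e \<le> dist (z a) (z b)" "z \<in> ?B"
      unfolding topspace_OC by simp_all
    then show "z \<in> ?C \<inter> ?B"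
      by (simp add: PiE_def)
  qed
  ultimately have "compactin OC ?D"
    unfolding ordered_conf_def compactin_subtopology by (auto simp: topspace_OC ordered_conf_def[symmetric])
  then have "compactin CX (fo ` ?D)"
    using continuous_map_fo by (rule image_compactin)
  moreover have "fo ` ?D = spread e"
  proof -
    have iff: "fo z \<in> spread e \<longleftrightarrow> (\<forall>a\<in>lab. \<forall>b\<in>lab. a = b \<or> e \<le> dist (z a) (z b))" if z: "z \<in> topspace OC" for z
    proof -
      have "(\<forall>x\<in>pts (fo z). \<forall>w\<in>pts (fo z). x = w \<or> e \<le> dist x w) \<longleftrightarrow> (\<forall>a\<in>lab. \<forall>b\<in>lab. a = b \<or> e \<le> dist (z a) (z b))"
        unfolding pts_fo ball_simps using OC_distinct[OF z] by metis
      moreover have "fo z \<in> topspace CX"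
        using z unfolding topspace_CX by (rule imageI)
      ultimately show ?thesis
        unfolding spread_def by simp
    qed
    show ?thesis
    proof (intro equalityI subsetI)
      fix Z assume "Z \<in> fo ` ?D"
      then obtain z where "z \<in> ?D" "Z = fo z"
        by (rule imageE)
      then show "Z \<in> spread e"
        using iff by simp
    next
      fix Z assume Z: "Z \<in> spread e"
      then have "Z \<in> fo ` topspace OC"
        unfolding spread_def topspace_CX by simp
      then obtain z where "z \<in> topspace OC" "Z = fo z"
        by (rule imageE)
      then show "Z \<in> fo ` ?D"
        using iff Z by (intro image_eqI[of _ _ z]) simp_all
    qed
  qed
  ultimately show ?thesis
    by simp
qed

text \<open>The strict inequality in \<open>V\<close> makes these sets open; they increase and
  exhaust the space, so a compact set lies in one of them.\<close>

lemma compact_subset_spread: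
  assumes K: "compactin CX K"
  obtains e where "0 < e" "K \<subseteq> spread e"
proof -
  define V where "V n = {Z \<in> topspace CX. \<forall>z\<in>pts Z. \<forall>w\<in>pts Z. z = w \<or> inverse (real (Suc n)) < dist z w}" for n
  have Vopen: "openin CX (V n)" for n
    unfolding V_def
  proof (rule openin_CX_Collect)
    have "openin OC {z \<in> topspace OC. \<forall>a\<in>lab. \<forall>b\<in>lab. a = b \<or> inverse (real (Suc n)) < dist (z a) (z b)}"
    proof (intro openin_Collect_all finite_lab)
      fix a b assume ab: "a \<in> lab" "b \<in> lab"
      show "openin OC {z \<in> topspace OC. a = b \<or> inverse (real (Suc n)) < dist (z a) (z b)}"
      proof (cases "a = b")
        case False
        have "continuous_map OC euclideanreal (\<lambda>z. dist (z a) (z b))"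
          using continuous_map_OC_proj[OF ab(1)] continuous_map_OC_proj[OF ab(2)]
          unfolding continuous_map_atin by (auto intro!: tendsto_intros)
        from openin_continuous_map_preimage[OF this, of "{inverse (real (Suc n))<..}"] False show ?thesis
          by simp
      qed simp
    qed
    moreover have "(\<forall>x\<in>pts (fo z). \<forall>w\<in>pts (fo z). x = w \<or> inverse (real (Suc n)) < dist x w) \<longleftrightarrow>
        (\<forall>a\<in>lab. \<forall>b\<in>lab. a = b \<or> inverse (real (Suc n)) < dist (z a) (z b))" if "z \<in> topspace OC" for z
      unfolding pts_fo ball_simps using OC_distinct[OF that] by metis
    ultimately show "openin OC {z \<in> topspace OC. \<forall>x\<in>pts (fo z). \<forall>w\<in>pts (fo z). x = w \<or> inverse (real (Suc n)) < dist x w}"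
      by (simp only: cong: conj_cong)
  qed
  have Vmono: "V n \<subseteq> V k" if "n \<le> k" for n k
  proof -
    have le: "inverse (real (Suc k)) \<le> inverse (real (Suc n))"
      using that by (simp add: le_imp_inverse_le)
    show ?thesis
    proof
      fix Z assume "Z \<in> V n"
      then have Z: "Z \<in> topspace CX" "\<forall>z\<in>pts Z. \<forall>w\<in>pts Z. z = w \<or> inverse (real (Suc n)) < dist z w"
        unfolding V_def by simp_all
      have "z = w \<or> inverse (real (Suc k)) < dist z w" if "z \<in> pts Z" "w \<in> pts Z" for z w
        using Z(2) that le by (meson order.strict_trans1)
      then show "Z \<in> V k"
        unfolding V_def using Z(1) by simp
    qed
  qed
  have "K \<subseteq> (\<Union>n. V n)"
  proof
    fix Z assume "Z \<in> K"
    then have Z: "Z \<in> topspace CX"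
      using compactin_subset_topspace[OF K] by blast
    have "finite (pts Z)"
      using Z finite_lab by (auto simp: topspace_CX pts_fo)
    then have fin: "finite {dist z w |z w. z \<in> pts Z \<and> w \<in> pts Z \<and> z \<noteq> w}" (is "finite ?D")
      by (intro finite_subset[of ?D "(\<lambda>(z, w). dist z w) ` (pts Z \<times> pts Z)"]) auto
    \<comment> \<open>The added 1 covers configurations with at most one point, for which there are
      no distances.\<close>
    have "0 < Min (insert 1 ?D)"
      using fin by (subst Min_gr_iff) auto
    then obtain n where n: "inverse (real (Suc n)) < Min (insert 1 ?D)"
      using reals_Archimedean by blast
    have "z = w \<or> inverse (real (Suc n)) < dist z w" if zw: "z \<in> pts Z" "w \<in> pts Z" for z w
    proof (cases "z = w")
      case False
      have "Min (insert 1 ?D) \<le> dist z w"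
        using fin zw False by (intro Min_le) auto
      then show ?thesis
        using n by linarith
    qed simp
    then have "Z \<in> V n"
      using Z unfolding V_def by simp
    then show "Z \<in> (\<Union>n. V n)"
      by blast
  qed
  then obtain \<F> where \<F>: "finite \<F>" "\<F> \<subseteq> range V" "K \<subseteq> \<Union>\<F>"
    using K Vopen unfolding compactin_def by (metis (no_types, lifting) imageE)
  obtain J where J: "finite J" "\<F> = V ` J"
    using finite_subset_image[OF \<F>(1,2)] by blast
  have "K \<subseteq> V (Max (insert 0 J))"
  proof
    fix Z assume "Z \<in> K"
    then obtain n where "n \<in> J" "Z \<in> V n"
      using \<F>(3) J(2) by blast
    then show "Z \<in> V (Max (insert 0 J))"
      using Vmono[of n "Max (insert 0 J)"] J(1) by auto
  qed
  also have "V n \<subseteq> spread (inverse (real (Suc n)))" for n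
  proof
    fix Z assume "Z \<in> V n"
    then have Z: "Z \<in> topspace CX" "\<forall>z\<in>pts Z. \<forall>w\<in>pts Z. z = w \<or> inverse (real (Suc n)) < dist z w"
      unfolding V_def by simp_all
    have "z = w \<or> inverse (real (Suc n)) \<le> dist z w" if "z \<in> pts Z" "w \<in> pts Z" for z w
      using Z(2) that by (meson less_imp_le)
    then show "Z \<in> spread (inverse (real (Suc n)))"
      unfolding spread_def using Z(1) by simp
  qed
  finally show ?thesis
    by (rule that[rotated]) simp
qed

lemma spread_mono:
  assumes "e \<le> e'"
  shows "spread e' \<subseteq> spread e"
proof
  fix Z assume "Z \<in> spread e'"
  then have Z: "Z \<in> topspace CX" "\<forall>z\<in>pts Z. \<forall>w\<in>pts Z. z = w \<or> e' \<le> dist z w"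
    unfolding spread_def by simp_all
  have "z = w \<or> e \<le> dist z w" if "z \<in> pts Z" "w \<in> pts Z" for z w
    using Z(2) that assms by (meson order_trans)
  then show "Z \<in> spread e"
    unfolding spread_def using Z(1) by simp
qed

end

section \<open>The module structure on Borel--Moore homology\<close>

locale twisted_pair =
  fixes T :: "'x transport" and n :: nat and X :: "'x topology" and A :: "'x set"
begin

abbreviation "cyc \<equiv> twisted_relcycles T n X A"
abbreviation "bnd \<equiv> twisted_relboundaries T n X A"
abbreviation "cls \<equiv> twisted_class T n X A"
abbreviation "H \<equiv> twisted_homology T n X A"

lemma class_self: "z \<in> cyc \<Longrightarrow> z \<in> cls z"
  by (simp add: twisted_class_def)

lemma class_eq_iff:
  assumes "z \<in> cyc" "w \<in> cyc"
  shows "cls z = cls w \<longleftrightarrow> z - w \<in> bnd"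
proof
  assume "cls z = cls w"
  then have "z \<in> cls w"
    using class_self[OF assms(1)] by simp
  then show "z - w \<in> bnd"
    by (simp add: twisted_class_def)
next
  assume zw: "z - w \<in> bnd"
  have "x - z \<in> bnd \<longleftrightarrow> x - w \<in> bnd" for x
    using twisted_relboundaries_trans[OF _ zw] twisted_relboundaries_trans[OF _ twisted_relboundaries_swap[OF zw]] by blast
  then show "cls z = cls w"
    by (simp add: twisted_class_def)
qed

text \<open>The operations of \<open>twisted_homology\<close> act on representatives picked by
  \<open>SOME\<close>; that these differ from a given one by a boundary makes the operations
  computable on any representative.\<close>

lemma class_representative:
  assumes "z \<in> cyc"
  shows "(SOME w. w \<in> cls z) \<in> cyc" "(SOME w. w \<in> cls z) - z \<in> bnd"
proof -
  have "(SOME w. w \<in> cls z) \<in> cls z"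
    by (rule someI[of _ z]) (rule class_self[OF assms])
  then show "(SOME w. w \<in> cls z) \<in> cyc" "(SOME w. w \<in> cls z) - z \<in> bnd"
    by (simp_all add: twisted_class_def)
qed

lemma carrier_H: "carrier H = cls ` cyc"
  by (simp add: twisted_homology_def)

lemma zero_H: "\<zero>\<^bsub>H\<^esub> = cls 0"
  by (simp add: twisted_homology_def)

lemma add_class:
  assumes "x \<in> cyc" "y \<in> cyc"
  shows "cls x \<oplus>\<^bsub>H\<^esub> cls y = cls (x + y)"
proof -
  let ?x = "SOME w. w \<in> cls x" and ?y = "SOME w. w \<in> cls y"
  note X = class_representative[OF assms(1)] and Y = class_representative[OF assms(2)]
  have "(?x + ?y) - (x + y) = (?x - x) + (?y - y)"
    by simp
  then have "(?x + ?y) - (x + y) \<in> bnd"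
    using twisted_relboundaries_add[OF X(2) Y(2)] by (simp only:)
  then have "cls (?x + ?y) = cls (x + y)"
    using X(1) Y(1) assms by (subst class_eq_iff) (auto intro: twisted_relcycles_add)
  then show ?thesis
    by (simp add: twisted_homology_def)
qed

lemma smult_class:
  assumes "x \<in> cyc"
  shows "r \<odot>\<^bsub>H\<^esub> cls x = cls (chain_scale r x)"
proof -
  let ?x = "SOME w. w \<in> cls x"
  note X = class_representative[OF assms(1)]
  have "chain_scale r ?x - chain_scale r x \<in> bnd"
    using twisted_relboundaries_scale[OF X(2), of r] by (simp add: chain_scale_diff)
  then have "cls (chain_scale r ?x) = cls (chain_scale r x)"
    using X(1) assms by (subst class_eq_iff) (auto intro: twisted_relcycles_scale)
  then show ?thesis
    by (simp add: twisted_homology_def)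
qed

lemma module_H: "module laurent_ring H"
proof (rule moduleI)
  show "cring laurent_ring"
    by (rule cring_laurent_ring)
  show "abelian_group H"
  proof (rule abelian_groupI)
    show "\<exists>y\<in>carrier H. y \<oplus>\<^bsub>H\<^esub> x = \<zero>\<^bsub>H\<^esub>" if x: "x \<in> carrier H" for x
    proof -
      obtain z where z: "x = cls z" "z \<in> cyc"
        using x by (auto simp: carrier_H)
      have m: "chain_scale (- 1) z \<in> cyc"
        by (rule twisted_relcycles_scale[OF z(2)])
      have "cls (chain_scale (- 1) z) \<oplus>\<^bsub>H\<^esub> x = \<zero>\<^bsub>H\<^esub>"
        unfolding z(1) add_class[OF m z(2)] zero_H by (simp add: chain_scale_minus_left)
      then show ?thesis
        using m by (auto simp: carrier_H)
    qed
  qed (auto simp: carrier_H zero_H add_class twisted_relcycles_add add_ac)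
qed (auto simp: carrier_H add_class smult_class twisted_relcycles_add twisted_relcycles_scale chain_scale_add chain_scale_add_left)

end

section \<open>Compatible families over the compact sets\<close>

locale borel_moore =
  fixes T :: "'x transport" and n :: nat and X :: "'x topology" and Y :: "'x set"
begin

abbreviation "off \<equiv> off_compact X Y"
abbreviation "HK K \<equiv> twisted_homology T n X (off K)"
abbreviation "clsK K \<equiv> twisted_class T n X (off K)"
abbreviation "cycK K \<equiv> twisted_relcycles T n X (off K)"
abbreviation "bndK K \<equiv> twisted_relboundaries T n X (off K)"
abbreviation "BM \<equiv> borel_moore_homology T n X Y"

lemma off_antimono: "K \<subseteq> L \<Longrightarrow> off L \<subseteq> off K"
  by (auto simp: off_compact_def)

lemma cycK_antimono: "K \<subseteq> L \<Longrightarrow> z \<in> cycK L \<Longrightarrow> z \<in> cycK K"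
  using off_antimono twisted_relcycles_mono by metis

lemma bndK_antimono: "K \<subseteq> L \<Longrightarrow> z \<in> bndK L \<Longrightarrow> z \<in> bndK K"
  using off_antimono twisted_relboundaries_mono by metis

lemma clsK_antimono:
  assumes "K \<subseteq> L" "z \<in> cycK L" "w \<in> cycK L" "clsK L z = clsK L w"
  shows "clsK K z = clsK K w"
  using assms(4) bndK_antimono[OF assms(1)] cycK_antimono[OF assms(1)] assms(2,3)
  unfolding twisted_pair.class_eq_iff[OF assms(2,3)] by (subst twisted_pair.class_eq_iff) auto

text \<open>A cycle representing the class at \<open>L\<close> represents it at every smaller
  compact set too. In this form the compatibility conditions disappear, and one works with a single
  chain at a time.\<close>

lemma carrier_BM_iff:
  "h \<in> carrier BM \<longleftrightarrow> h \<in> extensional {K. compactin X K} \<and>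
     (\<forall>L. compactin X L \<longrightarrow> (\<exists>z\<in>cycK L. \<forall>K. compactin X K \<longrightarrow> K \<subseteq> L \<longrightarrow> h K = clsK K z))"
proof
  assume "h \<in> carrier BM"
  then have h: "h \<in> extensional {K. compactin X K}" "\<And>L. compactin X L \<Longrightarrow> h L \<in> carrier (HK L)"
    "\<And>K L z. compactin X K \<Longrightarrow> compactin X L \<Longrightarrow> K \<subseteq> L \<Longrightarrow> z \<in> h L \<Longrightarrow> h K = clsK K z"
    by (auto simp: borel_moore_homology_def Let_def PiE_def Pi_iff)
  have "\<exists>z\<in>cycK L. \<forall>K. compactin X K \<longrightarrow> K \<subseteq> L \<longrightarrow> h K = clsK K z" if L: "compactin X L" for L
  proof -
    obtain z where z: "h L = clsK L z" "z \<in> cycK L"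
      using h(2)[OF L] by (auto simp: twisted_pair.carrier_H)
    then have "z \<in> h L"
      by (simp add: twisted_pair.class_self)
    then show ?thesis
      using z(2) h(3)[OF _ L] by blast
  qed
  then show "h \<in> extensional {K. compactin X K} \<and>
     (\<forall>L. compactin X L \<longrightarrow> (\<exists>z\<in>cycK L. \<forall>K. compactin X K \<longrightarrow> K \<subseteq> L \<longrightarrow> h K = clsK K z))"
    using h(1) by blast
next
  assume h: "h \<in> extensional {K. compactin X K} \<and>
     (\<forall>L. compactin X L \<longrightarrow> (\<exists>z\<in>cycK L. \<forall>K. compactin X K \<longrightarrow> K \<subseteq> L \<longrightarrow> h K = clsK K z))"
  have "h L \<in> carrier (HK L)" if "compactin X L" for L
    using h that by (auto simp: twisted_pair.carrier_H)
  moreover have "h K = clsK K z" if K: "compactin X K" and L: "compactin X L" and KL: "K \<subseteq> L" and z: "z \<in> h L" for K L z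
  proof -
    obtain w where w: "w \<in> cycK L" "\<And>K. compactin X K \<Longrightarrow> K \<subseteq> L \<Longrightarrow> h K = clsK K w"
      using h L by blast
    have "z \<in> clsK L w"
      using w(2)[OF L] z by simp
    then have zc: "z \<in> cycK L" "z - w \<in> bndK L"
      by (simp_all add: twisted_class_def)
    then have "clsK L z = clsK L w"
      using w(1) by (simp add: twisted_pair.class_eq_iff)
    then show ?thesis
      using clsK_antimono[OF KL zc(1) w(1)] w(2)[OF K KL] by simp
  qed
  ultimately show "h \<in> carrier BM"
    using h by (auto simp: borel_moore_homology_def Let_def PiE_def Pi_iff)
qed

lemma carrier_BM_representative:
  assumes "h \<in> carrier BM" "compactin X L"
  shows "\<exists>z\<in>cycK L. \<forall>K. compactin X K \<longrightarrow> K \<subseteq> L \<longrightarrow> h K = clsK K z"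
  using assms unfolding carrier_BM_iff by simp

lemma carrier_BM_extensional: "h \<in> carrier BM \<Longrightarrow> \<not> compactin X K \<Longrightarrow> h K = undefined"
  unfolding carrier_BM_iff extensional_def by simp

lemma carrier_BM_HK:
  assumes "h \<in> carrier BM" "compactin X K"
  shows "h K \<in> carrier (HK K)"
proof -
  obtain z where "z \<in> cycK K" "\<forall>L. compactin X L \<longrightarrow> L \<subseteq> K \<longrightarrow> h L = clsK L z"
    using carrier_BM_representative[OF assms] by (rule bexE)
  then show ?thesis
    using assms(2) by (simp add: twisted_pair.carrier_H)
qed

lemma add_BM: "compactin X K \<Longrightarrow> (g \<oplus>\<^bsub>BM\<^esub> h) K = g K \<oplus>\<^bsub>HK K\<^esub> h K"
  and smult_BM: "compactin X K \<Longrightarrow> (r \<odot>\<^bsub>BM\<^esub> h) K = r \<odot>\<^bsub>HK K\<^esub> h K"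
  and zero_BM: "compactin X K \<Longrightarrow> \<zero>\<^bsub>BM\<^esub> K = \<zero>\<^bsub>HK K\<^esub>"
  by (simp_all add: borel_moore_homology_def Let_def)

lemma add_BM_carrier:
  assumes g: "g \<in> carrier BM" and h: "h \<in> carrier BM"
  shows "g \<oplus>\<^bsub>BM\<^esub> h \<in> carrier BM"
  unfolding carrier_BM_iff
proof (intro conjI allI impI)
  show "g \<oplus>\<^bsub>BM\<^esub> h \<in> extensional {K. compactin X K}"
    by (simp add: borel_moore_homology_def Let_def)
  fix L assume L: "compactin X L"
  obtain x where x: "x \<in> cycK L" "\<forall>K. compactin X K \<longrightarrow> K \<subseteq> L \<longrightarrow> g K = clsK K x"
    using carrier_BM_representative[OF g L] by (rule bexE)
  obtain y where y: "y \<in> cycK L" "\<forall>K. compactin X K \<longrightarrow> K \<subseteq> L \<longrightarrow> h K = clsK K y"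
    using carrier_BM_representative[OF h L] by (rule bexE)
  show "\<exists>z\<in>cycK L. \<forall>K. compactin X K \<longrightarrow> K \<subseteq> L \<longrightarrow> (g \<oplus>\<^bsub>BM\<^esub> h) K = clsK K z"
    using x y cycK_antimono[of _ L] by (intro bexI[of _ "x + y"] allI impI) (simp_all add: add_BM twisted_pair.add_class twisted_relcycles_add)
qed

lemma smult_BM_carrier:
  assumes h: "h \<in> carrier BM"
  shows "r \<odot>\<^bsub>BM\<^esub> h \<in> carrier BM"
  unfolding carrier_BM_iff
proof (intro conjI allI impI)
  show "r \<odot>\<^bsub>BM\<^esub> h \<in> extensional {K. compactin X K}"
    by (simp add: borel_moore_homology_def Let_def)
  fix L assume L: "compactin X L"
  obtain y where y: "y \<in> cycK L" "\<forall>K. compactin X K \<longrightarrow> K \<subseteq> L \<longrightarrow> h K = clsK K y"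
    using carrier_BM_representative[OF h L] by (rule bexE)
  show "\<exists>z\<in>cycK L. \<forall>K. compactin X K \<longrightarrow> K \<subseteq> L \<longrightarrow> (r \<odot>\<^bsub>BM\<^esub> h) K = clsK K z"
    using y cycK_antimono[of _ L] by (intro bexI[of _ "chain_scale r y"] allI impI) (simp_all add: smult_BM twisted_pair.smult_class twisted_relcycles_scale)
qed

lemma zero_BM_carrier: "\<zero>\<^bsub>BM\<^esub> \<in> carrier BM"
  unfolding carrier_BM_iff
proof (intro conjI allI impI)
  show "\<zero>\<^bsub>BM\<^esub> \<in> extensional {K. compactin X K}"
    by (simp add: borel_moore_homology_def Let_def)
  show "\<exists>z\<in>cycK L. \<forall>K. compactin X K \<longrightarrow> K \<subseteq> L \<longrightarrow> \<zero>\<^bsub>BM\<^esub> K = clsK K z" for L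
    by (intro bexI[of _ 0] allI impI) (simp_all add: zero_BM twisted_pair.zero_H twisted_relcycles_0)
qed

lemma BM_eqI:
  assumes "g \<in> carrier BM" "h \<in> carrier BM" "\<And>K. compactin X K \<Longrightarrow> g K = h K"
  shows "g = h"
proof
  fix K show "g K = h K"
    using carrier_BM_extensional[OF assms(1), of K] carrier_BM_extensional[OF assms(2), of K] assms(3)[of K]
    by (cases "compactin X K") simp_all
qed

lemma module_BM: "module laurent_ring BM"
proof -
  have M: "module laurent_ring (HK K)" for K
    by (rule twisted_pair.module_H)
  have AG: "abelian_group (HK K)" for K
    by (rule module.axioms(2)[OF M])
  have CM: "abelian_monoid (HK K)" for K
    by (rule abelian_group.axioms(1)[OF AG])
  show ?thesis
  proof (rule moduleI)
    show "cring laurent_ring"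
      by (rule cring_laurent_ring)
    show "abelian_group BM"
    proof (rule abelian_groupI)
      show "x \<oplus>\<^bsub>BM\<^esub> y \<in> carrier BM" if "x \<in> carrier BM" "y \<in> carrier BM" for x y
        by (rule add_BM_carrier[OF that])
      show "\<zero>\<^bsub>BM\<^esub> \<in> carrier BM"
        by (rule zero_BM_carrier)
      show "(x \<oplus>\<^bsub>BM\<^esub> y) \<oplus>\<^bsub>BM\<^esub> z = x \<oplus>\<^bsub>BM\<^esub> (y \<oplus>\<^bsub>BM\<^esub> z)" if "x \<in> carrier BM" "y \<in> carrier BM" "z \<in> carrier BM" for x y z
        using that abelian_monoid.a_assoc[OF CM] carrier_BM_HK
        by (intro BM_eqI add_BM_carrier) (simp_all add: add_BM)
      show "x \<oplus>\<^bsub>BM\<^esub> y = y \<oplus>\<^bsub>BM\<^esub> x" if "x \<in> carrier BM" "y \<in> carrier BM" for x y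
        using that abelian_monoid.a_comm[OF CM] carrier_BM_HK
        by (intro BM_eqI add_BM_carrier) (simp_all add: add_BM)
      show "\<zero>\<^bsub>BM\<^esub> \<oplus>\<^bsub>BM\<^esub> x = x" if "x \<in> carrier BM" for x
        using that abelian_monoid.l_zero[OF CM] carrier_BM_HK
        by (intro BM_eqI add_BM_carrier zero_BM_carrier) (simp_all add: add_BM zero_BM)
      show "\<exists>y\<in>carrier BM. y \<oplus>\<^bsub>BM\<^esub> x = \<zero>\<^bsub>BM\<^esub>" if x: "x \<in> carrier BM" for x
      proof (rule bexI)
        show c: "(- 1) \<odot>\<^bsub>BM\<^esub> x \<in> carrier BM"
          by (rule smult_BM_carrier[OF x])
        show "(- 1) \<odot>\<^bsub>BM\<^esub> x \<oplus>\<^bsub>BM\<^esub> x = \<zero>\<^bsub>BM\<^esub>"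
        proof (rule BM_eqI[OF add_BM_carrier[OF c x] zero_BM_carrier])
          fix K assume K: "compactin X K"
          obtain z where z: "x K = clsK K z" "z \<in> cycK K"
            using carrier_BM_HK[OF x K] by (auto simp: twisted_pair.carrier_H)
          show "((- 1) \<odot>\<^bsub>BM\<^esub> x \<oplus>\<^bsub>BM\<^esub> x) K = \<zero>\<^bsub>BM\<^esub> K"
            using z twisted_relcycles_scale[OF z(2), of "- 1"]
            by (simp add: add_BM smult_BM zero_BM K twisted_pair.smult_class twisted_pair.add_class
                twisted_pair.zero_H chain_scale_minus_left)
        qed
      qed
    qed
    show "r \<odot>\<^bsub>BM\<^esub> x \<in> carrier BM" if "x \<in> carrier BM" for r x
      by (rule smult_BM_carrier[OF that])
    show "(r \<oplus>\<^bsub>laurent_ring\<^esub> s) \<odot>\<^bsub>BM\<^esub> x = r \<odot>\<^bsub>BM\<^esub> x \<oplus>\<^bsub>BM\<^esub> s \<odot>\<^bsub>BM\<^esub> x" if "x \<in> carrier BM" for r s x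
      using that module.smult_l_distr[OF M, of r s] carrier_BM_HK
      by (intro BM_eqI add_BM_carrier smult_BM_carrier) (simp_all add: add_BM smult_BM)
    show "r \<odot>\<^bsub>BM\<^esub> (x \<oplus>\<^bsub>BM\<^esub> y) = r \<odot>\<^bsub>BM\<^esub> x \<oplus>\<^bsub>BM\<^esub> r \<odot>\<^bsub>BM\<^esub> y" if "x \<in> carrier BM" "y \<in> carrier BM" for r x y
      using that module.smult_r_distr[OF M, of r] carrier_BM_HK
      by (intro BM_eqI add_BM_carrier smult_BM_carrier) (simp_all add: add_BM smult_BM)
    show "(r \<otimes>\<^bsub>laurent_ring\<^esub> s) \<odot>\<^bsub>BM\<^esub> x = r \<odot>\<^bsub>BM\<^esub> (s \<odot>\<^bsub>BM\<^esub> x)" if "x \<in> carrier BM" for r s x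
      using that module.smult_assoc1[OF M, of r s] carrier_BM_HK
      by (intro BM_eqI add_BM_carrier smult_BM_carrier) (simp_all add: add_BM smult_BM)
    show "\<one>\<^bsub>laurent_ring\<^esub> \<odot>\<^bsub>BM\<^esub> x = x" if "x \<in> carrier BM" for x
      using that module.smult_one[OF M] carrier_BM_HK
      by (intro BM_eqI smult_BM_carrier) (simp_all add: smult_BM)
  qed
qed

lemma finsum_BM:
  assumes fin: "finite B" and F: "\<And>b. b \<in> B \<Longrightarrow> F b \<in> carrier BM" and K: "compactin X K"
    and z: "\<And>b. b \<in> B \<Longrightarrow> z b \<in> cycK K" "\<And>b. b \<in> B \<Longrightarrow> F b K = clsK K (z b)"
  shows "(\<Oplus>\<^bsub>BM\<^esub>b\<in>B. f b \<odot>\<^bsub>BM\<^esub> F b) K = clsK K (\<Sum>b\<in>B. chain_scale (f b) (z b))"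
  using fin F z
proof (induction B rule: finite_induct)
  case empty
  interpret module laurent_ring BM
    by (rule module_BM)
  show ?case
    by (simp add: zero_BM[OF K] twisted_pair.zero_H)
next
  case (insert b B)
  interpret module laurent_ring BM
    by (rule module_BM)
  have "(\<Oplus>\<^bsub>BM\<^esub>b\<in>insert b B. f b \<odot>\<^bsub>BM\<^esub> F b) = f b \<odot>\<^bsub>BM\<^esub> F b \<oplus>\<^bsub>BM\<^esub> (\<Oplus>\<^bsub>BM\<^esub>b\<in>B. f b \<odot>\<^bsub>BM\<^esub> F b)"
    using insert.hyps insert.prems(1) smult_BM_carrier by (intro finsum_insert) auto
  then show ?case
    using insert.IH insert.prems insert.hyps
    by (simp add: add_BM[OF K] smult_BM[OF K] twisted_pair.smult_class twisted_pair.add_class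
        twisted_relcycles_sum twisted_relcycles_scale)
qed

end

section \<open>Bases of Borel--Moore homology\<close>

text \<open>Each value is the restriction of a value at a larger compact set of the cofinal family,
  where every cycle bounds.\<close>

lemma (in borel_moore) carrier_BM_trivial:
  assumes cofinal: "\<And>L. compactin X L \<Longrightarrow> \<exists>L'. compactin X L' \<and> L \<subseteq> L' \<and> cycK L' \<subseteq> bndK L'"
  shows "carrier BM = {\<zero>\<^bsub>BM\<^esub>}"
proof -
  have "h = \<zero>\<^bsub>BM\<^esub>" if h: "h \<in> carrier BM" for h
  proof (rule BM_eqI[OF h zero_BM_carrier])
    fix K assume K: "compactin X K"
    obtain L where L: "compactin X L" "K \<subseteq> L" "cycK L \<subseteq> bndK L"
      using cofinal[OF K] by (elim exE conjE)
    obtain z where z: "z \<in> cycK L" "\<forall>K. compactin X K \<longrightarrow> K \<subseteq> L \<longrightarrow> h K = clsK K z"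
      using carrier_BM_representative[OF h L(1)] by (rule bexE)
    have "z \<in> cycK K" "z \<in> bndK K"
      using cycK_antimono[OF L(2) z(1)] bndK_antimono[OF L(2), of z] z(1) L(3) by (simp_all add: subsetD)
    then have "clsK K z = clsK K 0"
      by (simp add: twisted_pair.class_eq_iff)
    then show "h K = \<zero>\<^bsub>BM\<^esub> K"
      using z(2) K L(2) by (simp add: zero_BM[OF K] twisted_pair.zero_H)
  qed
  then show ?thesis
    using zero_BM_carrier by blast
qed

text \<open>\<open>good L z\<close> means that \<open>L\<close> belongs to a cofinal family and that
  the chains \<open>z\<close> represent the classes \<open>F\<close> on \<open>L\<close> and below.
  So restriction between good sets carries basis to basis, and the limit behaves as if it were
  constant.\<close>

locale borel_moore_free = borel_moore T n X Y
  for T :: "'x transport" and n and X :: "'x topology" and Y :: "'x set" +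
  fixes I :: "'i set" and F :: "'i \<Rightarrow> 'x set \<Rightarrow> 'x tchain set"
    and good :: "'x set \<Rightarrow> ('i \<Rightarrow> 'x tchain) \<Rightarrow> bool"
  assumes finite_index: "finite I"
    and class_extensional: "i \<in> I \<Longrightarrow> F i \<in> extensional {K. compactin X K}"
    and cofinal: "compactin X L \<Longrightarrow> \<exists>L' z. L \<subseteq> L' \<and> good L' z"
    and good_compact: "good L z \<Longrightarrow> compactin X L"
    and good_free: "good L z \<Longrightarrow> twisted_free T n X (off L) I z"
    and good_class: "good L z \<Longrightarrow> i \<in> I \<Longrightarrow> compactin X K \<Longrightarrow> K \<subseteq> L \<Longrightarrow> F i K = clsK K (z i)"
begin

sublocale BM: module laurent_ring BM
  by (rule module_BM)

lemma good_cycle: "good L z \<Longrightarrow> i \<in> I \<Longrightarrow> z i \<in> cycK L"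
  by (rule twisted_free_relcycle[OF good_free])

lemma class_carrier:
  assumes i: "i \<in> I"
  shows "F i \<in> carrier BM"
  unfolding carrier_BM_iff
proof (intro conjI allI impI)
  show "F i \<in> extensional {K. compactin X K}"
    by (rule class_extensional[OF i])
  fix L assume L: "compactin X L"
  obtain L' z where L': "L \<subseteq> L'" "good L' z"
    using cofinal[OF L] by (elim exE conjE)
  show "\<exists>z\<in>cycK L. \<forall>K. compactin X K \<longrightarrow> K \<subseteq> L \<longrightarrow> F i K = clsK K z"
  proof (intro bexI[of _ "z i"] allI impI)
    show "z i \<in> cycK L"
      by (rule cycK_antimono[OF L'(1) good_cycle[OF L'(2) i]])
    show "F i K = clsK K (z i)" if "compactin X K" "K \<subseteq> L" for K
      using that(2) L'(1) by (intro good_class[OF L'(2) i that(1)]) simp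
  qed
qed

definition combination :: "('i \<Rightarrow> laurent) \<Rightarrow> 'x set \<Rightarrow> 'x tchain set" where
  "combination f = (\<Oplus>\<^bsub>BM\<^esub>i\<in>I. f i \<odot>\<^bsub>BM\<^esub> F i)"

lemma combination_carrier: "combination f \<in> carrier BM"
  unfolding combination_def by (intro BM.finsum_closed Pi_I smult_BM_carrier class_carrier)

lemma combination_at:
  assumes "good L z" "compactin X K" "K \<subseteq> L"
  shows "combination f K = clsK K (\<Sum>i\<in>I. chain_scale (f i) (z i))"
  unfolding combination_def
  using finite_index class_carrier assms(2)
proof (rule finsum_BM)
  fix i assume i: "i \<in> I"
  show "z i \<in> cycK K"
    by (rule cycK_antimono[OF assms(3) good_cycle[OF assms(1) i]])
  show "F i K = clsK K (z i)"
    by (rule good_class[OF assms(1) i assms(2,3)])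
qed

lemma combination_unique:
  assumes L: "good L z" and eq: "combination f L = combination g L" and i: "i \<in> I"
  shows "f i = g i"
proof -
  have cyc: "(\<Sum>i\<in>I. chain_scale (f i) (z i)) \<in> cycK L" for f
    by (intro twisted_relcycles_sum twisted_relcycles_scale good_cycle[OF L])
  have "clsK L (\<Sum>i\<in>I. chain_scale (f i) (z i)) = clsK L (\<Sum>i\<in>I. chain_scale (g i) (z i))"
    using eq unfolding combination_at[OF L good_compact[OF L] order_refl] .
  then have "(\<Sum>i\<in>I. chain_scale (f i) (z i)) - (\<Sum>i\<in>I. chain_scale (g i) (z i)) \<in> bndK L"
    unfolding twisted_pair.class_eq_iff[OF cyc cyc] .
  moreover have "chain_scale (f i - g i) (z i) = chain_scale (f i) (z i) - chain_scale (g i) (z i)" for i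
    using chain_scale_add_left[of "f i" "- g i" "z i"] by (simp add: chain_scale_minus_left)
  ultimately have "(\<Sum>i\<in>I. chain_scale (f i - g i) (z i)) \<in> bndK L"
    by (simp add: sum_subtractf)
  then have "f i - g i = 0"
    by (rule twisted_free_independent[OF good_free[OF L] _ i])
  then show ?thesis
    by simp
qed

lemma combination_generates:
  assumes L: "good L z" and h: "h \<in> carrier BM"
  shows "\<exists>f. \<forall>K. compactin X K \<longrightarrow> K \<subseteq> L \<longrightarrow> h K = combination f K"
proof -
  have cyc: "(\<Sum>i\<in>I. chain_scale (f i) (z i)) \<in> cycK L" for f
    by (intro twisted_relcycles_sum twisted_relcycles_scale good_cycle[OF L])
  obtain w where w: "w \<in> cycK L" "\<forall>K. compactin X K \<longrightarrow> K \<subseteq> L \<longrightarrow> h K = clsK K w"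
    using carrier_BM_representative[OF h good_compact[OF L]] by (rule bexE)
  obtain f where f: "w - (\<Sum>i\<in>I. chain_scale (f i) (z i)) \<in> bndK L"
    using twisted_free_generates[OF good_free[OF L] w(1)] by (rule exE)
  then have "clsK L w = clsK L (\<Sum>i\<in>I. chain_scale (f i) (z i))"
    unfolding twisted_pair.class_eq_iff[OF w(1) cyc] .
  then have "h K = combination f K" if "compactin X K" "K \<subseteq> L" for K
    unfolding combination_at[OF L that] using w(2) that clsK_antimono[OF that(2) w(1) cyc] by simp
  then show ?thesis
    by blast
qed

lemma good_exists: "\<exists>L z. good L z"
  using cofinal[OF compactin_empty] by blast

text \<open>Coefficients found at one good set \<open>L\<close> serve everywhere. For another
  compact \<open>K\<close>, a good set containing \<open>K\<close> and \<open>L\<close> supplies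
  coefficients as well, and uniqueness at \<open>L\<close> forces them to be the same.\<close>

lemma combination_surj:
  assumes h: "h \<in> carrier BM"
  shows "\<exists>f. h = combination f"
proof -
  obtain L z where L: "good L z"
    using good_exists by (elim exE)
  obtain f where f: "\<forall>K. compactin X K \<longrightarrow> K \<subseteq> L \<longrightarrow> h K = combination f K"
    using combination_generates[OF L h] by (rule exE)
  have "h = combination f"
  proof (rule BM_eqI[OF h combination_carrier])
    fix K assume K: "compactin X K"
    obtain M w where M: "K \<union> L \<subseteq> M" "good M w"
      using cofinal[OF compactin_Un[OF K good_compact[OF L]]] by (elim exE conjE)
    obtain g where g: "\<forall>K. compactin X K \<longrightarrow> K \<subseteq> M \<longrightarrow> h K = combination g K"
      using combination_generates[OF M(2) h] by (rule exE)
    have "combination f L = combination g L"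
      using f[rule_format, of L] g[rule_format, of L] good_compact[OF L] M(1) by simp
    then have eq: "f i = g i" if "i \<in> I" for i
      using that by (rule combination_unique[OF L])
    have "combination f = combination g"
      unfolding combination_def
    proof (rule BM.finsum_cong'[OF refl])
      show "(\<lambda>i. g i \<odot>\<^bsub>BM\<^esub> F i) \<in> I \<rightarrow> carrier BM"
        by (intro Pi_I smult_BM_carrier class_carrier)
    qed (simp only: eq)
    then show "h K = combination f K"
      using g K M(1) by simp
  qed
  then show ?thesis
    by blast
qed

text \<open>Unit vectors of coefficients give equal combinations at a good set only if they are
  equal. This is needed because \<open>module_basis\<close> speaks of the image as a set.\<close>

theorem inj_on_class: "inj_on F I"
proof (rule inj_onI)
  fix i j assume ij: "i \<in> I" "j \<in> I" "F i = F j"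
  obtain L z where L: "good L z"
    using good_exists by (elim exE)
  have delta: "combination (\<lambda>k. if k = i then 1 else 0) L = F i L" if i: "i \<in> I" for i
  proof -
    have "(\<Sum>k\<in>I. chain_scale (if k = i then 1 else 0) (z k)) = (\<Sum>k\<in>I. if k = i then z k else 0)"
      by (rule sum.cong) simp_all
    also have "\<dots> = z i"
      using i finite_index by simp
    finally show ?thesis
      unfolding combination_at[OF L good_compact[OF L] order_refl] good_class[OF L i good_compact[OF L] order_refl]
      by (simp only:)
  qed
  have "combination (\<lambda>k. if k = i then 1 else 0) L = combination (\<lambda>k. if k = j then 1 else 0) L"
    using ij by (simp only: delta)
  from combination_unique[OF L this ij(1)] show "i = j"
    by (simp split: if_splits)
qed

text \<open>Combinations over the index set are translated into sums over the image and back by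
  reindexing along the injective \<open>F\<close>; coefficients outside a finite subset are filled
  with 0.\<close>

theorem basis_BM: "module_basis laurent_ring BM (F ` I)"
  unfolding module_basis_def
proof (intro conjI ballI allI impI)
  show "F ` I \<subseteq> carrier BM"
    using class_carrier by blast
next
  fix h assume "h \<in> carrier BM"
  then obtain f where f: "h = combination f"
    using combination_surj by blast
  have "(\<Oplus>\<^bsub>BM\<^esub>b\<in>F ` I. f (inv_into I F b) \<odot>\<^bsub>BM\<^esub> b) = (\<Oplus>\<^bsub>BM\<^esub>i\<in>I. f (inv_into I F (F i)) \<odot>\<^bsub>BM\<^esub> F i)"
  proof (rule BM.finsum_reindex[OF _ inj_on_class])
    show "(\<lambda>b. f (inv_into I F b) \<odot>\<^bsub>BM\<^esub> b) \<in> F ` I \<rightarrow> carrier BM"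
      by (intro Pi_I smult_BM_carrier) (use class_carrier in blast)
  qed
  also have "\<dots> = h"
    unfolding f combination_def
  proof (rule BM.finsum_cong'[OF refl])
    show "(\<lambda>i. f i \<odot>\<^bsub>BM\<^esub> F i) \<in> I \<rightarrow> carrier BM"
      by (intro Pi_I smult_BM_carrier class_carrier)
  qed (simp only: inv_into_f_f[OF inj_on_class])
  finally have "h = (\<Oplus>\<^bsub>BM\<^esub>b\<in>F ` I. f (inv_into I F b) \<odot>\<^bsub>BM\<^esub> b)" ..
  then show "\<exists>A f. finite A \<and> A \<subseteq> F ` I \<and> f \<in> A \<rightarrow> carrier laurent_ring \<and> h = (\<Oplus>\<^bsub>BM\<^esub>b\<in>A. f b \<odot>\<^bsub>BM\<^esub> b)"
    using finite_index by (intro exI[of _ "F ` I"] exI[of _ "\<lambda>b. f (inv_into I F b)"] conjI) simp_all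
next
  fix A f b assume A: "finite A \<and> A \<subseteq> F ` I \<and> f \<in> A \<rightarrow> carrier laurent_ring \<and> (\<Oplus>\<^bsub>BM\<^esub>b\<in>A. f b \<odot>\<^bsub>BM\<^esub> b) = \<zero>\<^bsub>BM\<^esub>"
    and b: "b \<in> A"
  obtain L z where L: "good L z"
    using good_exists by (elim exE)
  define J where "J = {i \<in> I. F i \<in> A}"
  have J: "J \<subseteq> I" "finite J" "A = F ` J"
    using A finite_index by (auto simp: J_def)
  define g where "g i = (if i \<in> J then f (F i) else 0)" for i
  have "(\<Oplus>\<^bsub>BM\<^esub>b\<in>F ` J. f b \<odot>\<^bsub>BM\<^esub> b) = (\<Oplus>\<^bsub>BM\<^esub>i\<in>J. f (F i) \<odot>\<^bsub>BM\<^esub> F i)"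
  proof (rule BM.finsum_reindex[OF _ inj_on_subset[OF inj_on_class J(1)]])
    show "(\<lambda>b. f b \<odot>\<^bsub>BM\<^esub> b) \<in> F ` J \<rightarrow> carrier BM"
      using J(1) class_carrier by (intro Pi_I smult_BM_carrier) blast
  qed
  then have "(\<Oplus>\<^bsub>BM\<^esub>i\<in>J. f (F i) \<odot>\<^bsub>BM\<^esub> F i) L = \<zero>\<^bsub>BM\<^esub> L"
    using A J(3) by simp
  moreover have "(\<Oplus>\<^bsub>BM\<^esub>i\<in>J. f (F i) \<odot>\<^bsub>BM\<^esub> F i) L = clsK L (\<Sum>i\<in>J. chain_scale (f (F i)) (z i))"
    using J(1) by (intro finsum_BM J(2) good_compact[OF L] good_cycle[OF L] good_class[OF L] class_carrier) auto
  moreover have "(\<Sum>i\<in>J. chain_scale (f (F i)) (z i)) = (\<Sum>i\<in>I. chain_scale (g i) (z i))"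
    using J(1) finite_index by (intro sum.mono_neutral_cong_left) (simp_all add: g_def)
  moreover have cyc: "(\<Sum>i\<in>I. chain_scale (g i) (z i)) \<in> cycK L"
    by (intro twisted_relcycles_sum twisted_relcycles_scale good_cycle[OF L])
  ultimately have "(\<Sum>i\<in>I. chain_scale (g i) (z i)) \<in> bndK L"
    by (simp add: zero_BM[OF good_compact[OF L]] twisted_pair.zero_H twisted_pair.class_eq_iff)
  moreover obtain i where i: "i \<in> J" "b = F i"
    using b J(3) by blast
  ultimately have "g i = 0"
    using J(1) by (intro twisted_free_independent[OF good_free[OF L]]) auto
  then show "f b = \<zero>\<^bsub>laurent_ring\<^esub>"
    using i by (simp add: g_def)
qed

end

section \<open>The basis of necklaces\<close>

context configurations
begin

abbreviation "off \<equiv> off_compact CX (Conf_side l c)"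

lemma compact_subset_spread_small:
  assumes K: "compactin CX K"
  shows "\<exists>e. 0 < e \<and> (real m + 1) * e \<le> 1 \<and> K \<subseteq> spread e"
proof -
  obtain e where e: "0 < e" "K \<subseteq> spread e"
    using K by (rule compact_subset_spread)
  let ?e = "min e (1 / (real m + 1))"
  have "(real m + 1) * ?e \<le> (real m + 1) * (1 / (real m + 1))"
    by (intro mult_left_mono) simp_all
  then have "(real m + 1) * ?e \<le> 1"
    by simp
  moreover have "spread e \<subseteq> spread ?e"
    by (rule spread_mono) simp
  ultimately show ?thesis
    using e by (intro exI[of _ ?e]) auto
qed

lemma off_far_from: "K \<subseteq> spread e \<Longrightarrow> far_from e \<subseteq> off K"
  unfolding off_compact_spread[symmetric] by (rule borel_moore.off_antimono)

text \<open>All truncations fine enough for \<open>e\<close> give the same class, so the class is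
  eventually constant as the truncation tends to 0; the filter is nontrivial, hence
  \<open>THE\<close> picks this class.\<close>

lemma necklace_class_eq:
  assumes r: "r \<in> words" and K: "compactin CX K" "K \<subseteq> spread e"
    and \<epsilon>: "0 < \<epsilon>" "2 * real m * \<epsilon> < e" and e: "(real m + 1) * e \<le> 1"
  shows "necklace_class l a d c r K = twisted_class (Conf_transport l a d) m CX (off K) (necklace_chain l a d r \<epsilon>)"
proof -
  let ?T = "Conf_transport l a d"
  let ?z = "necklace_chain l a d r"
  have cyc: "?z \<epsilon>' \<in> twisted_relcycles ?T m CX (off K)" if "0 < \<epsilon>'" "2 * real m * \<epsilon>' < e" for \<epsilon>'
    using twisted_free_relcycle[OF necklaces_free[OF that e] r] off_far_from[OF K(2)] by (rule twisted_relcycles_mono)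
  have cls: "twisted_class ?T m CX (off K) (?z \<epsilon>') = twisted_class ?T m CX (off K) (?z \<epsilon>)"
    if "0 < \<epsilon>'" "2 * real m * \<epsilon>' < e" for \<epsilon>'
    unfolding twisted_pair.class_eq_iff[OF cyc[OF that] cyc[OF \<epsilon>]]
    using necklace_chain_independent[OF r that \<epsilon> e] off_far_from[OF K(2)] by (rule twisted_relboundaries_mono)
  have e0: "0 < e"
    using \<epsilon> by (smt (verit) mult_nonneg_nonneg of_nat_0_le_iff)
  \<comment> \<open>Dividing by \<open>2 * m + 1\<close> instead of \<open>2 * m\<close> includes
    the empty configuration, where \<open>m = 0\<close>.\<close>
  have ev: "\<forall>\<^sub>F \<epsilon>' in at_right 0. 0 < \<epsilon>' \<and> 2 * real m * \<epsilon>' < e"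
  proof (rule eventually_mono[OF eventually_at_right_real])
    show "0 < e / (2 * real m + 1)"
      using e0 by simp
    fix \<epsilon>' assume "\<epsilon>' \<in> {0<..<e / (2 * real m + 1)}"
    then have "0 < \<epsilon>'" "(2 * real m + 1) * \<epsilon>' < e"
      by (simp_all add: field_simps)
    then show "0 < \<epsilon>' \<and> 2 * real m * \<epsilon>' < e"
      by (simp add: algebra_simps)
  qed
  have "(THE h. \<forall>\<^sub>F \<epsilon> in at_right 0. ?z \<epsilon> \<in> twisted_relcycles ?T m CX (off K) \<and>
      h = twisted_class ?T m CX (off K) (?z \<epsilon>)) = twisted_class ?T m CX (off K) (?z \<epsilon>)"
  proof (rule the_equality)
    show "\<forall>\<^sub>F \<epsilon>' in at_right 0. ?z \<epsilon>' \<in> twisted_relcycles ?T m CX (off K) \<and>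
        twisted_class ?T m CX (off K) (?z \<epsilon>) = twisted_class ?T m CX (off K) (?z \<epsilon>')"
      using ev by (rule eventually_mono) (simp add: cyc cls)
    fix h assume "\<forall>\<^sub>F \<epsilon>' in at_right 0. ?z \<epsilon>' \<in> twisted_relcycles ?T m CX (off K) \<and>
        h = twisted_class ?T m CX (off K) (?z \<epsilon>')"
    then have "\<forall>\<^sub>F \<epsilon>' in at_right (0 :: real). h = twisted_class ?T m CX (off K) (?z \<epsilon>)"
      using ev by eventually_elim (simp add: cls)
    then show "h = twisted_class ?T m CX (off K) (?z \<epsilon>)"
      by simp
  qed
  then show ?thesis
    using K(1) by (simp add: necklace_class_def Let_def)
qed

lemma truncation_exists:
  assumes "0 < e"
  shows "\<exists>\<epsilon>. 0 < \<epsilon> \<and> 2 * real m * \<epsilon> < e"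
  using assms by (intro exI[of _ "e / (2 * real m + 1)"]) (simp add: field_simps)

text \<open>The predicate \<open>good\<close> for necklaces: sets \<open>spread e\<close> with one
  truncation fine enough for all words at once.\<close>

definition truncated :: "(nat \<Rightarrow> nat \<Rightarrow> int) \<Rightarrow> (nat \<Rightarrow> int) \<Rightarrow> config set \<Rightarrow> (nat list \<Rightarrow> config tchain) \<Rightarrow> bool" where
  "truncated a d L z \<longleftrightarrow> (\<exists>e \<epsilon>. 0 < \<epsilon> \<and> 2 * real m * \<epsilon> < e \<and> (real m + 1) * e \<le> 1 \<and> L = spread e \<and>
     z = (\<lambda>r. necklace_chain l a d r \<epsilon>))"

lemma truncatedE:
  assumes "truncated a d L z"
  obtains e \<epsilon> where "0 < \<epsilon>" "2 * real m * \<epsilon> < e" "(real m + 1) * e \<le> 1" "0 < e" "L = spread e"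
    "z = (\<lambda>r. necklace_chain l a d r \<epsilon>)"
proof -
  obtain e \<epsilon> where *: "0 < \<epsilon>" "2 * real m * \<epsilon> < e" "(real m + 1) * e \<le> 1" "L = spread e"
    "z = (\<lambda>r. necklace_chain l a d r \<epsilon>)"
    using assms unfolding truncated_def by (elim exE conjE)
  moreover have "0 < e"
    using *(1,2) by (smt (verit) mult_nonneg_nonneg of_nat_0_le_iff)
  ultimately show thesis
    by (intro that)
qed

lemma necklaces_borel_moore_free:
  "borel_moore_free (Conf_transport l a d) m CX (Conf_side l c) words (necklace_class l a d c) (truncated a d)"
proof
  show "finite words"
    by (rule finite_words)
  show "necklace_class l a d c r \<in> extensional {K. compactin CX K}" for r
    by (simp add: necklace_class_def)
  show "\<exists>L z. K \<subseteq> L \<and> truncated a d L z" if K: "compactin CX K" for K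
  proof -
    obtain e where e: "0 < e" "(real m + 1) * e \<le> 1" "K \<subseteq> spread e"
      using compact_subset_spread_small[OF K] by (elim exE conjE)
    obtain \<epsilon> where "0 < \<epsilon>" "2 * real m * \<epsilon> < e"
      using truncation_exists[OF e(1)] by (elim exE conjE)
    then have "truncated a d (spread e) (\<lambda>r. necklace_chain l a d r \<epsilon>)"
      unfolding truncated_def using e(2) by (intro exI[of _ e] exI[of _ \<epsilon>]) simp
    then show ?thesis
      using e(3) by (intro exI conjI)
  qed
  show "compactin CX L" if "truncated a d L z" for L z
    using that by (rule truncatedE) (simp add: spread_compact)
  show "twisted_free (Conf_transport l a d) m CX (off L) words z" if "truncated a d L z" for L z
    using that by (rule truncatedE) (simp add: off_compact_spread necklaces_free)
  show "necklace_class l a d c r K = twisted_class (Conf_transport l a d) m CX (off K) (z r)"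
    if L: "truncated a d L z" and r: "r \<in> words" and K: "compactin CX K" "K \<subseteq> L" for L z r K
    using L by (rule truncatedE) (use r K in \<open>simp add: necklace_class_eq\<close>)
qed

lemma HBM_trivial:
  assumes k: "k \<noteq> m"
  shows "carrier (HBM l a d c k) = {\<zero>\<^bsub>HBM l a d c k\<^esub>}"
  unfolding HBM_def
proof (rule borel_moore.carrier_BM_trivial)
  fix K assume "compactin CX K"
  then obtain e where e: "0 < e" "(real m + 1) * e \<le> 1" "K \<subseteq> spread e"
    using compact_subset_spread_small by metis
  obtain \<epsilon> where \<epsilon>: "0 < \<epsilon>" "2 * real m * \<epsilon> < e"
    using truncation_exists[OF e(1)] by (elim exE conjE)
  have "twisted_relcycles (Conf_transport l a d) k CX (off (spread e))
      \<subseteq> twisted_relboundaries (Conf_transport l a d) k CX (off (spread e))"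
    unfolding off_compact_spread using twisted_free_vanishes[OF necklaces_free[OF \<epsilon> e(2)] k] by blast
  then show "\<exists>L. compactin CX L \<and> K \<subseteq> L \<and> twisted_relcycles (Conf_transport l a d) k CX (off L)
      \<subseteq> twisted_relboundaries (Conf_transport l a d) k CX (off L)"
    using e spread_compact by blast
qed

end

theorem proposition2p16:
  fixes l :: nat
    and a :: "nat \<Rightarrow> nat \<Rightarrow> int"
    and d :: "nat \<Rightarrow> int"
    and c :: "nat \<Rightarrow> nat"
  assumes "cartan_datum l a d"
  shows "free_module laurent_ring (HBM l a d c (coloring_size l c)) \<and>
    inj_on (necklace_class l a d c) (color_words l c) \<and>
    module_basis laurent_ring (HBM l a d c (coloring_size l c))
      (necklace_class l a d c ` color_words l c) \<and>
    (\<forall>k. k \<noteq> coloring_size l c \<longrightarrow> carrier (HBM l a d c k) = {\<zero>\<^bsub>HBM l a d c k\<^esub>})"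
proof -
  interpret F: borel_moore_free "Conf_transport l a d" "coloring_size l c" "Conf l c" "Conf_side l c"
    "color_words l c" "necklace_class l a d c" "configurations.truncated l c a d"
    by (rule configurations.necklaces_borel_moore_free)
  show ?thesis
    using F.module_BM F.basis_BM F.inj_on_class configurations.HBM_trivial
    unfolding free_module_def HBM_def[symmetric] by blast
qed

end
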